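(* Let $n\le2$. Fix $\psi\in L^2(\mathbb{R}^n)$ with compact support and $\int\psi=1$, and fix $c\in\mathbb{R}$. Consider the functional $\mathcal{F}:w\mapsto TV(w+c\psi)$ on $D^{-1}(\mathbb{R}^n)$. Then for $w\in D^{-1}(\mathbb{R}^n)$ and $u=w+c\psi$, $$\partial_{D^{-1}}\mathcal{F}(w)=P\,\partial_{E^{-1}}TV(u),$$ where $P$ is the orthogonal projection from $E^{-1}$ onto $D^{-1}$. In particular, an element $v\in D^{-1}(\mathbb{R}^n)$ belongs to $\partial_{D^{-1}}\mathcal{F}(w)$ if and only if there is $Z\in L^\infty(\mathbb{R}^n;\mathbb{R}^n)$ with $\operatorname{div}Z\in E^1_0$ such that (i) $|Z|\le1$ a.e., (ii) $v=\Delta\operatorname{div}Z$ (meaning $\Delta[\operatorname{div}Z]$), (iii) $-\langle u,\operatorname{div}Z\rangle_E=TV(u)$.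
   Context: Here $n\in\{1,2\}$. $D^1=\{u\in L^1_{loc}(\mathbb{R}^n):\nabla u\in L^2(\mathbb{R}^n)\}$; $D^1_0=D^1/\mathbb{R}$ (classes $[f]$ modulo constants), a Hilbert space with inner product $\int\nabla u\cdot\nabla v$. $D^{-1}$ is its dual with pairing $\langle\cdot,\cdot\rangle$; $-\Delta:D^1_0\to D^{-1}$, $u\mapsto\int\nabla u\cdot\nabla(\cdot)$, is an isometric isomorphism and $(u,v)_{D^{-1}}=\langle u,(-\Delta)^{-1}v\rangle$. $D^{-1}$ is embedded in distributions on $\mathbb{R}^n$. $E^{-1}=\{w+c\psi:w\in D^{-1},c\in\mathbb{R}\}$ with inner product $(w_1+c_1\psi,w_2+c_2\psi)_{E^{-1}}=(w_1,w_2)_{D^{-1}}+c_1c_2$ (so $E^{-1}=D^{-1}\oplus\mathbb{R}\psi$ orthogonally). $E^1_0=D^1$, and $\langle w+c\psi,v\rangle_E=\langle w,[v]\rangle+c\int\psi v$ for $v\in E^1_0$. $TV:E^{-1}\to[0,\infty]$ is $TV(u)=\sup\{\langle u,-\operatorname{div}\varphi\rangle_E:\varphi\in C_c^\infty(\mathbb{R}^n;\mathbb{R}^n),\ |\varphi|\le1\}$. $\partial_{D^{-1}}$ and $\partial_{E^{-1}}$ denote subdifferentials of convex functionals in the Hilbert spaces $D^{-1}$ and $E^{-1}$, respectively (empty where the functional is $+\infty$). *)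

theory Defs
  imports "HOL-Analysis.Analysis"
begin

text \<open>
  The space \<open>R^n\<close> is a type \<open>'a :: euclidean_space\<close>, so \<open>n = DIM('a)\<close> and \<open>n \<ge> 1\<close>. Functions are
  Lebesgue measurable, and integrals are Bochner integrals with respect to \<open>lebesgue\<close>.
\<close>

subsection \<open>Test functions and Lebesgue spaces\<close>

primrec C_k :: "nat \<Rightarrow> ('a::euclidean_space \<Rightarrow> 'b::real_normed_vector) \<Rightarrow> bool" where
  "C_k 0 f \<longleftrightarrow> continuous_on UNIV f"
| "C_k (Suc k) f \<longleftrightarrow>
     (\<forall>x. f differentiable (at x)) \<and> (\<forall>h. C_k k (\<lambda>x. frechet_derivative f (at x) h))"

definition test_functions :: "('a::euclidean_space \<Rightarrow> 'b::real_normed_vector) set" where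
  "test_functions = {\<phi>. (\<forall>k. C_k k \<phi>) \<and> compact (closure {x. \<phi> x \<noteq> 0})}"

definition divergence :: "('a::euclidean_space \<Rightarrow> 'a) \<Rightarrow> 'a \<Rightarrow> real" where
  "divergence \<phi> x = (\<Sum>b\<in>Basis. frechet_derivative \<phi> (at x) b \<bullet> b)"

definition gradient :: "('a::euclidean_space \<Rightarrow> real) \<Rightarrow> 'a \<Rightarrow> 'a" where
  "gradient \<eta> x = (\<Sum>b\<in>Basis. frechet_derivative \<eta> (at x) b *\<^sub>R b)"

definition L1_loc :: "('a::euclidean_space \<Rightarrow> 'b::euclidean_space) set" where
  "L1_loc = {f. \<forall>K. compact K \<longrightarrow> f absolutely_integrable_on K}"

definition L2 :: "('a::euclidean_space \<Rightarrow> 'b::euclidean_space) set" where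
  "L2 = {f \<in> borel_measurable lebesgue. integrable lebesgue (\<lambda>x. (norm (f x))\<^sup>2)}"

definition Linf :: "('a::euclidean_space \<Rightarrow> 'b::euclidean_space) set" where
  "Linf = {f \<in> borel_measurable lebesgue. \<exists>C. AE x in lebesgue. norm (f x) \<le> C}"

text \<open>Compact support of an element of a Lebesgue space, that is, up to null sets.\<close>

definition compact_support :: "('a::euclidean_space \<Rightarrow> 'b::euclidean_space) \<Rightarrow> bool" where
  "compact_support f \<longleftrightarrow> (\<exists>K. compact K \<and> (AE x in lebesgue. x \<notin> K \<longrightarrow> f x = 0))"

definition has_weak_gradient ::
    "('a::euclidean_space \<Rightarrow> real) \<Rightarrow> ('a \<Rightarrow> 'a) \<Rightarrow> bool" where
  "has_weak_gradient u G \<longleftrightarrow> u \<in> L1_loc \<and> G \<in> L1_loc \<and>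
     (\<forall>\<phi>\<in>test_functions. (\<integral>x. u x * divergence \<phi> x \<partial>lebesgue) = - (\<integral>x. G x \<bullet> \<phi> x \<partial>lebesgue))"

definition has_weak_divergence ::
    "('a::euclidean_space \<Rightarrow> 'a) \<Rightarrow> ('a \<Rightarrow> real) \<Rightarrow> bool" where
  "has_weak_divergence Z d \<longleftrightarrow> Z \<in> L1_loc \<and> d \<in> L1_loc \<and>
     (\<forall>\<eta>\<in>test_functions. (\<integral>x. Z x \<bullet> gradient \<eta> x \<partial>lebesgue) = - (\<integral>x. d x * \<eta> x \<partial>lebesgue))"

text \<open>Weak gradients are unique only up to null sets; \<open>weak_gradient\<close> picks a representative.\<close>

definition weak_gradient :: "('a::euclidean_space \<Rightarrow> real) \<Rightarrow> 'a \<Rightarrow> 'a" where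
  "weak_gradient u = (SOME G. has_weak_gradient u G)"


subsection \<open>The spaces \<open>D\<^sup>1\<close> and \<open>D\<^sup>-\<^sup>1\<close>\<close>

definition D1 :: "('a::euclidean_space \<Rightarrow> real) set" where
  "D1 = {u \<in> L1_loc. \<exists>G\<in>L2. has_weak_gradient u G}"

definition D1_inner :: "('a::euclidean_space \<Rightarrow> real) \<Rightarrow> ('a \<Rightarrow> real) \<Rightarrow> real" where
  "D1_inner u v = (\<integral>x. weak_gradient u x \<bullet> weak_gradient v x \<partial>lebesgue)"

text \<open>
  A bounded linear functional on \<open>D\<^sup>1\<^sub>0 = D\<^sup>1/\<real>\<close> is given as a linear functional on \<open>D\<^sup>1\<close> that is bounded
  by the Dirichlet seminorm. The bound makes it constant on the classes modulo constants (and null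
  sets), so \<open>w v\<close> is the pairing of \<open>w\<close> with the class of \<open>v\<close>. Functionals are set to \<open>0\<close> outside
  \<open>D\<^sup>1\<close>, so that equality of functions is equality of functionals.
\<close>

definition D_neg1 :: "(('a::euclidean_space \<Rightarrow> real) \<Rightarrow> real) set" where
  "D_neg1 = {w.
     (\<forall>f\<in>D1. \<forall>g\<in>D1. w (\<lambda>x. f x + g x) = w f + w g) \<and>
     (\<forall>r. \<forall>f\<in>D1. w (\<lambda>x. r * f x) = r * w f) \<and>
     (\<exists>C. \<forall>f\<in>D1. \<bar>w f\<bar> \<le> C * sqrt (D1_inner f f)) \<and>
     (\<forall>f. f \<notin> D1 \<longrightarrow> w f = 0)}"

definition neg_laplacian ::
    "('a::euclidean_space \<Rightarrow> real) \<Rightarrow> (('a \<Rightarrow> real) \<Rightarrow> real)" where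
  "neg_laplacian u = (\<lambda>v. if v \<in> D1 then D1_inner u v else 0)"

definition laplacian ::
    "('a::euclidean_space \<Rightarrow> real) \<Rightarrow> (('a \<Rightarrow> real) \<Rightarrow> real)" where
  "laplacian u = (\<lambda>v. - neg_laplacian u v)"

text \<open>
  The inverse of \<open>-\<Delta>\<close> is determined up to an additive constant; \<open>inv_into\<close> picks a representative of
  the class, on which the value of an element of \<open>D\<^sup>-\<^sup>1\<close> does not depend.
\<close>

definition D_neg1_inner ::
    "(('a::euclidean_space \<Rightarrow> real) \<Rightarrow> real) \<Rightarrow> (('a \<Rightarrow> real) \<Rightarrow> real) \<Rightarrow> real" where
  "D_neg1_inner u v = u (inv_into D1 neg_laplacian v)"


subsection \<open>The space \<open>E\<^sup>-\<^sup>1\<close> and the total variation\<close>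

text \<open>
  The element \<open>w + c\<psi>\<close>, as a functional on \<open>E\<^sup>1\<^sub>0 = D\<^sup>1\<close>; its value at \<open>v\<close> is the pairing
  \<open>\<langle>w + c\<psi>, v\<rangle>\<^sub>E\<close>. Thus \<open>D\<^sup>-\<^sup>1\<close> is a subset of \<open>E\<^sup>-\<^sup>1\<close>, and the pairing of \<open>u\<close> in \<open>E\<^sup>-\<^sup>1\<close> with \<open>v\<close>
  is the application \<open>u v\<close>. The pairing is what identifies such a \<open>u\<close>: if \<open>\<integral>\<psi> = 1\<close> then \<open>c = u 1\<close>.
\<close>

definition E_sum ::
    "('a::euclidean_space \<Rightarrow> real) \<Rightarrow> (('a \<Rightarrow> real) \<Rightarrow> real) \<Rightarrow> real \<Rightarrow> (('a \<Rightarrow> real) \<Rightarrow> real)" where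
  "E_sum \<psi> w c = (\<lambda>v. if v \<in> D1 then w v + c * (\<integral>x. \<psi> x * v x \<partial>lebesgue) else 0)"

definition E_neg1 ::
    "('a::euclidean_space \<Rightarrow> real) \<Rightarrow> (('a \<Rightarrow> real) \<Rightarrow> real) set" where
  "E_neg1 \<psi> = {E_sum \<psi> w c | w c. w \<in> D_neg1}"

definition E_neg1_inner ::
    "('a::euclidean_space \<Rightarrow> real) \<Rightarrow> (('a \<Rightarrow> real) \<Rightarrow> real) \<Rightarrow> (('a \<Rightarrow> real) \<Rightarrow> real) \<Rightarrow> real" where
  "E_neg1_inner \<psi> u\<^sub>1 u\<^sub>2 = (THE r. \<exists>w\<^sub>1\<in>D_neg1. \<exists>w\<^sub>2\<in>D_neg1. \<exists>c\<^sub>1 c\<^sub>2.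
     u\<^sub>1 = E_sum \<psi> w\<^sub>1 c\<^sub>1 \<and> u\<^sub>2 = E_sum \<psi> w\<^sub>2 c\<^sub>2 \<and> r = D_neg1_inner w\<^sub>1 w\<^sub>2 + c\<^sub>1 * c\<^sub>2)"

definition TV :: "(('a::euclidean_space \<Rightarrow> real) \<Rightarrow> real) \<Rightarrow> ereal" where
  "TV u = (SUP \<phi> \<in> {\<phi> \<in> test_functions. \<forall>x. norm (\<phi> x) \<le> 1}. ereal (u (\<lambda>x. - divergence \<phi> x)))"


subsection \<open>Subdifferentials and orthogonal projections\<close>

text \<open>
  Both are relative to a space with carrier \<open>S\<close> and inner product \<open>ip\<close>, for functionals with values
  in \<open>(-\<infinity>, \<infinity>]\<close>.
\<close>

definition subdifferential ::
    "'b::minus set \<Rightarrow> ('b \<Rightarrow> 'b \<Rightarrow> real) \<Rightarrow> ('b \<Rightarrow> ereal) \<Rightarrow> 'b \<Rightarrow> 'b set" where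
  "subdifferential S ip F x =
     {v \<in> S. F x < \<infinity> \<and> (\<forall>y\<in>S. F x + ereal (ip v (y - x)) \<le> F y)}"

definition orthogonal_projection ::
    "('b \<Rightarrow> 'b \<Rightarrow> real) \<Rightarrow> 'b::minus set \<Rightarrow> 'b \<Rightarrow> 'b" where
  "orthogonal_projection ip S x = (THE p. p \<in> S \<and> (\<forall>z\<in>S. ip (x - p) z = 0))"

end

theory Submission
  imports Defs
begin

text \<open>
  Let \<open>v = -\<Delta> p\<close> be a subgradient of \<open>F\<close> at \<open>w\<close>. If \<open>([p], F(w) - \<langle>w, p\<rangle>)\<close> had positive distance in
  \<open>D\<^sup>1\<^sub>0 \<times> \<real>\<close> from the convex set of all \<open>([f], s)\<close> with \<open>f = -div \<phi>\<close>, \<open>|\<phi>| \<le> 1\<close>, \<open>s \<le> c \<integral>\<psi> f\<close>, a separating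
  functional would contradict the subgradient inequality. So some fields \<open>\<phi>\<^sub>k\<close> have \<open>-div \<phi>\<^sub>k\<close> tending
  to \<open>p\<close> in \<open>D\<^sup>1\<^sub>0\<close> and almost attaining the total variation of \<open>u\<close>. Minimising a weighted \<open>L\<^sup>2\<close> norm makes
  them converge almost everywhere, and the limit is \<open>Z\<close>.

  Conversely \<open>-\<langle>y, div Z\<rangle> \<le> TV(y)\<close> for all \<open>y\<close> in \<open>E\<^sup>-\<^sup>1\<close>, by approximating \<open>Z\<close> with mollified cutoffs; for
  \<open>n \<le> 2\<close> their divergences stay bounded in \<open>D\<^sup>1\<close>. Hence \<open>v - (\<integral>\<psi> div Z) \<psi>\<close> is a subgradient of \<open>TV\<close> at \<open>u\<close>,
  and \<open>P\<close> maps it to \<open>v\<close>.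
\<close>

subsection \<open>Smooth functions\<close>

text \<open>Two things are lost in passing from fields to their divergences. First, convergence of
  \<open>-div \<phi>\<close> in the Dirichlet seminorm says nothing about the fields, which are
  merely bounded by 1. Weak star compactness of the unit ball is replaced by uniform convexity: over
  a decreasing sequence of convex sets of fields, almost minimal points of a strictly positive
  weighted norm must approach each other. The same mechanism yields the Riesz representation and the
  density of test functions. Second, the seminorm does not see constants, whereas the pairing with
  \<psi> does. The missing constant is read off from the fields themselves, because \<integral>
  \<zeta> div \<phi> = - \<integral> \<phi> \<cdot> grad \<zeta> for a bump \<zeta> of mass 1, and
  the right-hand side converges along with them. The approximation in the converse has two
  parameters: the commutator of divergence and cutoff is shown to vanish weakly for a fixed
  mollifier, so the cutoff radius is chosen after the mollifier.\<close>

lemma C_k_mono_Suc: "C_k (Suc k) f \<Longrightarrow> C_k k f"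
proof (induction k arbitrary: f)
  case 0
  then show ?case
    by (simp add: continuous_on_eq_continuous_at differentiable_imp_continuous_within)
next
  case (Suc k)
  then show ?case by simp
qed

lemma C_k_const: "C_k k (\<lambda>x. c)"
  by (induction k arbitrary: c) (simp_all add: frechet_derivative_const)

lemma C_k_add: "C_k k f \<Longrightarrow> C_k k g \<Longrightarrow> C_k k (\<lambda>x. f x + g x)"
proof (induction k arbitrary: f g)
  case (Suc k)
  then have LD: "((\<lambda>x. f x + g x) has_derivative
      (\<lambda>h. frechet_derivative f (at x) h + frechet_derivative g (at x) h)) (at x)" for x
    by (intro has_derivative_add) (simp_all flip: frechet_derivative_works)
  have "frechet_derivative (\<lambda>x. f x + g x) (at x) =
      (\<lambda>h. frechet_derivative f (at x) h + frechet_derivative g (at x) h)" for x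
    by (rule frechet_derivative_at[OF LD, symmetric])
  with Suc show ?case by simp
qed (auto intro: continuous_intros)

lemma C_k_linear:
  assumes L: "bounded_linear L" shows "C_k k f \<Longrightarrow> C_k k (\<lambda>x. L (f x))"
proof (induction k arbitrary: f)
  case 0
  then show ?case using L by (auto intro: linear_continuous_on_compose continuous_intros bounded_linear.continuous_on)
next
  case (Suc k)
  then have D: "(f has_derivative frechet_derivative f (at x)) (at x)" for x
    by (simp flip: frechet_derivative_works)
  then have LD: "((\<lambda>x. L (f x)) has_derivative (\<lambda>h. L (frechet_derivative f (at x) h))) (at x)" for x
    using bounded_linear.has_derivative[OF L] by blast
  have "frechet_derivative (\<lambda>x. L (f x)) (at x) = (\<lambda>h. L (frechet_derivative f (at x) h))" for x
    by (rule frechet_derivative_at[OF LD, symmetric])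
  with Suc LD show ?case by (auto simp: differentiable_def)
qed

text \<open>The product rule leaves one factor undifferentiated, so the induction step needs the
  factors themselves in \<open>C_k k\<close>, which \<open>C_k_mono_Suc\<close> supplies. One
  bilinear statement serves products, scalar multiples and inner products.\<close>

lemma C_k_bilinear:
  assumes B: "bounded_bilinear B"
  shows "C_k k f \<Longrightarrow> C_k k g \<Longrightarrow> C_k k (\<lambda>x. B (f x) (g x))"
proof (induction k arbitrary: f g)
  case 0
  then show ?case using bounded_bilinear.continuous_on[OF B] by auto
next
  case (Suc k)
  then have D: "(f has_derivative frechet_derivative f (at x)) (at x)"
       "(g has_derivative frechet_derivative g (at x)) (at x)" for x
    by (simp_all flip: frechet_derivative_works)
  then have LD: "((\<lambda>x. B (f x) (g x)) has_derivative
      (\<lambda>h. B (f x) (frechet_derivative g (at x) h) + B (frechet_derivative f (at x) h) (g x))) (at x)" for x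
    using bounded_bilinear.FDERIV[OF B] by blast
  have "frechet_derivative (\<lambda>x. B (f x) (g x)) (at x) =
      (\<lambda>h. B (f x) (frechet_derivative g (at x) h) + B (frechet_derivative f (at x) h) (g x))" for x
    by (rule frechet_derivative_at[OF LD, symmetric])
  moreover have "C_k k f" "C_k k g" using Suc.prems C_k_mono_Suc by blast+
  moreover have "C_k k (\<lambda>x. frechet_derivative f (at x) h)" "C_k k (\<lambda>x. frechet_derivative g (at x) h)" for h
    using Suc.prems by simp_all
  moreover have "(\<lambda>x. B (f x) (g x)) differentiable at x" for x
    using LD unfolding differentiable_def by blast
  ultimately show ?case using Suc.IH
    by (simp add: C_k_add)
qed

lemmas C_k_mult = C_k_bilinear[OF bounded_bilinear_mult]

text \<open>The derivative of the composite in direction \<open>h\<close> is that of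
  \<open>f\<close> in direction \<open>L h\<close>, again precomposed with the same affine map;
  hence the induction over arbitrary \<open>f\<close>. Reflections, dilations and the coordinates
  inside \<open>box_bump\<close> are instances.\<close>

lemma C_k_affine:
  assumes L: "bounded_linear L" shows "C_k k f \<Longrightarrow> C_k k (\<lambda>x. f (L x + b))"
proof (induction k arbitrary: f)
  case 0
  then show ?case using L
    by (auto intro!: continuous_intros bounded_linear.continuous_on[OF L] continuous_on_compose2[where g=f and t=UNIV])
next
  case (Suc k)
  then have D: "(f has_derivative frechet_derivative f (at x)) (at x)" for x
    by (simp flip: frechet_derivative_works)
  have "((\<lambda>x. L x + b) has_derivative L) (at x)" for x
    using has_derivative_add[OF bounded_linear_imp_has_derivative[OF L] has_derivative_const[of b]] by simp
  from has_derivative_compose[OF this D]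
  have LD: "((\<lambda>x. f (L x + b)) has_derivative (\<lambda>h. frechet_derivative f (at (L x + b)) (L h))) (at x)" for x .
  have "frechet_derivative (\<lambda>x. f (L x + b)) (at x) = (\<lambda>h. frechet_derivative f (at (L x + b)) (L h))" for x
    by (rule frechet_derivative_at[OF LD, symmetric])
  with Suc LD show ?case
    using Suc.IH[of "\<lambda>x. frechet_derivative f (at x) (L h)" for h] by (auto simp: differentiable_def)
qed

lemma C_k_sum: "(\<And>i. i \<in> I \<Longrightarrow> C_k k (f i)) \<Longrightarrow> C_k k (\<lambda>x. \<Sum>i\<in>I. f i x)"
  by (induction I rule: infinite_finite_induct) (auto intro: C_k_const C_k_add)

lemma C_k_prod:
  fixes f :: "'i \<Rightarrow> 'a::euclidean_space \<Rightarrow> real"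
  shows "(\<And>i. i \<in> I \<Longrightarrow> C_k k (f i)) \<Longrightarrow> C_k k (\<lambda>x. \<Prod>i\<in>I. f i x)"
  by (induction I rule: infinite_finite_induct) (auto intro: C_k_const C_k_mult)

lemma C_k_frechet_derivative:
  assumes "\<And>k. C_k k f" shows "C_k k (\<lambda>x. frechet_derivative f (at x) h)"
  using assms[of "Suc k"] by simp

section \<open>Test functions: closure properties and uniform bounds\<close>

lemma test_functions_iff: "\<phi> \<in> test_functions \<longleftrightarrow> (\<forall>k. C_k k \<phi>) \<and> bounded {x. \<phi> x \<noteq> 0}"
  by (simp add: test_functions_def compact_eq_bounded_closed bounded_closure)
    (meson bounded_closure bounded_subset closure_subset)

lemma test_functions_support:
  assumes "\<phi> \<in> test_functions" obtains R where "R > 0" "\<And>x. norm x > R \<Longrightarrow> \<phi> x = 0"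
proof -
  from assms have "bounded {x. \<phi> x \<noteq> 0}" by (simp add: test_functions_iff)
  then obtain R where "R > 0" "\<forall>x\<in>{x. \<phi> x \<noteq> 0}. norm x \<le> R"
    using bounded_pos by blast
  then show ?thesis using that[of R] by force
qed

lemma test_functions_differentiable:
  "\<phi> \<in> test_functions \<Longrightarrow> (\<phi> has_derivative frechet_derivative \<phi> (at x)) (at x)"
  unfolding test_functions_iff by (metis C_k.simps(2) frechet_derivative_works)

lemma test_functions_continuous: "\<phi> \<in> test_functions \<Longrightarrow> continuous_on UNIV \<phi>"
  unfolding test_functions_iff by (metis C_k.simps(1))

lemma test_functions_measurable: "\<phi> \<in> test_functions \<Longrightarrow> \<phi> \<in> borel_measurable borel"
  by (simp add: borel_measurable_continuous_onI test_functions_continuous)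

lemma frechet_derivative_eq_0_outside:
  assumes "\<And>x. norm x > R \<Longrightarrow> \<phi> x = 0" "norm x > R"
  shows "frechet_derivative \<phi> (at x) h = 0"
proof -
  have "((\<lambda>x. 0) has_derivative (\<lambda>_. 0)) (at x)" by simp
  moreover have "open {x. norm x > R}" by (intro open_Collect_less continuous_intros)
  ultimately have "(\<phi> has_derivative (\<lambda>_. 0)) (at x)"
    using assms has_derivative_transform_within_open[of "\<lambda>_. 0" "\<lambda>_. 0" x UNIV "{x. norm x > R}" \<phi>]
    by simp
  then show ?thesis by (metis frechet_derivative_at)
qed

lemma test_functions_deriv:
  assumes "\<phi> \<in> test_functions" shows "(\<lambda>x. frechet_derivative \<phi> (at x) h) \<in> test_functions"
proof -
  obtain R where "R > 0" "\<And>x. norm x > R \<Longrightarrow> \<phi> x = 0" using assms by (rule test_functions_support) blast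
  then have "{x. frechet_derivative \<phi> (at x) h \<noteq> 0} \<subseteq> cball 0 R"
    using frechet_derivative_eq_0_outside[of R \<phi>] by force
  then show ?thesis
    using assms C_k_frechet_derivative unfolding test_functions_iff
    by (metis bounded_cball bounded_subset)
qed

lemma test_functions_bilinear:
  assumes B: "bounded_bilinear B" and "\<And>k. C_k k f" "g \<in> test_functions"
  shows "(\<lambda>x. B (f x) (g x)) \<in> test_functions"
proof -
  have "{x. B (f x) (g x) \<noteq> 0} \<subseteq> {x. g x \<noteq> 0}"
    using bounded_bilinear.zero_right[OF B] by auto
  then show ?thesis
    using assms(2,3) C_k_bilinear[OF B] bounded_subset unfolding test_functions_iff by blast
qed

lemma test_functions_add:
  "f \<in> test_functions \<Longrightarrow> g \<in> test_functions \<Longrightarrow> (\<lambda>x. f x + g x) \<in> test_functions"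
proof -
  assume "f \<in> test_functions" "g \<in> test_functions"
  moreover have "{x. f x + g x \<noteq> 0} \<subseteq> {x. f x \<noteq> 0} \<union> {x. g x \<noteq> 0}" by auto
  ultimately show ?thesis unfolding test_functions_iff
    using C_k_add bounded_subset[OF bounded_Un[THEN iffD2]] by blast
qed

lemma test_functions_linear:
  assumes L: "bounded_linear L" and "f \<in> test_functions"
  shows "(\<lambda>x. L (f x)) \<in> test_functions"
proof -
  have "{x. L (f x) \<noteq> 0} \<subseteq> {x. f x \<noteq> 0}"
    using linear_0[OF bounded_linear.linear[OF L]] by auto
  then show ?thesis
    using assms(2) C_k_linear[OF L] bounded_subset unfolding test_functions_iff by blast
qed

lemma test_functions_0: "(\<lambda>x. 0) \<in> test_functions"
  by (simp add: test_functions_iff C_k_const)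

lemma test_functions_sum:
  "(\<And>i. i \<in> I \<Longrightarrow> f i \<in> test_functions) \<Longrightarrow> (\<lambda>x. \<Sum>i\<in>I. f i x) \<in> test_functions"
  by (induction I rule: infinite_finite_induct) (auto intro: test_functions_0 test_functions_add)

lemma test_functions_bounded:
  assumes "f \<in> test_functions" obtains B where "B > 0" "\<And>x. norm (f x) \<le> B"
proof -
  obtain R where R: "R > 0" "\<And>x. norm x > R \<Longrightarrow> f x = 0" using assms by (rule test_functions_support) blast
  have "compact (f ` cball 0 R)"
    using assms by (intro compact_continuous_image) (auto intro: continuous_on_subset test_functions_continuous)
  then obtain B where "B > 0" "\<forall>y\<in>f ` cball 0 R. norm y \<le> B"
    using compact_imp_bounded bounded_pos by metis
  then show ?thesis using that[of B] R by (metis image_eqI less_eq_real_def linorder_not_less mem_cball_0 norm_zero)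
qed

text \<open>Bounds for the derivative reduce to the finitely many directional derivatives along
  \<open>Basis\<close>, each of which is again a test function and hence bounded.\<close>

lemma frechet_derivative_components:
  fixes f :: "'a::euclidean_space \<Rightarrow> 'b::real_normed_vector"
  assumes "f \<in> test_functions"
  shows "frechet_derivative f (at x) h = (\<Sum>b\<in>Basis. (h \<bullet> b) *\<^sub>R frechet_derivative f (at x) b)"
proof -
  interpret linear "frechet_derivative f (at x)"
    using test_functions_differentiable[OF assms] has_derivative_linear by blast
  show ?thesis
    by (subst (1) euclidean_representation[of h, symmetric]) (simp add: sum scale del: euclidean_representation)
qed

lemma test_functions_deriv_bound:
  fixes f :: "'a::euclidean_space \<Rightarrow> 'b::real_normed_vector"
  assumes "f \<in> test_functions"
  obtains B where "B > 0" "\<And>x h. norm (frechet_derivative f (at x) h) \<le> B * norm h"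
proof -
  have "\<forall>b. \<exists>B>0. \<forall>x. norm (frechet_derivative f (at x) b) \<le> B"
    using test_functions_bounded[OF test_functions_deriv[OF assms]] by metis
  then obtain B where B: "\<And>b. B b > 0" "\<And>b x. norm (frechet_derivative f (at x) b) \<le> B b" by metis
  have "norm (frechet_derivative f (at x) h) \<le> (\<Sum>b\<in>Basis. B b) * norm h" for x h
  proof -
    have "norm (frechet_derivative f (at x) h) \<le> (\<Sum>b\<in>Basis. norm ((h \<bullet> b) *\<^sub>R frechet_derivative f (at x) b))"
      unfolding frechet_derivative_components[OF assms, of x h] by (rule norm_sum)
    also have "\<dots> \<le> (\<Sum>b\<in>Basis. norm h * B b)"
      by (intro sum_mono) (auto intro!: mult_mono B Basis_le_norm)
    finally show ?thesis by (simp add: sum_distrib_left mult.commute)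
  qed
  moreover have "(\<Sum>b\<in>Basis. B b) > (0::real)" using B by (intro sum_pos) auto
  ultimately show ?thesis using that by blast
qed

text \<open>The directional derivatives are test functions with bounded derivative, so they are
  Lipschitz with a constant uniform in the base point; the linearised mean value inequality on
  \<open>cball x (norm h)\<close> then gives a remainder of order 2. Uniformity in \<open>x\<close>
  is what lets the remainder be integrated.\<close>

lemma test_functions_remainder:
  fixes f :: "'a::euclidean_space \<Rightarrow> 'b::real_normed_vector"
  assumes f: "f \<in> test_functions"
  obtains B where "B > 0" "\<And>x h. norm (f (x + h) - f x - frechet_derivative f (at x) h) \<le> B * (norm h)\<^sup>2"
proof -
  let ?D = "\<lambda>x. frechet_derivative f (at x)"
  have "\<forall>b. \<exists>B>0. \<forall>x h. norm (frechet_derivative (\<lambda>x. ?D x b) (at x) h) \<le> B * norm h"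
    using test_functions_deriv_bound[OF test_functions_deriv[OF f]] by metis
  then obtain B where B: "\<And>b. B b > 0"
     "\<And>b x h. norm (frechet_derivative (\<lambda>x. ?D x b) (at x) h) \<le> B b * norm h" by metis
  let ?C = "\<Sum>b\<in>Basis. B b"
  have lip: "norm (?D x b - ?D y b) \<le> B b * norm (x - y)" for x y b
    using B(1)[of b] test_functions_differentiable[OF test_functions_deriv[OF f]]
    by (intro differentiable_bound[where S=UNIV and f'="\<lambda>x. frechet_derivative (\<lambda>x. ?D x b) (at x)"])
       (auto intro!: onorm_bound B simp: less_imp_le)
  have op: "onorm (\<lambda>h. ?D x h - ?D y h) \<le> ?C * norm (x - y)" for x y
  proof (rule onorm_bound)
    show "0 \<le> ?C * norm (x - y)" using B(1) by (intro mult_nonneg_nonneg sum_nonneg) (auto simp: less_imp_le)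
    fix h
    have "norm (?D x h - ?D y h) = norm (\<Sum>b\<in>Basis. (h \<bullet> b) *\<^sub>R (?D x b - ?D y b))"
      unfolding frechet_derivative_components[OF f, of x h] frechet_derivative_components[OF f, of y h]
      by (simp add: sum_subtractf scaleR_diff_right)
    also have "\<dots> \<le> (\<Sum>b\<in>Basis. norm ((h \<bullet> b) *\<^sub>R (?D x b - ?D y b)))" by (rule norm_sum)
    also have "\<dots> \<le> (\<Sum>b\<in>Basis. norm h * (B b * norm (x - y)))"
      by (intro sum_mono) (auto intro!: mult_mono lip Basis_le_norm)
    finally show "norm (?D x h - ?D y h) \<le> ?C * norm (x - y) * norm h"
      by (simp add: sum_distrib_left sum_distrib_right mult_ac)
  qed
  have "norm (f (x + h) - f x - ?D x h) \<le> ?C * (norm h)\<^sup>2" for x h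
  proof -
    have "norm (f (x + h) - f x - ?D x (x + h - x)) \<le> norm (x + h - x) * (?C * norm h)"
    proof (rule differentiable_bound_linearization[where S="cball x (norm h)"])
      fix y assume "y \<in> cball x (norm h)"
      then have "norm (y - x) \<le> norm h" by (simp add: dist_norm norm_minus_commute)
      moreover have "?C \<ge> 0" using B(1) by (intro sum_nonneg) (auto simp: less_imp_le)
      ultimately show "onorm (?D y - ?D x) \<le> ?C * norm h"
        using op[of y x] mult_left_mono[of "norm (y - x)" "norm h" ?C] by (simp add: fun_diff_def)
    qed (auto intro: has_derivative_at_withinI test_functions_differentiable f simp: dist_norm mult_left_le_one_le)
    then show ?thesis by (simp add: power2_eq_square mult_ac)
  qed
  moreover have "?C > 0" using B by (intro sum_pos) auto
  ultimately show ?thesis using that by blast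
qed

text \<open>A function that is not integrable has Bochner integral 0, so the estimate needs only the
  dominating \<open>g\<close>; non-negativity of the integral of \<open>g\<close> settles that
  case.\<close>

lemma norm_integral_le:
  fixes f :: "'s \<Rightarrow> 'c::{banach, second_countable_topology}"
  assumes g: "integrable M g" and le: "AE x in M. norm (f x) \<le> g x"
  shows "norm (\<integral>x. f x \<partial>M) \<le> (\<integral>x. g x \<partial>M)"
proof (cases "integrable M f")
  case True
  then show ?thesis
    using g le by (intro order_trans[OF integral_norm_bound] integral_mono_AE) auto
next
  case False
  have "AE x in M. 0 \<le> g x" using le by eventually_elim (meson norm_ge_zero order_trans)
  then show ?thesis using False by (simp add: not_integrable_integral_eq integral_nonneg_AE)
qed

lemma has_derivative_quadratic:
  fixes F :: "'a::real_normed_vector \<Rightarrow> 'b::real_normed_vector"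
  assumes "bounded_linear D" "\<And>h. norm (F (x + h) - F x - D h) \<le> C * (norm h)\<^sup>2"
  shows "(F has_derivative D) (at x)"
  unfolding has_derivative_at
proof (intro conjI assms(1))
  show "(\<lambda>h. norm (F (x + h) - F x - D h) / norm h) \<midarrow>0\<rightarrow> 0"
  proof (rule Lim_null_comparison)
    show "\<forall>\<^sub>F h in at 0. norm (norm (F (x + h) - F x - D h) / norm h) \<le> C * norm h"
      using assms(2) by (auto simp: eventually_at_filter divide_simps power2_eq_square mult.assoc
          intro!: always_eventually)
    show "(\<lambda>h. C * norm h) \<midarrow>0\<rightarrow> 0"
      by (auto intro!: tendsto_eq_intros)
  qed
qed

subsection \<open>Convolutions with test functions\<close>

text \<open>
  The general shape covers both the convolution with an integrable function and the average of the
  translates of \<open>\<phi>\<close> along a segment.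
\<close>

lemma
  fixes \<phi> :: "'a::euclidean_space \<Rightarrow> real" and g :: "'s \<Rightarrow> 'c::{banach, second_countable_topology}"
  assumes \<phi>: "\<phi> \<in> test_functions" and g: "integrable M g" and T: "T \<in> borel_measurable M"
  shows integrable_convolution: "integrable M (\<lambda>s. \<phi> (x - T s) *\<^sub>R g s)"
    and has_derivative_convolution: "((\<lambda>x. \<integral>s. \<phi> (x - T s) *\<^sub>R g s \<partial>M) has_derivative
      (\<lambda>h. \<integral>s. frechet_derivative \<phi> (at (x - T s)) h *\<^sub>R g s \<partial>M)) (at x)"
proof -
  have int: "integrable M (\<lambda>s. \<eta> (x - T s) *\<^sub>R g s)" if \<eta>: "\<eta> \<in> test_functions" for \<eta> :: "'a \<Rightarrow> real" and x
  proof -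
    obtain B where B: "B > 0" "\<And>x. norm (\<eta> x) \<le> B" using test_functions_bounded[OF \<eta>] by blast
    have [measurable]: "\<eta> \<in> borel_measurable borel" by (rule test_functions_measurable[OF \<eta>])
    note [measurable] = borel_measurable_integrable[OF g] T
    show ?thesis
      by (rule Bochner_Integration.integrable_bound[where f="\<lambda>s. B * norm (g s)"])
         (use g B in \<open>auto intro!: mult_right_mono\<close>)
  qed
  from int[OF \<phi>] show "integrable M (\<lambda>s. \<phi> (x - T s) *\<^sub>R g s)" .
  let ?D = "\<lambda>x h. \<integral>s. frechet_derivative \<phi> (at (x - T s)) h *\<^sub>R g s \<partial>M"
  obtain B1 where B1: "B1 > 0" "\<And>x h. norm (frechet_derivative \<phi> (at x) h) \<le> B1 * norm h"
    using test_functions_deriv_bound[OF \<phi>] by blast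
  obtain B2 where B2: "B2 > 0" "\<And>x h. norm (\<phi> (x + h) - \<phi> x - frechet_derivative \<phi> (at x) h) \<le> B2 * (norm h)\<^sup>2"
    using test_functions_remainder[OF \<phi>] by blast
  note intD = int[OF test_functions_deriv[OF \<phi>]]
  have lin: "linear (frechet_derivative \<phi> (at y))" for y
    using test_functions_differentiable[OF \<phi>] has_derivative_linear by blast
  have "bounded_linear (?D x)"
  proof (rule bounded_linear_intro[where K="B1 * (\<integral>s. norm (g s) \<partial>M)"])
    fix h k r
    show "?D x (h + k) = ?D x h + ?D x k"
      by (simp add: linear_add[OF lin] scaleR_left_distrib intD)
    show "?D x (r *\<^sub>R h) = r *\<^sub>R ?D x h"
      by (simp add: linear_scale[OF lin] flip: scaleR_scaleR)
    have "norm (?D x h) \<le> (\<integral>s. (B1 * norm h) * norm (g s) \<partial>M)"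
      using B1(2) by (intro norm_integral_le) (auto intro!: mult_right_mono g)
    then show "norm (?D x h) \<le> norm h * (B1 * (\<integral>s. norm (g s) \<partial>M))" by (simp add: mult_ac)
  qed
  then show "((\<lambda>x. \<integral>s. \<phi> (x - T s) *\<^sub>R g s \<partial>M) has_derivative ?D x) (at x)"
  proof (rule has_derivative_quadratic[where C="B2 * (\<integral>s. norm (g s) \<partial>M)"])
    fix h
    \<comment> \<open>The Taylor remainder of \<phi> at \<open>x - T s\<close> is bounded
      independently of \<open>s\<close>, so integrating it against \<open>g\<close> keeps the order
      2 in \<open>h\<close>.\<close>
    let ?r = "\<lambda>s. \<phi> (x + h - T s) - \<phi> (x - T s) - frechet_derivative \<phi> (at (x - T s)) h"
    have r: "norm (?r s) \<le> B2 * (norm h)\<^sup>2" for s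
      using B2(2)[of "x - T s" h] by (simp add: algebra_simps)
    have "(\<integral>s. \<phi> (x + h - T s) *\<^sub>R g s \<partial>M) - (\<integral>s. \<phi> (x - T s) *\<^sub>R g s \<partial>M) - ?D x h = (\<integral>s. ?r s *\<^sub>R g s \<partial>M)"
      by (simp add: scaleR_left_diff_distrib intD int[OF \<phi>])
    also have "norm \<dots> \<le> (\<integral>s. (B2 * (norm h)\<^sup>2) * norm (g s) \<partial>M)"
      using r by (intro norm_integral_le) (auto intro!: mult_right_mono g)
    finally show "norm ((\<integral>s. \<phi> (x + h - T s) *\<^sub>R g s \<partial>M) - (\<integral>s. \<phi> (x - T s) *\<^sub>R g s \<partial>M) - ?D x h)
        \<le> B2 * (\<integral>s. norm (g s) \<partial>M) * (norm h)\<^sup>2"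
      by (simp add: mult_ac)
  qed
qed

lemma frechet_derivative_convolution:
  fixes \<phi> :: "'a::euclidean_space \<Rightarrow> real" and g :: "'s \<Rightarrow> 'c::{banach, second_countable_topology}"
  assumes "\<phi> \<in> test_functions" "integrable M g" "T \<in> borel_measurable M"
  shows "frechet_derivative (\<lambda>x. \<integral>s. \<phi> (x - T s) *\<^sub>R g s \<partial>M) (at x) =
     (\<lambda>h. \<integral>s. frechet_derivative \<phi> (at (x - T s)) h *\<^sub>R g s \<partial>M)"
  by (rule frechet_derivative_at[OF has_derivative_convolution[OF assms], symmetric])

text \<open>All derivatives fall on \<phi>, and directional derivatives of test functions are test
  functions; the induction therefore runs over \<phi> with the integrable \<open>g\<close>
  fixed.\<close>

lemma C_k_convolution:
  fixes \<phi> :: "'a::euclidean_space \<Rightarrow> real" and g :: "'s \<Rightarrow> 'c::{banach, second_countable_topology}"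
  assumes "\<phi> \<in> test_functions" and g: "integrable M g" "T \<in> borel_measurable M"
  shows "C_k k (\<lambda>x. \<integral>s. \<phi> (x - T s) *\<^sub>R g s \<partial>M)"
  using assms(1)
proof (induction k arbitrary: \<phi>)
  case 0
  from has_derivative_convolution[OF 0 g] show ?case
    by (auto simp: continuous_on_eq_continuous_at intro: has_derivative_continuous)
next
  case (Suc k)
  show ?case
    using Suc.IH[OF test_functions_deriv[OF Suc.prems]] has_derivative_convolution[OF Suc.prems g]
    by (auto simp: frechet_derivative_convolution[OF Suc.prems g] differentiable_def)
qed

lemma test_functions_convolution:
  fixes \<phi> :: "'a::euclidean_space \<Rightarrow> real" and g :: "'s \<Rightarrow> 'c::{banach, second_countable_topology}"
  assumes \<phi>: "\<phi> \<in> test_functions" and g: "integrable M g" "T \<in> borel_measurable M"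
    and R: "\<And>s. norm (T s) > R \<Longrightarrow> g s = 0"
  shows "(\<lambda>x. \<integral>s. \<phi> (x - T s) *\<^sub>R g s \<partial>M) \<in> test_functions"
proof -
  obtain r where r: "r > 0" "\<And>x. norm x > r \<Longrightarrow> \<phi> x = 0" using test_functions_support[OF \<phi>] by blast
  have "(\<integral>s. \<phi> (x - T s) *\<^sub>R g s \<partial>M) = 0" if "norm x > r + R" for x
  proof -
    have "\<phi> (x - T s) *\<^sub>R g s = 0" for s
      using that R[of s] r(2)[of "x - T s"] norm_triangle_ineq2[of x "T s"]
      by (cases "norm (T s) > R") auto
    then have "(\<lambda>s. \<phi> (x - T s) *\<^sub>R g s) = (\<lambda>s. 0)" by blast
    then show ?thesis by simp
  qed
  then have "{x. (\<integral>s. \<phi> (x - T s) *\<^sub>R g s \<partial>M) \<noteq> 0} \<subseteq> cball 0 (r + R)"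
    by force
  then show ?thesis
    using C_k_convolution[OF \<phi> g] bounded_subset[OF bounded_cball] unfolding test_functions_iff by blast
qed

subsection \<open>Integration by parts\<close>

lemma lborel_integral_translate:
  fixes f :: "'a::euclidean_space \<Rightarrow> 'b::{banach, second_countable_topology}"
  assumes "f \<in> borel_measurable borel"
  shows "(\<integral>x. f (x + c) \<partial>lborel) = (\<integral>x. f x \<partial>lborel)"
proof -
  have "(\<integral>x. f x \<partial>lborel) = (\<integral>x. f x \<partial>distr lborel borel ((+) c))" by (simp add: lborel_distr_plus)
  also have "\<dots> = (\<integral>x. f (c + x) \<partial>lborel)" using assms by (intro integral_distr) auto
  finally show ?thesis by (simp add: add.commute)
qed

lemma lborel_integrable_translate:
  fixes f :: "'a::euclidean_space \<Rightarrow> 'b::{banach, second_countable_topology}"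
  assumes "integrable lborel f" shows "integrable lborel (\<lambda>x. f (x + c))"
proof -
  have "integrable (distr lborel borel ((+) c)) f" using assms by (simp add: lborel_distr_plus)
  then show ?thesis
    using borel_measurable_integrable[OF assms] by (subst (asm) integrable_distr_eq) (auto simp: add.commute)
qed

lemma test_functions_integrable:
  fixes f :: "'a::euclidean_space \<Rightarrow> 'b::euclidean_space"
  assumes "f \<in> test_functions" shows "integrable lborel f"
proof -
  obtain R where R: "R > 0" "\<And>x. norm x > R \<Longrightarrow> f x = 0" using test_functions_support[OF assms] by blast
  have "integrable lborel (\<lambda>x. indicator (cball 0 R) x *\<^sub>R f x)"
    using assms by (intro borel_integrable_compact) (auto intro: continuous_on_subset test_functions_continuous)
  moreover have "indicator (cball 0 R) x *\<^sub>R f x = f x" for x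
    using R(2)[of x] by (auto simp: indicator_def)
  ultimately show ?thesis by simp
qed

text \<open>The integral of f(x + t h) - f(x) vanishes by translation invariance. Its first order
  part is t times the integral in question and the remainder is O(t^2) on one fixed ball, so
  dividing by t and letting t tend to 0 gives the claim.\<close>

lemma integral_frechet_derivative_eq_0:
  fixes f :: "'a::euclidean_space \<Rightarrow> real"
  assumes f: "f \<in> test_functions" shows "(\<integral>x. frechet_derivative f (at x) h \<partial>lborel) = 0"
proof -
  let ?J = "\<integral>x. frechet_derivative f (at x) h \<partial>lborel"
  obtain R where R: "R > 0" "\<And>x. norm x > R \<Longrightarrow> f x = 0" using test_functions_support[OF f] by blast
  obtain B where B: "B > 0" "\<And>x h. norm (f (x + h) - f x - frechet_derivative f (at x) h) \<le> B * (norm h)\<^sup>2"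
    using test_functions_remainder[OF f] by blast
  \<comment> \<open>For t between 0 and 1 this ball contains the supports of \<open>f\<close> and of
    its translates by t h, so the remainder vanishes outside it.\<close>
  let ?K = "cball (0::'a) (R + norm h)"
  have lin: "linear (frechet_derivative f (at y))" for y
    using test_functions_differentiable[OF f] has_derivative_linear by blast
  have "\<bar>?J\<bar> \<le> B * (norm h)\<^sup>2 * measure lborel ?K * t" if t: "0 < t" "t \<le> 1" for t
  proof -
    let ?r = "\<lambda>x. f (x + t *\<^sub>R h) - f x - t * frechet_derivative f (at x) h"
    have fi: "integrable lborel f" "integrable lborel (\<lambda>x. f (x + t *\<^sub>R h))"
         "integrable lborel (\<lambda>x. frechet_derivative f (at x) h)"
      using f by (auto intro: test_functions_integrable test_functions_deriv lborel_integrable_translate)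
    have r: "\<bar>?r x\<bar> \<le> indicator ?K x * (B * (t\<^sup>2 * (norm h)\<^sup>2))" for x
    proof (cases "x \<in> ?K")
      case True
      then show ?thesis using B(2)[of x "t *\<^sub>R h"] by (simp add: linear_scale[OF lin] power_mult_distrib)
    next
      case False
      then have "norm x > R + norm h" by simp
      moreover have "norm (t *\<^sub>R h) \<le> norm h" using t by (simp add: mult_left_le_one_le)
      ultimately have "norm x > R" "norm (x + t *\<^sub>R h) > R"
        using norm_triangle_ineq2[of x "- (t *\<^sub>R h)"] norm_ge_zero[of h]
        by (smt (verit) norm_minus_cancel diff_minus_eq_add)+
      then show ?thesis using R(2) B(1) frechet_derivative_eq_0_outside[of R f x h] by (simp add: less_imp_le)
    qed
    have "- (t * ?J) = (\<integral>x. ?r x \<partial>lborel)"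
      using fi lborel_integral_translate[OF test_functions_measurable[OF f], of "t *\<^sub>R h"] by simp
    also have "\<bar>\<dots>\<bar> \<le> (\<integral>x. indicator ?K x * (B * (t\<^sup>2 * (norm h)\<^sup>2)) \<partial>lborel)"
      using fi r emeasure_lborel_cball_finite[of "0::'a" "R + norm h"]
      by (intro integral_abs_bound_integral) auto
    also have "\<dots> = measure lborel ?K * (B * (t\<^sup>2 * (norm h)\<^sup>2))"
      by simp
    finally have "t * \<bar>?J\<bar> \<le> t * (B * (norm h)\<^sup>2 * measure lborel ?K * t)"
      using t by (simp add: abs_mult power2_eq_square mult_ac)
    then show ?thesis using t by simp
  qed
  then have ev: "\<forall>\<^sub>F t in at_right 0. \<bar>?J\<bar> \<le> B * (norm h)\<^sup>2 * measure lborel ?K * t"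
    using eventually_at_right[of 0 "1::real"] by (auto simp: eventually_at_right_field intro: exI[of _ 1])
  have "((\<lambda>t. B * (norm h)\<^sup>2 * measure lborel ?K * t) \<longlongrightarrow> B * (norm h)\<^sup>2 * measure lborel ?K * 0) (at_right 0)"
    by (intro tendsto_intros)
  then have "\<bar>?J\<bar> \<le> B * (norm h)\<^sup>2 * measure lborel ?K * 0"
    by (rule tendsto_lowerbound[OF _ ev]) simp
  then show ?thesis by simp
qed

text \<open>The definitions integrate over the completed measure, while translation, affine
  substitution and Fubini are used over \<open>lborel\<close>; Borel integrands pass between the
  two.\<close>

lemma integral_lebesgue_lborel:
  fixes f :: "'a::euclidean_space \<Rightarrow> 'b::{banach, second_countable_topology}"
  assumes "f \<in> borel_measurable borel" shows "integral\<^sup>L lebesgue f = integral\<^sup>L lborel f"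
  using assms by (intro integral_completion) simp

lemma integrable_lebesgue_lborel:
  fixes f :: "'a::euclidean_space \<Rightarrow> 'b::{banach, second_countable_topology}"
  assumes "f \<in> borel_measurable borel" shows "integrable lebesgue f \<longleftrightarrow> integrable lborel f"
  using assms by (intro integrable_completion) simp

subsection \<open>Bump functions\<close>

text \<open>The whole family t^(-m) exp(-1/t) rather than exp(-1/t) alone, because its linear span
  is closed under differentiation; smoothness then follows by induction over the order for all
  \<open>m\<close> at once.\<close>

definition smooth_step :: "nat \<Rightarrow> real \<Rightarrow> real" where
  "smooth_step m t = (if t > 0 then inverse t ^ m * exp (- inverse t) else 0)"

lemma smooth_step_DERIV: "(smooth_step m has_field_derivative (smooth_step (m + 2) t - m * smooth_step (m + 1) t)) (at t)"
proof -
  consider "t > 0" | "t < 0" | "t = 0" by linarith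
  then show ?thesis
  proof cases
    case 1
    have "((\<lambda>t. inverse t ^ m * exp (- inverse t)) has_field_derivative
        (smooth_step (m + 2) t - m * smooth_step (m + 1) t)) (at t)"
    proof (rule DERIV_cong[OF DERIV_mult])
      show "((\<lambda>t. inverse t ^ m) has_field_derivative
          (of_nat m * (- (inverse t ^ Suc (Suc 0)) * inverse t ^ (m - Suc 0)))) (at t)"
        using 1 by (intro DERIV_power DERIV_inverse) simp
      show "((\<lambda>t. exp (- inverse t)) has_field_derivative (exp (- inverse t) * (inverse t)\<^sup>2)) (at t)"
        using 1 by (auto intro!: derivative_eq_intros simp: power2_eq_square)
    qed (use 1 in \<open>cases m; simp add: smooth_step_def power2_eq_square algebra_simps\<close>)
    then show ?thesis
      by (rule has_field_derivative_transform_within_open[where S="{0<..}"]) (use 1 in \<open>auto simp: smooth_step_def\<close>)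
  next
    case 2
    have "((\<lambda>t. 0) has_field_derivative (smooth_step (m + 2) t - m * smooth_step (m + 1) t)) (at t)"
      using 2 by (simp add: smooth_step_def)
    then show ?thesis
      by (rule has_field_derivative_transform_within_open[where S="{..<0}"]) (use 2 in \<open>auto simp: smooth_step_def\<close>)
  next
    case 3
    have "((\<lambda>h. smooth_step m h / h) \<longlongrightarrow> 0) (at_right 0)"
    proof -
      \<comment> \<open>With s = 1/h the difference quotient at 0 becomes s^(m+1) / exp s, which
        tends to 0 as s tends to infinity.\<close>
      have "((\<lambda>h. inverse h ^ (Suc m) / exp (inverse h)) \<longlongrightarrow> (0::real)) (at_right 0)"
        by (rule filterlim_compose[OF tendsto_power_div_exp_0 filterlim_inverse_at_top_right])
      moreover have "\<forall>\<^sub>F h in at_right (0::real). inverse h ^ (Suc m) / exp (inverse h) = smooth_step m h / h"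
        unfolding eventually_at_right_field by (intro exI[of _ 1]) (auto simp: smooth_step_def exp_minus field_simps)
      ultimately show ?thesis by (simp add: tendsto_cong)
    qed
    moreover have "((\<lambda>h. smooth_step m h / h) \<longlongrightarrow> 0) (at_left 0)"
    proof -
      have "\<forall>\<^sub>F h in at_left (0::real). 0 = smooth_step m h / h"
        unfolding eventually_at_left_field by (intro exI[of _ "-1"]) (auto simp: smooth_step_def)
      then show ?thesis using tendsto_cong[of "\<lambda>_. 0" "\<lambda>h. smooth_step m h / h"] by auto
    qed
    ultimately have "((\<lambda>h. smooth_step m h / h) \<longlongrightarrow> 0) (at 0)"
      by (rule filterlim_split_at[rotated])
    then show ?thesis using 3 by (simp add: DERIV_def smooth_step_def)
  qed
qed

lemma C_k_smooth_step: "C_k k (smooth_step m)"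
proof (induction k arbitrary: m)
  case 0
  show ?case using smooth_step_DERIV by (auto simp: continuous_on_eq_continuous_at intro: DERIV_isCont)
next
  case (Suc k)
  have LD: "(smooth_step m has_derivative (*) (smooth_step (m + 2) t - m * smooth_step (m + 1) t)) (at t)" for t
    using smooth_step_DERIV unfolding has_field_derivative_def .
  have fd: "frechet_derivative (smooth_step m) (at t) = (*) (smooth_step (m + 2) t - m * smooth_step (m + 1) t)" for t
    by (rule frechet_derivative_at[OF LD, symmetric])
  have "C_k k (\<lambda>t. (smooth_step (m + 2) t + (- real m) * smooth_step (m + 1) t) * h)" for h
    by (intro C_k_mult C_k_add C_k_const Suc.IH)
  with LD show ?case by (auto simp: fd differentiable_def)
qed

lemma smooth_step_bounds: "0 \<le> smooth_step 0 t" "smooth_step 0 t \<le> 1"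
  by (auto simp: smooth_step_def)

text \<open>Each factor equals exp(-1/(k t)) at distance t inside a face of the box and tends to 1
  as \<open>k\<close> grows. So \<open>k\<close> is a steepness, and the limit of the bumps is the
  indicator of the open box.\<close>

definition box_bump :: "real \<Rightarrow> 'a::euclidean_space \<Rightarrow> 'a \<Rightarrow> 'a \<Rightarrow> real" where
  "box_bump k a b x = (\<Prod>i\<in>Basis. smooth_step 0 (k * ((x - a) \<bullet> i)) * smooth_step 0 (k * ((b - x) \<bullet> i)))"

lemma box_bump_bounds: "0 \<le> box_bump k a b x" "box_bump k a b x \<le> 1"
  unfolding box_bump_def by (auto intro!: prod_nonneg prod_le_1 mult_le_one smooth_step_bounds mult_nonneg_nonneg)

lemma box_bump_outside: "x \<notin> box a b \<Longrightarrow> k > 0 \<Longrightarrow> box_bump k a b x = 0"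
  by (auto simp: box_bump_def mem_box smooth_step_def algebra_simps not_less mult_le_0_iff) force

lemma box_bump_test_functions:
  assumes "k > 0" shows "box_bump k a b \<in> test_functions"
proof -
  have "C_k n (\<lambda>x::'a. smooth_step 0 (k * ((x - a) \<bullet> i)) * smooth_step 0 (k * ((b - x) \<bullet> i)))" for n i
  proof (intro C_k_mult)
    have L: "bounded_linear (\<lambda>x. c * (x \<bullet> i))" for c
      by (intro bounded_linear_const_mult bounded_linear_inner_left)
    show "C_k n (\<lambda>x. smooth_step 0 (k * ((x - a) \<bullet> i)))"
      using C_k_affine[OF L C_k_smooth_step, of n 0 k "- k * (a \<bullet> i)"] by (simp add: algebra_simps)
    show "C_k n (\<lambda>x. smooth_step 0 (k * ((b - x) \<bullet> i)))"
      using C_k_affine[OF L C_k_smooth_step, of n 0 "- k" "k * (b \<bullet> i)"] by (simp add: algebra_simps)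
  qed
  then have "C_k n (\<lambda>x. box_bump k a b x)" for n
    unfolding box_bump_def by (intro C_k_prod) auto
  moreover have "{x. box_bump k a b x \<noteq> 0} \<subseteq> box a b" using box_bump_outside assms by blast
  ultimately show ?thesis
    unfolding test_functions_iff using bounded_subset[OF bounded_box] by blast
qed

lemma box_bump_LIMSEQ: "(\<lambda>n. box_bump (real (Suc n)) a b x) \<longlonglongrightarrow> indicator (box a b) x"
proof (cases "x \<in> box a b")
  case False
  then show ?thesis by (simp add: box_bump_outside)
next
  case True
  have lim: "(\<lambda>n. smooth_step 0 (real (Suc n) * t)) \<longlonglongrightarrow> 1" if "t > 0" for t
  proof -
    have "(\<lambda>n. exp (- (inverse (real (Suc n)) * inverse t))) \<longlonglongrightarrow> exp (- (0 * inverse t))"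
      by (intro tendsto_intros LIMSEQ_inverse_real_of_nat)
    then show ?thesis using that by (simp add: smooth_step_def)
  qed
  have "(\<lambda>n. box_bump (real (Suc n)) a b x) \<longlonglongrightarrow> (\<Prod>i\<in>(Basis::'a set). 1 * 1)"
    unfolding box_bump_def using True
    by (intro tendsto_prod tendsto_mult lim) (auto simp: mem_box algebra_simps)
  then show ?thesis using True by simp
qed

text \<open>The value 1 at the origin, which is also the maximum, makes the dilations
  \<open>\<zeta> ((1/R) *\<^sub>R x)\<close> cutoffs between 0 and 1 that tend to 1 pointwise as R
  grows.\<close>

lemma cutoff_exists:
  obtains \<zeta> :: "'a::euclidean_space \<Rightarrow> real"
  where "\<zeta> \<in> test_functions" "\<And>x. 0 \<le> \<zeta> x" "\<And>x. \<zeta> x \<le> 1" "\<zeta> 0 = 1" "\<And>x. x \<notin> box (- One) One \<Longrightarrow> \<zeta> x = 0"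
proof -
  let ?b = "box_bump 1 (- One) (One::'a)"
  have b0: "?b 0 = (\<Prod>i\<in>(Basis::'a set). exp (- 2))"
    unfolding box_bump_def by (intro prod.cong) (simp_all add: smooth_step_def flip: exp_add)
  then have pos: "?b 0 > 0" by (simp add: prod_pos)
  have le: "?b x \<le> ?b 0" for x
  proof (cases "x \<in> box (- One) One")
    case False
    then show ?thesis using box_bump_outside[of x "- One" One 1] pos by simp
  next
    case True
    show ?thesis unfolding b0 unfolding box_bump_def
    proof (intro prod_mono conjI)
      fix i :: 'a assume i: "i \<in> Basis"
      define t where "t = x \<bullet> i"
      have t: "-1 < t" "t < 1" using True i by (auto simp: mem_box t_def)
      \<comment> \<open>The exponent 1/(1+t) + 1/(1-t) is smallest at t = 0, so every coordinate
        factor is largest at the centre.\<close>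
      have "2 \<le> inverse (1 + t) + inverse (1 - t)"
      proof -
        have "inverse (1 + t) + inverse (1 - t) = 2 / (1 - t\<^sup>2)"
          using t by (simp add: field_simps power2_eq_square)
        moreover have "0 < 1 - t\<^sup>2" using t by (simp add: abs_square_less_1 abs_less_iff)
        moreover have "2 \<le> 2 / (1 - t\<^sup>2)" if "0 < 1 - t\<^sup>2"
          using that by (simp add: pos_le_divide_eq)
        ultimately show ?thesis by simp
      qed
      then have "smooth_step 0 (t + 1) * smooth_step 0 (1 - t) \<le> exp (- 2)"
        using t by (simp add: smooth_step_def add.commute flip: exp_add)
      then show "smooth_step 0 (1 * ((x - - One) \<bullet> i)) * smooth_step 0 (1 * ((One - x) \<bullet> i)) \<le> exp (- 2)"
        using i by (simp add: t_def algebra_simps)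
    qed (auto intro!: mult_nonneg_nonneg smooth_step_bounds)
  qed
  define B where "B = ?b"
  have B: "B 0 > 0" "B x \<le> B 0" "0 \<le> B x" "x \<notin> box (- One) One \<Longrightarrow> B x = 0" for x
    unfolding B_def by (fact pos le box_bump_bounds | rule box_bump_outside, simp_all)+
  have "B \<in> test_functions" unfolding B_def by (intro box_bump_test_functions) simp
  then have "(\<lambda>x. B x / B 0) \<in> test_functions"
    by (rule test_functions_linear[OF bounded_linear_divide])
  then show ?thesis
    using B by (intro that[of "\<lambda>x. B x / B 0"]) (auto simp: divide_le_eq_1)
qed

subsection \<open>Lebesgue spaces\<close>

text \<open>Fubini for integrands such as g(x - s) rests on joint measurability, which is automatic
  for Borel functions; Lebesgue measurable ones are first changed on a null set.\<close>

lemma borel_representative: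
  fixes f :: "'a::euclidean_space \<Rightarrow> 'b::euclidean_space"
  assumes f: "f \<in> borel_measurable lebesgue"
  obtains g where "g \<in> borel_measurable borel" "AE x in lebesgue. f x = g x"
proof -
  have "\<exists>g\<in>borel_measurable lborel. AE x in lborel. f x \<bullet> b = g x" for b
    using f by (intro completion_ex_borel_measurable_real) auto
  then obtain g where g: "\<And>b. g b \<in> borel_measurable lborel" "\<And>b. AE x in lborel. f x \<bullet> b = g b x"
    by metis
  show ?thesis
  proof (rule that)
    show "(\<lambda>x. \<Sum>b\<in>Basis. g b x *\<^sub>R b) \<in> borel_measurable borel" using g(1) by auto
    have "AE x in lborel. \<forall>b\<in>Basis. f x \<bullet> b = g b x" using g(2) by (intro AE_finite_allI) auto
    then show "AE x in lebesgue. f x = (\<Sum>b\<in>Basis. g b x *\<^sub>R b)"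
    proof (intro AE_completion, eventually_elim)
      case (elim x)
      then have "(\<Sum>b\<in>Basis. g b x *\<^sub>R b) = (\<Sum>b\<in>Basis. (f x \<bullet> b) *\<^sub>R b)" by (intro sum.cong) auto
      then show ?case by (simp add: euclidean_representation)
    qed
  qed
qed

lemma AE_lebesgue_iff: "(AE x in lebesgue. P x) \<longleftrightarrow> (AE x in lborel. P x)"
  by (rule AE_completion_iff)

lemma borel_measurable_lebesgueI: "f \<in> borel_measurable borel \<Longrightarrow> f \<in> borel_measurable lebesgue"
  by (simp add: measurable_completion)

lemma borel_measurable_indicator_lebesgue:
  "A \<in> sets borel \<Longrightarrow> indicat_real A \<in> borel_measurable lebesgue"
  by (simp add: borel_measurable_indicator)

lemma integrable_lebesgue_bounded_support:
  fixes f :: "'a::euclidean_space \<Rightarrow> 'b::euclidean_space"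
  assumes f: "f \<in> L1_loc" and k: "k \<in> borel_measurable lebesgue" "\<And>x. \<bar>k x\<bar> \<le> B"
    and R: "\<And>x. norm x > R \<Longrightarrow> k x = 0"
  shows "integrable lebesgue (\<lambda>x. k x *\<^sub>R f x)"
proof -
  have i: "integrable lebesgue (\<lambda>x. indicator (cball 0 R) x *\<^sub>R f x)"
    using f by (simp add: L1_loc_def set_integrable_def)
  have "integrable lebesgue (\<lambda>x. k x *\<^sub>R (indicator (cball 0 R) x *\<^sub>R f x))"
  proof (rule Bochner_Integration.integrable_bound[where f="\<lambda>x. B * norm (indicator (cball 0 R) x *\<^sub>R f x)"])
    show "AE x in lebesgue. norm (k x *\<^sub>R (indicat_real (cball 0 R) x *\<^sub>R f x))
            \<le> norm (B * norm (indicator (cball 0 R) x *\<^sub>R f x))"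
      using k(2) by (auto simp: abs_mult indicator_def intro!: mult_right_mono order_trans[OF _ abs_ge_self])
    show "integrable lebesgue (\<lambda>x. B * norm (indicat_real (cball 0 R) x *\<^sub>R f x))"
      using i by (intro integrable_mult_right integrable_norm)
    show "(\<lambda>x. k x *\<^sub>R (indicat_real (cball 0 R) x *\<^sub>R f x)) \<in> borel_measurable lebesgue"
      using k(1) borel_measurable_integrable[OF i] by (rule borel_measurable_scaleR)
  qed
  moreover have "k x *\<^sub>R (indicator (cball 0 R) x *\<^sub>R f x) = k x *\<^sub>R f x" for x
    using R[of x] by (cases "norm x > R") (auto simp: indicator_def)
  ultimately show ?thesis by (simp only:)
qed

lemma integrable_lebesgue_test_function:
  fixes f :: "'a::euclidean_space \<Rightarrow> 'b::euclidean_space"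
  assumes "f \<in> L1_loc" "\<eta> \<in> test_functions"
  shows "integrable lebesgue (\<lambda>x. \<eta> x *\<^sub>R f x)"
proof -
  obtain B where "\<And>x. norm (\<eta> x) \<le> B" using test_functions_bounded[OF assms(2)] by blast
  moreover obtain R where "\<And>x. norm x > R \<Longrightarrow> \<eta> x = 0" using test_functions_support[OF assms(2)] by blast
  ultimately show ?thesis
    using assms by (intro integrable_lebesgue_bounded_support[where R=R and B=B]
        borel_measurable_lebesgueI test_functions_measurable) auto
qed

lemma integrable_lebesgue_test_field:
  fixes f :: "'a::euclidean_space \<Rightarrow> 'b::euclidean_space"
  assumes "f \<in> L1_loc" "\<phi> \<in> test_functions"
  shows "integrable lebesgue (\<lambda>x. f x \<bullet> \<phi> x)"
proof -
  have "(\<lambda>x. \<phi> x \<bullet> b) \<in> test_functions" for b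
    by (rule test_functions_linear[OF bounded_linear_inner_left assms(2)])
  then have "integrable lebesgue (\<lambda>x. \<Sum>b\<in>Basis. ((\<phi> x \<bullet> b) *\<^sub>R f x) \<bullet> b)"
    using assms(1) by (intro Bochner_Integration.integrable_sum integrable_inner_left integrable_lebesgue_test_function)
  then show ?thesis by (simp add: euclidean_inner[of "f _" "\<phi> _"] mult.commute)
qed

lemma bounded_subset_cball_0: "bounded (S :: 'a::real_normed_vector set) \<Longrightarrow> \<exists>R. S \<subseteq> cball 0 R"
  unfolding bounded_iff by (meson mem_cball_0 subsetI)

lemma L1_loc_iff_cball:
  "f \<in> L1_loc \<longleftrightarrow> (\<forall>R. integrable lebesgue (\<lambda>x. indicator (cball 0 R) x *\<^sub>R f x))"
proof
  assume "f \<in> L1_loc"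
  then show "\<forall>R. integrable lebesgue (\<lambda>x. indicator (cball 0 R) x *\<^sub>R f x)"
    by (simp add: L1_loc_def set_integrable_def)
next
  assume *: "\<forall>R. integrable lebesgue (\<lambda>x. indicator (cball 0 R) x *\<^sub>R f x)"
  show "f \<in> L1_loc" unfolding L1_loc_def
  proof safe
    fix K :: "'a set" assume K: "compact K"
    then obtain R where R: "K \<subseteq> cball 0 R" using bounded_subset_cball_0[OF compact_imp_bounded] by blast
    have "K \<in> sets lebesgue" using K by (simp add: borel_compact)
    then have "integrable lebesgue (\<lambda>x. indicator K x *\<^sub>R (indicator (cball 0 R) x *\<^sub>R f x))"
      using *[rule_format, of R] by (rule integrable_mult_indicator)
    moreover have "indicat_real K x *\<^sub>R (indicat_real (cball 0 R) x *\<^sub>R f x) = indicator K x *\<^sub>R f x" for x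
      using R by (auto simp: indicator_def)
    ultimately show "f absolutely_integrable_on K" unfolding set_integrable_def by (simp only:)
  qed
qed

lemma L1_loc_measurable:
  fixes f :: "'a::euclidean_space \<Rightarrow> 'b::euclidean_space"
  assumes "f \<in> L1_loc" shows "f \<in> borel_measurable lebesgue"
proof (rule borel_measurable_LIMSEQ_metric)
  show "(\<lambda>x. indicator (cball 0 (real n)) x *\<^sub>R f x) \<in> borel_measurable lebesgue" for n
    using assms by (intro borel_measurable_integrable) (simp add: L1_loc_iff_cball)
  fix x :: 'a
  have "\<forall>\<^sub>F n in sequentially. norm x \<le> real n"
    using filterlim_real_sequentially by (simp add: filterlim_at_top)
  then have "\<forall>\<^sub>F n in sequentially. indicator (cball 0 (real n)) x *\<^sub>R f x = f x"
    by eventually_elim simp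
  then show "(\<lambda>n. indicator (cball 0 (real n)) x *\<^sub>R f x) \<longlonglongrightarrow> f x"
    by (rule tendsto_eventually)
qed

lemma L1_loc_add: "f \<in> L1_loc \<Longrightarrow> g \<in> L1_loc \<Longrightarrow> (\<lambda>x. f x + g x) \<in> L1_loc"
  by (simp add: L1_loc_iff_cball scaleR_right_distrib)

lemma L1_loc_scaleR: "f \<in> L1_loc \<Longrightarrow> (\<lambda>x. c *\<^sub>R f x) \<in> L1_loc"
  unfolding L1_loc_iff_cball scaleR_left_commute[of _ c] by (intro allI integrable_scaleR_right) auto

lemma L1_loc_bounded_mult:
  fixes f :: "'a::euclidean_space \<Rightarrow> 'b::euclidean_space"
  assumes "f \<in> L1_loc" "k \<in> borel_measurable lebesgue" "\<And>x. \<bar>k x\<bar> \<le> B"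
  shows "(\<lambda>x. k x *\<^sub>R f x) \<in> L1_loc"
  unfolding L1_loc_iff_cball
proof
  fix R
  have "integrable lebesgue (\<lambda>x. (indicator (cball 0 R) x * k x) *\<^sub>R f x)"
    using assms order_trans[OF abs_ge_zero assms(3)]
    by (intro integrable_lebesgue_bounded_support[where B="B" and R=R] borel_measurable_times
        borel_measurable_indicator_lebesgue) (auto simp: indicator_def)
  then show "integrable lebesgue (\<lambda>x. indicat_real (cball 0 R) x *\<^sub>R (k x *\<^sub>R f x))" by simp
qed

lemma L1_loc_AE_bounded:
  fixes f :: "'a::euclidean_space \<Rightarrow> 'b::euclidean_space"
  assumes "f \<in> borel_measurable lebesgue" "AE x in lebesgue. norm (f x) \<le> B"
  shows "f \<in> L1_loc"
  unfolding L1_loc_iff_cball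
proof
  fix R :: real
  have "integrable lebesgue (\<lambda>x::'a. indicator (cball 0 R) x * B)"
    using emeasure_lborel_cball_finite[of "0::'a" R] by simp
  then show "integrable lebesgue (\<lambda>x. indicat_real (cball 0 R) x *\<^sub>R f x)"
  proof (rule Bochner_Integration.integrable_bound)
    show "(\<lambda>x. indicat_real (cball 0 R) x *\<^sub>R f x) \<in> borel_measurable lebesgue"
      using assms(1) by (intro borel_measurable_scaleR borel_measurable_indicator_lebesgue) auto
    show "AE x in lebesgue. norm (indicat_real (cball 0 R) x *\<^sub>R f x) \<le> norm (indicat_real (cball 0 R) x * B)"
      using assms(2) by eventually_elim (auto simp: indicator_def)
  qed
qed

lemma Linf_L1_loc: "f \<in> Linf \<Longrightarrow> f \<in> L1_loc"
  unfolding Linf_def using L1_loc_AE_bounded by blast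

lemma L1_loc_const: "(\<lambda>x. c) \<in> L1_loc"
  by (rule L1_loc_AE_bounded[where B="norm c"]) auto

lemma test_functions_L1_loc:
  fixes f :: "'a::euclidean_space \<Rightarrow> 'b::euclidean_space"
  assumes "f \<in> test_functions" shows "f \<in> L1_loc"
proof -
  obtain B where "\<And>x. norm (f x) \<le> B" using test_functions_bounded[OF assms] by blast
  then show ?thesis
    using assms by (intro L1_loc_AE_bounded borel_measurable_lebesgueI test_functions_measurable) auto
qed

text \<open>The Bochner integral of a non-integrable function is 0, so a bound on
  \<open>L2sq f\<close> is meaningful only together with \<open>f \<in> L2\<close>;
  \<open>L2I\<close> yields both from a bound on the non-negative integral.\<close>

definition L2sq :: "('a::euclidean_space \<Rightarrow> 'b::euclidean_space) \<Rightarrow> real" where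
  "L2sq f = (\<integral>x. (norm (f x))\<^sup>2 \<partial>lebesgue)"

lemma L2sq_nonneg: "0 \<le> L2sq f" by (simp add: L2sq_def)

lemma L2_nn_integral: "f \<in> L2 \<Longrightarrow> (\<integral>\<^sup>+x. ennreal ((norm (f x))\<^sup>2) \<partial>lebesgue) = ennreal (L2sq f)"
  unfolding L2_def L2sq_def by (simp add: nn_integral_eq_integral)

lemma L2I:
  fixes f :: "'a::euclidean_space \<Rightarrow> 'b::euclidean_space"
  assumes f: "f \<in> borel_measurable lebesgue" and le: "(\<integral>\<^sup>+x. ennreal ((norm (f x))\<^sup>2) \<partial>lebesgue) \<le> ennreal c"
    and c: "0 \<le> c"
  shows "f \<in> L2" "L2sq f \<le> c"
proof -
  show "f \<in> L2" unfolding L2_def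
    using f le by (auto intro!: integrableI_nonneg simp: le_less_trans)
  then show "L2sq f \<le> c" using L2_nn_integral le c by (metis ennreal_le_iff)
qed

lemma L2_cong_AE:
  fixes f :: "'a::euclidean_space \<Rightarrow> 'b::euclidean_space"
  assumes "f \<in> L2" "g \<in> borel_measurable lebesgue" "AE x in lebesgue. f x = g x"
  shows "g \<in> L2" "L2sq g = L2sq f"
proof -
  have "AE x in lebesgue. (norm (f x))\<^sup>2 = (norm (g x))\<^sup>2" using assms(3) by eventually_elim simp
  moreover have "f \<in> borel_measurable lebesgue" using assms(1) by (simp add: L2_def)
  ultimately show "g \<in> L2" "L2sq g = L2sq f" using assms
    by (auto simp: L2_def L2sq_def intro: integral_cong_AE integrable_cong_AE_imp)
qed

lemma L2_inner_integrable:
  fixes f g :: "'a::euclidean_space \<Rightarrow> 'b::euclidean_space"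
  assumes "f \<in> L2" "g \<in> L2" shows "integrable lebesgue (\<lambda>x. f x \<bullet> g x)"
proof (rule Bochner_Integration.integrable_bound[where f="\<lambda>x. (norm (f x))\<^sup>2 + (norm (g x))\<^sup>2"])
  have "\<bar>a \<bullet> b\<bar> \<le> (norm a)\<^sup>2 + (norm b)\<^sup>2" for a b :: 'b
  proof -
    have "\<bar>a \<bullet> b\<bar> \<le> norm a * norm b" by (rule Cauchy_Schwarz_ineq2)
    also have "2 * (norm a * norm b) \<le> (norm a)\<^sup>2 + (norm b)\<^sup>2" using sum_squares_bound[of "norm a" "norm b"] by simp
    then have "norm a * norm b \<le> (norm a)\<^sup>2 + (norm b)\<^sup>2" using mult_nonneg_nonneg[of "norm a" "norm b", OF norm_ge_zero norm_ge_zero] by linarith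
    finally show ?thesis .
  qed
  then show "AE x in lebesgue. norm (f x \<bullet> g x) \<le> norm ((norm (f x))\<^sup>2 + (norm (g x))\<^sup>2)" by simp
qed (use assms in \<open>auto simp: L2_def\<close>)

lemma L2_add_scaleR:
  fixes f g :: "'a::euclidean_space \<Rightarrow> 'b::euclidean_space"
  assumes "f \<in> L2" "g \<in> L2"
  shows "(\<lambda>x. f x + c *\<^sub>R g x) \<in> L2"
    and "L2sq (\<lambda>x. f x + c *\<^sub>R g x) = L2sq f + 2 * c * (\<integral>x. f x \<bullet> g x \<partial>lebesgue) + c\<^sup>2 * L2sq g"
proof -
  have eq: "(norm (f x + c *\<^sub>R g x))\<^sup>2 = (norm (f x))\<^sup>2 + 2 * c * (f x \<bullet> g x) + c\<^sup>2 * (norm (g x))\<^sup>2" for x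
    by (simp add: power2_norm_eq_inner inner_add_left inner_add_right inner_commute[of "g x" "f x"]
        power2_eq_square[of c] algebra_simps)
  have i: "integrable lebesgue (\<lambda>x. f x \<bullet> g x)" by (rule L2_inner_integrable[OF assms])
  show "(\<lambda>x. f x + c *\<^sub>R g x) \<in> L2" using assms i by (auto simp: L2_def eq)
  show "L2sq (\<lambda>x. f x + c *\<^sub>R g x) = L2sq f + 2 * c * (\<integral>x. f x \<bullet> g x \<partial>lebesgue) + c\<^sup>2 * L2sq g"
    unfolding L2sq_def eq using assms i by (simp add: L2_def)
qed

lemma L2_0: "(\<lambda>x. 0) \<in> L2" by (simp add: L2_def)

lemma L2_scaleR:
  fixes f :: "'a::euclidean_space \<Rightarrow> 'b::euclidean_space"
  assumes "f \<in> L2" shows "(\<lambda>x. c *\<^sub>R f x) \<in> L2" "L2sq (\<lambda>x. c *\<^sub>R f x) = c\<^sup>2 * L2sq f"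
  using L2_add_scaleR[OF L2_0 assms, of c] by (simp_all add: L2sq_def)

lemma L2_add:
  fixes f g :: "'a::euclidean_space \<Rightarrow> 'b::euclidean_space"
  assumes "f \<in> L2" "g \<in> L2" shows "(\<lambda>x. f x + g x) \<in> L2" "L2sq (\<lambda>x. f x + g x) \<le> 2 * L2sq f + 2 * L2sq g"
proof -
  show "(\<lambda>x. f x + g x) \<in> L2" using L2_add_scaleR(1)[OF assms, of 1] by simp
  have "L2sq (\<lambda>x. f x + g x) + L2sq (\<lambda>x. f x - g x) = 2 * L2sq f + 2 * L2sq g"
    using L2_add_scaleR(2)[OF assms, of 1] L2_add_scaleR(2)[OF assms, of "-1"] by simp
  then show "L2sq (\<lambda>x. f x + g x) \<le> 2 * L2sq f + 2 * L2sq g" using L2sq_nonneg[of "\<lambda>x. f x - g x"] by linarith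
qed

lemma L2_diff:
  fixes f g :: "'a::euclidean_space \<Rightarrow> 'b::euclidean_space"
  assumes "f \<in> L2" "g \<in> L2" shows "(\<lambda>x. f x - g x) \<in> L2"
    "L2sq (\<lambda>x. f x - g x) = L2sq f - 2 * (\<integral>x. f x \<bullet> g x \<partial>lebesgue) + L2sq g"
  using L2_add_scaleR[OF assms, of "-1"] by simp_all

lemma quadratic_form_Cauchy_Schwarz:
  fixes a b c :: real
  assumes "\<And>t. 0 \<le> a + 2 * t * b + t\<^sup>2 * c" "0 \<le> c"
  shows "b\<^sup>2 \<le> a * c"
proof (cases "c = 0")
  case True
  show ?thesis
  proof (cases "b = 0")
    case False
    \<comment> \<open>For c = 0 the form is affine in t, and this t gives it the value -1.\<close>
    then show ?thesis using assms(1)[of "- (a + 1) / (2 * b)"] True by (simp add: field_simps)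
  qed (use True in simp)
next
  case False
  then have "c > 0" using assms(2) by simp
  then show ?thesis using assms(1)[of "- b / c"] by (simp add: field_simps power2_eq_square)
qed

lemma L2_Cauchy_Schwarz:
  fixes f g :: "'a::euclidean_space \<Rightarrow> 'b::euclidean_space"
  assumes "f \<in> L2" "g \<in> L2" shows "(\<integral>x. f x \<bullet> g x \<partial>lebesgue)\<^sup>2 \<le> L2sq f * L2sq g"
  by (rule quadratic_form_Cauchy_Schwarz)
     (use L2sq_nonneg[of "\<lambda>x. f x + t *\<^sub>R g x" for t] L2sq_nonneg[of g] L2_add_scaleR(2)[OF assms] in \<open>auto simp: mult_ac\<close>)

lemma L2_L1_loc:
  fixes f :: "'a::euclidean_space \<Rightarrow> 'b::euclidean_space"
  assumes "f \<in> L2" shows "f \<in> L1_loc"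
  unfolding L1_loc_iff_cball
proof
  fix R :: real
  have i: "integrable lebesgue (indicat_real (cball (0::'a) R))"
    using emeasure_lborel_cball_finite[of "0::'a" R] by simp
  show "integrable lebesgue (\<lambda>x. indicat_real (cball 0 R) x *\<^sub>R f x)"
  proof (rule Bochner_Integration.integrable_bound)
    show "integrable lebesgue (\<lambda>x. indicat_real (cball 0 R) x + (norm (f x))\<^sup>2)"
      using assms i by (auto simp: L2_def)
    have "t \<le> 1 + t\<^sup>2" if "0 \<le> t" for t :: real
      using sum_squares_bound[of t 1] that by (simp add: power2_eq_square)
    then show "AE x in lebesgue. norm (indicat_real (cball 0 R) x *\<^sub>R f x)
        \<le> norm (indicat_real (cball 0 R) x + (norm (f x))\<^sup>2)"
      by (auto simp: indicator_def)
    show "(\<lambda>x. indicat_real (cball 0 R) x *\<^sub>R f x) \<in> borel_measurable lebesgue"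
      using assms by (intro borel_measurable_scaleR borel_measurable_indicator_lebesgue) (auto simp: L2_def)
  qed
qed

lemma test_functions_L2:
  fixes f :: "'a::euclidean_space \<Rightarrow> 'b::euclidean_space"
  assumes "f \<in> test_functions" shows "f \<in> L2"
proof -
  have "integrable lebesgue (\<lambda>x. f x \<bullet> f x)"
    using assms by (intro integrable_lebesgue_test_field test_functions_L1_loc)
  then show ?thesis
    using assms by (simp add: L2_def power2_norm_eq_inner borel_measurable_lebesgueI test_functions_measurable)
qed

subsection \<open>The fundamental lemma of the calculus of variations\<close>

text \<open>Open boxes are stable under intersection and generate the Borel sets, so vanishing
  integrals over boxes propagate to all Borel sets. The vanishing total integral enters for
  complements.\<close>

lemma AE_zero_if_box_integrals_zero:
  fixes f :: "'a::euclidean_space \<Rightarrow> real"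
  assumes f: "integrable lborel f" and zero: "\<And>a b. (\<integral>x. indicator (box a b) x *\<^sub>R f x \<partial>lborel) = 0"
    and UN: "(\<integral>x. f x \<partial>lborel) = 0"
  shows "AE x in lborel. f x = 0"
proof (rule sigma_finite_measure.density_zero[OF sigma_finite_lborel f])
  let ?G = "range (\<lambda>(a, b). box a b :: 'a set)"
  fix A :: "'a set" assume "A \<in> sets lborel"
  then have A: "A \<in> sigma_sets UNIV ?G" by (simp add: borel_eq_box)
  have "Int_stable ?G" by (auto simp: Int_stable_def box_Int_box)
  moreover have "?G \<subseteq> Pow UNIV" by auto
  ultimately show "set_lebesgue_integral lborel A f = 0" using A
  proof (induction rule: sigma_sets_induct_disjoint)
    case (compl A)
    then have A: "A \<in> sets lborel" by (simp add: borel_eq_box)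
    have "integrable lborel (\<lambda>x. indicator A x *\<^sub>R f x)"
      using A f by (rule integrable_mult_indicator)
    moreover have "indicator (UNIV - A) x *\<^sub>R f x = f x - indicator A x *\<^sub>R f x" for x
      by (auto simp: indicator_def)
    ultimately show ?case using compl(2) f UN by (simp add: set_lebesgue_integral_def)
  next
    case (union A)
    then have "A i \<in> sets lborel" for i by (auto simp: borel_eq_box)
    moreover have "set_integrable lborel (\<Union> (range A)) f"
      unfolding set_integrable_def using calculation f by (intro integrable_mult_indicator) auto
    ultimately show ?case
      using union by (subst lebesgue_integral_countable_add) (auto simp: disjoint_family_on_def)
  qed (use zero in \<open>auto simp: set_lebesgue_integral_def\<close>)
qed

text \<open>The bumps tend to indicators of boxes, so dominated convergence turns the hypothesis
  into vanishing integrals over boxes. Since \<open>g\<close> is only locally integrable, the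
  measure theoretic lemma is applied to its restriction to each box, and an exhaustion by boxes
  concludes.\<close>

lemma fundamental_lemma:
  fixes g :: "'a::euclidean_space \<Rightarrow> real"
  assumes g: "g \<in> L1_loc" and zero: "\<And>\<eta>. \<eta> \<in> test_functions \<Longrightarrow> (\<integral>x. g x * \<eta> x \<partial>lebesgue) = 0"
  shows "AE x in lebesgue. g x = 0"
proof -
  have box_int: "integrable lebesgue (\<lambda>x. indicator (box a b) x * g x)" for a b
  proof -
    obtain R where R: "box a b \<subseteq> cball 0 R" using bounded_subset_cball_0[OF bounded_box] by blast
    then show ?thesis
      using integrable_lebesgue_bounded_support[OF g borel_measurable_indicator_lebesgue, of "box a b" 1 R]
      by (force simp: indicator_def)
  qed
  have box_zero: "(\<integral>x. indicator (box a b) x * g x \<partial>lebesgue) = 0" for a b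
  proof -
    have gm: "g \<in> borel_measurable lebesgue" by (rule L1_loc_measurable[OF g])
    have "(\<lambda>n. \<integral>x. g x * box_bump (real (Suc n)) a b x \<partial>lebesgue) \<longlonglongrightarrow> (\<integral>x. indicator (box a b) x * g x \<partial>lebesgue)"
    proof (rule integral_dominated_convergence[where w="\<lambda>x. norm (indicator (box a b) x * g x)"])
      show "(\<lambda>x. g x * box_bump (real (Suc n)) a b x) \<in> borel_measurable lebesgue" for n
        using gm borel_measurable_lebesgueI[OF test_functions_measurable[OF box_bump_test_functions[of "real (Suc n)" a b]]]
        by simp
      show "(\<lambda>x. indicat_real (box a b) x * g x) \<in> borel_measurable lebesgue"
        using gm by (intro borel_measurable_times borel_measurable_indicator_lebesgue) auto
      show "integrable lebesgue (\<lambda>x. norm (indicat_real (box a b) x * g x))"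
        using box_int by (rule integrable_norm)
      show "AE x in lebesgue. (\<lambda>n. g x * box_bump (real (Suc n)) a b x) \<longlonglongrightarrow> indicat_real (box a b) x * g x"
        unfolding mult.commute[of "g _"] by (intro AE_I2 tendsto_mult_right box_bump_LIMSEQ)
      have "norm (g x * box_bump (real (Suc n)) a b x) \<le> norm (indicat_real (box a b) x * g x)" for n x
        using box_bump_bounds[of "real (Suc n)" a b x] box_bump_outside[of x a b "real (Suc n)"]
        by (cases "x \<in> box a b") (auto simp: abs_mult mult_left_le)
      then show "AE x in lebesgue. norm (g x * box_bump (real (Suc n)) a b x)
          \<le> norm (indicat_real (box a b) x * g x)" for n by simp
    qed
    moreover have "(\<integral>x. g x * box_bump (real (Suc n)) a b x \<partial>lebesgue) = 0" for n
      by (intro zero box_bump_test_functions) simp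
    ultimately have "(\<lambda>n. 0) \<longlonglongrightarrow> (\<integral>x. indicator (box a b) x * g x \<partial>lebesgue)"
      by (simp only:)
    then show ?thesis by (simp add: LIMSEQ_const_iff)
  qed
  obtain g0 where g0: "g0 \<in> borel_measurable borel" "AE x in lebesgue. g x = g0 x"
    using borel_representative[OF L1_loc_measurable[OF g]] by blast
  have "AE x in lborel. indicator (box a b) x * g0 x = 0" for a b
  proof (rule AE_zero_if_box_integrals_zero)
    have eq: "(\<integral>x. indicator (box c d) x * (indicator (box a b) x * g0 x) \<partial>lborel) = 0" for c d
    proof -
      obtain p q where pq: "box c d \<inter> box a b = box p q" by (simp add: box_Int_box)
      have e: "indicator (box c d) x * (indicator (box a b) x * y) = indicator (box p q) x * y" for x and y :: real
        unfolding pq[symmetric] by (simp add: indicator_def)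
      have "(\<integral>x. indicator (box p q) x * g0 x \<partial>lborel) = (\<integral>x. indicator (box p q) x * g0 x \<partial>lebesgue)"
        using g0(1) by (intro integral_lebesgue_lborel[symmetric]) auto
      also have "\<dots> = (\<integral>x. indicator (box p q) x * g x \<partial>lebesgue)"
        using g0 L1_loc_measurable[OF g]
        by (intro integral_cong_AE borel_measurable_times borel_measurable_indicator_lebesgue)
           (auto intro: borel_measurable_lebesgueI)
      finally show ?thesis unfolding e box_zero .
    qed
    then show "(\<integral>x. indicat_real (box c d) x *\<^sub>R (indicat_real (box a b) x * g0 x) \<partial>lborel) = 0" for c d by simp
    have "indicat_real (box a b) x * (indicat_real (box a b) x * g0 x) = indicat_real (box a b) x * g0 x" for x
      by (simp add: indicator_def)
    then show "(\<integral>x. indicat_real (box a b) x * g0 x \<partial>lborel) = 0" using eq[of a b] by (simp only:)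
    have "integrable lebesgue (\<lambda>x. indicat_real (box a b) x * g0 x)"
      by (rule integrable_cong_AE_imp[OF box_int[of a b]])
         (use g0 in \<open>auto intro: borel_measurable_lebesgueI\<close>)
    then show "integrable lborel (\<lambda>x. indicat_real (box a b) x * g0 x)"
      using g0(1) by (subst (asm) integrable_lebesgue_lborel) auto
  qed
  then have "AE x in lborel. \<forall>n::nat. indicator (box (- (real n *\<^sub>R One)) (real n *\<^sub>R One)) x * g0 x = 0"
    unfolding AE_all_countable by (intro allI)
  then have "AE x in lborel. g0 x = 0"
  proof eventually_elim
    case (elim x)
    obtain n :: nat where n: "norm x < real n" using reals_Archimedean2 by blast
    have "x \<in> box (- (real n *\<^sub>R One)) (real n *\<^sub>R One)"
      using n Basis_le_norm[of _ x] by (force simp: mem_box abs_less_iff)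
    with elim[rule_format, of n] show ?case by simp
  qed
  then have "AE x in lebesgue. g0 x = 0" by (simp add: AE_lebesgue_iff)
  with g0(2) show ?thesis by eventually_elim simp
qed

lemma fundamental_lemma_field:
  fixes G :: "'a::euclidean_space \<Rightarrow> 'b::euclidean_space"
  assumes G: "G \<in> L1_loc" and zero: "\<And>\<phi>. \<phi> \<in> test_functions \<Longrightarrow> (\<integral>x. G x \<bullet> \<phi> x \<partial>lebesgue) = 0"
  shows "AE x in lebesgue. G x = 0"
proof -
  have "AE x in lebesgue. G x \<bullet> b = 0" for b
  proof (rule fundamental_lemma)
    show "(\<lambda>x. G x \<bullet> b) \<in> L1_loc"
      using G by (simp add: L1_loc_iff_cball flip: inner_scaleR_left)
    fix \<eta> :: "'a \<Rightarrow> real" assume "\<eta> \<in> test_functions"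
    then have "(\<lambda>x. \<eta> x *\<^sub>R b) \<in> test_functions"
      by (rule test_functions_linear[OF bounded_linear_scaleR_left])
    from zero[OF this] show "(\<integral>x. (G x \<bullet> b) * \<eta> x \<partial>lebesgue) = 0" by (simp add: mult.commute)
  qed
  then have "AE x in lebesgue. \<forall>b\<in>Basis. G x \<bullet> b = 0" by (intro AE_finite_allI) auto
  then show ?thesis by eventually_elim (simp add: euclidean_all_zero_iff)
qed

subsection \<open>Completeness and minimising sequences\<close>

text \<open>With the weight 2^k the squared increments, of size 4^(-k) in the mean, remain summable,
  so the weighted series is finite almost everywhere. Its terms then bound the increments by a
  multiple of 2^(-k/2), which is summable.\<close>

lemma L2_fast_Cauchy_convergent:
  fixes f :: "nat \<Rightarrow> 's \<Rightarrow> 'c::euclidean_space"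
  assumes [measurable]: "\<And>k. f k \<in> borel_measurable M"
    and le: "\<And>k. (\<integral>\<^sup>+x. ennreal ((norm (f k x - f (Suc k) x))\<^sup>2) \<partial>M) \<le> ennreal (c * (1/4)^k)"
    and c: "0 \<le> c"
  shows "AE x in M. convergent (\<lambda>k. f k x)"
proof -
  let ?d = "\<lambda>k x. ennreal (2^k * (norm (f k x - f (Suc k) x))\<^sup>2)"
  have "(\<integral>\<^sup>+x. (\<Sum>k. ?d k x) \<partial>M) = (\<Sum>k. \<integral>\<^sup>+x. ?d k x \<partial>M)" by (rule nn_integral_suminf) simp
  also have "\<dots> \<le> (\<Sum>k. ennreal (c * (1/2)^k))"
  proof (intro suminf_le allI)
    fix k
    have "(\<integral>\<^sup>+x. ?d k x \<partial>M) = ennreal (2^k) * (\<integral>\<^sup>+x. ennreal ((norm (f k x - f (Suc k) x))\<^sup>2) \<partial>M)"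
      by (subst nn_integral_cmult[symmetric]) (auto simp: ennreal_mult)
    also have "\<dots> \<le> ennreal (2^k) * ennreal (c * (1/4)^k)" by (intro mult_left_mono le) simp
    also have "\<dots> = ennreal (c * (1/2)^k)"
    proof -
      have "(2::real)^k * (1/4)^k = (1/2)^k" by (simp flip: power_mult_distrib)
      then show ?thesis using c by (subst ennreal_mult[symmetric]) (auto simp: mult.left_commute[of "2^k"])
    qed
    finally show "(\<integral>\<^sup>+x. ?d k x \<partial>M) \<le> ennreal (c * (1/2)^k)" .
  qed auto
  also have "\<dots> = ennreal (\<Sum>k. c * (1/2)^k)"
    using c by (intro suminf_ennreal2 summable_mult) (auto simp: summable_geometric)
  finally have "(\<integral>\<^sup>+x. (\<Sum>k. ?d k x) \<partial>M) \<noteq> \<infinity>" by (auto simp: top_unique)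
  then have "AE x in M. (\<Sum>k. ?d k x) \<noteq> \<infinity>" by (intro nn_integral_PInf_AE) simp_all
  then show ?thesis
  proof eventually_elim
    case (elim x)
    define U where "U = (\<Sum>k. ?d k x)"
    have "U \<noteq> top" using elim by (simp add: U_def)
    then obtain S where "U = ennreal S" "0 \<le> S" using ennreal_cases[of U] by blast
    then have S: "(\<Sum>k. ?d k x) = ennreal S" "0 \<le> S" by (simp_all add: U_def)
    have "norm (f (Suc k) x - f k x) \<le> sqrt S * (sqrt (1/2))^k" for k
    proof -
      define d where "d = (\<lambda>k. ?d k x)"
      have "sum d {k} \<le> suminf d" by (intro sum_le_suminf summableI) auto
      then have "?d k x \<le> (\<Sum>k. ?d k x)" by (simp add: d_def)
      then have "2^k * (norm (f k x - f (Suc k) x))\<^sup>2 \<le> S" unfolding S(1) by (subst (asm) ennreal_le_iff[OF S(2)])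
      then have "(norm (f (Suc k) x - f k x))\<^sup>2 \<le> S * (1/2)^k"
        by (simp add: field_simps norm_minus_commute)
      then have "norm (f (Suc k) x - f k x) \<le> sqrt (S * (1/2)^k)" by (rule real_le_rsqrt)
      then show ?thesis by (simp add: real_sqrt_mult real_sqrt_power)
    qed
    moreover have "summable (\<lambda>k. sqrt S * (sqrt (1/2))^k)"
      by (intro summable_mult summable_geometric) (simp add: real_sqrt_divide)
    ultimately have "summable (\<lambda>k. f (Suc k) x - f k x)"
      by (rule summable_comparison_test'[where N=0, rotated])
    then have "convergent (\<lambda>n. \<Sum>k<n. f (Suc k) x - f k x)" by (simp add: summable_iff_convergent)
    then have "convergent (\<lambda>n. (f n x - f 0 x) + f 0 x)"
      unfolding sum_lessThan_telescope[of "\<lambda>k. f k x"] by (intro convergent_add convergent_const)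
    then show ?case by simp
  qed
qed

lemma nn_integral_norm2_limit_le:
  fixes f :: "nat \<Rightarrow> 's \<Rightarrow> 'c::euclidean_space"
  assumes [measurable]: "\<And>k. f k \<in> borel_measurable M" "g \<in> borel_measurable M"
    and le: "\<And>l. l \<ge> k \<Longrightarrow> (\<integral>\<^sup>+x. ennreal ((norm (g x - f l x))\<^sup>2) \<partial>M) \<le> C"
    and lim: "AE x in M. (\<lambda>l. f l x) \<longlonglongrightarrow> F x"
  shows "(\<integral>\<^sup>+x. ennreal ((norm (g x - F x))\<^sup>2) \<partial>M) \<le> C"
proof -
  have "(\<integral>\<^sup>+x. ennreal ((norm (g x - F x))\<^sup>2) \<partial>M) =
      (\<integral>\<^sup>+x. liminf (\<lambda>l. ennreal ((norm (g x - f l x))\<^sup>2)) \<partial>M)"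
  proof (intro nn_integral_cong_AE, use lim in eventually_elim)
    case (elim x)
    then have "(\<lambda>l. ennreal ((norm (g x - f l x))\<^sup>2)) \<longlonglongrightarrow> ennreal ((norm (g x - F x))\<^sup>2)"
      by (intro tendsto_intros)
    from lim_imp_Liminf[OF trivial_limit_sequentially this] show ?case by (rule sym)
  qed
  also have "\<dots> \<le> liminf (\<lambda>l. \<integral>\<^sup>+x. ennreal ((norm (g x - f l x))\<^sup>2) \<partial>M)" by (rule nn_integral_liminf) simp
  also have "\<dots> \<le> liminf (\<lambda>l. C)"
    by (intro Liminf_mono eventually_sequentiallyI[of k] le)
  finally show ?thesis by (simp add: Liminf_const)
qed

text \<open>
  The substitute for weak compactness: if the midpoint of two points decreases a convex functional by
  their distance, near-minimisers over a decreasing sequence of sets form a Cauchy sequence.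
\<close>

lemma nested_near_minimisers:
  fixes Q :: "'s \<Rightarrow> real" and C :: "nat \<Rightarrow> 's set"
  assumes ne: "\<And>k. C k \<noteq> {}" and dec: "\<And>i j. i \<le> j \<Longrightarrow> C j \<subseteq> C i"
    and bdd: "\<And>x. x \<in> C 0 \<Longrightarrow> b \<le> Q x" and bdd': "\<And>k. \<exists>x\<in>C k. Q x \<le> B"
    and mid: "\<And>k x y. x \<in> C k \<Longrightarrow> y \<in> C k \<Longrightarrow> \<exists>z\<in>C k. Q z \<le> (Q x + Q y) / 2 - N x y"
  obtains x where "\<And>k. x k \<in> C k" "\<And>k l. k \<le> l \<Longrightarrow> N (x k) (x l) \<le> (1/4)^k"
    "\<And>k z. (\<And>j. C j = C 0) \<Longrightarrow> z \<in> C 0 \<Longrightarrow> Q (x k) \<le> Q z + (1/4)^k"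
proof -
  define m where "m k = (INF x\<in>C k. Q x)" for k
  have bb: "bdd_below (Q ` C k)" for k
    using bdd dec[of 0 k] by (intro bdd_belowI[of _ b]) auto
  have lo: "m k \<le> Q x" if "x \<in> C k" for k x
    unfolding m_def using that by (rule cINF_lower[OF bb])
  have near: "\<exists>x\<in>C k. Q x < m k + e" if "e > 0" for k e
    unfolding m_def using that ne[of k] cINF_less_iff[OF ne bb] by (metis less_add_same_cancel1)
  have "incseq m"
    unfolding incseq_def m_def using dec ne bb by (auto intro!: cINF_superset_mono)
  moreover have "m k \<le> B" for k using bdd'[of k] lo[of _ k] by force
  ultimately obtain L where L: "m \<longlonglongrightarrow> L" "\<And>k. m k \<le> L"
    using incseq_convergent by metis
  \<comment> \<open>The infima over the shrinking sets increase to \<open>L\<close>. Beyond the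
    index \<open>r k\<close> they are within (1/4)^k / 2 of it, so near-minimality in different sets
    can be compared with this one number.\<close>
  have "\<exists>r\<ge>k. \<forall>j\<ge>r. L - m j \<le> (1/4)^k / 2" for k
  proof -
    have "\<forall>\<^sub>F j in sequentially. m j > L - (1/4)^k / 2"
      using L(1) by (rule order_tendstoD) simp
    then obtain r where "\<And>j. j \<ge> r \<Longrightarrow> m j > L - (1/4)^k / 2" by (auto simp: eventually_sequentially)
    then show ?thesis by (intro exI[of _ "max r k"]) force
  qed
  then obtain r where r: "\<And>k. r k \<ge> k" "\<And>k j. j \<ge> r k \<Longrightarrow> L - m j \<le> (1/4)^k / 2" by metis
  have "\<exists>x. x \<in> C (r k) \<and> Q x < m (r k) + (1/4)^k / 2" for k
    using near[of "(1/4)^k / 2" "r k"] by auto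
  then obtain x where x: "\<And>k. x k \<in> C (r k)" "\<And>k. Q (x k) < m (r k) + (1/4)^k / 2" by metis
  show ?thesis
  proof (rule that)
    show "x k \<in> C k" for k using x(1)[of k] dec[OF r(1)[of k]] by auto
  next
    fix k l :: nat assume kl: "k \<le> l"
    have q: "(1/4::real)^l \<le> (1/4)^k" using kl by (intro power_decreasing) auto
    \<comment> \<open>Both points lie in the larger set \<open>C j\<close>, and so does the point
      \<open>z\<close> of the midpoint condition, where \<open>Q\<close> is at least
      \<open>m j\<close>. The values at both points are at most L + (1/4)^k / 2 and
      \<open>m j\<close> is at least L - (1/4)^k / 2, which leaves (1/4)^k for the distance
      term.\<close>
    define j where "j = min (r k) (r l)"
    have "L - m (r k) \<le> (1/4)^k / 2" "L - m (r l) \<le> (1/4)^k / 2"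
      using r(2)[of k "r k", OF order_refl] r(2)[of l "r l", OF order_refl] q by linarith+
    then have mj: "L - m j \<le> (1/4)^k / 2" by (simp add: j_def min_def)
    have "x k \<in> C j" "x l \<in> C j"
      using x(1) dec[of j "r k"] dec[of j "r l"] by (auto simp: j_def)
    from mid[OF this] obtain z where z: "z \<in> C j" "Q z \<le> (Q (x k) + Q (x l)) / 2 - N (x k) (x l)" by blast
    have "Q (x k) \<le> L + (1/4)^k / 2" "Q (x l) \<le> L + (1/4)^k / 2"
      using x(2)[of k] x(2)[of l] L(2)[of "r k"] L(2)[of "r l"] q by linarith+
    with z lo[OF z(1)] mj show "N (x k) (x l) \<le> (1/4)^k" by argo
  next
    fix k z assume "z \<in> C 0" "\<And>k. C k = C 0"
    then have "m (r k) \<le> Q z" using lo by metis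
    then show "Q (x k) \<le> Q z + (1/4)^k" using x(2)[of k] zero_le_power[of "1/4::real" k] by linarith
  qed
qed

subsection \<open>Young's inequality\<close>

lemma nn_integral_lborel_translate:
  fixes f :: "'a::euclidean_space \<Rightarrow> ennreal"
  assumes [measurable]: "f \<in> borel_measurable borel"
  shows "(\<integral>\<^sup>+x. f (x + c) \<partial>lborel) = (\<integral>\<^sup>+x. f x \<partial>lborel)"
proof -
  have "(\<integral>\<^sup>+x. f x \<partial>lborel) = (\<integral>\<^sup>+x. f x \<partial>distr lborel borel ((+) c))" by (simp add: lborel_distr_plus)
  also have "\<dots> = (\<integral>\<^sup>+x. f (c + x) \<partial>lborel)" by (intro nn_integral_distr) auto
  finally show ?thesis by (simp add: add.commute)
qed

text \<open>Cauchy-Schwarz with |w| split into two square roots, then Tonelli and translation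
  invariance. A general shift \<open>T\<close> over a general measure space covers both convolution,
  where \<open>T\<close> is the identity, and averaging along a segment, where \<open>T t\<close> is
  a multiple of one vector.\<close>

lemma Young_L2:
  fixes g :: "'a::euclidean_space \<Rightarrow> 'c::euclidean_space" and w :: "'s \<Rightarrow> real"
  assumes M: "sigma_finite_measure M" and w: "integrable M w"
    and [measurable]: "T \<in> borel_measurable M" "g \<in> borel_measurable borel"
  shows "(\<integral>\<^sup>+x. ennreal ((norm (\<integral>s. w s *\<^sub>R g (x - T s) \<partial>M))\<^sup>2) \<partial>lborel)
     \<le> ennreal ((\<integral>s. \<bar>w s\<bar> \<partial>M)\<^sup>2) * (\<integral>\<^sup>+x. ennreal ((norm (g x))\<^sup>2) \<partial>lborel)"
proof -
  interpret M: sigma_finite_measure M by fact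
  interpret P: pair_sigma_finite M lborel ..
  note [measurable] = borel_measurable_integrable[OF w]
  let ?W = "\<integral>\<^sup>+s. ennreal \<bar>w s\<bar> \<partial>M"
  have W: "?W = ennreal (\<integral>s. \<bar>w s\<bar> \<partial>M)" using w by (intro nn_integral_eq_integral) auto
  have pt: "ennreal ((norm (\<integral>s. w s *\<^sub>R g (x - T s) \<partial>M))\<^sup>2)
      \<le> ?W * (\<integral>\<^sup>+s. ennreal \<bar>w s\<bar> * ennreal ((norm (g (x - T s)))\<^sup>2) \<partial>M)" for x
  proof -
    have "ennreal (norm (\<integral>s. w s *\<^sub>R g (x - T s) \<partial>M)) \<le> (\<integral>\<^sup>+s. ennreal (norm (w s *\<^sub>R g (x - T s))) \<partial>M)"
      by (cases "integrable M (\<lambda>s. w s *\<^sub>R g (x - T s))")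
         (auto intro: integral_norm_bound_ennreal simp: not_integrable_integral_eq simp del: norm_scaleR)
    also have "\<dots> = (\<integral>\<^sup>+s. ennreal (sqrt \<bar>w s\<bar>) * ennreal (sqrt \<bar>w s\<bar> * norm (g (x - T s))) \<partial>M)"
      by (intro nn_integral_cong) (simp flip: ennreal_mult add: mult.assoc[symmetric])
    finally have "(ennreal (norm (\<integral>s. w s *\<^sub>R g (x - T s) \<partial>M)))\<^sup>2
       \<le> (\<integral>\<^sup>+s. ennreal (sqrt \<bar>w s\<bar>) * ennreal (sqrt \<bar>w s\<bar> * norm (g (x - T s))) \<partial>M)\<^sup>2"
      by (rule power_mono) simp
    also have "\<dots> \<le> (\<integral>\<^sup>+s. (ennreal (sqrt \<bar>w s\<bar>))\<^sup>2 \<partial>M) * (\<integral>\<^sup>+s. (ennreal (sqrt \<bar>w s\<bar> * norm (g (x - T s))))\<^sup>2 \<partial>M)"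
      by (rule Cauchy_Schwarz_nn_integral) simp_all
    also have "\<dots> = ?W * (\<integral>\<^sup>+s. ennreal \<bar>w s\<bar> * ennreal ((norm (g (x - T s)))\<^sup>2) \<partial>M)"
      by (simp add: ennreal_power power_mult_distrib flip: ennreal_mult)
    finally show ?thesis by (simp add: ennreal_power)
  qed
  have "(\<integral>\<^sup>+x. ennreal ((norm (\<integral>s. w s *\<^sub>R g (x - T s) \<partial>M))\<^sup>2) \<partial>lborel)
    \<le> (\<integral>\<^sup>+x. ?W * (\<integral>\<^sup>+s. ennreal \<bar>w s\<bar> * ennreal ((norm (g (x - T s)))\<^sup>2) \<partial>M) \<partial>lborel)"
    by (intro nn_integral_mono pt)
  also have "\<dots> = ?W * (\<integral>\<^sup>+x. (\<integral>\<^sup>+s. ennreal \<bar>w s\<bar> * ennreal ((norm (g (x - T s)))\<^sup>2) \<partial>M) \<partial>lborel)"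
    by (intro nn_integral_cmult) measurable
  also have "(\<integral>\<^sup>+x. (\<integral>\<^sup>+s. ennreal \<bar>w s\<bar> * ennreal ((norm (g (x - T s)))\<^sup>2) \<partial>M) \<partial>lborel)
     = (\<integral>\<^sup>+s. (\<integral>\<^sup>+x. ennreal \<bar>w s\<bar> * ennreal ((norm (g (x - T s)))\<^sup>2) \<partial>lborel) \<partial>M)"
    by (rule P.Fubini') measurable
  also have "\<dots> = (\<integral>\<^sup>+s. ennreal \<bar>w s\<bar> * (\<integral>\<^sup>+x. ennreal ((norm (g x))\<^sup>2) \<partial>lborel) \<partial>M)"
  proof (rule nn_integral_cong)
    fix s
    have "(\<integral>\<^sup>+x. ennreal \<bar>w s\<bar> * ennreal ((norm (g (x - T s)))\<^sup>2) \<partial>lborel)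
       = ennreal \<bar>w s\<bar> * (\<integral>\<^sup>+x. ennreal ((norm (g (x - T s)))\<^sup>2) \<partial>lborel)"
      by (rule nn_integral_cmult) measurable
    then show "(\<integral>\<^sup>+x. ennreal \<bar>w s\<bar> * ennreal ((norm (g (x - T s)))\<^sup>2) \<partial>lborel)
       = ennreal \<bar>w s\<bar> * (\<integral>\<^sup>+x. ennreal ((norm (g x))\<^sup>2) \<partial>lborel)"
      using nn_integral_lborel_translate[of "\<lambda>x. ennreal ((norm (g x))\<^sup>2)" "- T s"] by simp
  qed
  also have "\<dots> = ?W * (\<integral>\<^sup>+x. ennreal ((norm (g x))\<^sup>2) \<partial>lborel)" by (rule nn_integral_multc) simp
  finally show ?thesis by (simp add: W power2_eq_square ennreal_mult mult.assoc)
qed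

subsection \<open>Weak gradients\<close>

lemma gradient_inner: "gradient \<eta> x \<bullet> y = (\<Sum>b\<in>Basis. frechet_derivative \<eta> (at x) b * (y \<bullet> b))"
  unfolding gradient_def inner_sum_left by (intro sum.cong) (simp_all add: inner_commute)

lemma gradient_inner_test:
  "\<eta> \<in> test_functions \<Longrightarrow> gradient \<eta> x \<bullet> h = frechet_derivative \<eta> (at x) h"
  by (simp add: gradient_inner frechet_derivative_components[of \<eta> x h] mult.commute)

lemma divergence_test_functions:
  "\<phi> \<in> test_functions \<Longrightarrow> divergence \<phi> \<in> test_functions"
  unfolding divergence_def
  by (intro test_functions_sum test_functions_linear[OF bounded_linear_inner_left] test_functions_deriv)

lemma gradient_test_functions: "\<eta> \<in> test_functions \<Longrightarrow> gradient \<eta> \<in> test_functions"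
  unfolding gradient_def
  by (intro test_functions_sum test_functions_linear[OF bounded_linear_scaleR_left] test_functions_deriv)

lemma frechet_derivative_scaleR_const:
  assumes "\<eta> \<in> test_functions"
  shows "frechet_derivative (\<lambda>x. \<eta> x *\<^sub>R v) (at x) = (\<lambda>h. frechet_derivative \<eta> (at x) h *\<^sub>R v)"
  by (rule frechet_derivative_at[symmetric])
     (intro has_derivative_scaleR_left test_functions_differentiable assms)

lemma divergence_scaleR_const:
  assumes "\<eta> \<in> test_functions"
  shows "divergence (\<lambda>x. \<eta> x *\<^sub>R v) x = frechet_derivative \<eta> (at x) v"
  unfolding divergence_def frechet_derivative_scaleR_const[OF assms]
    frechet_derivative_components[OF assms, of x v] by (simp add: mult.commute)

text \<open>The products \<open>\<eta> x * (\<phi> x \<bullet> b)\<close> inherit compact support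
  from \<eta>, so the integrals of their derivatives along \<open>b\<close> vanish; summing over
  \<open>Basis\<close> produces both terms.\<close>

lemma integration_by_parts:
  fixes \<eta> :: "'a::euclidean_space \<Rightarrow> real"
  assumes \<eta>: "\<eta> \<in> test_functions" and \<phi>: "\<And>k. C_k k \<phi>"
  shows "(\<integral>x. \<eta> x * divergence \<phi> x \<partial>lebesgue) = - (\<integral>x. gradient \<eta> x \<bullet> \<phi> x \<partial>lebesgue)"
proof -
  have d\<phi>: "(\<phi> has_derivative frechet_derivative \<phi> (at x)) (at x)" for x
    using \<phi>[of "Suc 0"] by (simp flip: frechet_derivative_works)
  have c1: "continuous_on UNIV \<phi>" "continuous_on UNIV (\<lambda>x. frechet_derivative \<phi> (at x) b)" for b
    using \<phi>[of 0] \<phi>[of "Suc 0"] by simp_all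
  let ?p = "\<lambda>b x. \<eta> x * (\<phi> x \<bullet> b)"
  have p: "?p b \<in> test_functions" for b
    using test_functions_bilinear[OF bounded_bilinear.flip[OF bounded_bilinear_mult]
        C_k_linear[OF bounded_linear_inner_left \<phi>] \<eta>] by (simp add: mult.commute)
  have D: "frechet_derivative (?p b) (at x) b =
      \<eta> x * (frechet_derivative \<phi> (at x) b \<bullet> b) + frechet_derivative \<eta> (at x) b * (\<phi> x \<bullet> b)" for b x
  proof -
    have "(?p b has_derivative (\<lambda>h. \<eta> x * (frechet_derivative \<phi> (at x) h \<bullet> b) + frechet_derivative \<eta> (at x) h * (\<phi> x \<bullet> b))) (at x)"
      by (intro has_derivative_mult has_derivative_inner_left test_functions_differentiable \<eta> d\<phi>)
    then show ?thesis by (simp flip: frechet_derivative_at)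
  qed
  have "(\<integral>x. (\<Sum>b\<in>Basis. frechet_derivative (?p b) (at x) b) \<partial>lborel) = 0"
    by (subst Bochner_Integration.integral_sum)
       (auto intro!: test_functions_integrable test_functions_deriv p integral_frechet_derivative_eq_0 sum.neutral)
  moreover have "(\<Sum>b\<in>Basis. frechet_derivative (?p b) (at x) b) = \<eta> x * divergence \<phi> x + gradient \<eta> x \<bullet> \<phi> x" for x
    by (simp add: D sum.distrib divergence_def gradient_inner sum_distrib_left)
  moreover have i1: "integrable lborel (\<lambda>x. \<eta> x * divergence \<phi> x)"
  proof -
    have "C_k k (divergence \<phi>)" for k
      unfolding divergence_def by (intro C_k_sum C_k_linear[OF bounded_linear_inner_left] C_k_frechet_derivative \<phi>)
    then have "(\<lambda>x. divergence \<phi> x * \<eta> x) \<in> test_functions"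
      using \<eta> by (intro test_functions_bilinear[OF bounded_bilinear_mult])
    from test_functions_integrable[OF this] show ?thesis by (simp add: mult.commute)
  qed
  moreover have i2: "integrable lborel (\<lambda>x. gradient \<eta> x \<bullet> \<phi> x)"
  proof -
    have "(\<lambda>x. \<phi> x \<bullet> gradient \<eta> x) \<in> test_functions"
      using \<phi> gradient_test_functions[OF \<eta>] by (intro test_functions_bilinear[OF bounded_bilinear_inner])
    from test_functions_integrable[OF this] show ?thesis by (simp add: inner_commute)
  qed
  ultimately have "(\<integral>x. \<eta> x * divergence \<phi> x \<partial>lborel) + (\<integral>x. gradient \<eta> x \<bullet> \<phi> x \<partial>lborel) = 0"
    by simp
  then show ?thesis
    using borel_measurable_integrable[OF i1] borel_measurable_integrable[OF i2]
    by (simp add: integral_lebesgue_lborel)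
qed

lemma has_weak_gradient_test_function:
  assumes "\<eta> \<in> test_functions" shows "has_weak_gradient \<eta> (gradient \<eta>)"
  unfolding has_weak_gradient_def
  using assms integration_by_parts[OF assms] gradient_test_functions[OF assms]
  by (auto intro!: test_functions_L1_loc) (auto simp: test_functions_iff)

lemma has_weak_gradient_const: "has_weak_gradient (\<lambda>x. c) (\<lambda>x. 0)"
  unfolding has_weak_gradient_def
proof (intro conjI L1_loc_const ballI)
  fix \<phi> :: "'a \<Rightarrow> 'a" assume \<phi>: "\<phi> \<in> test_functions"
  have "(\<integral>x. divergence \<phi> x \<partial>lborel) = 0"
  proof -
    have "(\<lambda>x. \<phi> x \<bullet> b) \<in> test_functions" for b
      by (rule test_functions_linear[OF bounded_linear_inner_left \<phi>])
    moreover have "frechet_derivative (\<lambda>x. \<phi> x \<bullet> b) (at x) h = frechet_derivative \<phi> (at x) h \<bullet> b" for x b h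
      using has_derivative_inner_left[OF test_functions_differentiable[OF \<phi>]]
      by (metis frechet_derivative_at)
    ultimately have "(\<integral>x. frechet_derivative \<phi> (at x) b \<bullet> b \<partial>lborel) = 0" for b
      using integral_frechet_derivative_eq_0[of "\<lambda>x. \<phi> x \<bullet> b" b] by simp
    then show ?thesis unfolding divergence_def
      by (subst Bochner_Integration.integral_sum)
         (auto intro!: test_functions_integrable test_functions_linear[OF bounded_linear_inner_left] test_functions_deriv \<phi>)
  qed
  then show "(\<integral>x. c * divergence \<phi> x \<partial>lebesgue) = - (\<integral>x. 0 \<bullet> \<phi> x \<partial>lebesgue)"
    using test_functions_measurable[OF divergence_test_functions[OF \<phi>]]
    by (simp add: integral_lebesgue_lborel)
qed

lemma L1_loc_test_mult_integrable:
  fixes u :: "'a::euclidean_space \<Rightarrow> real"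
  assumes "u \<in> L1_loc" "\<eta> \<in> test_functions" shows "integrable lebesgue (\<lambda>x. u x * \<eta> x)"
  using integrable_lebesgue_test_function[OF assms] by (simp add: mult.commute)

lemma has_weak_gradient_lincomb:
  assumes "has_weak_gradient f F" "has_weak_gradient g G"
  shows "has_weak_gradient (\<lambda>x. a * f x + b * g x) (\<lambda>x. a *\<^sub>R F x + b *\<^sub>R G x)"
  unfolding has_weak_gradient_def
proof (intro conjI ballI)
  note A = assms[unfolded has_weak_gradient_def]
  show "(\<lambda>x. a * f x + b * g x) \<in> L1_loc" "(\<lambda>x. a *\<^sub>R F x + b *\<^sub>R G x) \<in> L1_loc"
    using A L1_loc_scaleR[of f a] L1_loc_scaleR[of g b] by (auto intro!: L1_loc_add L1_loc_scaleR)
  fix \<phi> :: "'a \<Rightarrow> 'a" assume \<phi>: "\<phi> \<in> test_functions"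
  have "integrable lebesgue (\<lambda>x. f x * divergence \<phi> x)" "integrable lebesgue (\<lambda>x. g x * divergence \<phi> x)"
    "integrable lebesgue (\<lambda>x. F x \<bullet> \<phi> x)" "integrable lebesgue (\<lambda>x. G x \<bullet> \<phi> x)"
    using A \<phi> by (auto intro!: L1_loc_test_mult_integrable integrable_lebesgue_test_field divergence_test_functions)
  then show "(\<integral>x. (a * f x + b * g x) * divergence \<phi> x \<partial>lebesgue) =
     - (\<integral>x. (a *\<^sub>R F x + b *\<^sub>R G x) \<bullet> \<phi> x \<partial>lebesgue)"
    using A \<phi> by (simp add: distrib_right inner_add_left mult.assoc)
qed

text \<open>This allows a function and its gradient to be replaced by Borel representatives before
  Fubini is used.\<close>

lemma has_weak_gradient_cong_AE:
  assumes u: "has_weak_gradient u G" and v: "AE x in lebesgue. u x = v x" "v \<in> borel_measurable lebesgue"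
    and H: "AE x in lebesgue. G x = H x" "H \<in> borel_measurable lebesgue"
  shows "has_weak_gradient v H"
proof -
  have L: "f' \<in> L1_loc" if "f \<in> L1_loc" "AE x in lebesgue. f x = f' x" "f' \<in> borel_measurable lebesgue"
    for f f' :: "'a \<Rightarrow> 'c::euclidean_space"
    unfolding L1_loc_iff_cball
  proof
    fix R :: real
    show "integrable lebesgue (\<lambda>x. indicat_real (cball 0 R) x *\<^sub>R f' x)"
    proof (rule integrable_cong_AE_imp)
      show "integrable lebesgue (\<lambda>x. indicat_real (cball 0 R) x *\<^sub>R f x)"
        using that(1) by (simp add: L1_loc_iff_cball)
      show "(\<lambda>x. indicat_real (cball 0 R) x *\<^sub>R f' x) \<in> borel_measurable lebesgue"
        using that(3) by (intro borel_measurable_scaleR borel_measurable_indicator_lebesgue) auto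
      show "AE x in lebesgue. indicat_real (cball 0 R) x *\<^sub>R f x = indicat_real (cball 0 R) x *\<^sub>R f' x"
        using that(2) by eventually_elim simp
    qed
  qed
  note A = u[unfolded has_weak_gradient_def]
  have vL: "v \<in> L1_loc" and HL: "H \<in> L1_loc" using L A v H by blast+
  moreover have "(\<integral>x. v x * divergence \<phi> x \<partial>lebesgue) = - (\<integral>x. H x \<bullet> \<phi> x \<partial>lebesgue)"
    if \<phi>: "\<phi> \<in> test_functions" for \<phi>
  proof -
    have "(\<integral>x. v x * divergence \<phi> x \<partial>lebesgue) = (\<integral>x. u x * divergence \<phi> x \<partial>lebesgue)"
      using A vL v(1) \<phi> divergence_test_functions[OF \<phi>]
      by (intro integral_cong_AE borel_measurable_integrable L1_loc_test_mult_integrable) auto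
    moreover have "(\<integral>x. H x \<bullet> \<phi> x \<partial>lebesgue) = (\<integral>x. G x \<bullet> \<phi> x \<partial>lebesgue)"
      using A HL H(1) \<phi>
      by (intro integral_cong_AE borel_measurable_integrable integrable_lebesgue_test_field) auto
    ultimately show ?thesis using A \<phi> by simp
  qed
  ultimately show ?thesis by (simp add: has_weak_gradient_def)
qed

lemma has_weak_gradient_unique:
  assumes "has_weak_gradient u G" "has_weak_gradient u H"
  shows "AE x in lebesgue. G x = H x"
proof -
  have "AE x in lebesgue. 1 *\<^sub>R G x + (-1) *\<^sub>R H x = 0"
  proof (rule fundamental_lemma_field)
    have *: "has_weak_gradient (\<lambda>x. 1 * u x + (-1) * u x) (\<lambda>x. 1 *\<^sub>R G x + (-1) *\<^sub>R H x)"
      by (rule has_weak_gradient_lincomb[OF assms])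
    show "(\<lambda>x. 1 *\<^sub>R G x + (-1) *\<^sub>R H x) \<in> L1_loc" using * by (simp add: has_weak_gradient_def)
    fix \<phi> :: "'a \<Rightarrow> 'a" assume "\<phi> \<in> test_functions"
    with * show "(\<integral>x. (1 *\<^sub>R G x + (-1) *\<^sub>R H x) \<bullet> \<phi> x \<partial>lebesgue) = 0"
      unfolding has_weak_gradient_def by simp
  qed
  then show ?thesis by simp
qed

lemma has_weak_gradient_weak_gradient: "has_weak_gradient u G \<Longrightarrow> has_weak_gradient u (weak_gradient u)"
  unfolding weak_gradient_def by (rule someI[of "has_weak_gradient u"])

lemma weak_gradient_AE_eq: "has_weak_gradient u G \<Longrightarrow> AE x in lebesgue. weak_gradient u x = G x"
  using has_weak_gradient_unique has_weak_gradient_weak_gradient by blast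

lemma D1I: "has_weak_gradient u G \<Longrightarrow> G \<in> L2 \<Longrightarrow> u \<in> D1"
  by (auto simp: D1_def has_weak_gradient_def)

lemma has_weak_gradient_measurable:
  assumes "has_weak_gradient u G" shows "u \<in> borel_measurable lebesgue" "G \<in> borel_measurable lebesgue"
  using assms by (simp_all add: has_weak_gradient_def L1_loc_measurable)

lemma D1_weak_gradient:
  assumes "u \<in> D1" shows "has_weak_gradient u (weak_gradient u)" "weak_gradient u \<in> L2"
proof -
  obtain G where G: "G \<in> L2" "has_weak_gradient u G" using assms by (auto simp: D1_def)
  show *: "has_weak_gradient u (weak_gradient u)" by (rule has_weak_gradient_weak_gradient[OF G(2)])
  have "AE x in lebesgue. G x = weak_gradient u x" by (rule has_weak_gradient_unique[OF G(2) *])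
  then show "weak_gradient u \<in> L2"
    by (rule L2_cong_AE(1)[OF G(1) has_weak_gradient_measurable(2)[OF *]])
qed

lemma D1_L1_loc: "u \<in> D1 \<Longrightarrow> u \<in> L1_loc"
  by (simp add: D1_def)

lemma D1_lincomb: "f \<in> D1 \<Longrightarrow> g \<in> D1 \<Longrightarrow> (\<lambda>x. a * f x + b * g x) \<in> D1"
  by (rule D1I[OF has_weak_gradient_lincomb L2_add(1)])
     (auto intro: D1_weak_gradient L2_scaleR(1))

lemma D1_const: "(\<lambda>x. c) \<in> D1"
  by (rule D1I[OF has_weak_gradient_const L2_0])

lemma D1_scale: "f \<in> D1 \<Longrightarrow> (\<lambda>x. a * f x) \<in> D1"
  using D1_lincomb[OF _ D1_const, of f a 0 0] by simp

lemma D1_add: "f \<in> D1 \<Longrightarrow> g \<in> D1 \<Longrightarrow> (\<lambda>x. f x + g x) \<in> D1"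
  using D1_lincomb[of f g 1 1] by simp

lemma D1_diff: "f \<in> D1 \<Longrightarrow> g \<in> D1 \<Longrightarrow> (\<lambda>x. f x - g x) \<in> D1"
  using D1_lincomb[of f g 1 "-1"] by simp

lemma D1_minus: "f \<in> D1 \<Longrightarrow> (\<lambda>x. - f x) \<in> D1"
  using D1_scale[of f "-1"] by simp

lemma test_functions_D1: "\<eta> \<in> test_functions \<Longrightarrow> \<eta> \<in> D1"
  by (rule D1I[OF has_weak_gradient_test_function]) (auto intro: test_functions_L2 gradient_test_functions)

text \<open>\<open>D1_inner\<close> is built on chosen weak gradients; any other ones agree with
  them almost everywhere.\<close>

lemma D1_inner_eq:
  assumes "has_weak_gradient u G" "has_weak_gradient v H" "G \<in> L2" "H \<in> L2"
  shows "D1_inner u v = (\<integral>x. G x \<bullet> H x \<partial>lebesgue)"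
  unfolding D1_inner_def
proof (rule integral_cong_AE)
  show "AE x in lebesgue. weak_gradient u x \<bullet> weak_gradient v x = G x \<bullet> H x"
    using weak_gradient_AE_eq[OF assms(1)] weak_gradient_AE_eq[OF assms(2)] by eventually_elim simp
  show "(\<lambda>x. weak_gradient u x \<bullet> weak_gradient v x) \<in> borel_measurable lebesgue"
    "(\<lambda>x. G x \<bullet> H x) \<in> borel_measurable lebesgue"
    using assms has_weak_gradient_measurable(2) has_weak_gradient_weak_gradient
    by (blast intro: borel_measurable_inner)+
qed

lemma D1_inner_lincomb:
  assumes "f \<in> D1" "g \<in> D1" "h \<in> D1"
  shows "D1_inner (\<lambda>x. a * f x + b * g x) h = a * D1_inner f h + b * D1_inner g h"
proof -
  have "D1_inner (\<lambda>x. a * f x + b * g x) h =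
      (\<integral>x. (a *\<^sub>R weak_gradient f x + b *\<^sub>R weak_gradient g x) \<bullet> weak_gradient h x \<partial>lebesgue)"
    using assms by (intro D1_inner_eq has_weak_gradient_lincomb D1_weak_gradient L2_add L2_scaleR)
  also have "\<dots> = a * D1_inner f h + b * D1_inner g h"
    unfolding D1_inner_def using assms
    by (simp add: inner_add_left L2_inner_integrable D1_weak_gradient)
  finally show ?thesis .
qed

lemma D1_inner_commute: "D1_inner f g = D1_inner g f"
  by (simp add: D1_inner_def inner_commute)

lemma D1_inner_lincomb_right:
  assumes "f \<in> D1" "g \<in> D1" "h \<in> D1"
  shows "D1_inner h (\<lambda>x. a * f x + b * g x) = a * D1_inner h f + b * D1_inner h g"
  using D1_inner_lincomb[OF assms] by (simp add: D1_inner_commute)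

lemma D1_inner_self: "D1_inner f f = L2sq (weak_gradient f)"
  by (simp add: D1_inner_def L2sq_def power2_norm_eq_inner)

lemma D1_inner_self_eq: "has_weak_gradient u G \<Longrightarrow> G \<in> L2 \<Longrightarrow> D1_inner u u = L2sq G"
  by (simp add: D1_inner_eq L2sq_def power2_norm_eq_inner)

lemma D1_inner_nonneg: "0 \<le> D1_inner f f"
  by (simp add: D1_inner_self L2sq_nonneg)

lemma D1_Cauchy_Schwarz:
  "f \<in> D1 \<Longrightarrow> g \<in> D1 \<Longrightarrow> (D1_inner f g)\<^sup>2 \<le> D1_inner f f * D1_inner g g"
  unfolding D1_inner_self unfolding D1_inner_def by (intro L2_Cauchy_Schwarz D1_weak_gradient)

lemma D1_inner_lincomb_self:
  assumes "f \<in> D1" "g \<in> D1"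
  shows "D1_inner (\<lambda>x. a * f x + b * g x) (\<lambda>x. a * f x + b * g x) =
     a\<^sup>2 * D1_inner f f + 2 * a * b * D1_inner f g + b\<^sup>2 * D1_inner g g"
  using assms
  by (simp add: D1_inner_lincomb D1_inner_lincomb_right D1_lincomb D1_inner_commute[of g f]
      power2_eq_square algebra_simps)

subsection \<open>Difference quotients\<close>

lemma lborel_integral_indicator_frechet_derivative:
  fixes \<eta> :: "'a::euclidean_space \<Rightarrow> real"
  assumes \<eta>: "\<eta> \<in> test_functions"
  shows "(\<integral>t. frechet_derivative \<eta> (at (x - t *\<^sub>R h)) h * indicator {0..1} t \<partial>lborel) = \<eta> x - \<eta> (x - h)"
proof -
  have lin: "linear (frechet_derivative \<eta> (at y))" for y
    using test_functions_differentiable[OF \<eta>] has_derivative_linear by blast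
  have "((\<lambda>t. - \<eta> (x - t *\<^sub>R h)) has_real_derivative frechet_derivative \<eta> (at (x - t *\<^sub>R h)) h) (at t)" for t :: real
  proof -
    have "((\<lambda>t. x - t *\<^sub>R h) has_derivative (\<lambda>t. - (t *\<^sub>R h))) (at t)"
      by (auto intro!: derivative_eq_intros)
    from has_derivative_compose[OF this test_functions_differentiable[OF \<eta>]]
    have "((\<lambda>t. - \<eta> (x - t *\<^sub>R h)) has_derivative (\<lambda>s. - frechet_derivative \<eta> (at (x - t *\<^sub>R h)) (- (s *\<^sub>R h)))) (at t)"
      by (rule has_derivative_minus)
    moreover have "(\<lambda>s. - frechet_derivative \<eta> (at (x - t *\<^sub>R h)) (- (s *\<^sub>R h))) =
        (*) (frechet_derivative \<eta> (at (x - t *\<^sub>R h)) h)"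
      by (auto simp: linear_neg[OF lin] linear_scale[OF lin])
    ultimately show ?thesis by (simp add: has_field_derivative_def)
  qed
  moreover have "continuous_on UNIV (\<lambda>t. frechet_derivative \<eta> (at (x - t *\<^sub>R h)) h)"
    by (rule continuous_on_compose2[OF test_functions_continuous[OF test_functions_deriv[OF \<eta>]]])
       (auto intro!: continuous_intros)
  ultimately have "(\<integral>t. frechet_derivative \<eta> (at (x - t *\<^sub>R h)) h * indicator {0..1} t \<partial>lborel) =
      - \<eta> (x - 1 *\<^sub>R h) - - \<eta> (x - 0 *\<^sub>R h)"
    by (intro integral_FTC_Icc_real) (auto simp: continuous_on_eq_continuous_at)
  then show ?thesis by simp
qed

text \<open>The map (s, x) to (s, x + T s) translates each section and so preserves the integrals of
  the norm over sections. It permits a translation to be substituted under a double integral before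
  the order is swapped back.\<close>

lemma integrable_shear:
  fixes F :: "'s \<times> 'a::euclidean_space \<Rightarrow> real"
  assumes M: "sigma_finite_measure M" and F: "integrable (M \<Otimes>\<^sub>M lborel) F"
    and [measurable]: "T \<in> borel_measurable M"
  shows "integrable (M \<Otimes>\<^sub>M lborel) (\<lambda>(s, x). F (s, x + T s))"
proof -
  interpret M: sigma_finite_measure M by fact
  interpret P: pair_sigma_finite M lborel ..
  have [measurable]: "F \<in> borel_measurable (M \<Otimes>\<^sub>M borel)"
    using borel_measurable_integrable[OF F] by (simp cong: measurable_cong_sets sets_pair_measure_cong)
  show ?thesis
  proof (rule P.Fubini_integrable)
    show "(\<lambda>(s, x). F (s, x + T s)) \<in> borel_measurable (M \<Otimes>\<^sub>M lborel)" by measurable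
    have sec: "(\<lambda>x. F (s, x)) \<in> borel_measurable borel" if "s \<in> space M" for s
      using that by measurable
    have "integrable M (\<lambda>s. \<integral>x. norm (F (s, x)) \<partial>lborel)"
      using P.integrable_fst'[OF integrable_norm[OF F]] by simp
    moreover have "(\<integral>x. norm (F (s, x + T s)) \<partial>lborel) = (\<integral>x. norm (F (s, x)) \<partial>lborel)" if "s \<in> space M" for s
      using sec[OF that] by (intro lborel_integral_translate[of "\<lambda>x. norm (F (s, x))"]) auto
    ultimately show "integrable M (\<lambda>s. \<integral>x. norm (case (s, x) of (s, x) \<Rightarrow> F (s, x + T s)) \<partial>lborel)"
      by (simp cong: Bochner_Integration.integrable_cong)
    show "AE s in M. integrable lborel (\<lambda>x. case (s, x) of (s, x) \<Rightarrow> F (s, x + T s))"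
      using P.AE_integrable_fst'[OF F] by eventually_elim (simp add: lborel_integrable_translate[of "\<lambda>x. F (_, x)"])
  qed
qed

lemma integrable_pair_mult:
  fixes f :: "'s \<Rightarrow> real" and g :: "'t \<Rightarrow> real"
  assumes "sigma_finite_measure M" "sigma_finite_measure N" and f: "integrable M f" and g: "integrable N g"
  shows "integrable (M \<Otimes>\<^sub>M N) (\<lambda>(x, y). f x * g y)"
proof -
  interpret M: sigma_finite_measure M by fact
  interpret N: sigma_finite_measure N by fact
  interpret P: pair_sigma_finite M N ..
  note [measurable] = borel_measurable_integrable[OF f] borel_measurable_integrable[OF g]
  show ?thesis
    by (rule P.Fubini_integrable) (use f g in \<open>simp_all add: abs_mult\<close>)
qed

text \<open>The difference is identified weakly. Tested against \<eta> it becomes \<open>u\<close>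
  tested against \<eta>(x - h) - \<eta>(x), which is minus the divergence of a test field: \<eta>
  averaged over the segment, times \<open>h\<close>. The weak gradient and Fubini then give the
  averaged derivative, and Young's inequality bounds it.\<close>

lemma weak_difference_formula:
  fixes u :: "'a::euclidean_space \<Rightarrow> real"
  assumes u: "has_weak_gradient u G" and G: "G \<in> L2"
    and [measurable]: "u \<in> borel_measurable borel" "G \<in> borel_measurable borel"
  shows "AE x in lborel. u (x + h) - u x = (\<integral>t. indicator {0..1} t *\<^sub>R (G (x - - (t *\<^sub>R h)) \<bullet> h) \<partial>lborel)"
    and "(\<integral>\<^sup>+x. ennreal ((u (x + h) - u x)\<^sup>2) \<partial>lborel) \<le> ennreal ((norm h)\<^sup>2 * L2sq G)"
proof -
  let ?i = "indicat_real {0..1::real}"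
  let ?W = "\<lambda>x. \<integral>t. ?i t *\<^sub>R (G (x - - (t *\<^sub>R h)) \<bullet> h) \<partial>lborel"
  have ii: "integrable lborel ?i" "(\<integral>t. \<bar>?i t\<bar> \<partial>lborel) = 1" by simp_all
  have [measurable]: "?W \<in> borel_measurable borel" by measurable
  have "(\<integral>\<^sup>+x. ennreal ((norm (?W x))\<^sup>2) \<partial>lborel) \<le> ennreal ((\<integral>t. \<bar>?i t\<bar> \<partial>lborel)\<^sup>2) * (\<integral>\<^sup>+x. ennreal ((norm (G x \<bullet> h))\<^sup>2) \<partial>lborel)"
    by (rule Young_L2[OF sigma_finite_lborel ii(1)]) measurable
  also have "\<dots> \<le> (\<integral>\<^sup>+x. ennreal ((norm h)\<^sup>2) * ennreal ((norm (G x))\<^sup>2) \<partial>lborel)"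
  proof -
    have "(G x \<bullet> h)\<^sup>2 \<le> (norm h)\<^sup>2 * (norm (G x))\<^sup>2" for x
      using Cauchy_Schwarz_ineq[of "G x" h] by (simp add: power2_norm_eq_inner mult.commute)
    then show ?thesis by (auto simp: ii(2) intro!: nn_integral_mono simp flip: ennreal_mult)
  qed
  also have "\<dots> = ennreal ((norm h)\<^sup>2) * (\<integral>\<^sup>+x. ennreal ((norm (G x))\<^sup>2) \<partial>lebesgue)"
    by (simp add: nn_integral_cmult nn_integral_completion)
  also have "\<dots> = ennreal ((norm h)\<^sup>2 * L2sq G)"
    by (simp add: L2_nn_integral[OF G] ennreal_mult L2sq_nonneg)
  finally have W: "(\<integral>\<^sup>+x. ennreal ((norm (?W x))\<^sup>2) \<partial>lborel) \<le> ennreal ((norm h)\<^sup>2 * L2sq G)" .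
  have W2: "?W \<in> L2"
    using W by (intro L2I(1)[where c="(norm h)\<^sup>2 * L2sq G"])
      (auto simp: nn_integral_completion L2sq_nonneg borel_measurable_lebesgueI)
  have uL: "u \<in> L1_loc" and GL: "G \<in> L1_loc" using u by (auto simp: has_weak_gradient_def)
  have ushift: "(\<lambda>x. u (x + h)) \<in> L1_loc"
    unfolding L1_loc_iff_cball
  proof
    fix R :: real
    have "integrable lebesgue (\<lambda>x. indicator (cball h R) x *\<^sub>R u x)"
      using uL by (simp add: L1_loc_def set_integrable_def)
    moreover have "(\<lambda>x. indicat_real (cball h R) x *\<^sub>R u x) \<in> borel_measurable borel"
      by (intro borel_measurable_scaleR borel_measurable_indicator assms(3)) simp
    ultimately have "integrable lborel (\<lambda>x. indicator (cball h R) x *\<^sub>R u x)"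
      by (simp only: integrable_lebesgue_lborel)
    from lborel_integrable_translate[OF this, of h]
    have "integrable lborel (\<lambda>x. indicator (cball h R) (x + h) *\<^sub>R u (x + h))" .
    moreover have "indicat_real (cball h R) (x + h) = indicator (cball 0 R) x" for x
      by (simp add: indicator_def dist_norm)
    ultimately show "integrable lebesgue (\<lambda>x. indicat_real (cball 0 R) x *\<^sub>R u (x + h))"
      by (subst integrable_lebesgue_lborel) auto
  qed
  have "AE x in lebesgue. (u (x + h) - u x) - ?W x = 0"
  proof (rule fundamental_lemma)
    have VL: "(\<lambda>x. u (x + h) - u x) \<in> L1_loc"
      using L1_loc_add[OF ushift L1_loc_scaleR[OF uL, of "-1"]] by simp
    show "(\<lambda>x. u (x + h) - u x - ?W x) \<in> L1_loc"
      using L1_loc_add[OF VL L1_loc_scaleR[OF L2_L1_loc[OF W2], of "-1"]] by simp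
    fix \<eta> :: "'a \<Rightarrow> real" assume \<eta>: "\<eta> \<in> test_functions"
    have [measurable]: "\<eta> \<in> borel_measurable borel" by (rule test_functions_measurable[OF \<eta>])
    define \<Phi> where "\<Phi> = (\<lambda>x. (\<integral>t. \<eta> (x - t *\<^sub>R h) *\<^sub>R ?i t \<partial>lborel) *\<^sub>R h)"
    have av: "(\<lambda>x. \<integral>t. \<eta> (x - t *\<^sub>R h) *\<^sub>R ?i t \<partial>lborel) \<in> test_functions"
    proof (rule test_functions_convolution[OF \<eta> ii(1), where R="norm h"])
      show "?i t = 0" if "norm h < norm (t *\<^sub>R h)" for t
        using that mult_left_le_one_le[of "norm h" "\<bar>t\<bar>"] by (auto simp: indicator_def)
    qed measurable
    have \<Phi>: "\<Phi> \<in> test_functions"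
      unfolding \<Phi>_def by (rule test_functions_linear[OF bounded_linear_scaleR_left av])
    \<comment> \<open>The divergence of a scalar function times \<open>h\<close> is its derivative
      along \<open>h\<close>; averaged over the segment it collapses by the fundamental theorem of
      calculus.\<close>
    have div\<Phi>: "divergence \<Phi> x = \<eta> x - \<eta> (x - h)" for x
    proof -
      have "divergence \<Phi> x = (\<integral>t. frechet_derivative \<eta> (at (x - t *\<^sub>R h)) h *\<^sub>R ?i t \<partial>lborel)"
        unfolding \<Phi>_def divergence_scaleR_const[OF av]
        by (subst frechet_derivative_convolution[OF \<eta> ii(1)]) auto
      then show ?thesis using lborel_integral_indicator_frechet_derivative[OF \<eta>, of x h] by simp
    qed
    have to_lb: "(\<integral>x. u x * \<zeta> x \<partial>lebesgue) = (\<integral>x. u x * \<zeta> x \<partial>lborel)" "integrable lborel (\<lambda>x. u x * \<zeta> x)"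
      if "\<zeta> \<in> test_functions" for \<zeta>
    proof -
      have [measurable]: "\<zeta> \<in> borel_measurable borel" by (rule test_functions_measurable[OF that])
      show "(\<integral>x. u x * \<zeta> x \<partial>lebesgue) = (\<integral>x. u x * \<zeta> x \<partial>lborel)"
        by (rule integral_lebesgue_lborel) measurable
      show "integrable lborel (\<lambda>x. u x * \<zeta> x)"
        using L1_loc_test_mult_integrable[OF uL that] by (subst (asm) integrable_lebesgue_lborel) auto
    qed
    have \<eta>h: "(\<lambda>x. \<eta> (x - h)) \<in> test_functions"
    proof -
      have "(\<lambda>x. \<eta> x + (-1) *\<^sub>R divergence \<Phi> x) \<in> test_functions"
        by (intro test_functions_add \<eta> test_functions_linear[OF bounded_linear_scaleR_right] divergence_test_functions \<Phi>)
      then show ?thesis by (simp add: div\<Phi>)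
    qed
    have "(\<integral>x. (u (x + h) - u x) * \<eta> x \<partial>lborel) = (\<integral>x. G x \<bullet> \<Phi> x \<partial>lborel)"
    proof -
      have i1: "integrable lborel (\<lambda>x. u (x + h) * \<eta> x)"
        using lborel_integrable_translate[OF to_lb(2)[OF \<eta>h], of h] by simp
      have "(\<integral>x. u (x + h) * \<eta> x \<partial>lborel) = (\<integral>x. u x * \<eta> (x - h) \<partial>lborel)"
        using lborel_integral_translate[of "\<lambda>x. u x * \<eta> (x - h)" h] by simp
      then have "(\<integral>x. (u (x + h) - u x) * \<eta> x \<partial>lborel) = - (\<integral>x. u x * divergence \<Phi> x \<partial>lborel)"
        using i1 to_lb(2)[OF \<eta>] to_lb(2)[OF \<eta>h] by (simp add: div\<Phi> left_diff_distrib right_diff_distrib)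
      also have "\<dots> = (\<integral>x. G x \<bullet> \<Phi> x \<partial>lebesgue)"
        using u \<Phi> to_lb(1)[OF divergence_test_functions[OF \<Phi>]] by (simp add: has_weak_gradient_def)
      also have "\<dots> = (\<integral>x. G x \<bullet> \<Phi> x \<partial>lborel)"
        using test_functions_measurable[OF \<Phi>] by (intro integral_lebesgue_lborel) auto
      finally show ?thesis .
    qed
    also have "\<dots> = (\<integral>x. \<eta> x * ?W x \<partial>lborel)"
    proof -
      obtain B where B: "B > 0" "\<And>x. norm (\<eta> x) \<le> B" using test_functions_bounded[OF \<eta>] by blast
      obtain r where r: "r > 0" "\<And>x. norm x > r \<Longrightarrow> \<eta> x = 0" using test_functions_support[OF \<eta>] by blast
      let ?F = "\<lambda>(t, x). ?i t * \<eta> (x - t *\<^sub>R h) * (G x \<bullet> h)"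
      \<comment> \<open>For t in [0, 1] the factor \<eta>(x - t h) vanishes outside this ball, on
        which \<open>G\<close> is integrable; that dominates the double integral.\<close>
      let ?K = "cball (0::'a) (r + norm h)"
      have "integrable lebesgue (\<lambda>x. indicat_real ?K x *\<^sub>R G x)" using GL by (simp add: L1_loc_iff_cball)
      moreover have "(\<lambda>x. indicat_real ?K x *\<^sub>R G x) \<in> borel_measurable borel"
        by (intro borel_measurable_scaleR borel_measurable_indicator assms(4)) simp
      ultimately have "integrable lborel (\<lambda>x. indicat_real ?K x *\<^sub>R G x)"
        by (simp only: integrable_lebesgue_lborel)
      then have "integrable lborel (\<lambda>x. (indicat_real ?K x *\<^sub>R G x) \<bullet> h)" by (rule integrable_inner_left)
      then have "integrable lborel (\<lambda>x. B * (indicat_real ?K x * (G x \<bullet> h)))" by simp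
      from integrable_pair_mult[OF sigma_finite_lborel sigma_finite_lborel ii(1) this]
      have F: "integrable (lborel \<Otimes>\<^sub>M lborel) ?F"
      proof (rule Bochner_Integration.integrable_bound)
        show "?F \<in> borel_measurable (lborel \<Otimes>\<^sub>M lborel)" by measurable
        have "norm (?F (t, x)) \<le> norm (?i t * (B * (indicat_real ?K x * (G x \<bullet> h))))" for t x
        proof (cases "t \<in> {0..1} \<and> x \<in> ?K")
          case True
          then show ?thesis using B by (auto simp: abs_mult intro!: mult_right_mono)
        next
          case False
          have "\<eta> (x - t *\<^sub>R h) = 0" if t: "t \<in> {0..1}" and x: "x \<notin> ?K"
          proof (rule r(2))
            have "norm (t *\<^sub>R h) \<le> norm h" using t by (simp add: mult_left_le_one_le)
            then show "r < norm (x - t *\<^sub>R h)" using x norm_triangle_ineq2[of x "t *\<^sub>R h"] by simp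
          qed
          then show ?thesis using False by (auto simp: indicator_def)
        qed
        then show "AE z in lborel \<Otimes>\<^sub>M lborel. norm (?F z) \<le>
            norm (case z of (t, x) \<Rightarrow> ?i t * (B * (indicat_real ?K x * (G x \<bullet> h))))" by auto
      qed
      \<comment> \<open>The shear moves the translation from \<eta> to \<open>G\<close>, after which
        \<eta> no longer depends on t.\<close>
      have F': "integrable (lborel \<Otimes>\<^sub>M lborel) (\<lambda>(t, x). ?F (t, x + t *\<^sub>R h))"
        by (rule integrable_shear[OF sigma_finite_lborel F]) measurable
      have "(\<integral>x. G x \<bullet> \<Phi> x \<partial>lborel) = (\<integral>x. (\<integral>t. ?F (t, x) \<partial>lborel) \<partial>lborel)"
      proof (intro Bochner_Integration.integral_cong refl)
        fix x
        have "(\<integral>t. ?F (t, x) \<partial>lborel) = (\<integral>t. (\<eta> (x - t *\<^sub>R h) *\<^sub>R ?i t) * (G x \<bullet> h) \<partial>lborel)"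
          by (simp add: mult_ac)
        also have "\<dots> = (\<integral>t. \<eta> (x - t *\<^sub>R h) *\<^sub>R ?i t \<partial>lborel) * (G x \<bullet> h)"
          by (rule integral_mult_left_zero)
        finally show "G x \<bullet> \<Phi> x = (\<integral>t. ?F (t, x) \<partial>lborel)" by (auto simp: \<Phi>_def)
      qed
      also have "\<dots> = (\<integral>t. (\<integral>x. ?F (t, x) \<partial>lborel) \<partial>lborel)"
        using lborel_pair.Fubini_integral[of "\<lambda>t x. ?F (t, x)"] F by simp
      also have "\<dots> = (\<integral>t. (\<integral>x. ?F (t, x + t *\<^sub>R h) \<partial>lborel) \<partial>lborel)"
        by (intro Bochner_Integration.integral_cong refl lborel_integral_translate[symmetric]) simp
      also have "\<dots> = (\<integral>x. (\<integral>t. ?F (t, x + t *\<^sub>R h) \<partial>lborel) \<partial>lborel)"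
        using lborel_pair.Fubini_integral[of "\<lambda>t x. ?F (t, x + t *\<^sub>R h)"] F' by simp
      also have "\<dots> = (\<integral>x. \<eta> x * ?W x \<partial>lborel)"
      proof (intro Bochner_Integration.integral_cong refl)
        fix x
        have "(\<integral>t. ?F (t, x + t *\<^sub>R h) \<partial>lborel) = (\<integral>t. \<eta> x * (?i t *\<^sub>R (G (x - - (t *\<^sub>R h)) \<bullet> h)) \<partial>lborel)"
          by (simp add: mult_ac)
        then show "(\<integral>t. ?F (t, x + t *\<^sub>R h) \<partial>lborel) = \<eta> x * ?W x" by simp
      qed
      finally show ?thesis .
    qed
    finally have eq: "(\<integral>x. (u (x + h) - u x) * \<eta> x \<partial>lebesgue) = (\<integral>x. ?W x * \<eta> x \<partial>lebesgue)"
      by (simp add: integral_lebesgue_lborel mult.commute)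
    show "(\<integral>x. (u (x + h) - u x - ?W x) * \<eta> x \<partial>lebesgue) = 0"
      using eq L1_loc_test_mult_integrable[OF VL \<eta>] L1_loc_test_mult_integrable[OF L2_L1_loc[OF W2] \<eta>]
      by (simp only: left_diff_distrib[of "u (_ + h) - u _"]) simp
  qed
  then show AE: "AE x in lborel. u (x + h) - u x = ?W x" by (simp add: AE_lebesgue_iff)
  have "(\<integral>\<^sup>+x. ennreal ((u (x + h) - u x)\<^sup>2) \<partial>lborel) = (\<integral>\<^sup>+x. ennreal ((norm (?W x))\<^sup>2) \<partial>lborel)"
  proof (intro nn_integral_cong_AE, use AE in eventually_elim)
    case (elim x)
    then show ?case by simp
  qed
  with W show "(\<integral>\<^sup>+x. ennreal ((u (x + h) - u x)\<^sup>2) \<partial>lborel) \<le> ennreal ((norm h)\<^sup>2 * L2sq G)" by simp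
qed

subsection \<open>A Poincare inequality on cubes\<close>

text \<open>\<open>R\<close> is half the side length. Differences of two points of
  \<open>cube R\<close> lie in \<open>cube (2 * R)\<close> and volumes are explicit, which
  determines the constant in the Poincare inequality.\<close>

abbreviation cube :: "real \<Rightarrow> 'a::euclidean_space set" where
  "cube R \<equiv> cbox (- (R *\<^sub>R One)) (R *\<^sub>R One)"

lemma mem_cube: "x \<in> cube R \<longleftrightarrow> (\<forall>i\<in>Basis. \<bar>x \<bullet> i\<bar> \<le> R)"
  by (auto simp: mem_box abs_le_iff)

lemma cube_mono: "R \<le> S \<Longrightarrow> cube R \<subseteq> cube S"
  by (auto simp: mem_cube) (meson order_trans)

lemma emeasure_cube: "R \<ge> 0 \<Longrightarrow> emeasure lborel (cube R :: 'a::euclidean_space set) = ennreal ((2 * R) ^ DIM('a))"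
  by (subst emeasure_lborel_cbox) (auto simp: inner_add_left)

lemma measure_cube: "R \<ge> 0 \<Longrightarrow> measure lborel (cube R :: 'a::euclidean_space set) = (2 * R) ^ DIM('a)"
  unfolding measure_def by (subst emeasure_cube) auto

lemma norm_le_cube: "x \<in> cube R \<Longrightarrow> norm (x::'a::euclidean_space) \<le> R * DIM('a)"
  using norm_le_l1[of x] sum_bounded_above[of Basis "\<lambda>i. \<bar>x \<bullet> i\<bar>" R]
  by (auto simp: mem_cube mult.commute)

lemma in_cubeI: "norm x \<le> R \<Longrightarrow> x \<in> cube R"
  using Basis_le_norm[of _ x] by (force simp: mem_cube)

text \<open>A mean value argument: were \<open>f\<close> larger than \<open>K\<close> everywhere on
  \<open>Q\<close>, the excess would integrate to zero and vanish almost everywhere, against the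
  positive measure of \<open>Q\<close>.\<close>

lemma nn_integral_le_const_imp_exists:
  fixes f :: "'s \<Rightarrow> ennreal"
  assumes [measurable]: "f \<in> borel_measurable M" "Q \<in> sets M" and Q: "0 < emeasure M Q" "emeasure M Q < \<infinity>"
    and le: "(\<integral>\<^sup>+x\<in>Q. f x \<partial>M) \<le> ennreal K * emeasure M Q"
  shows "\<exists>x\<in>Q. f x \<le> ennreal K"
proof (rule ccontr)
  assume "\<not> ?thesis"
  then have gt: "ennreal K < f x" if "x \<in> Q" for x using that by force
  have fin: "ennreal K * emeasure M Q < top" using Q by (simp add: ennreal_mult_less_top)
  have "(\<integral>\<^sup>+x\<in>Q. f x \<partial>M) = (\<integral>\<^sup>+x. ennreal K * indicator Q x + (f x - ennreal K) * indicator Q x \<partial>M)"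
    using gt by (intro nn_integral_cong)
      (auto simp: indicator_def less_imp_le add_diff_inverse_ennreal)
  also have "\<dots> = ennreal K * emeasure M Q + (\<integral>\<^sup>+x. (f x - ennreal K) * indicator Q x \<partial>M)"
    by (subst nn_integral_add) (auto simp: nn_integral_cmult_indicator)
  finally have "ennreal K * emeasure M Q + (\<integral>\<^sup>+x. (f x - ennreal K) * indicator Q x \<partial>M) \<le> ennreal K * emeasure M Q + 0"
    using le by simp
  then have "(\<integral>\<^sup>+x. (f x - ennreal K) * indicator Q x \<partial>M) = 0"
    using fin unfolding ennreal_add_left_cancel_le by auto
  then have "AE x in M. (f x - ennreal K) * indicator Q x = 0" by (subst (asm) nn_integral_0_iff_AE) auto
  then have "AE x in M. x \<notin> Q"
  proof eventually_elim
    case (elim x)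
    then show ?case using gt[of x] diff_eq_0_iff_ennreal[of "f x" "ennreal K"]
      by (auto simp: indicator_def split: if_splits)
  qed
  then have "emeasure M Q = 0"
    using AE_iff_measurable[of Q M "\<lambda>x. x \<notin> Q"] sets.sets_into_space[of Q M] by auto
  with Q show False by simp
qed

text \<open>The double integral of (u x - u y)^2 over the cube is rewritten with h = x - y in
  \<open>cube (2 * R)\<close> and bounded by the estimate for translates. Averaging in y yields a
  good point y, and m is the value u y. The constant comes from |h| \<le> 2 R n and from the ratio
  2^n of the volumes of the two cubes. The norm of \<open>G\<close> is that on the whole space
  because the estimate for translates is global.\<close>

lemma Poincare_borel:
  fixes u :: "'a::euclidean_space \<Rightarrow> real" and R :: real
  assumes u: "has_weak_gradient u G" and G: "G \<in> L2"
    and [measurable]: "u \<in> borel_measurable borel" "G \<in> borel_measurable borel" and R: "R > 0"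
  shows "\<exists>m. (\<integral>\<^sup>+x. ennreal ((indicator (cube R) x * (u x - m))\<^sup>2) \<partial>lborel)
      \<le> ennreal (4 * 2 ^ DIM('a) * (real DIM('a))\<^sup>2 * R\<^sup>2 * L2sq G)"
proof -
  let ?Q = "cube R :: 'a set" and ?Q2 = "cube (2 * R) :: 'a set"
  let ?n = "DIM('a)"
  let ?K = "4 * 2 ^ ?n * (real ?n)\<^sup>2 * R\<^sup>2 * L2sq G"
  have K: "0 \<le> ?K" by (simp add: L2sq_nonneg)
  have [measurable]: "?Q \<in> sets borel" "?Q2 \<in> sets borel" by simp_all
  have "(\<integral>\<^sup>+y\<in>?Q. (\<integral>\<^sup>+x. ennreal ((indicator ?Q x * (u x - u y))\<^sup>2) \<partial>lborel) \<partial>lborel)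
     = (\<integral>\<^sup>+y. (\<integral>\<^sup>+x. indicator ?Q y * ennreal ((indicator ?Q x * (u x - u y))\<^sup>2) \<partial>lborel) \<partial>lborel)"
    by (intro nn_integral_cong) (subst nn_integral_cmult, auto simp: mult.commute)
  also have "\<dots> = (\<integral>\<^sup>+y. (\<integral>\<^sup>+h. indicator ?Q y * ennreal ((indicator ?Q (h + y) * (u (h + y) - u y))\<^sup>2) \<partial>lborel) \<partial>lborel)"
    by (intro nn_integral_cong nn_integral_lborel_translate[symmetric]) measurable
  also have "\<dots> \<le> (\<integral>\<^sup>+y. (\<integral>\<^sup>+h. indicator ?Q2 h * ennreal ((u (y + h) - u y)\<^sup>2) \<partial>lborel) \<partial>lborel)"
  proof (intro nn_integral_mono)
    fix y h :: 'a
    have "h \<in> ?Q2" if "y \<in> ?Q" "h + y \<in> ?Q"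
      unfolding mem_cube
    proof
      fix i :: 'a assume "i \<in> Basis"
      then have "\<bar>y \<bullet> i\<bar> \<le> R" "\<bar>(h + y) \<bullet> i\<bar> \<le> R" using that by (auto simp: mem_cube)
      then show "\<bar>h \<bullet> i\<bar> \<le> 2 * R" unfolding inner_add_left by linarith
    qed
    then show "indicator ?Q y * ennreal ((indicator ?Q (h + y) * (u (h + y) - u y))\<^sup>2)
        \<le> indicator ?Q2 h * ennreal ((u (y + h) - u y)\<^sup>2)"
      by (auto simp: indicator_def add.commute)
  qed
  also have "\<dots> = (\<integral>\<^sup>+h. (\<integral>\<^sup>+y. indicator ?Q2 h * ennreal ((u (y + h) - u y)\<^sup>2) \<partial>lborel) \<partial>lborel)"
    by (rule lborel_pair.Fubini'[symmetric]) measurable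
  also have "\<dots> = (\<integral>\<^sup>+h. indicator ?Q2 h * (\<integral>\<^sup>+y. ennreal ((u (y + h) - u y)\<^sup>2) \<partial>lborel) \<partial>lborel)"
    by (intro nn_integral_cong nn_integral_cmult) measurable
  also have "\<dots> \<le> (\<integral>\<^sup>+h. ennreal ((2 * R * real ?n)\<^sup>2 * L2sq G) * indicator ?Q2 h \<partial>lborel)"
  proof (intro nn_integral_mono)
    fix h :: 'a
    show "indicator ?Q2 h * (\<integral>\<^sup>+y. ennreal ((u (y + h) - u y)\<^sup>2) \<partial>lborel) \<le> ennreal ((2 * R * real ?n)\<^sup>2 * L2sq G) * indicator ?Q2 h"
    proof (cases "h \<in> ?Q2")
      case True
      then have "(norm h)\<^sup>2 \<le> (2 * R * real ?n)\<^sup>2" using norm_le_cube by (intro power_mono) auto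
      then have "ennreal ((norm h)\<^sup>2 * L2sq G) \<le> ennreal ((2 * R * real ?n)\<^sup>2 * L2sq G)"
        by (intro ennreal_leI mult_right_mono L2sq_nonneg)
      with weak_difference_formula(2)[OF u G assms(3,4), of h] True show ?thesis by simp
    qed simp
  qed
  also have "\<dots> = ennreal ((2 * R * real ?n)\<^sup>2 * L2sq G) * ennreal ((2 * (2 * R)) ^ ?n)"
    using R by (subst nn_integral_cmult_indicator) (simp_all add: emeasure_cube del: emeasure_lborel_cbox)
  also have "\<dots> = ennreal ?K * emeasure lborel ?Q"
    using R power_mult_distrib[of "2::real" 2 ?n] by (simp add: emeasure_cube L2sq_nonneg power_mult_distrib mult_ac del: emeasure_lborel_cbox flip: ennreal_mult)
  finally have "\<exists>y\<in>?Q. (\<integral>\<^sup>+x. ennreal ((indicator ?Q x * (u x - u y))\<^sup>2) \<partial>lborel) \<le> ennreal ?K"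
  proof (intro nn_integral_le_const_imp_exists[where M=lborel])
    show "0 < emeasure lborel ?Q" "emeasure lborel ?Q < \<infinity>"
      using R emeasure_cube[of R, where 'a='a] by (simp_all del: emeasure_lborel_cbox)
  qed measurable
  then show ?thesis by blast
qed

definition Poincare_const :: "'a::euclidean_space itself \<Rightarrow> real" where
  "Poincare_const _ = 4 * 2 ^ DIM('a) * (real DIM('a))\<^sup>2"

lemma Poincare_const_nonneg: "0 \<le> Poincare_const TYPE('a::euclidean_space)"
  by (simp add: Poincare_const_def)

lemma Poincare:
  fixes u :: "'a::euclidean_space \<Rightarrow> real"
  assumes u: "u \<in> D1" and R: "R > 0"
  obtains m where "(\<lambda>x. indicator (cube R) x * (u x - m)) \<in> L2"
    "L2sq (\<lambda>x. indicator (cube R) x * (u x - m)) \<le> Poincare_const TYPE('a) * R\<^sup>2 * D1_inner u u"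
proof -
  note wg = D1_weak_gradient[OF u]
  note m = has_weak_gradient_measurable[OF wg(1)]
  obtain v where v: "v \<in> borel_measurable borel" "AE x in lebesgue. u x = v x"
    using borel_representative[OF m(1)] by blast
  obtain H where H: "H \<in> borel_measurable borel" "AE x in lebesgue. weak_gradient u x = H x"
    using borel_representative[OF m(2)] by blast
  note ml = v(1)[THEN borel_measurable_lebesgueI] H(1)[THEN borel_measurable_lebesgueI]
  have "has_weak_gradient v H" by (rule has_weak_gradient_cong_AE[OF wg(1) v(2) ml(1) H(2) ml(2)])
  moreover have HL: "H \<in> L2" "L2sq H = D1_inner u u"
    using L2_cong_AE[OF wg(2) ml(2) H(2)] by (simp_all add: D1_inner_self)
  ultimately obtain k where k: "(\<integral>\<^sup>+x. ennreal ((indicator (cube R) x * (v x - k))\<^sup>2) \<partial>lborel)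
      \<le> ennreal (Poincare_const TYPE('a) * R\<^sup>2 * D1_inner u u)"
    using Poincare_borel[of v H R] v(1) H(1) R by (auto simp: Poincare_const_def)
  let ?f = "\<lambda>x. indicator (cube R) x * (u x - k)"
  have fm: "?f \<in> borel_measurable lebesgue"
    using m(1) by (intro borel_measurable_times borel_measurable_indicator_lebesgue borel_measurable_diff) auto
  have "(\<integral>\<^sup>+x. ennreal ((norm (?f x))\<^sup>2) \<partial>lebesgue) = (\<integral>\<^sup>+x. ennreal ((indicator (cube R) x * (v x - k))\<^sup>2) \<partial>lebesgue)"
  proof (intro nn_integral_cong_AE, use v(2) in eventually_elim)
    case (elim x)
    then show ?case by simp
  qed
  with k have le: "(\<integral>\<^sup>+x. ennreal ((norm (?f x))\<^sup>2) \<partial>lebesgue) \<le> ennreal (Poincare_const TYPE('a) * R\<^sup>2 * D1_inner u u)"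
    by (simp add: nn_integral_completion)
  have "0 \<le> Poincare_const TYPE('a) * R\<^sup>2 * D1_inner u u"
    by (intro mult_nonneg_nonneg Poincare_const_nonneg D1_inner_nonneg) simp
  from L2I[OF fm le this] that show ?thesis by blast
qed

lemma indicator_cube_L2: "indicat_real (cube R :: 'a::euclidean_space set) \<in> L2"
  "L2sq (indicat_real (cube R :: 'a set)) = measure lborel (cube R :: 'a set)"
proof -
  have "(norm (indicat_real (cube R) x))\<^sup>2 = indicator (cube R) x" for x :: 'a by (simp add: indicator_def)
  then show "indicat_real (cube R :: 'a set) \<in> L2" "L2sq (indicat_real (cube R :: 'a set)) = measure lborel (cube R :: 'a set)"
    using emeasure_lborel_cbox_finite[of "- (R *\<^sub>R One)" "R *\<^sub>R (One::'a)"]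
    by (auto simp: L2_def L2sq_def intro!: borel_measurable_indicator)
qed

lemma D1_cube_L2:
  fixes u :: "'a::euclidean_space \<Rightarrow> real"
  assumes "u \<in> D1" shows "(\<lambda>x. indicator (cube R) x * u x) \<in> L2"
proof -
  \<comment> \<open>The Poincare inequality asks for a positive side, so membership is obtained on a
    cube with side parameter at least 1 and then restricted.\<close>
  define S where "S = max R 1"
  have S: "S > 0" "R \<le> S" by (auto simp: S_def)
  obtain m where m: "(\<lambda>x. indicator (cube S) x * (u x - m)) \<in> L2" using Poincare[OF assms S(1)] by blast
  have "(\<lambda>x. indicator (cube S) x * (u x - m) + m * indicator (cube S) x) \<in> L2"
    using L2_add(1)[OF m L2_scaleR(1)[OF indicator_cube_L2(1)], of m] by simp
  moreover have "indicator (cube S) x * (u x - m) + m * indicator (cube S) x = indicator (cube S) x * u x" for x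
    by (simp add: indicator_def)
  ultimately have SL: "(\<lambda>x. indicator (cube S) x * u x) \<in> L2" by simp
  show ?thesis unfolding L2_def
  proof (intro CollectI conjI)
    show mR: "(\<lambda>x. indicator (cube R) x * u x) \<in> borel_measurable lebesgue"
      using L1_loc_measurable[OF D1_L1_loc[OF assms]]
      by (intro borel_measurable_times borel_measurable_indicator_lebesgue) auto
    have sub: "cube R \<subseteq> (cube S :: 'a set)" using S(2) by (rule cube_mono)
    have iS: "integrable lebesgue (\<lambda>x. (norm (indicator (cube S) x * u x))\<^sup>2)"
      using SL by (simp only: L2_def mem_Collect_eq)
    have le: "(norm (indicator (cube R) x * u x))\<^sup>2 \<le> (norm (indicator (cube S) x * u x))\<^sup>2" for x
      using subsetD[OF sub, of x] by (cases "x \<in> cube R") auto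
    show "integrable lebesgue (\<lambda>x. (norm (indicator (cube R) x * u x))\<^sup>2)"
    proof (rule Bochner_Integration.integrable_bound[where f="\<lambda>x. (norm (indicator (cube S) x * u x))\<^sup>2"])
      show "integrable lebesgue (\<lambda>x. (norm (indicator (cube S) x * u x))\<^sup>2)" by (rule iS)
      show "(\<lambda>x. (norm (indicator (cube R) x * u x))\<^sup>2) \<in> borel_measurable lebesgue"
        by (rule borel_measurable_power[OF measurable_compose[OF mR borel_measurable_norm]])
      show "AE x in lebesgue. norm ((norm (indicator (cube R) x * u x))\<^sup>2) \<le> norm ((norm (indicator (cube S) x * u x))\<^sup>2)"
      proof (rule AE_I2)
        fix x :: 'a
        show "norm ((norm (indicator (cube R) x * u x))\<^sup>2) \<le> norm ((norm (indicator (cube S) x * u x))\<^sup>2)"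
          using le[of x] by simp
      qed
    qed
  qed
qed

section \<open>Pairings of D^1 with compactly supported square integrable functions\<close>

lemma compact_support_cube:
  assumes "compact_support f" obtains R where "R > 0" "AE x in lebesgue. f x = indicator (cube R) x *\<^sub>R f x"
proof -
  obtain K where K: "compact K" "AE x in lebesgue. x \<notin> K \<longrightarrow> f x = 0"
    using assms by (auto simp: compact_support_def)
  obtain r where r: "K \<subseteq> cball 0 r" using bounded_subset_cball_0[OF compact_imp_bounded[OF K(1)]] by blast
  have "cball 0 r \<subseteq> cube (max r 1)" using in_cubeI[of _ "max r 1"] by force
  with r K(2) have "AE x in lebesgue. f x = indicator (cube (max r 1)) x *\<^sub>R f x"
    by (auto simp: indicator_def elim!: eventually_mono)
  then show ?thesis using that[of "max r 1"] by simp
qed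

lemma test_functions_compact_support:
  assumes "\<eta> \<in> test_functions" shows "compact_support \<eta>"
proof -
  obtain R where "\<And>x. norm x > R \<Longrightarrow> \<eta> x = 0" using test_functions_support[OF assms] by blast
  then show ?thesis unfolding compact_support_def
    by (intro exI[of _ "cball 0 R"]) auto
qed

text \<open>
  Every pairing of \<open>D\<^sup>1\<close> with a compactly supported \<open>L\<^sup>2\<close> function is turned into integrals over a cube,
  where a function of \<open>D\<^sup>1\<close> is square integrable.
\<close>

lemma L2_compact_D1:
  fixes g :: "'a::euclidean_space \<Rightarrow> real"
  assumes g: "g \<in> L2" "AE x in lebesgue. g x = indicator (cube R) x *\<^sub>R g x" and f: "f \<in> D1"
  shows "integrable lebesgue (\<lambda>x. g x * f x)" "integrable lebesgue g"
    "(\<integral>x. g x * f x \<partial>lebesgue) = (\<integral>x. g x \<bullet> (indicator (cube R) x * (f x - m)) \<partial>lebesgue) + m * (\<integral>x. g x \<partial>lebesgue)"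
    "integrable lebesgue (\<lambda>x. g x \<bullet> (indicator (cube R) x * (f x - m)))"
proof -
  have fm: "(\<lambda>x. f x - m) \<in> D1" by (intro D1_diff f D1_const)
  have gm: "g \<in> borel_measurable lebesgue" using g by (simp add: L2_def)
  have fme: "f \<in> borel_measurable lebesgue" by (rule L1_loc_measurable[OF D1_L1_loc[OF f]])
  have i1: "integrable lebesgue (\<lambda>x. g x \<bullet> (indicator (cube R) x * h x))" if "h \<in> D1" for h
    by (rule L2_inner_integrable[OF g(1) D1_cube_L2[OF that]])
  have i2: "integrable lebesgue (\<lambda>x. g x * h x)" if h: "h \<in> D1" for h
  proof (rule integrable_cong_AE_imp[OF i1[OF h]])
    show "(\<lambda>x. g x * h x) \<in> borel_measurable lebesgue"
      using gm L1_loc_measurable[OF D1_L1_loc[OF h]] by simp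
    show "AE x in lebesgue. g x \<bullet> (indicator (cube R) x * h x) = g x * h x"
      using g(2) by eventually_elim (auto simp: indicator_def split: if_splits)
  qed
  show "integrable lebesgue (\<lambda>x. g x * f x)" by (rule i2[OF f])
  show gi: "integrable lebesgue g" using i2[OF D1_const, of 1] by simp
  show "integrable lebesgue (\<lambda>x. g x \<bullet> (indicator (cube R) x * (f x - m)))" by (rule i1[OF fm])
  have "(\<integral>x. g x \<bullet> (indicator (cube R) x * (f x - m)) \<partial>lebesgue) = (\<integral>x. g x * (f x - m) \<partial>lebesgue)"
  proof (rule integral_cong_AE)
    show "AE x in lebesgue. g x \<bullet> (indicator (cube R) x * (f x - m)) = g x * (f x - m)"
      using g(2) by eventually_elim (auto simp: indicator_def split: if_splits)
  qed (use i1[OF fm] i2[OF fm] in \<open>auto dest: borel_measurable_integrable\<close>)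
  also have "\<dots> = (\<integral>x. g x * f x \<partial>lebesgue) - m * (\<integral>x. g x \<partial>lebesgue)"
    using i2[OF f] gi by (simp add: right_diff_distrib)
  finally show "(\<integral>x. g x * f x \<partial>lebesgue) = (\<integral>x. g x \<bullet> (indicator (cube R) x * (f x - m)) \<partial>lebesgue) + m * (\<integral>x. g x \<partial>lebesgue)"
    by simp
qed

lemma L2_compact_D1_integrable:
  assumes "g \<in> L2" "compact_support g" "f \<in> D1"
  shows "integrable lebesgue (\<lambda>x. g x * f x)" "integrable lebesgue g"
proof -
  obtain R where "AE x in lebesgue. g x = indicator (cube R) x *\<^sub>R g x"
    using compact_support_cube[OF assms(2)] by blast
  from L2_compact_D1(1,2)[OF assms(1) this assms(3)]
  show "integrable lebesgue (\<lambda>x. g x * f x)" "integrable lebesgue g" by auto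
qed

text \<open>Mean zero cancels the unknown constant of the Poincare inequality, so the pairing is
  controlled by the seminorm alone; this is what makes such a \<open>g\<close> an element of
  D^-1.\<close>

lemma L2_compact_mean_zero_bound:
  fixes g :: "'a::euclidean_space \<Rightarrow> real"
  assumes g: "g \<in> L2" "compact_support g" "(\<integral>x. g x \<partial>lebesgue) = 0"
  obtains C where "C \<ge> 0" "\<And>f. f \<in> D1 \<Longrightarrow> \<bar>\<integral>x. g x * f x \<partial>lebesgue\<bar> \<le> C * sqrt (D1_inner f f)"
proof -
  obtain R where R: "R > 0" "AE x in lebesgue. g x = indicator (cube R) x *\<^sub>R g x"
    using compact_support_cube[OF g(2)] by blast
  let ?C = "sqrt (L2sq g * (Poincare_const TYPE('a) * R\<^sup>2))"
  have "\<bar>\<integral>x. g x * f x \<partial>lebesgue\<bar> \<le> ?C * sqrt (D1_inner f f)" if f: "f \<in> D1" for f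
  proof -
    obtain m where m: "(\<lambda>x. indicator (cube R) x * (f x - m)) \<in> L2"
      "L2sq (\<lambda>x. indicator (cube R) x * (f x - m)) \<le> Poincare_const TYPE('a) * R\<^sup>2 * D1_inner f f"
      using Poincare[OF f R(1)] by blast
    have "(\<integral>x. g x * f x \<partial>lebesgue)\<^sup>2 \<le> L2sq g * L2sq (\<lambda>x. indicator (cube R) x * (f x - m))"
      using L2_compact_D1(3)[OF g(1) R(2) f, of m] L2_Cauchy_Schwarz[OF g(1) m(1)] g(3) by simp
    also have "\<dots> \<le> L2sq g * (Poincare_const TYPE('a) * R\<^sup>2 * D1_inner f f)"
      by (intro mult_left_mono m L2sq_nonneg)
    finally have "sqrt ((\<integral>x. g x * f x \<partial>lebesgue)\<^sup>2) \<le> sqrt (L2sq g * (Poincare_const TYPE('a) * R\<^sup>2) * D1_inner f f)"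
      unfolding mult.assoc by (rule real_sqrt_le_mono)
    then show ?thesis by (simp add: real_sqrt_mult)
  qed
  moreover have "?C \<ge> 0" by (simp add: L2sq_nonneg Poincare_const_nonneg)
  ultimately show ?thesis using that by blast
qed

lemma test_function_integral_pos:
  fixes c :: "'a::euclidean_space \<Rightarrow> real"
  assumes c: "c \<in> test_functions" "\<And>x. 0 \<le> c x" "c y > 0" shows "0 < (\<integral>x. c x \<partial>lborel)"
proof -
  have i: "integrable lborel c" by (rule test_functions_integrable[OF c(1)])
  have "0 \<le> (\<integral>x. c x \<partial>lborel)" using c(2) by (intro integral_nonneg_AE) simp
  moreover have "(\<integral>x. c x \<partial>lborel) \<noteq> 0"
  proof
    assume "(\<integral>x. c x \<partial>lborel) = 0"
    then have AE: "AE x in lborel. c x = 0" using i c(2) by (subst (asm) integral_nonneg_eq_0_iff_AE) auto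
    have op: "open (c -` {0<..})"
      using test_functions_continuous[OF c(1)] by (intro open_vimage) auto
    have "y \<in> c -` {0<..}" using c(3) by simp
    with op obtain a b where ab: "y \<in> box a b" "box a b \<subseteq> c -` {0<..}"
      by (rule open_contains_box) (rule that; assumption)
    have "AE x in lborel. x \<notin> box a b" using AE by eventually_elim (use ab(2) in force)
    then have "emeasure lborel (box a b) = 0"
      using AE_iff_measurable[of "box a b" lborel "\<lambda>x. x \<notin> box a b"] by auto
    moreover have "a \<bullet> i < b \<bullet> i" if "i \<in> Basis" for i
      using ab(1) that by (force simp: mem_box)
    then have "emeasure lborel (box a b) > 0"
      by (auto simp: emeasure_lborel_box_eq less_imp_le inner_diff_left intro!: prod_pos)
    ultimately show False by simp
  qed
  ultimately show ?thesis by linarith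
qed

lemma unit_mass_test_function:
  obtains \<zeta> :: "'a::euclidean_space \<Rightarrow> real" where "\<zeta> \<in> test_functions" "\<And>x. 0 \<le> \<zeta> x" "(\<integral>x. \<zeta> x \<partial>lebesgue) = 1"
    "\<And>x. x \<notin> cube 1 \<Longrightarrow> \<zeta> x = 0"
proof -
  obtain c :: "'a \<Rightarrow> real" where c: "c \<in> test_functions" "\<And>x. 0 \<le> c x" "\<And>x. c x \<le> 1" "c 0 = 1"
      "\<And>x. x \<notin> box (- One) One \<Longrightarrow> c x = 0"
    by (rule cutoff_exists) (rule that; assumption)
  have pos: "0 < (\<integral>x. c x \<partial>lborel)"
    using c(4) by (intro test_function_integral_pos[where y=0] c) simp
  let ?I = "\<integral>x. c x \<partial>lborel"
  show ?thesis
  proof (rule that)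
    show t: "(\<lambda>x. c x / ?I) \<in> test_functions" by (rule test_functions_linear[OF bounded_linear_divide c(1)])
    show "(\<integral>x. c x / ?I \<partial>lebesgue) = 1"
      using test_functions_measurable[OF t] pos by (subst integral_lebesgue_lborel) auto
    show "0 \<le> c x / ?I" for x using c(2) pos by simp
    show "c x / ?I = 0" if "x \<notin> cube 1" for x using c(5)[of x] that box_subset_cbox by force
  qed
qed

subsection \<open>Completeness of the Dirichlet space\<close>

text \<open>The constant in the Poincare inequality depends on \<open>f\<close> and on the cube in
  an unspecified way. It is replaced by the weighted mean against \<zeta>, which is linear in
  \<open>f\<close> and the same for all cubes, so that the difference of two normalised functions is
  the normalised difference.\<close>

lemma D1_mean_bound:
  fixes \<zeta> :: "'a::euclidean_space \<Rightarrow> real"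
  assumes \<zeta>: "\<zeta> \<in> test_functions" "(\<integral>x. \<zeta> x \<partial>lebesgue) = 1" "\<And>x. x \<notin> cube 1 \<Longrightarrow> \<zeta> x = 0" and R: "R \<ge> 1"
  obtains C where "C \<ge> 0" "\<And>f. f \<in> D1 \<Longrightarrow> L2sq (\<lambda>x. indicator (cube R) x * (f x - (\<integral>x. \<zeta> x * f x \<partial>lebesgue))) \<le> C * D1_inner f f"
proof -
  have R0: "R > 0" using R by simp
  have \<zeta>L: "\<zeta> \<in> L2" by (rule test_functions_L2[OF \<zeta>(1)])
  have sub: "cube 1 \<subseteq> (cube R :: 'a set)" using R by (rule cube_mono)
  have \<zeta>Q: "AE x in lebesgue. \<zeta> x = indicator (cube R) x *\<^sub>R \<zeta> x"
    using \<zeta>(3) sub by (intro AE_I2) (auto simp: indicator_def)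
  let ?P = "Poincare_const TYPE('a) * R\<^sup>2" and ?V = "measure lborel (cube R :: 'a set)"
  let ?C = "2 * ?P + 2 * (L2sq \<zeta> * ?P * ?V)"
  have P: "0 \<le> ?P" by (simp add: Poincare_const_nonneg)
  have "L2sq (\<lambda>x. indicator (cube R) x * (f x - (\<integral>x. \<zeta> x * f x \<partial>lebesgue))) \<le> ?C * D1_inner f f" if f: "f \<in> D1" for f
  proof -
    let ?M = "\<integral>x. \<zeta> x * f x \<partial>lebesgue"
    obtain m where m: "(\<lambda>x. indicator (cube R) x * (f x - m)) \<in> L2"
      "L2sq (\<lambda>x. indicator (cube R) x * (f x - m)) \<le> ?P * D1_inner f f"
      using Poincare[OF f R0] by blast
    have "(?M - m)\<^sup>2 \<le> L2sq \<zeta> * L2sq (\<lambda>x. indicator (cube R) x * (f x - m))"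
      using L2_compact_D1(3)[OF \<zeta>L \<zeta>Q f, of m] L2_Cauchy_Schwarz[OF \<zeta>L m(1)] \<zeta>(2) by simp
    also have "\<dots> \<le> L2sq \<zeta> * (?P * D1_inner f f)" by (intro mult_left_mono m L2sq_nonneg)
    finally have Mm: "(m - ?M)\<^sup>2 \<le> L2sq \<zeta> * (?P * D1_inner f f)" by (simp add: power2_commute)
    have "L2sq (\<lambda>x. indicator (cube R) x * (f x - m) + (m - ?M) *\<^sub>R indicator (cube R) x)
      \<le> 2 * L2sq (\<lambda>x. indicator (cube R) x * (f x - m)) + 2 * ((m - ?M)\<^sup>2 * ?V)"
      using L2_add(2)[OF m(1) L2_scaleR(1)[OF indicator_cube_L2(1)], of "m - ?M"]
      by (simp add: L2_scaleR(2)[OF indicator_cube_L2(1)] indicator_cube_L2(2) del: real_scaleR_def)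
    also have "\<dots> \<le> 2 * (?P * D1_inner f f) + 2 * (L2sq \<zeta> * (?P * D1_inner f f) * ?V)"
      using m(2) Mm by (intro add_mono mult_left_mono mult_right_mono) auto
    also have "\<dots> = ?C * D1_inner f f" by (simp add: algebra_simps)
    also have "(\<lambda>x. indicator (cube R) x * (f x - m) + (m - ?M) *\<^sub>R indicator (cube R) x) = (\<lambda>x. indicator (cube R) x * (f x - ?M))"
      by (auto simp: algebra_simps)
    finally show ?thesis .
  qed
  moreover have "?C \<ge> 0" using P by (simp add: L2sq_nonneg)
  ultimately show ?thesis using that by blast
qed

lemma D1_inner_diff_const:
  assumes "f \<in> D1" "g \<in> D1"
  shows "D1_inner (\<lambda>x. f x - a) (\<lambda>x. g x - b) = D1_inner f g"
proof -
  have "has_weak_gradient (\<lambda>x. h x - c) (weak_gradient h)" if "h \<in> D1" for h and c :: real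
    using has_weak_gradient_lincomb[OF D1_weak_gradient(1)[OF that] has_weak_gradient_const, of 1 "-1" c] by simp
  then show ?thesis using assms D1_weak_gradient(2) by (subst D1_inner_eq) (auto simp: D1_inner_def)
qed

text \<open>The geometric rate is the one delivered by \<open>nested_near_minimisers\<close>; it
  gives almost everywhere convergence without passing to a subsequence, and Fatou estimates the
  distance to the limit.\<close>

lemma L2_complete:
  fixes f :: "nat \<Rightarrow> 'a::euclidean_space \<Rightarrow> 'b::euclidean_space"
  assumes f: "\<And>k. f k \<in> L2" and Cauchy: "\<And>k l. k \<le> l \<Longrightarrow> L2sq (\<lambda>x. f k x - f l x) \<le> c * (1/4)^k"
    and c: "c \<ge> 0"
  obtains F where "F \<in> L2" "\<And>k. L2sq (\<lambda>x. f k x - F x) \<le> c * (1/4)^k"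
proof -
  have fm: "f k \<in> borel_measurable lebesgue" for k using f by (simp add: L2_def)
  have nn: "(\<integral>\<^sup>+x. ennreal ((norm (f k x - f l x))\<^sup>2) \<partial>lebesgue) \<le> ennreal (c * (1/4)^k)" if "k \<le> l" for k l
    using Cauchy[OF that] L2_nn_integral[OF L2_diff(1)[OF f f], of k l] by (simp add: ennreal_leI)
  have conv: "AE x in lebesgue. convergent (\<lambda>k. f k x)"
    by (rule L2_fast_Cauchy_convergent[OF fm nn c]) simp
  define F where "F x = lim (\<lambda>k. f k x)" for x
  have Fm: "F \<in> borel_measurable lebesgue" unfolding F_def by (intro borel_measurable_lim_metric fm)
  have lim: "AE x in lebesgue. (\<lambda>k. f k x) \<longlonglongrightarrow> F x"
    using conv by eventually_elim (simp add: F_def convergent_LIMSEQ_iff)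
  have Fnn: "(\<integral>\<^sup>+x. ennreal ((norm (f k x - F x))\<^sup>2) \<partial>lebesgue) \<le> ennreal (c * (1/4)^k)" for k
    by (rule nn_integral_norm2_limit_le[where k=k and f=f]) (use fm nn lim in auto)
  have d: "(\<lambda>x. f k x - F x) \<in> L2" "L2sq (\<lambda>x. f k x - F x) \<le> c * (1/4)^k" for k
    using c Fm fm Fnn by (intro L2I[where c="c * (1/4)^k"]; simp)+
  then have "F \<in> L2" using L2_diff(1)[OF f[of 0] d(1)[of 0]] by simp
  with d(2) that show ?thesis by blast
qed

lemma LIMSEQ_if_square_le_geometric:
  fixes a :: "nat \<Rightarrow> real"
  assumes "\<And>k. (a k - b)\<^sup>2 \<le> C * (1/4)^k" shows "a \<longlonglongrightarrow> b"
proof -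
  have "(\<lambda>k. sqrt (C * (1/4)^k)) \<longlonglongrightarrow> sqrt (C * 0)"
    by (intro tendsto_intros LIMSEQ_power_zero) simp
  then have lim: "(\<lambda>k. sqrt (C * (1/4)^k)) \<longlonglongrightarrow> 0" by simp
  have "norm (a k - b) \<le> sqrt (C * (1/4)^k)" for k
    using real_sqrt_le_mono[OF assms[of k]] by simp
  then have "(\<lambda>k. a k - b) \<longlonglongrightarrow> 0"
    by (intro Lim_null_comparison[OF _ lim] always_eventually allI)
  then show ?thesis by (simp add: LIM_zero_iff)
qed

text \<open>The seminorm ignores constants, so convergence of functions is obtained after
  subtracting their weighted means. Square integrable bounds on growing cubes give an almost
  everywhere limit, the gradients converge separately in \<open>L2\<close>, and testing links the
  two limits.\<close>

lemma D1_complete: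
  fixes f :: "nat \<Rightarrow> 'a::euclidean_space \<Rightarrow> real"
  assumes f: "\<And>k. f k \<in> D1" and c: "c \<ge> 0"
    and Cauchy: "\<And>k l. k \<le> l \<Longrightarrow> D1_inner (\<lambda>x. f k x - f l x) (\<lambda>x. f k x - f l x) \<le> c * (1/4)^k"
  obtains F where "F \<in> D1" "\<And>k. D1_inner (\<lambda>x. f k x - F x) (\<lambda>x. f k x - F x) \<le> c * (1/4)^k"
proof -
  obtain \<zeta> :: "'a \<Rightarrow> real" where \<zeta>: "\<zeta> \<in> test_functions" "(\<integral>x. \<zeta> x \<partial>lebesgue) = 1" "\<And>x. x \<notin> cube 1 \<Longrightarrow> \<zeta> x = 0"
    using unit_mass_test_function by metis
  define v where "v k = (\<lambda>x. f k x - (\<integral>x. \<zeta> x * f k x \<partial>lebesgue))" for k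
  have vD: "v k \<in> D1" for k unfolding v_def by (intro D1_diff f D1_const)
  have vm: "v k \<in> borel_measurable lebesgue" for k by (rule L1_loc_measurable[OF D1_L1_loc[OF vD]])
  have \<zeta>c: "compact_support \<zeta>" "\<zeta> \<in> L2" using \<zeta> test_functions_compact_support test_functions_L2 by blast+
  have vdiff: "v k x - v l x = (f k x - f l x) - (\<integral>x. \<zeta> x * (f k x - f l x) \<partial>lebesgue)" for k l x
    using L2_compact_D1_integrable(1)[OF \<zeta>c(2,1) f] by (simp add: v_def right_diff_distrib)
  have "\<exists>C. C \<ge> 0 \<and> (\<forall>k l. k \<le> l \<longrightarrow> L2sq (\<lambda>x. indicator (cube R) x * v k x - indicator (cube R) x * v l x) \<le> C * (1/4)^k)"
    if R: "R \<ge> 1" for R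
  proof -
    obtain C where C: "C \<ge> 0" "\<And>f. f \<in> D1 \<Longrightarrow> L2sq (\<lambda>x. indicator (cube R) x * (f x - (\<integral>x. \<zeta> x * f x \<partial>lebesgue))) \<le> C * D1_inner f f"
      using D1_mean_bound[OF \<zeta> R] by blast
    have "L2sq (\<lambda>x. indicator (cube R) x * v k x - indicator (cube R) x * v l x) \<le> (C * c) * (1/4)^k" if "k \<le> l" for k l
    proof -
      have "L2sq (\<lambda>x. indicator (cube R) x * v k x - indicator (cube R) x * v l x)
          \<le> C * D1_inner (\<lambda>x. f k x - f l x) (\<lambda>x. f k x - f l x)"
        using C(2)[OF D1_diff[OF f f], of k l] unfolding vdiff[symmetric] by (simp add: right_diff_distrib)
      also have "\<dots> \<le> C * (c * (1/4)^k)" by (intro mult_left_mono Cauchy that C)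
      finally show ?thesis by (simp add: mult.assoc)
    qed
    then show ?thesis using C(1) c by (intro exI[of _ "C * c"]) auto
  qed
  then have "\<exists>C. \<forall>R. R \<ge> 1 \<longrightarrow> C R \<ge> 0 \<and>
     (\<forall>k l. k \<le> l \<longrightarrow> L2sq (\<lambda>x. indicator (cube R) x * v k x - indicator (cube R) x * v l x) \<le> C R * (1/4)^k)"
    by (intro choice) auto
  then obtain C where C: "\<And>R. R \<ge> 1 \<Longrightarrow> C R \<ge> 0"
    "\<And>R k l. R \<ge> 1 \<Longrightarrow> k \<le> l \<Longrightarrow> L2sq (\<lambda>x. indicator (cube R) x * v k x - indicator (cube R) x * v l x) \<le> C R * (1/4)^k"
    by blast
  have ivL: "(\<lambda>x. indicator (cube R) x * v k x) \<in> L2" for R k by (rule D1_cube_L2[OF vD])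
  have nn: "(\<integral>\<^sup>+x. ennreal ((norm (indicator (cube R) x * v k x - indicator (cube R) x * v l x))\<^sup>2) \<partial>lebesgue)
      \<le> ennreal (C R * (1/4)^k)" if "R \<ge> 1" "k \<le> l" for R k l
    using C(2)[OF that] L2_nn_integral[OF L2_diff(1)[OF ivL ivL], of R k R l] by (simp add: ennreal_leI)
  \<comment> \<open>Countably many cubes give convergence at almost every point of space; the index
    is shifted because the bounds \<open>C R\<close> are available for R \<ge> 1.\<close>
  have "AE x in lebesgue. convergent (\<lambda>k. indicator (cube (real (Suc n))) x * v k x)" for n
    by (rule L2_fast_Cauchy_convergent[where c="C (real (Suc n))"])
       (use ivL nn[of "real (Suc n)"] C(1)[of "real (Suc n)"] in \<open>auto simp: L2_def\<close>)
  then have "AE x in lebesgue. \<forall>n. convergent (\<lambda>k. indicator (cube (real (Suc n))) x * v k x)"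
    unfolding AE_all_countable by blast
  then have conv: "AE x in lebesgue. convergent (\<lambda>k. v k x)"
  proof eventually_elim
    case (elim x)
    obtain n where "norm x \<le> real n" using real_arch_simple by blast
    then have "x \<in> cube (real (Suc n))" by (intro in_cubeI) simp
    with elim[rule_format, of n] show ?case by simp
  qed
  define F where "F x = lim (\<lambda>k. v k x)" for x
  have Fm: "F \<in> borel_measurable lebesgue" unfolding F_def by (intro borel_measurable_lim_metric vm)
  have Flim: "AE x in lebesgue. (\<lambda>k. v k x) \<longlonglongrightarrow> F x"
    using conv by eventually_elim (simp add: F_def convergent_LIMSEQ_iff)
  have iFm: "(\<lambda>x. indicator (cube R) x * F x) \<in> borel_measurable lebesgue" for R
    using Fm by (intro borel_measurable_times borel_measurable_indicator_lebesgue) auto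
  have Fle: "(\<integral>\<^sup>+x. ennreal ((norm (indicator (cube R) x * v k x - indicator (cube R) x * F x))\<^sup>2) \<partial>lebesgue)
      \<le> ennreal (C R * (1/4)^k)" if R1: "R \<ge> 1" for R k
  proof (rule nn_integral_norm2_limit_le[where k=k and f="\<lambda>l x. indicator (cube R) x * v l x"])
    show "AE x in lebesgue. (\<lambda>l. indicator (cube R) x * v l x) \<longlonglongrightarrow> indicator (cube R) x * F x"
      using Flim by eventually_elim (intro tendsto_intros)
    show "(\<integral>\<^sup>+x. ennreal ((norm (indicator (cube R) x * v k x - indicator (cube R) x * v l x))\<^sup>2) \<partial>lebesgue)
      \<le> ennreal (C R * (1/4)^k)" if "k \<le> l" for l
      by (rule nn[OF R1 that])
  qed (use ivL in \<open>simp_all add: L2_def\<close>)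
  have iF: "(\<lambda>x. indicator (cube R) x * v k x - indicator (cube R) x * F x) \<in> L2"
    "L2sq (\<lambda>x. indicator (cube R) x * v k x - indicator (cube R) x * F x) \<le> C R * (1/4)^k" if "R \<ge> 1" for R k
  proof -
    have *: "(\<lambda>x. indicator (cube R) x * v k x - indicator (cube R) x * F x) \<in> borel_measurable lebesgue"
      using ivL[of R k] iFm[of R] by (intro borel_measurable_diff) (auto simp: L2_def)
    have "0 \<le> C R * (1/4)^k" using C(1)[OF that] by simp
    from L2I[OF * Fle[OF that] this] show "(\<lambda>x. indicator (cube R) x * v k x - indicator (cube R) x * F x) \<in> L2"
      "L2sq (\<lambda>x. indicator (cube R) x * v k x - indicator (cube R) x * F x) \<le> C R * (1/4)^k" by auto
  qed
  have iFL: "(\<lambda>x. indicator (cube R) x * F x) \<in> L2" if "R \<ge> 1" for R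
    using L2_diff(1)[OF ivL[of R 0] iF(1)[OF that, of 0]] by simp
  have FL: "F \<in> L1_loc"
    unfolding L1_loc_iff_cball
  proof
    fix R :: real
    have "(\<lambda>x. indicator (cube (max R 1)) x * F x) \<in> L1_loc" by (intro L2_L1_loc iFL) simp
    then have "integrable lebesgue (\<lambda>x. indicator (cball 0 R) x *\<^sub>R (indicator (cube (max R 1)) x * F x))"
      by (simp only: L1_loc_iff_cball)
    moreover have "indicator (cball 0 R) x *\<^sub>R (indicator (cube (max R 1)) x * F x) = indicat_real (cball 0 R) x *\<^sub>R F x" for x
      using in_cubeI[of x "max R 1"] by (auto simp: indicator_def)
    ultimately show "integrable lebesgue (\<lambda>x. indicat_real (cball 0 R) x *\<^sub>R F x)" by (simp only:)
  qed
  define g where "g k = weak_gradient (v k)" for k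
  have gL: "g k \<in> L2" for k unfolding g_def by (rule D1_weak_gradient(2)[OF vD])
  have gm: "g k \<in> borel_measurable lebesgue" for k using gL by (simp add: L2_def)
  have wgd: "has_weak_gradient (\<lambda>x. v k x - v l x) (\<lambda>x. g k x - g l x)" for k l
    using has_weak_gradient_lincomb[OF D1_weak_gradient(1)[OF vD[of k]] D1_weak_gradient(1)[OF vD[of l]], of 1 "-1"]
    by (simp add: g_def)
  have gC: "L2sq (\<lambda>x. g k x - g l x) \<le> c * (1/4)^k" if "k \<le> l" for k l
  proof -
    have "L2sq (\<lambda>x. g k x - g l x) = D1_inner (\<lambda>x. v k x - v l x) (\<lambda>x. v k x - v l x)"
      by (rule D1_inner_self_eq[OF wgd L2_diff(1)[OF gL gL], symmetric])
    also have "\<dots> = D1_inner (\<lambda>x. f k x - f l x) (\<lambda>x. f k x - f l x)"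
      unfolding vdiff by (intro D1_inner_diff_const D1_diff f)
    finally show ?thesis using Cauchy[OF that] by simp
  qed
  obtain G where GL: "G \<in> L2" and Gd': "\<And>k. L2sq (\<lambda>x. g k x - G x) \<le> c * (1/4)^k"
    using L2_complete[OF gL gC c] by blast
  have Gd: "(\<lambda>x. g k x - G x) \<in> L2" "L2sq (\<lambda>x. g k x - G x) \<le> c * (1/4)^k" for k
    by (rule L2_diff(1)[OF gL GL], rule Gd')
  have FG: "has_weak_gradient F G"
    unfolding has_weak_gradient_def
  proof (intro conjI ballI FL L2_L1_loc GL)
    fix \<phi> :: "'a \<Rightarrow> 'a" assume \<phi>: "\<phi> \<in> test_functions"
    have d: "divergence \<phi> \<in> test_functions" by (rule divergence_test_functions[OF \<phi>])
    obtain r where r: "\<And>x. norm x > r \<Longrightarrow> divergence \<phi> x = 0" using test_functions_support[OF d] by blast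
    \<comment> \<open>The divergence of the test field vanishes outside this cube, so the local
      convergence on it is all that the limit uses.\<close>
    define R where "R = max r 1"
    have R: "R \<ge> 1" by (simp add: R_def)
    have out: "divergence \<phi> x = 0" if "x \<notin> cube R" for x
      using that in_cubeI[of x R] r[of x] by (force simp: R_def)
    have ip: "(\<integral>x. v k x * divergence \<phi> x \<partial>lebesgue) - (\<integral>x. F x * divergence \<phi> x \<partial>lebesgue) =
        (\<integral>x. (indicator (cube R) x * v k x - indicator (cube R) x * F x) \<bullet> divergence \<phi> x \<partial>lebesgue)" for k
    proof -
      have "(indicator (cube R) x * v k x - indicator (cube R) x * F x) \<bullet> divergence \<phi> x =
          v k x * divergence \<phi> x - F x * divergence \<phi> x" for x
        using out[of x] by (auto simp: indicator_def algebra_simps)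
      then show ?thesis
        using L1_loc_test_mult_integrable[OF D1_L1_loc[OF vD] d] L1_loc_test_mult_integrable[OF FL d] by simp
    qed
    have "((\<integral>x. v k x * divergence \<phi> x \<partial>lebesgue) - (\<integral>x. F x * divergence \<phi> x \<partial>lebesgue))\<^sup>2
        \<le> (C R * L2sq (divergence \<phi>)) * (1/4)^k" for k
    proof -
      have "((\<integral>x. v k x * divergence \<phi> x \<partial>lebesgue) - (\<integral>x. F x * divergence \<phi> x \<partial>lebesgue))\<^sup>2
        \<le> L2sq (\<lambda>x. indicator (cube R) x * v k x - indicator (cube R) x * F x) * L2sq (divergence \<phi>)"
        unfolding ip by (rule L2_Cauchy_Schwarz[OF iF(1)[OF R] test_functions_L2[OF d]])
      also have "\<dots> \<le> (C R * (1/4)^k) * L2sq (divergence \<phi>)"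
        by (intro mult_right_mono iF R L2sq_nonneg)
      finally show ?thesis by (simp add: mult_ac)
    qed
    then have l1: "(\<lambda>k. (\<integral>x. v k x * divergence \<phi> x \<partial>lebesgue)) \<longlonglongrightarrow> (\<integral>x. F x * divergence \<phi> x \<partial>lebesgue)"
      by (rule LIMSEQ_if_square_le_geometric)
    have "((\<integral>x. g k x \<bullet> \<phi> x \<partial>lebesgue) - (\<integral>x. G x \<bullet> \<phi> x \<partial>lebesgue))\<^sup>2 \<le> (c * L2sq \<phi>) * (1/4)^k" for k
    proof -
      have "(\<integral>x. g k x \<bullet> \<phi> x \<partial>lebesgue) - (\<integral>x. G x \<bullet> \<phi> x \<partial>lebesgue) = (\<integral>x. (g k x - G x) \<bullet> \<phi> x \<partial>lebesgue)"
        using L2_inner_integrable[OF gL test_functions_L2[OF \<phi>]] L2_inner_integrable[OF GL test_functions_L2[OF \<phi>]]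
        by (simp add: inner_diff_left)
      then have "((\<integral>x. g k x \<bullet> \<phi> x \<partial>lebesgue) - (\<integral>x. G x \<bullet> \<phi> x \<partial>lebesgue))\<^sup>2 \<le> L2sq (\<lambda>x. g k x - G x) * L2sq \<phi>"
        using L2_Cauchy_Schwarz[OF Gd(1)[of k] test_functions_L2[OF \<phi>]] by simp
      also have "\<dots> \<le> (c * (1/4)^k) * L2sq \<phi>" by (intro mult_right_mono Gd L2sq_nonneg)
      finally show ?thesis by (simp add: mult_ac)
    qed
    then have l2: "(\<lambda>k. (\<integral>x. g k x \<bullet> \<phi> x \<partial>lebesgue)) \<longlonglongrightarrow> (\<integral>x. G x \<bullet> \<phi> x \<partial>lebesgue)"
      by (rule LIMSEQ_if_square_le_geometric)
    have "(\<integral>x. v k x * divergence \<phi> x \<partial>lebesgue) = - (\<integral>x. g k x \<bullet> \<phi> x \<partial>lebesgue)" for k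
      using D1_weak_gradient(1)[OF vD[of k]] \<phi> by (simp add: has_weak_gradient_def g_def)
    then have "(\<lambda>k. (\<integral>x. v k x * divergence \<phi> x \<partial>lebesgue)) \<longlonglongrightarrow> - (\<integral>x. G x \<bullet> \<phi> x \<partial>lebesgue)"
      using tendsto_minus[OF l2] by simp
    with l1 show "(\<integral>x. F x * divergence \<phi> x \<partial>lebesgue) = - (\<integral>x. G x \<bullet> \<phi> x \<partial>lebesgue)"
      by (rule LIMSEQ_unique)
  qed
  have FD: "F \<in> D1" by (rule D1I[OF FG GL])
  have "D1_inner (\<lambda>x. f k x - F x) (\<lambda>x. f k x - F x) \<le> c * (1/4)^k" for k
  proof -
    let ?M = "\<integral>x. \<zeta> x * f k x \<partial>lebesgue"
    \<comment> \<open>The subtracted weighted mean is a constant and leaves the seminorm unchanged,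
      so the estimate returns to the original sequence.\<close>
    have "D1_inner (\<lambda>x. f k x - F x) (\<lambda>x. f k x - F x) = D1_inner (\<lambda>x. (f k x - F x) - ?M) (\<lambda>x. (f k x - F x) - ?M)"
      by (intro D1_inner_diff_const[symmetric] D1_diff f FD)
    also have "(\<lambda>x. (f k x - F x) - ?M) = (\<lambda>x. v k x - F x)" by (auto simp: v_def)
    also have "D1_inner (\<lambda>x. v k x - F x) (\<lambda>x. v k x - F x) = L2sq (\<lambda>x. g k x - G x)"
      using has_weak_gradient_lincomb[OF D1_weak_gradient(1)[OF vD[of k]] FG, of 1 "-1"] Gd(1)
      by (intro D1_inner_self_eq) (auto simp: g_def)
    finally show ?thesis using Gd(2) by simp
  qed
  with FD that show ?thesis by blast
qed

subsection \<open>The dual of the Dirichlet space\<close>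

lemma D_neg1_lincomb:
  assumes w: "w \<in> D_neg1" and f: "f \<in> D1" and g: "g \<in> D1"
  shows "w (\<lambda>x. a * f x + b * g x) = a * w f + b * w g"
proof -
  have "w (\<lambda>x. a * f x + b * g x) = w (\<lambda>x. a * f x) + w (\<lambda>x. b * g x)"
    using w D1_scale[OF f, of a] D1_scale[OF g, of b] by (simp add: D_neg1_def)
  then show ?thesis using w f g by (simp add: D_neg1_def)
qed

lemma D_neg1_diff: "w \<in> D_neg1 \<Longrightarrow> f \<in> D1 \<Longrightarrow> g \<in> D1 \<Longrightarrow> w (\<lambda>x. f x - g x) = w f - w g"
  using D_neg1_lincomb[of w f g 1 "-1"] by simp

lemma D_neg1_minus: "w \<in> D_neg1 \<Longrightarrow> f \<in> D1 \<Longrightarrow> w (\<lambda>x. - f x) = - w f"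
  using D_neg1_lincomb[of w f f "-1" 0] by simp

lemma D_neg1_bound:
  assumes "w \<in> D_neg1" obtains C where "C \<ge> 0" "\<And>f. f \<in> D1 \<Longrightarrow> \<bar>w f\<bar> \<le> C * sqrt (D1_inner f f)"
proof -
  obtain C where C: "\<And>f. f \<in> D1 \<Longrightarrow> \<bar>w f\<bar> \<le> C * sqrt (D1_inner f f)"
    using assms unfolding D_neg1_def by blast
  have "\<bar>w f\<bar> \<le> \<bar>C\<bar> * sqrt (D1_inner f f)" if "f \<in> D1" for f
    using C[OF that] D1_inner_nonneg[of f] by (meson abs_ge_self mult_right_mono order_trans real_sqrt_ge_zero)
  then show ?thesis using that[of "\<bar>C\<bar>"] by simp
qed

lemma D_neg1_cong:
  assumes w: "w \<in> D_neg1" and f: "f \<in> D1" "g \<in> D1" and z: "D1_inner (\<lambda>x. f x - g x) (\<lambda>x. f x - g x) = 0"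
  shows "w f = w g"
proof -
  obtain C where "\<And>f. f \<in> D1 \<Longrightarrow> \<bar>w f\<bar> \<le> C * sqrt (D1_inner f f)" using D_neg1_bound[OF w] by blast
  from this[OF D1_diff[OF f]] show ?thesis using z D_neg1_diff[OF w f] by simp
qed

lemma D_neg1_eqI: "w \<in> D_neg1 \<Longrightarrow> w' \<in> D_neg1 \<Longrightarrow> (\<And>f. f \<in> D1 \<Longrightarrow> w f = w' f) \<Longrightarrow> w = w'"
  unfolding D_neg1_def by (intro ext) (metis (mono_tags, lifting) mem_Collect_eq)

lemma neg_laplacian_D_neg1:
  assumes U: "U \<in> D1" shows "neg_laplacian U \<in> D_neg1"
  unfolding D_neg1_def
proof (intro CollectI conjI ballI allI impI)
  fix f g :: "'a \<Rightarrow> real" assume f: "f \<in> D1" and g: "g \<in> D1"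
  show "neg_laplacian U (\<lambda>x. f x + g x) = neg_laplacian U f + neg_laplacian U g"
    using D1_inner_lincomb_right[OF f g U, of 1 1] f g D1_add[OF f g] by (simp add: neg_laplacian_def)
next
  fix r and f :: "'a \<Rightarrow> real" assume f: "f \<in> D1"
  show "neg_laplacian U (\<lambda>x. r * f x) = r * neg_laplacian U f"
    using D1_inner_lincomb_right[OF f f U, of r 0] f D1_scale[OF f] by (simp add: neg_laplacian_def)
next
  show "\<exists>C. \<forall>f\<in>D1. \<bar>neg_laplacian U f\<bar> \<le> C * sqrt (D1_inner f f)"
  proof (intro exI[of _ "sqrt (D1_inner U U)"] ballI)
    fix f :: "'a \<Rightarrow> real" assume f: "f \<in> D1"
    have "sqrt ((D1_inner U f)\<^sup>2) \<le> sqrt (D1_inner U U * D1_inner f f)"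
      by (intro real_sqrt_le_mono D1_Cauchy_Schwarz U f)
    then show "\<bar>neg_laplacian U f\<bar> \<le> sqrt (D1_inner U U) * sqrt (D1_inner f f)"
      using f by (simp add: neg_laplacian_def real_sqrt_mult)
  qed
qed (simp add: neg_laplacian_def)

lemma D1_parallelogram:
  assumes f: "f \<in> D1" and g: "g \<in> D1"
  shows "D1_inner (\<lambda>x. (1/2) * f x + (1/2) * g x) (\<lambda>x. (1/2) * f x + (1/2) * g x) =
     (D1_inner f f + D1_inner g g) / 2 - D1_inner (\<lambda>x. f x - g x) (\<lambda>x. f x - g x) / 4"
proof -
  have "D1_inner (\<lambda>x. f x - g x) (\<lambda>x. f x - g x) = D1_inner f f - 2 * D1_inner f g + D1_inner g g"
    using D1_inner_lincomb_self[OF f g, of 1 "-1"] by simp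
  then show ?thesis using D1_inner_lincomb_self[OF f g, of "1/2" "1/2"] by (simp add: power2_eq_square field_simps)
qed

lemma D1_inner_diff_LIMSEQ:
  assumes "\<And>k. f k \<in> D1" "F \<in> D1" "v \<in> D1"
    and le: "\<And>k. D1_inner (\<lambda>x. f k x - F x) (\<lambda>x. f k x - F x) \<le> c * (1/4)^k"
  shows "(\<lambda>k. D1_inner (f k) v) \<longlonglongrightarrow> D1_inner F v"
proof (rule LIMSEQ_if_square_le_geometric)
  fix k
  have "D1_inner (f k) v - D1_inner F v = D1_inner (\<lambda>x. f k x - F x) v"
    using D1_inner_lincomb[OF assms(1,2,3), of 1 k "-1"] by simp
  then have "(D1_inner (f k) v - D1_inner F v)\<^sup>2 \<le> D1_inner (\<lambda>x. f k x - F x) (\<lambda>x. f k x - F x) * D1_inner v v"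
    using D1_Cauchy_Schwarz[OF D1_diff[OF assms(1,2)] assms(3)] by simp
  also have "\<dots> \<le> (c * (1/4)^k) * D1_inner v v" by (intro mult_right_mono le D1_inner_nonneg)
  finally show "(D1_inner (f k) v - D1_inner F v)\<^sup>2 \<le> (c * D1_inner v v) * (1/4)^k" by (simp add: mult_ac)
qed

lemma linear_coeff_zero:
  fixes b c :: real assumes "\<And>t. 0 \<le> 2 * t * b + t\<^sup>2 * c" "0 \<le> c" shows "b = 0"
  using quadratic_form_Cauchy_Schwarz[of 0 b c] assms by simp

text \<open>The representing function minimises \<open>D1_inner f f - 2 * w f\<close>. The
  parallelogram identity supplies the midpoint condition of \<open>nested_near_minimisers\<close>,
  and the vanishing first variation is the desired equation.\<close>

lemma Riesz_D1:
  assumes w: "w \<in> D_neg1" obtains U where "U \<in> D1" "neg_laplacian U = w"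
proof -
  obtain C where C: "\<And>f. f \<in> D1 \<Longrightarrow> \<bar>w f\<bar> \<le> C * sqrt (D1_inner f f)" using D_neg1_bound[OF w] by blast
  define Q where "Q f = D1_inner f f - 2 * w f" for f
  define N where "N f g = D1_inner (\<lambda>x. f x - g x) (\<lambda>x. f x - g x) / 4" for f g :: "'a \<Rightarrow> real"
  obtain x where x: "\<And>k::nat. x k \<in> D1" "\<And>k l. k \<le> l \<Longrightarrow> N (x k) (x l) \<le> (1/4)^k"
      "\<And>k z. (\<And>j::nat. D1 = (D1 :: ('a \<Rightarrow> real) set)) \<Longrightarrow> z \<in> D1 \<Longrightarrow> Q (x k) \<le> Q z + (1/4)^k"
  proof (rule nested_near_minimisers[where C="\<lambda>_. D1" and Q=Q and N=N and b="- C\<^sup>2" and B=0])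
    show "- C\<^sup>2 \<le> Q f" if "f \<in> D1" for f
    proof -
      \<comment> \<open>Completing the square bounds the functional below by -C^2, with C a bound
        for the norm of \<open>w\<close>.\<close>
      have "0 \<le> (sqrt (D1_inner f f) - C)\<^sup>2" by simp
      then have "2 * (C * sqrt (D1_inner f f)) \<le> D1_inner f f + C\<^sup>2"
        using D1_inner_nonneg[of f] by (simp add: power2_diff mult_ac)
      then show ?thesis using C[OF that] unfolding Q_def by linarith
    qed
    have "w (\<lambda>x. 0) = 0" using D_neg1_lincomb[OF w D1_const D1_const, of 0 0 0 0] by simp
    moreover have "D1_inner (\<lambda>x::'a. 0) (\<lambda>x. 0) = 0"
      using D1_inner_lincomb_self[OF D1_const D1_const, of 0 0 0 0] by simp
    ultimately show "\<exists>x\<in>D1. Q x \<le> 0"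
      by (intro bexI[OF _ D1_const[of 0]]) (simp add: Q_def)
    show "\<exists>z\<in>D1. Q z \<le> (Q f + Q g) / 2 - N f g" if "f \<in> D1" "g \<in> D1" for f g
      using D1_parallelogram[OF that] D_neg1_lincomb[OF w that, of "1/2" "1/2"]
      by (intro bexI[OF _ D1_lincomb[OF that, of "1/2" "1/2"]]) (simp add: Q_def N_def field_simps)
  qed (use D1_const that in auto)
  obtain U where U: "U \<in> D1" "\<And>k. D1_inner (\<lambda>y. x k y - U y) (\<lambda>y. x k y - U y) \<le> 4 * (1/4)^k"
  proof (rule D1_complete[where f=x and c=4, OF x(1)])
    show "D1_inner (\<lambda>y. x k y - x l y) (\<lambda>y. x k y - x l y) \<le> 4 * (1/4)^k" if "k \<le> l" for k l
      using x(2)[OF that] by (simp add: N_def)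
  qed (use that in auto)
  have "neg_laplacian U = w"
  proof (rule D_neg1_eqI[OF neg_laplacian_D_neg1[OF U(1)] w])
    fix v :: "'a \<Rightarrow> real" assume v: "v \<in> D1"
    \<comment> \<open>Comparing \<open>x k\<close> with x k + t v costs an error (1/4)^k; the limit
      is taken in this inequality instead of evaluating the functional at \<open>U\<close>.\<close>
    have "0 \<le> 2 * t * (D1_inner U v - w v) + t\<^sup>2 * D1_inner v v" for t
    proof (rule LIMSEQ_le_const)
      have "(\<lambda>k. 2 * t * (D1_inner (x k) v - w v) + t\<^sup>2 * D1_inner v v + (1/4)^k)
          \<longlonglongrightarrow> 2 * t * (D1_inner U v - w v) + t\<^sup>2 * D1_inner v v + 0"
        by (intro tendsto_intros D1_inner_diff_LIMSEQ[OF x(1) U(1) v U(2)] LIMSEQ_power_zero) simp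
      then show "(\<lambda>k. 2 * t * (D1_inner (x k) v - w v) + t\<^sup>2 * D1_inner v v + (1/4)^k)
          \<longlonglongrightarrow> 2 * t * (D1_inner U v - w v) + t\<^sup>2 * D1_inner v v" by simp
      have "0 \<le> 2 * t * (D1_inner (x k) v - w v) + t\<^sup>2 * D1_inner v v + (1/4)^k" for k
        using x(3)[OF refl D1_lincomb[OF x(1) v, of 1 k t], of k]
          D1_inner_lincomb_self[OF x(1) v, of 1 k t] D_neg1_lincomb[OF w x(1) v, of 1 k t]
        by (simp add: Q_def algebra_simps)
      then show "\<exists>N. \<forall>k\<ge>N. 0 \<le> 2 * t * (D1_inner (x k) v - w v) + t\<^sup>2 * D1_inner v v + (1/4)^k" by blast
    qed
    from linear_coeff_zero[OF this D1_inner_nonneg] show "neg_laplacian U v = w v"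
      using v by (simp add: neg_laplacian_def)
  qed
  with U(1) that show ?thesis by blast
qed

subsection \<open>Weak convergence\<close>

lemma L2_inner_LIMSEQ:
  fixes f :: "nat \<Rightarrow> 'a::euclidean_space \<Rightarrow> 'b::euclidean_space"
  assumes "\<And>k. f k \<in> L2" "F \<in> L2" "g \<in> L2" and le: "\<And>k. L2sq (\<lambda>x. f k x - F x) \<le> c * (1/4)^k"
  shows "(\<lambda>k. \<integral>x. f k x \<bullet> g x \<partial>lebesgue) \<longlonglongrightarrow> (\<integral>x. F x \<bullet> g x \<partial>lebesgue)"
proof (rule LIMSEQ_if_square_le_geometric)
  fix k
  have "(\<integral>x. f k x \<bullet> g x \<partial>lebesgue) - (\<integral>x. F x \<bullet> g x \<partial>lebesgue) = (\<integral>x. (f k x - F x) \<bullet> g x \<partial>lebesgue)"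
    using L2_inner_integrable[OF assms(1)[of k] assms(3)] L2_inner_integrable[OF assms(2,3)]
    by (simp add: inner_diff_left)
  then have "((\<integral>x. f k x \<bullet> g x \<partial>lebesgue) - (\<integral>x. F x \<bullet> g x \<partial>lebesgue))\<^sup>2 \<le> L2sq (\<lambda>x. f k x - F x) * L2sq g"
    using L2_Cauchy_Schwarz[OF L2_diff(1)[OF assms(1,2)] assms(3)] by simp
  also have "\<dots> \<le> (c * (1/4)^k) * L2sq g" by (intro mult_right_mono le L2sq_nonneg)
  finally show "((\<integral>x. f k x \<bullet> g x \<partial>lebesgue) - (\<integral>x. F x \<bullet> g x \<partial>lebesgue))\<^sup>2 \<le> (c * L2sq g) * (1/4)^k"
    by (simp add: mult_ac)
qed

text \<open>The orthogonal complement of the test functions in \<open>L\<^sup>2\<close> is trivial by the fundamental lemma.\<close>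

lemma test_functions_dense_L2:
  fixes A :: "'a::euclidean_space \<Rightarrow> 'b::euclidean_space"
  assumes A: "A \<in> L2" and e: "e > 0"
  obtains \<phi> where "\<phi> \<in> test_functions" "L2sq (\<lambda>x. A x - \<phi> x) < e"
proof -
  define Q where "Q \<phi> = L2sq (\<lambda>x. A x - \<phi> x)" for \<phi>
  define N where "N f g = L2sq (\<lambda>x. f x - g x) / 4" for f g :: "'a \<Rightarrow> 'b"
  note tL = test_functions_L2
  obtain x where x: "\<And>k::nat. x k \<in> test_functions" "\<And>k l. k \<le> l \<Longrightarrow> N (x k) (x l) \<le> (1/4)^k"
      "\<And>k z. (\<And>j::nat. test_functions = (test_functions :: ('a \<Rightarrow> 'b) set)) \<Longrightarrow> z \<in> test_functions \<Longrightarrow> Q (x k) \<le> Q z + (1/4)^k"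
  proof (rule nested_near_minimisers[where C="\<lambda>_. test_functions" and Q=Q and N=N and b="0" and B="Q (\<lambda>x. 0)"])
    show "\<exists>z\<in>test_functions. Q z \<le> (Q f + Q g) / 2 - N f g"
      if f: "f \<in> test_functions" and g: "g \<in> test_functions" for f g
    proof (rule bexI)
      let ?z = "\<lambda>x. (1/2) *\<^sub>R f x + (1/2) *\<^sub>R g x"
      show "?z \<in> test_functions"
        by (intro test_functions_add test_functions_linear[OF bounded_linear_scaleR_right] f g)
      have a: "(\<lambda>x. A x - f x) \<in> L2" and b: "(\<lambda>x. A x - g x) \<in> L2"
        by (intro L2_diff A tL f g)+
      have "A x - ?z x = (1/2) *\<^sub>R ((A x - f x) + 1 *\<^sub>R (A x - g x))" for x
        by (simp add: algebra_simps) (simp flip: scaleR_left_distrib)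
      then have "Q ?z = (1/2)\<^sup>2 * L2sq (\<lambda>x. (A x - f x) + 1 *\<^sub>R (A x - g x))"
        unfolding Q_def using L2_scaleR(2)[OF L2_add_scaleR(1)[OF a b, of 1], of "1/2"] by simp
      also have "\<dots> = (1/4) * (Q f + 2 * (\<integral>x. (A x - f x) \<bullet> (A x - g x) \<partial>lebesgue) + Q g)"
        unfolding L2_add_scaleR(2)[OF a b, of 1] Q_def by (simp add: power2_eq_square)
      finally have z: "Q ?z = (1/4) * (Q f + 2 * (\<integral>x. (A x - f x) \<bullet> (A x - g x) \<partial>lebesgue) + Q g)" .
      have "L2sq (\<lambda>x. g x - f x) = Q f - 2 * (\<integral>x. (A x - f x) \<bullet> (A x - g x) \<partial>lebesgue) + Q g"
        using L2_diff(2)[OF a b] by (simp add: Q_def)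
      moreover have "L2sq (\<lambda>x. g x - f x) = L2sq (\<lambda>x. f x - g x)"
        by (simp add: L2sq_def norm_minus_commute)
      ultimately show "Q ?z \<le> (Q f + Q g) / 2 - N f g" by (simp add: z N_def field_simps)
    qed
    show "\<exists>x\<in>test_functions. Q x \<le> Q (\<lambda>x. 0)" using test_functions_0 by blast
    show "0 \<le> Q f" for f by (simp add: Q_def L2sq_nonneg)
  qed (use test_functions_0 that in auto)
  have xL: "x k \<in> L2" for k by (rule tL[OF x(1)])
  obtain F where F: "F \<in> L2" "\<And>k. L2sq (\<lambda>y. x k y - F y) \<le> 4 * (1/4)^k"
  proof (rule L2_complete[where f=x and c=4, OF xL])
    show "L2sq (\<lambda>y. x k y - x l y) \<le> 4 * (1/4)^k" if "k \<le> l" for k l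
      using x(2)[OF that] by (simp add: N_def)
  qed (use that in auto)
  have AF: "(\<lambda>y. A y - F y) \<in> L2" by (rule L2_diff(1)[OF A F(1)])
  \<comment> \<open>\<open>F\<close> is the point closest to \<open>A\<close> in the closure of the
    test functions, so the first variation makes A - F orthogonal to all of them.\<close>
  have "AE y in lebesgue. A y - F y = 0"
  proof (rule fundamental_lemma_field[OF L2_L1_loc[OF AF]])
    fix \<phi> :: "'a \<Rightarrow> 'b" assume \<phi>: "\<phi> \<in> test_functions"
    let ?I = "\<lambda>f. \<integral>y. f y \<bullet> \<phi> y \<partial>lebesgue"
    have IA: "?I (\<lambda>y. A y - f y) = ?I A - ?I f" if "f \<in> L2" for f
      using L2_inner_integrable[OF A tL[OF \<phi>]] L2_inner_integrable[OF that tL[OF \<phi>]] by (simp add: inner_diff_left)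
    have lim: "(\<lambda>k. ?I (x k)) \<longlonglongrightarrow> ?I F"
      by (rule L2_inner_LIMSEQ[OF xL F(1) tL[OF \<phi>] F(2)])
    have "0 \<le> 2 * t * (- ?I (\<lambda>y. A y - F y)) + t\<^sup>2 * L2sq \<phi>" for t
    proof (rule LIMSEQ_le_const)
      have "(\<lambda>k. 2 * t * (?I (x k) - ?I A) + t\<^sup>2 * L2sq \<phi> + (1/4)^k) \<longlonglongrightarrow> 2 * t * (?I F - ?I A) + t\<^sup>2 * L2sq \<phi> + 0"
        by (intro tendsto_intros lim LIMSEQ_power_zero) simp
      then show "(\<lambda>k. 2 * t * (?I (x k) - ?I A) + t\<^sup>2 * L2sq \<phi> + (1/4)^k) \<longlonglongrightarrow> 2 * t * (- ?I (\<lambda>y. A y - F y)) + t\<^sup>2 * L2sq \<phi>"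
        by (simp add: IA[OF F(1)])
      have "0 \<le> 2 * t * (?I (x k) - ?I A) + t\<^sup>2 * L2sq \<phi> + (1/4)^k" for k
      proof -
        have "(\<lambda>y. x k y + t *\<^sub>R \<phi> y) \<in> test_functions"
          by (intro test_functions_add test_functions_linear[OF bounded_linear_scaleR_right] x(1) \<phi>)
        from x(3)[OF refl this, of k]
        have "Q (x k) \<le> Q (\<lambda>y. x k y + t *\<^sub>R \<phi> y) + (1/4)^k" .
        moreover have "Q (\<lambda>y. x k y + t *\<^sub>R \<phi> y) = Q (x k) - 2 * t * ?I (\<lambda>y. A y - x k y) + t\<^sup>2 * L2sq \<phi>"
          using L2_add_scaleR(2)[OF L2_diff(1)[OF A xL] tL[OF \<phi>], of k "- t"] by (simp add: Q_def algebra_simps)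
        ultimately show ?thesis unfolding IA[OF xL] by (simp add: algebra_simps)
      qed
      then show "\<exists>N. \<forall>k\<ge>N. 0 \<le> 2 * t * (?I (x k) - ?I A) + t\<^sup>2 * L2sq \<phi> + (1/4)^k" by blast
    qed
    from linear_coeff_zero[OF this L2sq_nonneg] show "?I (\<lambda>y. A y - F y) = 0" by simp
  qed
  then have AE: "AE y in lebesgue. x k y - F y = x k y - A y" for k by eventually_elim simp
  have "L2sq (\<lambda>y. A y - x k y) \<le> 4 * (1/4)^k" for k
  proof -
    have "L2sq (\<lambda>y. x k y - A y) = L2sq (\<lambda>y. x k y - F y)"
      using L2_diff(1)[OF xL A] by (intro L2_cong_AE(2)[OF L2_diff(1)[OF xL F(1)] _ AE]) (simp add: L2_def)
    then show ?thesis using F(2)[of k] by (simp add: L2sq_def norm_minus_commute)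
  qed
  moreover have "(\<lambda>k. 4 * (1/4::real)^k) \<longlonglongrightarrow> 0"
    by (intro tendsto_mult_right_zero LIMSEQ_power_zero) simp
  then obtain k where "4 * (1/4::real)^k < e"
    using order_tendstoD(2)[of "\<lambda>k. 4 * (1/4::real)^k" 0 sequentially e] e by (auto dest: eventually_happens)
  ultimately have "L2sq (\<lambda>y. A y - x k y) < e" by (meson le_less_trans)
  with x(1) that show ?thesis by blast
qed

text \<open>The uniform bound reduces weak convergence to a dense set of test fields. The number K
  bounds the squared norm of the other factor, which is why \<open>A\<close> is approximated up to
  (e/2)^2 / K.\<close>

lemma L2_weak_convergence:
  fixes B :: "nat \<Rightarrow> 'a::euclidean_space \<Rightarrow> 'b::euclidean_space"
  assumes B: "\<And>k. B k \<in> L2" "\<And>k. L2sq (B k) \<le> M" and F: "F \<in> L2" and A: "A \<in> L2"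
    and lim: "\<And>\<phi>. \<phi> \<in> test_functions \<Longrightarrow> (\<lambda>k. \<integral>x. B k x \<bullet> \<phi> x \<partial>lebesgue) \<longlonglongrightarrow> (\<integral>x. F x \<bullet> \<phi> x \<partial>lebesgue)"
  shows "(\<lambda>k. \<integral>x. A x \<bullet> B k x \<partial>lebesgue) \<longlonglongrightarrow> (\<integral>x. A x \<bullet> F x \<partial>lebesgue)"
proof (rule LIMSEQ_I)
  fix e :: real assume e: "e > 0"
  define K where "K = 2 * M + 2 * L2sq F + 1"
  have M: "0 \<le> M" using B(2)[of 0] L2sq_nonneg[of "B 0"] by linarith
  have K: "K > 0" using M L2sq_nonneg[of F] by (simp add: K_def)
  obtain \<phi> where \<phi>: "\<phi> \<in> test_functions" "L2sq (\<lambda>x. A x - \<phi> x) < (e/2)\<^sup>2 / K"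
    using test_functions_dense_L2[OF A, of "(e/2)\<^sup>2 / K"] e K by auto
  note \<phi>L = test_functions_L2[OF \<phi>(1)]
  obtain n where n: "\<And>k. k \<ge> n \<Longrightarrow> \<bar>(\<integral>x. B k x \<bullet> \<phi> x \<partial>lebesgue) - (\<integral>x. F x \<bullet> \<phi> x \<partial>lebesgue)\<bar> < e/2"
    using LIMSEQ_D[OF lim[OF \<phi>(1)], of "e/2"] e by auto
  have "norm ((\<integral>x. A x \<bullet> B k x \<partial>lebesgue) - (\<integral>x. A x \<bullet> F x \<partial>lebesgue)) < e" if "k \<ge> n" for k
  proof -
    have d: "(\<lambda>x. B k x - F x) \<in> L2" by (rule L2_diff(1)[OF B(1) F])
    have dK: "L2sq (\<lambda>x. B k x - F x) \<le> K"
      using L2_add(2)[OF B(1) L2_scaleR(1)[OF F], of k "-1"] L2_scaleR(2)[OF F, of "-1"] B(2)[of k]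
      by (simp add: K_def)
    let ?J = "\<integral>x. (A x - \<phi> x) \<bullet> (B k x - F x) \<partial>lebesgue"
    have "?J\<^sup>2 \<le> L2sq (\<lambda>x. A x - \<phi> x) * L2sq (\<lambda>x. B k x - F x)"
      by (rule L2_Cauchy_Schwarz[OF L2_diff(1)[OF A \<phi>L] d])
    also have "\<dots> \<le> L2sq (\<lambda>x. A x - \<phi> x) * K" by (intro mult_left_mono dK L2sq_nonneg)
    also have "\<dots> < (e/2)\<^sup>2" using \<phi>(2) K by (simp add: pos_less_divide_eq)
    finally have "\<bar>?J\<bar>\<^sup>2 < (e/2)\<^sup>2" by simp
    then have "\<bar>?J\<bar> < e/2" using e by (intro power2_less_imp_less[of "\<bar>?J\<bar>" "e/2"]) auto
    moreover have "(\<integral>x. A x \<bullet> B k x \<partial>lebesgue) - (\<integral>x. A x \<bullet> F x \<partial>lebesgue) =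
        ?J + ((\<integral>x. B k x \<bullet> \<phi> x \<partial>lebesgue) - (\<integral>x. F x \<bullet> \<phi> x \<partial>lebesgue))"
      using L2_inner_integrable[OF A B(1)[of k]] L2_inner_integrable[OF A F]
        L2_inner_integrable[OF \<phi>L B(1)[of k]] L2_inner_integrable[OF \<phi>L F]
      by (simp add: inner_diff_left inner_diff_right inner_commute[of "B k _"] inner_commute[of "F _"])
    ultimately show ?thesis using n[OF that] by (simp add: abs_if split: if_splits)
  qed
  then show "\<exists>n. \<forall>k\<ge>n. norm ((\<integral>x. A x \<bullet> B k x \<partial>lebesgue) - (\<integral>x. A x \<bullet> F x \<partial>lebesgue)) < e" by blast
qed

text \<open>By Riesz, \<open>w\<close> is integration against the gradient of some \<open>U\<close>.
  Distributional convergence gives convergence of the gradients against test fields, by the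
  definition of the weak gradient, and the energy bound extends it to the gradient of
  \<open>U\<close>.\<close>

lemma D_neg1_weak_convergence:
  fixes f :: "nat \<Rightarrow> 'a::euclidean_space \<Rightarrow> real"
  assumes w: "w \<in> D_neg1" and f: "\<And>k. f k \<in> D1" "\<And>k. D1_inner (f k) (f k) \<le> M" and F: "F \<in> D1"
    and lim: "\<And>\<eta>. \<eta> \<in> test_functions \<Longrightarrow> (\<lambda>k. \<integral>x. f k x * \<eta> x \<partial>lebesgue) \<longlonglongrightarrow> (\<integral>x. F x * \<eta> x \<partial>lebesgue)"
  shows "(\<lambda>k. w (f k)) \<longlonglongrightarrow> w F"
proof -
  obtain U where U: "U \<in> D1" "neg_laplacian U = w" using Riesz_D1[OF w] by blast
  have "(\<lambda>k. \<integral>x. weak_gradient U x \<bullet> weak_gradient (f k) x \<partial>lebesgue) \<longlonglongrightarrow>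
      (\<integral>x. weak_gradient U x \<bullet> weak_gradient F x \<partial>lebesgue)"
  proof (rule L2_weak_convergence)
    show "weak_gradient (f k) \<in> L2" "L2sq (weak_gradient (f k)) \<le> M" for k
      using D1_weak_gradient(2)[OF f(1)] f(2)[of k] by (simp_all add: D1_inner_self)
    show "weak_gradient F \<in> L2" "weak_gradient U \<in> L2" using D1_weak_gradient F U by blast+
    fix \<phi> :: "'a \<Rightarrow> 'a" assume \<phi>: "\<phi> \<in> test_functions"
    have "(\<integral>x. weak_gradient u x \<bullet> \<phi> x \<partial>lebesgue) = - (\<integral>x. u x * divergence \<phi> x \<partial>lebesgue)" if "u \<in> D1" for u
      using D1_weak_gradient(1)[OF that] \<phi> by (simp add: has_weak_gradient_def)
    then show "(\<lambda>k. \<integral>x. weak_gradient (f k) x \<bullet> \<phi> x \<partial>lebesgue) \<longlonglongrightarrow> (\<integral>x. weak_gradient F x \<bullet> \<phi> x \<partial>lebesgue)"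
      using f(1) F tendsto_minus[OF lim[OF divergence_test_functions[OF \<phi>]]] by simp
  qed
  then show ?thesis using U f(1) F by (auto simp: neg_laplacian_def D1_inner_def)
qed

lemma L2_compact_mean_zero_D_neg1:
  fixes g :: "'a::euclidean_space \<Rightarrow> real"
  assumes g: "g \<in> L2" "compact_support g" "(\<integral>x. g x \<partial>lebesgue) = 0"
  shows "(\<lambda>f. if f \<in> D1 then \<integral>x. g x * f x \<partial>lebesgue else 0) \<in> D_neg1"
proof -
  note i = L2_compact_D1_integrable(1)[OF g(1,2)]
  obtain C where "\<And>f. f \<in> D1 \<Longrightarrow> \<bar>\<integral>x. g x * f x \<partial>lebesgue\<bar> \<le> C * sqrt (D1_inner f f)"
    using L2_compact_mean_zero_bound[OF g] by blast
  then show ?thesis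
    unfolding D_neg1_def
    by (auto simp: D1_add D1_scale distrib_left i mult.left_commute intro!: exI[of _ C])
qed

lemma L2_compact_diff:
  assumes "f \<in> L2" "compact_support f" "g \<in> L2" "compact_support g"
  shows "(\<lambda>x. f x - c *\<^sub>R g x) \<in> L2" "compact_support (\<lambda>x. f x - c *\<^sub>R g x)"
proof -
  show "(\<lambda>x. f x - c *\<^sub>R g x) \<in> L2" using L2_add_scaleR(1)[OF assms(1,3), of "- c"] by simp
  obtain K L where K: "compact K" "AE x in lebesgue. x \<notin> K \<longrightarrow> f x = 0" and L: "compact L" "AE x in lebesgue. x \<notin> L \<longrightarrow> g x = 0"
    using assms by (auto simp: compact_support_def)
  have "AE x in lebesgue. x \<notin> K \<union> L \<longrightarrow> f x - c *\<^sub>R g x = 0"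
    using K(2) L(2) by eventually_elim auto
  with K(1) L(1) show "compact_support (\<lambda>x. f x - c *\<^sub>R g x)"
    unfolding compact_support_def by blast
qed

text \<open>Subtracting a multiple of a test function reduces the pairing with \<open>\<psi>\<close> to an element of \<open>D\<^sup>-\<^sup>1\<close>.\<close>

lemma E_neg1_weak_convergence:
  fixes f :: "nat \<Rightarrow> 'a::euclidean_space \<Rightarrow> real"
  assumes \<psi>: "\<psi> \<in> L2" "compact_support \<psi>" and w: "w \<in> D_neg1"
    and f: "\<And>k. f k \<in> D1" "\<And>k. D1_inner (f k) (f k) \<le> M" and F: "F \<in> D1"
    and lim: "\<And>\<eta>. \<eta> \<in> test_functions \<Longrightarrow> (\<lambda>k. \<integral>x. f k x * \<eta> x \<partial>lebesgue) \<longlonglongrightarrow> (\<integral>x. F x * \<eta> x \<partial>lebesgue)"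
  shows "(\<lambda>k. E_sum \<psi> w c (f k)) \<longlonglongrightarrow> E_sum \<psi> w c F"
proof -
  obtain \<zeta> :: "'a \<Rightarrow> real" where \<zeta>: "\<zeta> \<in> test_functions" "(\<integral>x. \<zeta> x \<partial>lebesgue) = 1"
    using unit_mass_test_function by metis
  note \<zeta>L = test_functions_L2[OF \<zeta>(1)] test_functions_compact_support[OF \<zeta>(1)]
  let ?m = "\<integral>x. \<psi> x \<partial>lebesgue"
  let ?g = "\<lambda>x. \<psi> x - ?m *\<^sub>R \<zeta> x"
  let ?W = "\<lambda>f. if f \<in> D1 then \<integral>x. ?g x * f x \<partial>lebesgue else 0"
  have i\<psi>: "integrable lebesgue (\<lambda>x. \<psi> x * h x)" and i\<zeta>: "integrable lebesgue (\<lambda>x. \<zeta> x * h x)" if "h \<in> D1" for h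
    using L2_compact_D1_integrable(1) \<psi> \<zeta>L that by blast+
  have "integrable lebesgue \<psi>" "integrable lebesgue \<zeta>" using i\<psi>[OF D1_const[of 1]] i\<zeta>[OF D1_const[of 1]] by simp_all
  then have "(\<integral>x. ?g x \<partial>lebesgue) = 0" using \<zeta>(2) by simp
  from L2_compact_mean_zero_D_neg1[OF L2_compact_diff[OF \<psi> \<zeta>L] this]
  have W: "?W \<in> D_neg1" .
  have eq: "(\<integral>x. \<psi> x * h x \<partial>lebesgue) = ?W h + ?m * (\<integral>x. h x * \<zeta> x \<partial>lebesgue)" if "h \<in> D1" for h
    using that i\<psi>[OF that] i\<zeta>[OF that] by (simp add: left_diff_distrib mult.assoc mult.commute[of "h _"])
  have "(\<lambda>k. w (f k) + c * (?W (f k) + ?m * (\<integral>x. f k x * \<zeta> x \<partial>lebesgue)))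
      \<longlonglongrightarrow> w F + c * (?W F + ?m * (\<integral>x. F x * \<zeta> x \<partial>lebesgue))"
    by (intro tendsto_add tendsto_mult_left lim \<zeta>(1) D_neg1_weak_convergence[OF w f F lim]
        D_neg1_weak_convergence[OF W f F lim])
  then show ?thesis using f(1) F by (simp only: E_sum_def if_True eq)
qed

subsection \<open>Mollification\<close>

lemma lborel_integral_affine:
  fixes f :: "'a::euclidean_space \<Rightarrow> 'b::{banach, second_countable_topology}"
  assumes c: "c \<noteq> 0" and [measurable]: "f \<in> borel_measurable borel"
  shows "(\<integral>x. f x \<partial>lborel) = \<bar>c\<bar> ^ DIM('a) *\<^sub>R (\<integral>x. f (t + c *\<^sub>R x) \<partial>lborel)"
proof -
  have "(\<integral>x. f x \<partial>lborel) = (\<integral>x. f x \<partial>density (distr lborel borel (\<lambda>x. t + c *\<^sub>R x)) (\<lambda>_. ennreal (\<bar>c\<bar> ^ DIM('a))))"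
    by (subst lborel_affine[OF c, of t]) (rule refl)
  also have "\<dots> = (\<integral>x. \<bar>c\<bar> ^ DIM('a) *\<^sub>R f x \<partial>distr lborel borel (\<lambda>x. t + c *\<^sub>R x))"
    by (subst integral_density) auto
  also have "\<dots> = (\<integral>x. \<bar>c\<bar> ^ DIM('a) *\<^sub>R f (t + c *\<^sub>R x) \<partial>lborel)"
    by (subst integral_distr) auto
  finally show ?thesis by simp
qed

lemma lborel_integral_reflect:
  fixes f :: "'a::euclidean_space \<Rightarrow> 'b::{banach, second_countable_topology}"
  assumes "f \<in> borel_measurable borel" shows "(\<integral>s. f (x - s) \<partial>lborel) = (\<integral>s. f s \<partial>lborel)"
  using lborel_integral_affine[of "-1" f x] assms by simp

text \<open>The shape is that of \<open>has_derivative_convolution\<close> with \<open>T\<close> the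
  identity, so smoothness and derivatives come from there. The integral is over
  \<open>lebesgue\<close> because \<open>g\<close> may be merely Lebesgue measurable.\<close>

definition conv :: "('a::euclidean_space \<Rightarrow> real) \<Rightarrow> ('a \<Rightarrow> 'b::euclidean_space) \<Rightarrow> 'a \<Rightarrow> 'b" where
  "conv \<rho> g x = (\<integral>s. \<rho> (x - s) *\<^sub>R g s \<partial>lebesgue)"

lemma conv_eq: "conv \<rho> g = (\<lambda>x. \<integral>s. \<rho> (x - s) *\<^sub>R g s \<partial>lebesgue)"
  by (rule ext) (simp add: conv_def)

lemma id_measurable_lebesgue: "(\<lambda>s. s) \<in> borel_measurable lebesgue"
  by (intro borel_measurable_lebesgueI) simp

lemma conv_test_functions:
  assumes "\<rho> \<in> test_functions" "integrable lebesgue g" "\<And>s. norm s > R \<Longrightarrow> g s = 0"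
  shows "conv \<rho> g \<in> test_functions"
  unfolding conv_eq by (rule test_functions_convolution[OF assms(1,2) id_measurable_lebesgue assms(3)])

lemma conv_integrable:
  fixes \<rho> :: "'a::euclidean_space \<Rightarrow> real" and g :: "'a \<Rightarrow> 'b::euclidean_space"
  assumes "\<rho> \<in> test_functions" "integrable lebesgue g"
  shows "integrable lebesgue (\<lambda>s. \<rho> (x - s) *\<^sub>R g s)"
  by (rule integrable_convolution[OF assms id_measurable_lebesgue])

lemma frechet_derivative_conv:
  assumes "\<rho> \<in> test_functions" "integrable lebesgue g"
  shows "frechet_derivative (conv \<rho> g) (at x) h = conv (\<lambda>z. frechet_derivative \<rho> (at z) h) g x"
  unfolding conv_eq by (subst frechet_derivative_convolution[OF assms id_measurable_lebesgue]) (rule refl)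

lemma conv_borel:
  fixes g :: "'a::euclidean_space \<Rightarrow> 'b::euclidean_space"
  assumes \<rho>: "\<rho> \<in> borel_measurable borel" and g: "g \<in> borel_measurable lebesgue"
    and g0: "g0 \<in> borel_measurable borel" "AE x in lebesgue. g x = g0 x"
  shows "conv \<rho> g x = (\<integral>s. \<rho> (x - s) *\<^sub>R g0 s \<partial>lborel)" "conv \<rho> g x = (\<integral>s. \<rho> s *\<^sub>R g0 (x - s) \<partial>lborel)"
proof -
  note [measurable] = \<rho> g0(1)
  have "conv \<rho> g x = (\<integral>s. \<rho> (x - s) *\<^sub>R g0 s \<partial>lebesgue)"
    unfolding conv_def
  proof (rule integral_cong_AE)
    have "(\<lambda>s. \<rho> (x - s)) \<in> borel_measurable lebesgue" by (intro borel_measurable_lebesgueI) measurable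
    then show "(\<lambda>s. \<rho> (x - s) *\<^sub>R g s) \<in> borel_measurable lebesgue" using g by (rule borel_measurable_scaleR)
    show "(\<lambda>s. \<rho> (x - s) *\<^sub>R g0 s) \<in> borel_measurable lebesgue" by (intro borel_measurable_lebesgueI) measurable
    show "AE s in lebesgue. \<rho> (x - s) *\<^sub>R g s = \<rho> (x - s) *\<^sub>R g0 s" using g0(2) by eventually_elim simp
  qed
  then show *: "conv \<rho> g x = (\<integral>s. \<rho> (x - s) *\<^sub>R g0 s \<partial>lborel)" by (simp add: integral_lebesgue_lborel)
  show "conv \<rho> g x = (\<integral>s. \<rho> s *\<^sub>R g0 (x - s) \<partial>lborel)"
    unfolding * using lborel_integral_reflect[of "\<lambda>s. \<rho> s *\<^sub>R g0 (x - s)" x] by simp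
qed

lemma conv_L2:
  fixes g :: "'a::euclidean_space \<Rightarrow> 'b::euclidean_space"
  assumes \<rho>: "\<rho> \<in> test_functions" and g: "g \<in> L2"
  shows "conv \<rho> g \<in> L2" "L2sq (conv \<rho> g) \<le> (\<integral>x. \<bar>\<rho> x\<bar> \<partial>lborel)\<^sup>2 * L2sq g"
proof -
  have gm: "g \<in> borel_measurable lebesgue" using g by (simp add: L2_def)
  obtain g0 where g0: "g0 \<in> borel_measurable borel" "AE x in lebesgue. g x = g0 x"
    using borel_representative[OF gm] by blast
  note [measurable] = g0(1) test_functions_measurable[OF \<rho>]
  have eq: "conv \<rho> g = (\<lambda>x. \<integral>s. \<rho> s *\<^sub>R g0 (x - s) \<partial>lborel)"
    by (rule ext) (rule conv_borel(2)[OF test_functions_measurable[OF \<rho>] gm g0])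
  have m: "conv \<rho> g \<in> borel_measurable borel" unfolding eq by measurable
  have g02: "g0 \<in> L2" "L2sq g0 = L2sq g" using L2_cong_AE[OF g borel_measurable_lebesgueI[OF g0(1)] g0(2)] by auto
  have "(\<integral>\<^sup>+x. ennreal ((norm (conv \<rho> g x))\<^sup>2) \<partial>lborel)
      \<le> ennreal ((\<integral>x. \<bar>\<rho> x\<bar> \<partial>lborel)\<^sup>2) * (\<integral>\<^sup>+x. ennreal ((norm (g0 x))\<^sup>2) \<partial>lborel)"
    unfolding eq by (rule Young_L2[OF sigma_finite_lborel test_functions_integrable[OF \<rho>]]) measurable
  also have "(\<integral>\<^sup>+x. ennreal ((norm (g0 x))\<^sup>2) \<partial>lborel) = ennreal (L2sq g)"
    using L2_nn_integral[OF g02(1)] by (simp add: nn_integral_completion g02(2))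
  finally have le: "(\<integral>\<^sup>+x. ennreal ((norm (conv \<rho> g x))\<^sup>2) \<partial>lebesgue) \<le> ennreal ((\<integral>x. \<bar>\<rho> x\<bar> \<partial>lborel)\<^sup>2 * L2sq g)"
    by (simp add: nn_integral_completion ennreal_mult L2sq_nonneg)
  show "conv \<rho> g \<in> L2" "L2sq (conv \<rho> g) \<le> (\<integral>x. \<bar>\<rho> x\<bar> \<partial>lborel)\<^sup>2 * L2sq g"
    using L2I[OF borel_measurable_lebesgueI[OF m] le] by (simp_all add: L2sq_nonneg)
qed

lemma reflected_test_function:
  assumes "\<rho> \<in> test_functions"
  shows "(\<lambda>s. \<rho> (x - s)) \<in> test_functions"
    "frechet_derivative (\<lambda>s. \<rho> (x - s)) (at s) h = - frechet_derivative \<rho> (at (x - s)) h"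
proof -
  obtain R where R: "R > 0" "\<And>y. norm y > R \<Longrightarrow> \<rho> y = 0" using test_functions_support[OF assms] by blast
  have "C_k k (\<lambda>s. \<rho> (x - s))" for k
    using C_k_affine[OF bounded_linear_minus[OF bounded_linear_ident], of k \<rho> x] assms
    by (simp add: test_functions_iff)
  moreover have "{s. \<rho> (x - s) \<noteq> 0} \<subseteq> cball x R"
    using R(2) by (force simp: dist_norm)
  ultimately show "(\<lambda>s. \<rho> (x - s)) \<in> test_functions"
    unfolding test_functions_iff using bounded_subset[OF bounded_cball] by blast
  have "((\<lambda>s. x - s) has_derivative (\<lambda>h. - h)) (at s)" by (auto intro!: derivative_eq_intros)
  from has_derivative_compose[OF this test_functions_differentiable[OF assms]]
  have "frechet_derivative (\<lambda>s. \<rho> (x - s)) (at s) = (\<lambda>h. frechet_derivative \<rho> (at (x - s)) (- h))"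
    by (rule frechet_derivative_at[symmetric])
  moreover have "linear (frechet_derivative \<rho> (at (x - s)))"
    using test_functions_differentiable[OF assms] has_derivative_linear by blast
  ultimately show "frechet_derivative (\<lambda>s. \<rho> (x - s)) (at s) h = - frechet_derivative \<rho> (at (x - s)) h"
    by (simp add: linear_neg)
qed

text \<open>As a function of s, the mollifier \<rho>(x - s) times a basis vector is a test field;
  the weak gradient moves the derivative from the mollifier to \<open>v\<close>.\<close>

lemma gradient_conv_weak:
  assumes \<rho>: "\<rho> \<in> test_functions" and v: "has_weak_gradient v G" and iv: "integrable lebesgue v"
    and iG: "integrable lebesgue G" and supp: "\<And>s. norm s > R \<Longrightarrow> v s = 0"
  shows "gradient (conv \<rho> v) x = conv \<rho> G x"
proof (rule euclidean_eqI)
  fix b :: 'a assume "b \<in> Basis"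
  note r = reflected_test_function[OF \<rho>]
  let ?\<phi> = "\<lambda>s. \<rho> (x - s) *\<^sub>R b"
  have \<phi>: "?\<phi> \<in> test_functions" by (rule test_functions_linear[OF bounded_linear_scaleR_left r(1)])
  have "gradient (conv \<rho> v) x \<bullet> b = frechet_derivative (conv \<rho> v) (at x) b"
    by (intro gradient_inner_test conv_test_functions[OF \<rho> iv supp])
  also have "\<dots> = - (\<integral>s. v s * divergence ?\<phi> s \<partial>lebesgue)"
    unfolding frechet_derivative_conv[OF \<rho> iv] divergence_scaleR_const[OF r(1)] r(2) conv_def
    by (simp add: mult.commute)
  also have "\<dots> = (\<integral>s. G s \<bullet> ?\<phi> s \<partial>lebesgue)" using v \<phi> by (simp add: has_weak_gradient_def)
  also have "\<dots> = (\<integral>s. (\<rho> (x - s) *\<^sub>R G s) \<bullet> b \<partial>lebesgue)" by simp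
  also have "\<dots> = conv \<rho> G x \<bullet> b"
    unfolding conv_def by (rule integral_inner_left) (simp add: conv_integrable[OF \<rho> iG])
  finally show "gradient (conv \<rho> v) x \<bullet> b = conv \<rho> G x \<bullet> b" .
qed

lemma L2sq_gradient:
  assumes "\<eta> \<in> test_functions"
  shows "L2sq (gradient \<eta>) = (\<Sum>b\<in>Basis. L2sq (\<lambda>x. frechet_derivative \<eta> (at x) b))"
proof -
  have "(norm (gradient \<eta> x))\<^sup>2 = (\<Sum>b\<in>Basis. (norm (frechet_derivative \<eta> (at x) b))\<^sup>2)" for x
  proof -
    have "(norm (gradient \<eta> x))\<^sup>2 = (\<Sum>b\<in>Basis. (gradient \<eta> x \<bullet> b)\<^sup>2)"
      unfolding power2_norm_eq_inner euclidean_inner[of "gradient \<eta> x" "gradient \<eta> x"]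
      by (simp add: power2_eq_square)
    then show ?thesis by (simp add: gradient_inner_test[OF assms])
  qed
  moreover have "integrable lebesgue (\<lambda>x. (norm (frechet_derivative \<eta> (at x) b))\<^sup>2)" for b
    using test_functions_L2[OF test_functions_deriv[OF assms]] by (simp add: L2_def)
  ultimately show ?thesis unfolding L2sq_def by simp
qed

lemma scaled_test_function:
  fixes \<zeta> :: "'a::euclidean_space \<Rightarrow> real"
  assumes \<zeta>: "\<zeta> \<in> test_functions" "\<And>x. x \<notin> cube 1 \<Longrightarrow> \<zeta> x = 0" and e: "e > 0"
  shows "(\<lambda>x. \<zeta> ((1/e) *\<^sub>R x)) \<in> test_functions" "\<And>x. x \<notin> cube e \<Longrightarrow> \<zeta> ((1/e) *\<^sub>R x) = 0"
    "(\<integral>x. \<zeta> ((1/e) *\<^sub>R x) \<partial>lebesgue) = e ^ DIM('a) * (\<integral>x. \<zeta> x \<partial>lebesgue)"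
    "frechet_derivative (\<lambda>x. \<zeta> ((1/e) *\<^sub>R x)) (at x) h = (1/e) * frechet_derivative \<zeta> (at ((1/e) *\<^sub>R x)) h"
proof -
  show out: "\<zeta> ((1/e) *\<^sub>R x) = 0" if "x \<notin> cube e" for x
  proof (rule \<zeta>(2))
    show "(1/e) *\<^sub>R x \<notin> cube 1" using that e unfolding mem_cube by (auto simp: divide_simps)
  qed
  have "C_k k (\<lambda>x. \<zeta> ((1/e) *\<^sub>R x))" for k
    using C_k_affine[OF bounded_linear_scaleR_right, of k \<zeta> "1/e" 0] \<zeta>(1) by (simp add: test_functions_iff)
  moreover have "{x. \<zeta> ((1/e) *\<^sub>R x) \<noteq> 0} \<subseteq> cube e" using out by blast
  ultimately show t: "(\<lambda>x. \<zeta> ((1/e) *\<^sub>R x)) \<in> test_functions"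
    unfolding test_functions_iff using bounded_subset[OF bounded_cbox] by blast
  show "(\<integral>x. \<zeta> ((1/e) *\<^sub>R x) \<partial>lebesgue) = e ^ DIM('a) * (\<integral>x. \<zeta> x \<partial>lebesgue)"
    using lborel_integral_affine[of e "\<lambda>x. \<zeta> ((1/e) *\<^sub>R x)" 0] e test_functions_measurable[OF t] test_functions_measurable[OF \<zeta>(1)]
    by (simp add: integral_lebesgue_lborel)
  have "((\<lambda>x. (1/e) *\<^sub>R x) has_derivative (\<lambda>h. (1/e) *\<^sub>R h)) (at x)" by (auto intro!: derivative_eq_intros)
  from has_derivative_compose[OF this test_functions_differentiable[OF \<zeta>(1)]]
  have "frechet_derivative (\<lambda>x. \<zeta> ((1/e) *\<^sub>R x)) (at x) = (\<lambda>h. frechet_derivative \<zeta> (at ((1/e) *\<^sub>R x)) ((1/e) *\<^sub>R h))"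
    by (rule frechet_derivative_at[symmetric])
  moreover have "linear (frechet_derivative \<zeta> (at ((1/e) *\<^sub>R x)))"
    using test_functions_differentiable[OF \<zeta>(1)] has_derivative_linear by blast
  ultimately show "frechet_derivative (\<lambda>x. \<zeta> ((1/e) *\<^sub>R x)) (at x) h = (1/e) * frechet_derivative \<zeta> (at ((1/e) *\<^sub>R x)) h"
    by (simp add: linear_scale)
qed

lemma mollifier_exists:
  assumes e: "e > 0"
  obtains \<rho> :: "'a::euclidean_space \<Rightarrow> real" where "\<rho> \<in> test_functions" "\<And>x. 0 \<le> \<rho> x" "(\<integral>x. \<rho> x \<partial>lborel) = 1"
    "\<And>x. x \<notin> cube e \<Longrightarrow> \<rho> x = 0"
proof -
  obtain \<zeta> :: "'a \<Rightarrow> real" where \<zeta>: "\<zeta> \<in> test_functions" "\<And>x. 0 \<le> \<zeta> x" "(\<integral>x. \<zeta> x \<partial>lebesgue) = 1"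
    "\<And>x. x \<notin> cube 1 \<Longrightarrow> \<zeta> x = 0" by (rule unit_mass_test_function) (rule that; assumption)
  note s = scaled_test_function[OF \<zeta>(1,4) e]
  let ?\<rho> = "\<lambda>x. \<zeta> ((1/e) *\<^sub>R x) / e ^ DIM('a)"
  have t: "?\<rho> \<in> test_functions" by (rule test_functions_linear[OF bounded_linear_divide s(1)])
  show ?thesis
  proof (rule that[OF t])
    have "(\<integral>x. ?\<rho> x \<partial>lebesgue) = 1" using s(3) \<zeta>(3) e by simp
    then show "(\<integral>x. ?\<rho> x \<partial>lborel) = 1" using test_functions_measurable[OF t] by (simp only: integral_lebesgue_lborel)
  qed (use s(2) \<zeta>(2) e in auto)
qed

text \<open>The mollifier is transferred to the test function. Averages of a smooth \<eta> converge
  everywhere under a common bound, so limits of mollifications can be computed by dominated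
  convergence.\<close>

lemma conv_against_test_function:
  fixes g :: "'a::euclidean_space \<Rightarrow> real"
  assumes \<rho>: "\<rho> \<in> test_functions" and g: "integrable lebesgue g" and \<eta>: "\<eta> \<in> test_functions"
  shows "(\<integral>x. conv \<rho> g x * \<eta> x \<partial>lebesgue) = (\<integral>s. g s * (\<integral>x. \<rho> x * \<eta> (x + s) \<partial>lborel) \<partial>lebesgue)"
proof -
  have gm: "g \<in> borel_measurable lebesgue" using g by (rule borel_measurable_integrable)
  obtain g0 where g0: "g0 \<in> borel_measurable borel" "AE x in lebesgue. g x = g0 x"
    using borel_representative[OF gm] by blast
  note [measurable] = g0(1) test_functions_measurable[OF \<rho>] test_functions_measurable[OF \<eta>]
  have ig0: "integrable lborel g0"
    using integrable_cong_AE_imp[OF g borel_measurable_lebesgueI[OF g0(1)] g0(2)] g0(1)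
    by (simp add: integrable_lebesgue_lborel)
  obtain B where B: "B > 0" "\<And>x. norm (\<eta> x) \<le> B" using test_functions_bounded[OF \<eta>] by blast
  let ?F = "\<lambda>(s, x). g0 s * \<rho> x * \<eta> (x + s)"
  have F: "integrable (lborel \<Otimes>\<^sub>M lborel) ?F"
  proof (rule Bochner_Integration.integrable_bound)
    show "integrable (lborel \<Otimes>\<^sub>M lborel) (\<lambda>(s, x). g0 s * (\<rho> x * B))"
      using test_functions_integrable[OF \<rho>]
      by (intro integrable_pair_mult sigma_finite_lborel ig0 integrable_mult_left)
    show "AE z in lborel \<Otimes>\<^sub>M lborel. norm (?F z) \<le> norm (case z of (s, x) \<Rightarrow> g0 s * (\<rho> x * B))"
      using B by (auto simp: abs_mult mult.assoc intro!: mult_left_mono AE_I2)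
  qed measurable
  have F': "integrable (lborel \<Otimes>\<^sub>M lborel) (\<lambda>(s, x). ?F (s, x + (- s)))"
    by (rule integrable_shear[OF sigma_finite_lborel F]) simp
  have "(\<integral>x. conv \<rho> g x * \<eta> x \<partial>lebesgue) = (\<integral>x. conv \<rho> g x * \<eta> x \<partial>lborel)"
  proof (rule integral_lebesgue_lborel)
    have "conv \<rho> g = (\<lambda>x. \<integral>s. \<rho> s *\<^sub>R g0 (x - s) \<partial>lborel)"
      by (rule ext) (rule conv_borel(2)[OF test_functions_measurable[OF \<rho>] gm g0])
    then have "conv \<rho> g \<in> borel_measurable borel" by simp
    then show "(\<lambda>x. conv \<rho> g x * \<eta> x) \<in> borel_measurable borel" by measurable
  qed
  also have "\<dots> = (\<integral>x. (\<integral>s. ?F (s, x + (- s)) \<partial>lborel) \<partial>lborel)"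
    by (intro Bochner_Integration.integral_cong refl)
       (simp add: conv_borel(1)[OF test_functions_measurable[OF \<rho>] gm g0] mult_ac flip: integral_mult_right_zero)
  also have "\<dots> = (\<integral>s. (\<integral>x. ?F (s, x + (- s)) \<partial>lborel) \<partial>lborel)"
    using lborel_pair.Fubini_integral[of "\<lambda>s x. ?F (s, x + (- s))"] F' by simp
  also have "\<dots> = (\<integral>s. (\<integral>x. ?F (s, x) \<partial>lborel) \<partial>lborel)"
    by (intro Bochner_Integration.integral_cong refl lborel_integral_translate) simp
  also have "\<dots> = (\<integral>s. g0 s * (\<integral>x. \<rho> x * \<eta> (x + s) \<partial>lborel) \<partial>lborel)"
    by (simp add: mult.assoc)
  also have "\<dots> = (\<integral>s. g0 s * (\<integral>x. \<rho> x * \<eta> (x + s) \<partial>lborel) \<partial>lebesgue)"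
    by (rule integral_lebesgue_lborel[symmetric]) measurable
  also have "\<dots> = (\<integral>s. g s * (\<integral>x. \<rho> x * \<eta> (x + s) \<partial>lborel) \<partial>lebesgue)"
  proof (rule integral_cong_AE)
    have m: "(\<lambda>s. \<integral>x. \<rho> x * \<eta> (x + s) \<partial>lborel) \<in> borel_measurable lebesgue"
      by (intro borel_measurable_lebesgueI) measurable
    show "(\<lambda>s. g s * (\<integral>x. \<rho> x * \<eta> (x + s) \<partial>lborel)) \<in> borel_measurable lebesgue"
      by (rule borel_measurable_times[OF gm m])
    show "(\<lambda>s. g0 s * (\<integral>x. \<rho> x * \<eta> (x + s) \<partial>lborel)) \<in> borel_measurable lebesgue"
      by (rule borel_measurable_times[OF borel_measurable_lebesgueI[OF g0(1)] m])
    show "AE s in lebesgue. g0 s * (\<integral>x. \<rho> x * \<eta> (x + s) \<partial>lborel) = g s * (\<integral>x. \<rho> x * \<eta> (x + s) \<partial>lborel)"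
      using g0(2) by eventually_elim simp
  qed
  finally show ?thesis .
qed

text \<open>These are the uniform bound, the common support and the pointwise rate that dominated
  convergence asks for; \<open>e * DIM('a)\<close> bounds the norm on \<open>cube e\<close>.\<close>

lemma mollified_test_function_bounds:
  fixes \<rho> :: "'a::euclidean_space \<Rightarrow> real"
  assumes \<rho>: "\<rho> \<in> test_functions" "\<And>x. 0 \<le> \<rho> x" "(\<integral>x. \<rho> x \<partial>lborel) = 1" "\<And>x. x \<notin> cube e \<Longrightarrow> \<rho> x = 0" and e: "0 < e"
    and \<eta>: "\<eta> \<in> test_functions"
  shows "(\<And>x. \<bar>\<eta> x\<bar> \<le> B) \<Longrightarrow> \<bar>\<integral>x. \<rho> x * \<eta> (x + s) \<partial>lborel\<bar> \<le> B"
    and "(\<And>x. norm x > r \<Longrightarrow> \<eta> x = 0) \<Longrightarrow> norm s > r + e * DIM('a) \<Longrightarrow> (\<integral>x. \<rho> x * \<eta> (x + s) \<partial>lborel) = 0"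
    and "(\<And>x h. norm (frechet_derivative \<eta> (at x) h) \<le> L * norm h) \<Longrightarrow>
        \<bar>(\<integral>x. \<rho> x * \<eta> (x + s) \<partial>lborel) - \<eta> s\<bar> \<le> L * (e * DIM('a))"
proof -
  note [measurable] = test_functions_measurable[OF \<rho>(1)] test_functions_measurable[OF \<eta>]
  have i\<rho>: "integrable lborel \<rho>" by (rule test_functions_integrable[OF \<rho>(1)])
  have supp: "norm x \<le> e * DIM('a)" if "\<rho> x \<noteq> 0" for x
    using \<rho>(4)[of x] that norm_le_cube[of x e] by blast
  show "\<bar>\<integral>x. \<rho> x * \<eta> (x + s) \<partial>lborel\<bar> \<le> B" if B: "\<And>x. \<bar>\<eta> x\<bar> \<le> B"
  proof -
    have "norm (\<integral>x. \<rho> x * \<eta> (x + s) \<partial>lborel) \<le> (\<integral>x. \<rho> x * B \<partial>lborel)"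
      using i\<rho> B \<rho>(2) by (intro norm_integral_le) (auto simp: abs_mult intro!: mult_left_mono)
    then show ?thesis using \<rho>(3) by simp
  qed
  show "(\<integral>x. \<rho> x * \<eta> (x + s) \<partial>lborel) = 0" if r: "\<And>x. norm x > r \<Longrightarrow> \<eta> x = 0" and s: "norm s > r + e * DIM('a)"
  proof -
    have "\<rho> x * \<eta> (x + s) = 0" for x
    proof (cases "\<rho> x = 0")
      case False
      then have "norm (x + s) > r" using supp[of x] s norm_triangle_ineq4[of "x + s" x] by simp
      then show ?thesis using r by simp
    qed simp
    then have "(\<lambda>x. \<rho> x * \<eta> (x + s)) = (\<lambda>x. 0)" by blast
    then show ?thesis by simp
  qed
  show "\<bar>(\<integral>x. \<rho> x * \<eta> (x + s) \<partial>lborel) - \<eta> s\<bar> \<le> L * (e * DIM('a))"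
    if L: "\<And>x h. norm (frechet_derivative \<eta> (at x) h) \<le> L * norm h"
  proof -
    have L0: "0 \<le> L"
    proof -
      have "0 \<le> L * norm (One::'a)" using L[of 0 One] norm_ge_zero order_trans by blast
      then show ?thesis by (simp add: zero_le_mult_iff)
    qed
    have lip: "norm (\<eta> (x + s) - \<eta> s) \<le> L * norm x" for x
    proof -
      have "norm (\<eta> (x + s) - \<eta> s) \<le> L * norm ((x + s) - s)"
        using test_functions_differentiable[OF \<eta>] L0 L
        by (intro differentiable_bound[where S=UNIV and f'="\<lambda>x. frechet_derivative \<eta> (at x)"]) (auto intro!: onorm_bound)
      then show ?thesis by simp
    qed
    obtain B where B: "B > 0" "\<And>x. norm (\<eta> x) \<le> B" using test_functions_bounded[OF \<eta>] by blast
    have i: "integrable lborel (\<lambda>x. \<rho> x * \<eta> (x + s))"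
      by (rule Bochner_Integration.integrable_bound[where f="\<lambda>x. \<rho> x * B"])
         (use i\<rho> B in \<open>auto simp: abs_mult intro!: mult_left_mono\<close>)
    have "(\<integral>x. \<rho> x * \<eta> (x + s) \<partial>lborel) - \<eta> s = (\<integral>x. \<rho> x * (\<eta> (x + s) - \<eta> s) \<partial>lborel)"
      using i i\<rho> \<rho>(3) by (simp add: right_diff_distrib)
    also have "norm \<dots> \<le> (\<integral>x. \<rho> x * (L * (e * DIM('a))) \<partial>lborel)"
    proof (rule norm_integral_le)
      show "AE x in lborel. norm (\<rho> x * (\<eta> (x + s) - \<eta> s)) \<le> \<rho> x * (L * (e * DIM('a)))"
      proof (rule AE_I2)
        fix x
        show "norm (\<rho> x * (\<eta> (x + s) - \<eta> s)) \<le> \<rho> x * (L * (e * DIM('a)))"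
        proof (cases "\<rho> x = 0")
          case False
          then have "\<bar>\<eta> (x + s) - \<eta> s\<bar> \<le> L * (e * DIM('a))"
            using lip[of x] mult_left_mono[OF supp[of x] L0] by simp
          then show ?thesis using \<rho>(2)[of x] by (simp add: abs_mult mult_left_mono)
        qed simp
      qed
    qed (use i\<rho> in simp)
    finally show ?thesis using \<rho>(3) by simp
  qed
qed

subsection \<open>Products with test functions\<close>

lemma gradient_mult:
  assumes "f \<in> test_functions" "g \<in> test_functions"
  shows "(\<lambda>x. f x * g x) \<in> test_functions" "gradient (\<lambda>x. f x * g x) x = f x *\<^sub>R gradient g x + g x *\<^sub>R gradient f x"
proof -
  show "(\<lambda>x. f x * g x) \<in> test_functions"
    using assms by (intro test_functions_bilinear[OF bounded_bilinear_mult]) (auto simp: test_functions_iff)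
  have "frechet_derivative (\<lambda>x. f x * g x) (at x) = (\<lambda>h. f x * frechet_derivative g (at x) h + frechet_derivative f (at x) h * g x)"
    by (rule frechet_derivative_at[symmetric])
       (intro has_derivative_mult test_functions_differentiable assms)
  then show "gradient (\<lambda>x. f x * g x) x = f x *\<^sub>R gradient g x + g x *\<^sub>R gradient f x"
    by (simp add: gradient_def scaleR_sum_right scaleR_left_distrib sum.distrib mult.commute)
qed

lemma divergence_mult:
  assumes "f \<in> test_functions" "\<phi> \<in> test_functions"
  shows "(\<lambda>x. f x *\<^sub>R \<phi> x) \<in> test_functions" "divergence (\<lambda>x. f x *\<^sub>R \<phi> x) x = f x * divergence \<phi> x + gradient f x \<bullet> \<phi> x"
proof -
  show "(\<lambda>x. f x *\<^sub>R \<phi> x) \<in> test_functions"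
    using assms by (intro test_functions_bilinear[OF bounded_bilinear_scaleR]) (auto simp: test_functions_iff)
  have "frechet_derivative (\<lambda>x. f x *\<^sub>R \<phi> x) (at x) = (\<lambda>h. f x *\<^sub>R frechet_derivative \<phi> (at x) h + frechet_derivative f (at x) h *\<^sub>R \<phi> x)"
    by (rule frechet_derivative_at[symmetric])
       (intro has_derivative_scaleR test_functions_differentiable assms)
  then show "divergence (\<lambda>x. f x *\<^sub>R \<phi> x) x = f x * divergence \<phi> x + gradient f x \<bullet> \<phi> x"
    by (simp add: divergence_def gradient_inner inner_add_left sum.distrib sum_distrib_left)
qed

text \<open>The weak gradient of \<open>u\<close> is tested with \<kappa> \<phi>, whose divergence
  contains the additional term grad \<kappa> \<cdot> \<phi>; that term is moved to the other
  side.\<close>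

lemma has_weak_gradient_mult:
  assumes u: "has_weak_gradient u G" and \<kappa>: "\<kappa> \<in> test_functions"
  shows "has_weak_gradient (\<lambda>x. \<kappa> x * u x) (\<lambda>x. \<kappa> x *\<^sub>R G x + u x *\<^sub>R gradient \<kappa> x)"
  unfolding has_weak_gradient_def
proof (intro conjI ballI)
  note A = u[unfolded has_weak_gradient_def]
  note \<kappa>m = borel_measurable_lebesgueI[OF test_functions_measurable[OF \<kappa>]]
  obtain B where B: "\<And>x. norm (\<kappa> x) \<le> B" using test_functions_bounded[OF \<kappa>] by blast
  have "(\<lambda>x. \<kappa> x *\<^sub>R u x) \<in> L1_loc" "(\<lambda>x. \<kappa> x *\<^sub>R G x) \<in> L1_loc"
    using A B \<kappa>m by (auto intro!: L1_loc_bounded_mult[where B=B] simp del: real_scaleR_def)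
  moreover have uL: "(\<lambda>x. u x *\<^sub>R gradient \<kappa> x) \<in> L1_loc"
    unfolding L1_loc_iff_cball
  proof
    fix R :: real
    have gt: "gradient \<kappa> \<in> test_functions" by (rule gradient_test_functions[OF \<kappa>])
    obtain C where C: "\<And>x. norm (gradient \<kappa> x) \<le> C" using test_functions_bounded[OF gt] by blast
    have iu: "integrable lebesgue (\<lambda>x. indicat_real (cball 0 R) x *\<^sub>R u x)" using A by (simp add: L1_loc_iff_cball)
    show "integrable lebesgue (\<lambda>x. indicat_real (cball 0 R) x *\<^sub>R (u x *\<^sub>R gradient \<kappa> x))"
    proof (rule Bochner_Integration.integrable_bound)
      show "integrable lebesgue (\<lambda>x. C * norm (indicat_real (cball 0 R) x *\<^sub>R u x))"
        using iu by (intro integrable_mult_right integrable_norm)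
      have "(\<lambda>x. (indicat_real (cball 0 R) x *\<^sub>R u x) *\<^sub>R gradient \<kappa> x) \<in> borel_measurable lebesgue"
        by (intro borel_measurable_scaleR borel_measurable_integrable[OF iu]
            borel_measurable_lebesgueI test_functions_measurable gt)
      then show "(\<lambda>x. indicat_real (cball 0 R) x *\<^sub>R (u x *\<^sub>R gradient \<kappa> x)) \<in> borel_measurable lebesgue" by simp
      show "AE x in lebesgue. norm (indicat_real (cball 0 R) x *\<^sub>R (u x *\<^sub>R gradient \<kappa> x))
          \<le> norm (C * norm (indicat_real (cball 0 R) x *\<^sub>R u x))"
      proof (rule AE_I2)
        fix x
        have "0 \<le> C" using C[of x] norm_ge_zero order_trans by blast
        then show "norm (indicat_real (cball 0 R) x *\<^sub>R (u x *\<^sub>R gradient \<kappa> x))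
          \<le> norm (C * norm (indicat_real (cball 0 R) x *\<^sub>R u x))"
          using mult_right_mono[OF C[of x], of "\<bar>indicat_real (cball 0 R) x * u x\<bar>"] by (simp add: abs_mult mult_ac)
      qed
    qed
  qed
  ultimately show "(\<lambda>x. \<kappa> x * u x) \<in> L1_loc" "(\<lambda>x. \<kappa> x *\<^sub>R G x + u x *\<^sub>R gradient \<kappa> x) \<in> L1_loc"
    by (simp_all add: L1_loc_add)
  fix \<phi> :: "'a \<Rightarrow> 'a" assume \<phi>: "\<phi> \<in> test_functions"
  note d = divergence_mult[OF \<kappa> \<phi>]
  have t: "(\<lambda>x. gradient \<kappa> x \<bullet> \<phi> x) \<in> test_functions"
    using \<phi> gradient_test_functions[OF \<kappa>]
    by (intro test_functions_bilinear[OF bounded_bilinear_inner]) (auto simp: test_functions_iff)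
  have i: "integrable lebesgue (\<lambda>x. u x * divergence (\<lambda>x. \<kappa> x *\<^sub>R \<phi> x) x)"
      "integrable lebesgue (\<lambda>x. u x * (gradient \<kappa> x \<bullet> \<phi> x))"
      "integrable lebesgue (\<lambda>x. G x \<bullet> (\<kappa> x *\<^sub>R \<phi> x))"
    using A by (auto intro!: L1_loc_test_mult_integrable integrable_lebesgue_test_field t d(1) divergence_test_functions simp del: inner_scaleR_right)
  have "(\<integral>x. \<kappa> x * u x * divergence \<phi> x \<partial>lebesgue) =
     (\<integral>x. u x * divergence (\<lambda>x. \<kappa> x *\<^sub>R \<phi> x) x - u x * (gradient \<kappa> x \<bullet> \<phi> x) \<partial>lebesgue)"
    unfolding d(2) by (simp add: algebra_simps)
  also have "\<dots> = (\<integral>x. u x * divergence (\<lambda>x. \<kappa> x *\<^sub>R \<phi> x) x \<partial>lebesgue) - (\<integral>x. u x * (gradient \<kappa> x \<bullet> \<phi> x) \<partial>lebesgue)"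
    by (rule Bochner_Integration.integral_diff[OF i(1,2)])
  also have "\<dots> = - ((\<integral>x. G x \<bullet> (\<kappa> x *\<^sub>R \<phi> x) \<partial>lebesgue) + (\<integral>x. u x * (gradient \<kappa> x \<bullet> \<phi> x) \<partial>lebesgue))"
    using A d(1) by simp
  also have "\<dots> = - (\<integral>x. G x \<bullet> (\<kappa> x *\<^sub>R \<phi> x) + u x * (gradient \<kappa> x \<bullet> \<phi> x) \<partial>lebesgue)"
    by (simp only: Bochner_Integration.integral_add[OF i(3,2)])
  finally show "(\<integral>x. \<kappa> x * u x * divergence \<phi> x \<partial>lebesgue) =
     - (\<integral>x. (\<kappa> x *\<^sub>R G x + u x *\<^sub>R gradient \<kappa> x) \<bullet> \<phi> x \<partial>lebesgue)"
    by (simp add: inner_add_left)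
qed

subsection \<open>Bounded vector fields with divergence in \<open>D\<^sup>1\<close>\<close>

lemma L2_dominated:
  fixes f :: "'a::euclidean_space \<Rightarrow> 'b::euclidean_space" and g :: "'a \<Rightarrow> 'c::euclidean_space"
  assumes g: "g \<in> L2" and f: "f \<in> borel_measurable lebesgue"
    and le: "AE x in lebesgue. norm (f x) \<le> C * norm (g x)"
  shows "f \<in> L2" "L2sq f \<le> C\<^sup>2 * L2sq g"
proof -
  have "AE x in lebesgue. ennreal ((norm (f x))\<^sup>2) \<le> ennreal (C\<^sup>2) * ennreal ((norm (g x))\<^sup>2)"
    using le
  proof eventually_elim
    case (elim x)
    then have "(norm (f x))\<^sup>2 \<le> (C * norm (g x))\<^sup>2" by (intro power_mono) auto
    then show ?case by (simp add: power_mult_distrib ennreal_leI flip: ennreal_mult)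
  qed
  then have "(\<integral>\<^sup>+x. ennreal ((norm (f x))\<^sup>2) \<partial>lebesgue) \<le> (\<integral>\<^sup>+x. ennreal (C\<^sup>2) * ennreal ((norm (g x))\<^sup>2) \<partial>lebesgue)"
    by (rule nn_integral_mono_AE)
  also have "\<dots> = ennreal (C\<^sup>2) * (\<integral>\<^sup>+x. ennreal ((norm (g x))\<^sup>2) \<partial>lebesgue)"
  proof (intro nn_integral_cmult)
    have [measurable]: "g \<in> borel_measurable lebesgue" using g by (simp add: L2_def)
    show "(\<lambda>x. ennreal ((norm (g x))\<^sup>2)) \<in> borel_measurable lebesgue" by measurable
  qed
  also have "\<dots> = ennreal (C\<^sup>2 * L2sq g)" by (simp add: L2_nn_integral[OF g] ennreal_mult L2sq_nonneg)
  finally show "f \<in> L2" "L2sq f \<le> C\<^sup>2 * L2sq g" using L2I[OF f] by (simp_all add: L2sq_nonneg)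
qed

lemma gradient_eq_0_outside:
  assumes "closed Q" "\<And>x. x \<notin> Q \<Longrightarrow> f x = 0" "x \<notin> Q"
  shows "gradient f x = 0"
proof -
  have "((\<lambda>x. 0) has_derivative (\<lambda>_. 0)) (at x)" by simp
  then have "(f has_derivative (\<lambda>_. 0)) (at x)"
    using assms has_derivative_transform_within_open[of "\<lambda>_. 0" "\<lambda>_. 0" x UNIV "- Q" f] by auto
  then have "frechet_derivative f (at x) = (\<lambda>_. 0)" by (metis frechet_derivative_at)
  then show ?thesis by (simp add: gradient_def)
qed

lemma E_sum_lincomb:
  assumes \<psi>: "\<psi> \<in> L2" "compact_support \<psi>" and w: "w \<in> D_neg1" and f: "f \<in> D1" and g: "g \<in> D1"
  shows "E_sum \<psi> w c (\<lambda>x. a * f x + b * g x) = a * E_sum \<psi> w c f + b * E_sum \<psi> w c g"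
proof -
  have "(\<integral>x. \<psi> x * (a * f x + b * g x) \<partial>lebesgue) = a * (\<integral>x. \<psi> x * f x \<partial>lebesgue) + b * (\<integral>x. \<psi> x * g x \<partial>lebesgue)"
    using L2_compact_D1_integrable(1)[OF \<psi> f] L2_compact_D1_integrable(1)[OF \<psi> g]
    by (simp add: distrib_left mult.left_commute)
  then show ?thesis
    using f g D1_lincomb[OF f g] D_neg1_lincomb[OF w f g] by (simp add: E_sum_def algebra_simps)
qed

lemma E_sum_minus:
  assumes "\<psi> \<in> L2" "compact_support \<psi>" "w \<in> D_neg1" "f \<in> D1"
  shows "E_sum \<psi> w c (\<lambda>x. - f x) = - E_sum \<psi> w c f"
  using E_sum_lincomb[OF assms assms(4), of c "-1" 0] by simp

lemma E_sum_zero: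
  assumes "\<psi> \<in> L2" "compact_support \<psi>" "w \<in> D_neg1"
  shows "E_sum \<psi> w c (\<lambda>x. 0) = 0"
  using E_sum_lincomb[OF assms D1_const D1_const, of c 0 0 0 0] by simp

text \<open>
  The hypothesis \<open>n \<le> 2\<close> enters here, through \<open>R\<^sup>n \<le> R\<^sup>2\<close>: the gradients of the rescaled cutoffs stay
  bounded in \<open>L\<^sup>2\<close>. The mean of \<open>d\<close> over a large cube is controlled because \<open>d\<close> is the divergence of a
  bounded field.
\<close>

lemma cutoff_divergence_bounded:
  fixes \<kappa> :: "'a::euclidean_space \<Rightarrow> real"
  assumes n: "DIM('a) \<le> 2"
    and \<kappa>: "\<kappa> \<in> test_functions" "\<And>x. 0 \<le> \<kappa> x" "\<And>x. \<kappa> x \<le> 1" "\<And>x. x \<notin> cube 1 \<Longrightarrow> \<kappa> x = 0"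
    and I: "0 < (\<integral>x. \<kappa> x \<partial>lebesgue)"
    and Z: "has_weak_divergence Z d" "AE x in lebesgue. norm (Z x) \<le> 1" and d: "d \<in> D1"
  obtains M B where "\<And>R. R \<ge> 1 \<Longrightarrow> D1_inner (\<lambda>x. \<kappa> ((1/R) *\<^sub>R x) * d x) (\<lambda>x. \<kappa> ((1/R) *\<^sub>R x) * d x) \<le> M"
    "\<And>R. R \<ge> 1 \<Longrightarrow> (\<lambda>x. \<kappa> ((1/R) *\<^sub>R x) * d x) \<in> D1"
    "\<And>R. R \<ge> 1 \<Longrightarrow> (\<lambda>x. Z x \<bullet> gradient (\<lambda>x. \<kappa> ((1/R) *\<^sub>R x)) x) \<in> L2"
    "\<And>R. R \<ge> 1 \<Longrightarrow> L2sq (\<lambda>x. Z x \<bullet> gradient (\<lambda>x. \<kappa> ((1/R) *\<^sub>R x)) x) \<le> M"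
    "\<And>R x. R \<ge> 1 \<Longrightarrow> norm (gradient (\<lambda>x. \<kappa> ((1/R) *\<^sub>R x)) x) \<le> B / R"
    "\<And>R x. R \<ge> 1 \<Longrightarrow> x \<notin> cube R \<Longrightarrow> gradient (\<lambda>x. \<kappa> ((1/R) *\<^sub>R x)) x = 0"
proof -
  let ?n = "DIM('a)" and ?P = "Poincare_const TYPE('a)" and ?I = "\<integral>x. \<kappa> x \<partial>lebesgue"
  define A where "A = D1_inner d d"
  have A: "0 \<le> A" by (simp add: A_def D1_inner_nonneg)
  have P: "0 \<le> ?P" by (rule Poincare_const_nonneg)
  obtain B where B: "B > 0" "\<And>x. norm (gradient \<kappa> x) \<le> B"
    using test_functions_bounded[OF gradient_test_functions[OF \<kappa>(1)]] by blast
  define c0 where "c0 = (?I / 2 ^ ?n)\<^sup>2"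
  have c0: "c0 > 0" using I by (simp add: c0_def)
  \<comment> \<open>R^2 \<open>K\<close> will bound the integral of d^2 over \<open>cube R\<close>:
    a Poincare part, and a part from the constant m, for which m^2 times the volume is at most R^2
    (8 B^2 + 2 P A) / \<open>c0\<close>.\<close>
  define K where "K = 2 * (?P * A) + 2 * ((8 * B\<^sup>2 + 2 * ?P * A) / c0)"
  \<comment> \<open>The first two summands bound the energy of the cut-off \<open>d\<close> by the
    product rule, the last one the squared norm of \<open>Z\<close> paired with the gradient of the
    cutoff; their sum bounds both.\<close>
  define M where "M = 2 * A + 2 * (B\<^sup>2 * K) + 4 * B\<^sup>2"
  have K: "0 \<le> K" using A P c0 by (simp add: K_def)
  have dm: "d \<in> borel_measurable lebesgue" by (rule L1_loc_measurable[OF D1_L1_loc[OF d]])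
  have Zm: "Z \<in> borel_measurable lebesgue" using Z by (simp add: has_weak_divergence_def L1_loc_measurable)
  have main: "D1_inner (\<lambda>x. k x * d x) (\<lambda>x. k x * d x) \<le> M \<and> (\<lambda>x. k x * d x) \<in> D1 \<and> (\<lambda>x. Z x \<bullet> gradient k x) \<in> L2 \<and>
      L2sq (\<lambda>x. Z x \<bullet> gradient k x) \<le> M \<and> (\<forall>x. norm (gradient k x) \<le> B / R) \<and> (\<forall>x. x \<notin> cube R \<longrightarrow> gradient k x = 0)"
    if R: "R \<ge> 1" and k_def: "k = (\<lambda>x. \<kappa> ((1/R) *\<^sub>R x))" for R k
  proof -
    have R0: "R > 0" using R by simp
    let ?Q = "cube R :: 'a set"
    define V where "V = (2 * R) ^ ?n"
    have V: "V > 0" "V \<le> 4 * R\<^sup>2"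
    proof -
      show "V > 0" using R0 by (simp add: V_def)
      \<comment> \<open>The volume of \<open>cube R\<close> is at most 4 R^2 because 2 R \<ge> 1 and
        n \<le> 2. It compensates the factor (B / R)^2 from the gradient of the cutoff.\<close>
      have "V \<le> (2 * R)\<^sup>2" unfolding V_def using R n by (intro power_increasing) auto
      then show "V \<le> 4 * R\<^sup>2" by (simp add: power_mult_distrib)
    qed
    have VQ: "measure lborel ?Q = V" using measure_cube[of R, where 'a='a] R0 by (simp add: V_def)
    have k: "k \<in> test_functions" "\<And>x. x \<notin> ?Q \<Longrightarrow> k x = 0" "(\<integral>x. k x \<partial>lebesgue) = R ^ ?n * ?I"
      "\<And>x h. frechet_derivative k (at x) h = (1/R) * frechet_derivative \<kappa> (at ((1/R) *\<^sub>R x)) h"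
      unfolding k_def using scaled_test_function[OF \<kappa>(1,4) R0] by auto
    have k01: "0 \<le> k x" "k x \<le> 1" for x using \<kappa> by (simp_all add: k_def)
    have kc: "compact_support k" by (rule test_functions_compact_support[OF k(1)])
    note kL = test_functions_L2[OF k(1)]
    note gt = gradient_test_functions[OF k(1)]
    note gm = borel_measurable_lebesgueI[OF test_functions_measurable[OF gt]]
    have kQ: "AE x in lebesgue. k x = indicator ?Q x *\<^sub>R k x"
      using k(2) by (intro AE_I2) (auto simp: indicator_def)
    have gB: "norm (gradient k x) \<le> B / R" for x
    proof -
      have "gradient k x = (1/R) *\<^sub>R gradient \<kappa> ((1/R) *\<^sub>R x)"
        unfolding gradient_def k(4) by (simp add: scaleR_sum_right)
      then show ?thesis using B(2)[of "(1/R) *\<^sub>R x"] R0 by (simp add: divide_right_mono)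
    qed
    have g0: "gradient k x = 0" if "x \<notin> ?Q" for x
      using that k(2) by (intro gradient_eq_0_outside[of ?Q]) auto
    have gQ: "norm (gradient k x) \<le> B / R * indicator ?Q x" for x
      using gB[of x] g0[of x] by (auto simp: indicator_def)
    have iQ: "integrable lebesgue (indicat_real ?Q)" "(\<integral>x. indicat_real ?Q x \<partial>lebesgue) = V"
      using emeasure_lborel_cbox_finite[of "- (R *\<^sub>R One)" "R *\<^sub>R (One::'a)"] VQ by auto
    have Zg: "AE x in lebesgue. norm (Z x \<bullet> gradient k x) \<le> B / R * norm (indicat_real ?Q x)"
      using Z(2)
    proof eventually_elim
      case (elim x)
      have "norm (Z x \<bullet> gradient k x) \<le> norm (Z x) * norm (gradient k x)"
        using Cauchy_Schwarz_ineq2 by simp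
      also have "\<dots> \<le> 1 * (B / R * indicator ?Q x)" using elim gQ[of x] by (intro mult_mono) auto
      finally show ?case by simp
    qed
    have Zgm: "(\<lambda>x. Z x \<bullet> gradient k x) \<in> borel_measurable lebesgue" by (intro borel_measurable_inner Zm gm)
    note Zg2 = L2_dominated[OF indicator_cube_L2(1) Zgm Zg]
    have BV: "(B / R)\<^sup>2 * V \<le> 4 * B\<^sup>2"
    proof -
      have "(B / R)\<^sup>2 * V \<le> (B / R)\<^sup>2 * (4 * R\<^sup>2)" by (intro mult_left_mono V) simp
      then show ?thesis using R0 by (simp add: power_divide)
    qed
    obtain m where m: "(\<lambda>x. indicator ?Q x * (d x - m)) \<in> L2"
        "L2sq (\<lambda>x. indicator ?Q x * (d x - m)) \<le> ?P * R\<^sup>2 * A"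
      unfolding A_def using Poincare[OF d R0] by blast
    let ?F = "\<lambda>x. indicator ?Q x * (d x - m)"
    have kd: "(\<integral>x. k x * d x \<partial>lebesgue) = (\<integral>x. k x \<bullet> ?F x \<partial>lebesgue) + m * (R ^ ?n * ?I)"
      using L2_compact_D1(3)[OF kL kQ d, of m] k(3) by simp
    \<comment> \<open>The weak divergence turns the weighted integral of \<open>d\<close> into one
      of Z \<cdot> grad k, so |Z| \<le> 1 bounds it by B / R times the volume.\<close>
    have t1: "\<bar>\<integral>x. k x * d x \<partial>lebesgue\<bar> \<le> B / R * V"
    proof -
      have e1: "(\<integral>x. k x * d x \<partial>lebesgue) = - (\<integral>x. Z x \<bullet> gradient k x \<partial>lebesgue)"
        using Z(1) k(1) by (simp add: has_weak_divergence_def mult.commute)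
      have e2: "norm (\<integral>x. Z x \<bullet> gradient k x \<partial>lebesgue) \<le> (\<integral>x. B / R * norm (indicat_real ?Q x) \<partial>lebesgue)"
        using iQ(1) Zg by (intro norm_integral_le) auto
      have e3: "(\<integral>x. B / R * norm (indicat_real ?Q x) \<partial>lebesgue) = B / R * V"
        using iQ(2) by simp
      show ?thesis using e2 unfolding e1 e3 by simp
    qed
    have t2: "(\<integral>x. k x \<bullet> ?F x \<partial>lebesgue)\<^sup>2 \<le> V * (?P * R\<^sup>2 * A)"
    proof -
      have "L2sq k \<le> 1\<^sup>2 * L2sq (indicat_real ?Q)"
      proof (rule L2_dominated(2)[OF indicator_cube_L2(1)])
        show "k \<in> borel_measurable lebesgue" using kL by (simp add: L2_def)
        show "AE x in lebesgue. norm (k x) \<le> 1 * norm (indicat_real ?Q x)"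
          using k01 k(2) by (intro AE_I2) (auto simp: indicator_def)
      qed
      then have "L2sq k \<le> V" by (simp add: indicator_cube_L2(2) VQ)
      then have "L2sq k * L2sq ?F \<le> V * (?P * R\<^sup>2 * A)"
        using V(1) by (intro mult_mono m(2) L2sq_nonneg) auto
      with L2_Cauchy_Schwarz[OF kL m(1)] show ?thesis by simp
    qed
    \<comment> \<open>The identity \<open>kd\<close> is solved for m. The mass of the cutoff is R^n
      I = V I / 2^n, whose square is V^2 \<open>c0\<close>.\<close>
    have "(m * (R ^ ?n * ?I))\<^sup>2 \<le> 2 * (\<integral>x. k x * d x \<partial>lebesgue)\<^sup>2 + 2 * (\<integral>x. k x \<bullet> ?F x \<partial>lebesgue)\<^sup>2"
    proof -
      have "m * (R ^ ?n * ?I) = (\<integral>x. k x * d x \<partial>lebesgue) - (\<integral>x. k x \<bullet> ?F x \<partial>lebesgue)" using kd by simp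
      moreover have "(a - b)\<^sup>2 \<le> 2 * a\<^sup>2 + 2 * b\<^sup>2" for a b :: real
        using zero_le_power2[of "a + b"] by (simp add: power2_eq_square algebra_simps)
      ultimately show ?thesis by simp
    qed
    also have "\<dots> \<le> 2 * (B / R * V)\<^sup>2 + 2 * (V * (?P * R\<^sup>2 * A))"
    proof -
      have "(\<integral>x. k x * d x \<partial>lebesgue)\<^sup>2 \<le> (B / R * V)\<^sup>2"
        using t1 by (metis abs_ge_zero power2_abs power_mono)
      with t2 show ?thesis by simp
    qed
    finally have "m\<^sup>2 * (V\<^sup>2 * c0) \<le> 2 * (B / R * V)\<^sup>2 + 2 * (V * (?P * R\<^sup>2 * A))"
      by (simp add: V_def c0_def power_mult_distrib power_divide)
    then have "V * (m\<^sup>2 * V * c0) \<le> V * (2 * ((B / R)\<^sup>2 * V) + 2 * (?P * R\<^sup>2 * A))"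
      by (simp add: power2_eq_square algebra_simps)
    then have "m\<^sup>2 * V * c0 \<le> 2 * ((B / R)\<^sup>2 * V) + 2 * (?P * R\<^sup>2 * A)"
      using V(1) by (rule mult_left_le_imp_le)
    also have "\<dots> \<le> 8 * B\<^sup>2 + 2 * (?P * R\<^sup>2 * A)" using BV by linarith
    \<comment> \<open>R \<ge> 1 absorbs the constant, so that all terms scale like R^2.\<close>
    also have "\<dots> \<le> R\<^sup>2 * (8 * B\<^sup>2) + 2 * (?P * R\<^sup>2 * A)"
      using R mult_right_mono[of 1 "R\<^sup>2" "8 * B\<^sup>2"] by simp
    finally have "m\<^sup>2 * V * c0 \<le> R\<^sup>2 * (8 * B\<^sup>2 + 2 * ?P * A)" by (simp add: algebra_simps)
    then have mV: "m\<^sup>2 * V \<le> R\<^sup>2 * ((8 * B\<^sup>2 + 2 * ?P * A) / c0)"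
      using c0 by (simp add: pos_le_divide_eq)
    have dQ: "(\<lambda>x. indicator ?Q x * d x) \<in> L2" by (rule D1_cube_L2[OF d])
    have "L2sq (\<lambda>x. indicator ?Q x * d x) \<le> 2 * L2sq ?F + 2 * (m\<^sup>2 * V)"
    proof -
      have "(\<lambda>x. indicator ?Q x * d x) = (\<lambda>x. ?F x + m *\<^sub>R indicator ?Q x)" by (auto simp: algebra_simps)
      then show ?thesis
        using L2_add(2)[OF m(1) L2_scaleR(1)[OF indicator_cube_L2(1)[of R]], of m]
          L2_scaleR(2)[OF indicator_cube_L2(1)[of R, where 'a='a], of m]
        by (simp only: indicator_cube_L2(2) VQ)
    qed
    also have "\<dots> \<le> 2 * (?P * R\<^sup>2 * A) + 2 * (R\<^sup>2 * ((8 * B\<^sup>2 + 2 * ?P * A) / c0))"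
      using m(2) mV by simp
    also have "\<dots> = R\<^sup>2 * K" by (simp add: K_def algebra_simps)
    finally have dQK: "L2sq (\<lambda>x. indicator ?Q x * d x) \<le> R\<^sup>2 * K" .
    note wd = D1_weak_gradient[OF d]
    have wdm: "weak_gradient d \<in> borel_measurable lebesgue" using wd(2) by (simp add: L2_def)
    have km: "k \<in> borel_measurable lebesgue" using kL by (simp add: L2_def)
    have "AE x in lebesgue. norm (k x *\<^sub>R weak_gradient d x) \<le> 1 * norm (weak_gradient d x)"
      using k01 by (intro AE_I2) (simp add: mult_left_le_one_le)
    from L2_dominated[OF wd(2) borel_measurable_scaleR[OF km wdm] this]
    have p1: "(\<lambda>x. k x *\<^sub>R weak_gradient d x) \<in> L2" "L2sq (\<lambda>x. k x *\<^sub>R weak_gradient d x) \<le> A"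
      by (simp_all add: A_def D1_inner_self)
    have "AE x in lebesgue. norm (d x *\<^sub>R gradient k x) \<le> (B / R) * norm (indicator ?Q x * d x)"
    proof (rule AE_I2)
      fix x
      show "norm (d x *\<^sub>R gradient k x) \<le> (B / R) * norm (indicator ?Q x * d x)"
        using mult_left_mono[OF gQ[of x], of "\<bar>d x\<bar>"] by (simp add: abs_mult mult_ac)
    qed
    note p2 = L2_dominated[OF dQ borel_measurable_scaleR[OF dm gm] this]
    have "L2sq (\<lambda>x. d x *\<^sub>R gradient k x) \<le> B\<^sup>2 * K"
    proof -
      have "(B / R)\<^sup>2 * L2sq (\<lambda>x. indicator ?Q x * d x) \<le> (B / R)\<^sup>2 * (R\<^sup>2 * K)"
        by (intro mult_left_mono dQK) simp
      also have "\<dots> = B\<^sup>2 * K" using R0 by (simp add: power_divide)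
      finally show ?thesis using p2(2) by linarith
    qed
    with p1(2) have sq: "L2sq (\<lambda>x. k x *\<^sub>R weak_gradient d x + d x *\<^sub>R gradient k x) \<le> 2 * A + 2 * (B\<^sup>2 * K)"
      using L2_add(2)[OF p1(1) p2(1)] by linarith
    note wk = has_weak_gradient_mult[OF wd(1) k(1)]
    note L = L2_add(1)[OF p1(1) p2(1)]
    have "D1_inner (\<lambda>x. k x * d x) (\<lambda>x. k x * d x) \<le> M"
      using D1_inner_self_eq[OF wk L] sq zero_le_power2[of B] unfolding M_def by linarith
    moreover have "(\<lambda>x. k x * d x) \<in> D1" by (rule D1I[OF wk L])
    moreover have "L2sq (\<lambda>x. Z x \<bullet> gradient k x) \<le> M"
    proof -
      have "L2sq (\<lambda>x. Z x \<bullet> gradient k x) \<le> (B / R)\<^sup>2 * V"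
        using Zg2(2) by (simp only: indicator_cube_L2(2) VQ)
      moreover have "0 \<le> B\<^sup>2 * K" using K by simp
      ultimately show ?thesis using BV A unfolding M_def by linarith
    qed
    ultimately show ?thesis using Zg2(1) gB g0 by simp
  qed
  show ?thesis
    using main[OF _ refl] by (intro that[of M B]) blast+
qed

text \<open>The derivative falls on the mollifier. Testing the weak divergence of \<open>Z\<close>
  with \<rho>(x - s) k(s) then produces, by the product rule, the term with \<open>d\<close> and the
  commutator Z \<cdot> grad k.\<close>

lemma divergence_mollified_cutoff:
  fixes Z :: "'a::euclidean_space \<Rightarrow> 'a"
  assumes Z: "has_weak_divergence Z d" and \<rho>: "\<rho> \<in> test_functions" and k: "k \<in> test_functions"
  shows "divergence (conv \<rho> (\<lambda>s. k s *\<^sub>R Z s)) x = conv \<rho> (\<lambda>s. k s * d s) x + conv \<rho> (\<lambda>s. Z s \<bullet> gradient k s) x"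
proof -
  have ZL: "Z \<in> L1_loc" and dL: "d \<in> L1_loc" using Z by (auto simp: has_weak_divergence_def)
  have iZ: "integrable lebesgue (\<lambda>s. k s *\<^sub>R Z s)" by (rule integrable_lebesgue_test_function[OF ZL k])
  note r = reflected_test_function[OF \<rho>, of x]
  note \<eta> = gradient_mult[OF r(1) k]
  have gr: "gradient (\<lambda>s. \<rho> (x - s)) s = - gradient \<rho> (x - s)" for s
    unfolding gradient_def r(2) by (simp add: sum_negf)
  have kr: "(\<lambda>s. k s *\<^sub>R gradient (\<lambda>s. \<rho> (x - s)) s) \<in> test_functions"
    using k gradient_test_functions[OF r(1)]
    by (intro test_functions_bilinear[OF bounded_bilinear_scaleR]) (auto simp: test_functions_iff)
  have rk: "(\<lambda>s. \<rho> (x - s) *\<^sub>R gradient k s) \<in> test_functions"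
    using r(1) gradient_test_functions[OF k]
    by (intro test_functions_bilinear[OF bounded_bilinear_scaleR]) (auto simp: test_functions_iff)
  have i1: "integrable lebesgue (\<lambda>s. Z s \<bullet> (k s *\<^sub>R gradient (\<lambda>s. \<rho> (x - s)) s))"
    and i2: "integrable lebesgue (\<lambda>s. Z s \<bullet> (\<rho> (x - s) *\<^sub>R gradient k s))"
    by (intro integrable_lebesgue_test_field ZL kr rk)+
  have "divergence (conv \<rho> (\<lambda>s. k s *\<^sub>R Z s)) x = (\<Sum>b\<in>Basis. conv (\<lambda>z. frechet_derivative \<rho> (at z) b) (\<lambda>s. k s *\<^sub>R Z s) x \<bullet> b)"
    unfolding divergence_def frechet_derivative_conv[OF \<rho> iZ] ..
  also have "\<dots> = (\<Sum>b\<in>Basis. \<integral>s. (frechet_derivative \<rho> (at (x - s)) b *\<^sub>R k s *\<^sub>R Z s) \<bullet> b \<partial>lebesgue)"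
    unfolding conv_def
    by (intro sum.cong refl integral_inner_left[symmetric] conv_integrable[OF test_functions_deriv[OF \<rho>] iZ])
  also have "\<dots> = (\<integral>s. (\<Sum>b\<in>Basis. (frechet_derivative \<rho> (at (x - s)) b *\<^sub>R k s *\<^sub>R Z s) \<bullet> b) \<partial>lebesgue)"
    by (intro Bochner_Integration.integral_sum[symmetric] integrable_inner_left conv_integrable[OF test_functions_deriv[OF \<rho>] iZ])
  also have "\<dots> = (\<integral>s. - (Z s \<bullet> (k s *\<^sub>R gradient (\<lambda>s. \<rho> (x - s)) s)) \<partial>lebesgue)"
  proof (intro Bochner_Integration.integral_cong refl)
    fix s
    have "Z s \<bullet> gradient \<rho> (x - s) = (\<Sum>b\<in>Basis. frechet_derivative \<rho> (at (x - s)) b * (Z s \<bullet> b))"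
      by (metis gradient_inner inner_commute)
    then show "(\<Sum>b\<in>Basis. (frechet_derivative \<rho> (at (x - s)) b *\<^sub>R k s *\<^sub>R Z s) \<bullet> b) = - (Z s \<bullet> (k s *\<^sub>R gradient (\<lambda>s. \<rho> (x - s)) s))"
      by (simp add: gr sum_distrib_left mult_ac)
  qed
  also have "\<dots> = - (\<integral>s. Z s \<bullet> (k s *\<^sub>R gradient (\<lambda>s. \<rho> (x - s)) s) \<partial>lebesgue)" by simp
  also have "\<dots> = (\<integral>s. Z s \<bullet> (\<rho> (x - s) *\<^sub>R gradient k s) \<partial>lebesgue) - (\<integral>s. Z s \<bullet> gradient (\<lambda>s. \<rho> (x - s) * k s) s \<partial>lebesgue)"
    unfolding \<eta>(2) inner_add_right by (simp only: Bochner_Integration.integral_add[OF i2 i1])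
  also have "(\<integral>s. Z s \<bullet> gradient (\<lambda>s. \<rho> (x - s) * k s) s \<partial>lebesgue) = - (\<integral>s. d s * (\<rho> (x - s) * k s) \<partial>lebesgue)"
    using Z \<eta>(1) unfolding has_weak_divergence_def by blast
  finally show ?thesis
    by (simp add: conv_def[of _ "\<lambda>s. k s * d s"] conv_def[of _ "\<lambda>s. d s * k s"] conv_def[of _ "\<lambda>s. Z s \<bullet> gradient k s"] mult_ac)
qed

section \<open>Duality inequality between bounded fields and the total variation\<close>

lemma norm_conv_le:
  fixes g :: "'a::euclidean_space \<Rightarrow> 'b::euclidean_space"
  assumes \<rho>: "\<rho> \<in> test_functions" "\<And>x. 0 \<le> \<rho> x" "(\<integral>x. \<rho> x \<partial>lborel) = 1" and g: "AE x in lebesgue. norm (g x) \<le> C"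
  shows "norm (conv \<rho> g x) \<le> C"
proof -
  note r = reflected_test_function(1)[OF \<rho>(1), of x]
  have "integrable lebesgue (\<lambda>s. \<rho> (x - s))"
    using test_functions_integrable[OF r] test_functions_measurable[OF r] by (simp add: integrable_lebesgue_lborel)
  moreover have "AE s in lebesgue. norm (\<rho> (x - s) *\<^sub>R g s) \<le> \<rho> (x - s) * C"
    using g by eventually_elim (simp add: mult_left_mono \<rho>(2))
  ultimately have "norm (conv \<rho> g x) \<le> (\<integral>s. \<rho> (x - s) * C \<partial>lebesgue)"
    unfolding conv_def by (intro norm_integral_le) auto
  also have "\<dots> = (\<integral>s. \<rho> (x - s) \<partial>lborel) * C"
    using test_functions_measurable[OF r] by (simp add: integral_lebesgue_lborel)
  also have "\<dots> = C" using lborel_integral_reflect[OF test_functions_measurable[OF \<rho>(1)]] \<rho>(3) by simp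
  finally show ?thesis .
qed

lemma test_function_D1_inner: "\<eta> \<in> test_functions \<Longrightarrow> D1_inner \<eta> \<eta> = L2sq (gradient \<eta>)"
  by (intro D1_inner_self_eq has_weak_gradient_test_function test_functions_L2 gradient_test_functions)

text \<open>Mollified cutoffs of \<open>Z\<close> are admissible in \<open>TV\<close>. Their
  divergences split into the mollified \<open>p j\<close>, with energy bounded uniformly in both
  parameters, and the mollified commutator \<open>q j\<close>, whose energy is bounded with a
  constant depending on the mollifier. Hence j is chosen after i. Weak convergence with bounded
  energy suffices, because every element of E^-1 is continuous for it.\<close>

lemma pairing_le_TV:
  fixes Z :: "'a::euclidean_space \<Rightarrow> 'a"
  assumes n: "DIM('a) \<le> 2" and \<psi>: "\<psi> \<in> L2" "compact_support \<psi>" and w: "w \<in> D_neg1"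
    and Z: "has_weak_divergence Z d" "AE x in lebesgue. norm (Z x) \<le> 1" and d: "d \<in> D1"
  shows "ereal (- E_sum \<psi> w c d) \<le> TV (E_sum \<psi> w c)"
proof -
  let ?y = "E_sum \<psi> w c"
  have ZL: "Z \<in> L1_loc" and dL: "d \<in> L1_loc" using Z by (auto simp: has_weak_divergence_def)
  obtain \<kappa> :: "'a \<Rightarrow> real" where \<kappa>: "\<kappa> \<in> test_functions" "\<And>x. 0 \<le> \<kappa> x" "\<And>x. \<kappa> x \<le> 1" "\<kappa> 0 = 1"
      "\<And>x. x \<notin> box (- One) One \<Longrightarrow> \<kappa> x = 0"
    by (rule cutoff_exists) (rule that; assumption)
  have \<kappa>Q: "\<kappa> x = 0" if "x \<notin> cube 1" for x using \<kappa>(5)[of x] that box_subset_cbox by force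
  have "0 < (\<integral>x. \<kappa> x \<partial>lborel)" using \<kappa>(4) by (intro test_function_integral_pos[where y=0] \<kappa>) simp
  then have I: "0 < (\<integral>x. \<kappa> x \<partial>lebesgue)" using test_functions_measurable[OF \<kappa>(1)] by (simp add: integral_lebesgue_lborel)
  define k where "k j = (\<lambda>x. \<kappa> ((1 / real (Suc j)) *\<^sub>R x))" for j
  obtain M B where MB: "\<And>R. R \<ge> 1 \<Longrightarrow> D1_inner (\<lambda>x. \<kappa> ((1/R) *\<^sub>R x) * d x) (\<lambda>x. \<kappa> ((1/R) *\<^sub>R x) * d x) \<le> M"
    "\<And>R. R \<ge> 1 \<Longrightarrow> (\<lambda>x. \<kappa> ((1/R) *\<^sub>R x) * d x) \<in> D1"
    "\<And>R. R \<ge> 1 \<Longrightarrow> (\<lambda>x. Z x \<bullet> gradient (\<lambda>x. \<kappa> ((1/R) *\<^sub>R x)) x) \<in> L2"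
    "\<And>R. R \<ge> 1 \<Longrightarrow> L2sq (\<lambda>x. Z x \<bullet> gradient (\<lambda>x. \<kappa> ((1/R) *\<^sub>R x)) x) \<le> M"
    "\<And>R x. R \<ge> 1 \<Longrightarrow> norm (gradient (\<lambda>x. \<kappa> ((1/R) *\<^sub>R x)) x) \<le> B / R"
    "\<And>R x. R \<ge> 1 \<Longrightarrow> x \<notin> cube R \<Longrightarrow> gradient (\<lambda>x. \<kappa> ((1/R) *\<^sub>R x)) x = 0"
  proof (rule cutoff_divergence_bounded[OF n \<kappa>(1-3) _ I Z d])
    show "\<kappa> x = 0" if "x \<notin> cube 1" for x by (rule \<kappa>Q[OF that])
  qed (rule that; assumption)
  have kt: "k j \<in> test_functions" for j
    unfolding k_def by (rule scaled_test_function(1)[OF \<kappa>(1) \<kappa>Q]) simp_all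
  have kout: "k j x = 0" if "norm x > real (Suc j) * DIM('a)" for j x
    unfolding k_def using that norm_le_cube[of x "real (Suc j)"]
    by (intro scaled_test_function(2)[OF \<kappa>(1) \<kappa>Q]) auto
  have kb: "\<bar>k j x\<bar> \<le> 1" for j x using \<kappa>(2,3) by (simp add: k_def)
  define p where "p j = (\<lambda>x. k j x * d x)" for j
  define q where "q j = (\<lambda>x. Z x \<bullet> gradient (k j) x)" for j
  have pD: "p j \<in> D1" "D1_inner (p j) (p j) \<le> M" for j
    unfolding p_def k_def by (intro MB; simp)+
  have qL: "q j \<in> L2" "L2sq (q j) \<le> M" for j
    unfolding q_def k_def by (intro MB; simp)+
  have ip: "integrable lebesgue (p j)" for j
    using integrable_lebesgue_test_function[OF dL kt] by (simp add: p_def)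
  have iq: "integrable lebesgue (q j)" for j
    unfolding q_def by (rule integrable_lebesgue_test_field[OF ZL gradient_test_functions[OF kt]])
  have qout: "q j s = 0" if "norm s > real (Suc j) * DIM('a)" for j s
  proof -
    have "s \<notin> cube (real (Suc j))" using that norm_le_cube[of s "real (Suc j)"] by auto
    then have "gradient (k j) s = 0" unfolding k_def by (intro MB(6)) simp_all
    then show ?thesis by (simp add: q_def)
  qed
  have pout: "p j s = 0" if "norm s > real (Suc j) * DIM('a)" for j s
    using kout[OF that] by (simp add: p_def)
  have qb: "AE x in lebesgue. norm (q j x) \<le> B / real (Suc j)" for j
    using Z(2)
  proof eventually_elim
    case (elim x)
    have "norm (q j x) \<le> norm (Z x) * norm (gradient (k j) x)"
      unfolding q_def using Cauchy_Schwarz_ineq2 by simp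
    also have "\<dots> \<le> 1 * (B / real (Suc j))"
      using elim MB(5)[of "real (Suc j)" x] by (intro mult_mono) (auto simp: k_def)
    finally show ?case by simp
  qed
  have "\<exists>\<rho> :: 'a \<Rightarrow> real. \<rho> \<in> test_functions \<and> (\<forall>x. 0 \<le> \<rho> x) \<and> (\<integral>x. \<rho> x \<partial>lborel) = 1 \<and> (\<forall>x. x \<notin> cube (1 / real (Suc i)) \<longrightarrow> \<rho> x = 0)" for i
    using mollifier_exists[of "1 / real (Suc i)"] by (metis of_nat_0_less_iff zero_less_Suc zero_less_divide_1_iff)
  then obtain \<rho> :: "nat \<Rightarrow> 'a \<Rightarrow> real" where \<rho>: "\<And>i. \<rho> i \<in> test_functions" "\<And>i x. 0 \<le> \<rho> i x" "\<And>i. (\<integral>x. \<rho> i x \<partial>lborel) = 1"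
      "\<And>i x. x \<notin> cube (1 / real (Suc i)) \<Longrightarrow> \<rho> i x = 0" by metis
  have qt: "conv (\<rho> i) (q j) \<in> test_functions" for i j by (rule conv_test_functions[OF \<rho>(1) iq qout])
  have pt: "conv (\<rho> i) (p j) \<in> test_functions" for i j by (rule conv_test_functions[OF \<rho>(1) ip pout])
  \<comment> \<open>For a fixed mollifier the commutator is O(1/j) uniformly, while its
    \<open>L2\<close> bound and the derivatives of the mollifier bound its energy; so it tends to
    zero weakly.\<close>
  have qlim: "(\<lambda>j. ?y (conv (\<rho> i) (q j))) \<longlonglongrightarrow> 0" for i
  proof -
    define C where "C = (\<Sum>b\<in>Basis. (\<integral>x. \<bar>frechet_derivative (\<rho> i) (at x) b\<bar> \<partial>lborel)\<^sup>2 * M)"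
    have "(\<lambda>j. ?y (conv (\<rho> i) (q j))) \<longlonglongrightarrow> ?y (\<lambda>x. 0)"
    proof (rule E_neg1_weak_convergence[OF \<psi> w _ _ D1_const])
      show "conv (\<rho> i) (q j) \<in> D1" for j by (rule test_functions_D1[OF qt])
      show "D1_inner (conv (\<rho> i) (q j)) (conv (\<rho> i) (q j)) \<le> C" for j
        unfolding test_function_D1_inner[OF qt] L2sq_gradient[OF qt] C_def
      proof (rule sum_mono)
        fix b :: 'a
        have "L2sq (conv (\<lambda>z. frechet_derivative (\<rho> i) (at z) b) (q j)) \<le>
            (\<integral>x. \<bar>frechet_derivative (\<rho> i) (at x) b\<bar> \<partial>lborel)\<^sup>2 * L2sq (q j)"
          by (rule conv_L2(2)[OF test_functions_deriv[OF \<rho>(1)] qL(1)])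
        also have "\<dots> \<le> (\<integral>x. \<bar>frechet_derivative (\<rho> i) (at x) b\<bar> \<partial>lborel)\<^sup>2 * M"
          by (intro mult_left_mono qL) simp
        finally show "L2sq (\<lambda>x. frechet_derivative (conv (\<rho> i) (q j)) (at x) b) \<le>
            (\<integral>x. \<bar>frechet_derivative (\<rho> i) (at x) b\<bar> \<partial>lborel)\<^sup>2 * M"
          unfolding frechet_derivative_conv[OF \<rho>(1) iq] .
      qed
      fix \<eta> :: "'a \<Rightarrow> real" assume \<eta>: "\<eta> \<in> test_functions"
      have i\<eta>: "integrable lebesgue (\<lambda>x. \<bar>\<eta> x\<bar>)"
        using test_functions_integrable[OF \<eta>] test_functions_measurable[OF \<eta>] by (simp add: integrable_lebesgue_lborel)
      have lim0: "(\<lambda>j. B * (\<integral>x. \<bar>\<eta> x\<bar> \<partial>lebesgue) / real (Suc j)) \<longlonglongrightarrow> 0"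
        by (rule LIMSEQ_Suc[OF lim_const_over_n])
      have "norm (\<integral>x. conv (\<rho> i) (q j) x * \<eta> x \<partial>lebesgue) \<le> B * (\<integral>x. \<bar>\<eta> x\<bar> \<partial>lebesgue) / real (Suc j)" for j
      proof -
        have "norm (\<integral>x. conv (\<rho> i) (q j) x * \<eta> x \<partial>lebesgue) \<le> (\<integral>x. B / real (Suc j) * \<bar>\<eta> x\<bar> \<partial>lebesgue)"
        proof (rule norm_integral_le)
          show "AE x in lebesgue. norm (conv (\<rho> i) (q j) x * \<eta> x) \<le> B / real (Suc j) * \<bar>\<eta> x\<bar>"
          proof (rule AE_I2)
            fix x
            have "norm (conv (\<rho> i) (q j) x) * \<bar>\<eta> x\<bar> \<le> B / real (Suc j) * \<bar>\<eta> x\<bar>"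
              by (intro mult_right_mono norm_conv_le[OF \<rho>(1-3) qb]) simp
            then show "norm (conv (\<rho> i) (q j) x * \<eta> x) \<le> B / real (Suc j) * \<bar>\<eta> x\<bar>"
              by (simp add: abs_mult)
          qed
        qed (use i\<eta> in simp)
        then show ?thesis by simp
      qed
      then have "(\<lambda>j. \<integral>x. conv (\<rho> i) (q j) x * \<eta> x \<partial>lebesgue) \<longlonglongrightarrow> 0"
        by (intro Lim_null_comparison[OF _ lim0] always_eventually allI)
      then show "(\<lambda>j. \<integral>x. conv (\<rho> i) (q j) x * \<eta> x \<partial>lebesgue) \<longlonglongrightarrow> (\<integral>x. 0 * \<eta> x \<partial>lebesgue)" by simp
    qed
    then show ?thesis using E_sum_zero[OF \<psi> w] by simp
  qed
  have "\<exists>j\<ge>i. \<bar>?y (conv (\<rho> i) (q j))\<bar> < 1 / real (Suc i)" for i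
  proof -
    obtain N where "\<And>j. j \<ge> N \<Longrightarrow> \<bar>?y (conv (\<rho> i) (q j))\<bar> < 1 / real (Suc i)"
      using LIMSEQ_D[OF qlim[of i], of "1 / real (Suc i)"] by auto
    then show ?thesis by (intro exI[of _ "max i N"]) simp
  qed
  \<comment> \<open>J i \<ge> i also makes the cutoff radii tend to infinity, so that k (J i) tends
    to 1 pointwise.\<close>
  then obtain J where J: "\<And>i. J i \<ge> i" "\<And>i. \<bar>?y (conv (\<rho> i) (q (J i)))\<bar> < 1 / real (Suc i)" by metis
  have plim: "(\<lambda>i. ?y (conv (\<rho> i) (p (J i)))) \<longlonglongrightarrow> ?y d"
  proof (rule E_neg1_weak_convergence[OF \<psi> w _ _ d])
    show "conv (\<rho> i) (p (J i)) \<in> D1" for i by (rule test_functions_D1[OF pt])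
    show "D1_inner (conv (\<rho> i) (p (J i))) (conv (\<rho> i) (p (J i))) \<le> M" for i
    proof -
      note wp = D1_weak_gradient[OF pD(1)[of "J i"]]
      have kG: "AE x in lebesgue. weak_gradient (p (J i)) x =
          k (J i) x *\<^sub>R weak_gradient d x + d x *\<^sub>R gradient (k (J i)) x"
        unfolding p_def by (rule weak_gradient_AE_eq[OF has_weak_gradient_mult[OF D1_weak_gradient(1)[OF d] kt]])
      let ?G = "\<lambda>x. k (J i) x *\<^sub>R weak_gradient d x + d x *\<^sub>R gradient (k (J i)) x"
      have wk: "has_weak_gradient (p (J i)) ?G"
        unfolding p_def by (rule has_weak_gradient_mult[OF D1_weak_gradient(1)[OF d] kt])
      have G2: "?G \<in> L2" "L2sq ?G = L2sq (weak_gradient (p (J i)))"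
        using L2_cong_AE[OF wp(2) has_weak_gradient_measurable(2)[OF wk] kG] by auto
      have iG: "integrable lebesgue ?G"
      proof -
        have 1: "integrable lebesgue (\<lambda>x. k (J i) x *\<^sub>R weak_gradient d x)"
          using D1_weak_gradient(1)[OF d] by (intro integrable_lebesgue_test_function kt) (simp add: has_weak_gradient_def)
        define r where "r = real (Suc (J i)) * DIM('a)"
        have "integrable lebesgue (\<lambda>x. indicator (cball 0 r) x *\<^sub>R ?G x)"
          using wk by (simp add: has_weak_gradient_def L1_loc_iff_cball)
        moreover have "indicator (cball 0 r) x *\<^sub>R ?G x = ?G x" for x
        proof (cases "norm x > r")
          case True
          then have "k (J i) x = 0" unfolding r_def by (rule kout)
          moreover have "gradient (k (J i)) x = 0"
            using True kout by (intro gradient_eq_0_outside[of "cball 0 r"]) (auto simp: r_def)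
          ultimately show ?thesis by simp
        qed simp
        ultimately show ?thesis by (simp only:)
      qed
      \<comment> \<open>Here the derivative is put on \<open>p (J i)\<close> rather than on the
        mollifier, whose integral is 1; the energy bound M therefore holds for every i.\<close>
      have eq: "gradient (conv (\<rho> i) (p (J i))) = conv (\<rho> i) ?G"
        by (rule ext) (rule gradient_conv_weak[OF \<rho>(1) wk ip iG pout])
      have "L2sq (conv (\<rho> i) ?G) \<le> (\<integral>x. \<bar>\<rho> i x\<bar> \<partial>lborel)\<^sup>2 * L2sq ?G" by (rule conv_L2(2)[OF \<rho>(1) G2(1)])
      also have "(\<integral>x. \<bar>\<rho> i x\<bar> \<partial>lborel) = 1" using \<rho>(2,3) by simp
      finally show ?thesis
        unfolding test_function_D1_inner[OF pt] eq using pD(2)[of "J i"] by (simp add: G2(2) D1_inner_self)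
    qed
    fix \<eta> :: "'a \<Rightarrow> real" assume \<eta>: "\<eta> \<in> test_functions"
    obtain b where b: "\<And>x. norm (\<eta> x) \<le> b" using test_functions_bounded[OF \<eta>] by blast
    obtain r where r: "\<And>x. norm x > r \<Longrightarrow> \<eta> x = 0" using test_functions_support[OF \<eta>] by blast
    obtain L where L: "\<And>x h. norm (frechet_derivative \<eta> (at x) h) \<le> L * norm h"
      using test_functions_deriv_bound[OF \<eta>] by metis
    define m where "m i s = (\<integral>x. \<rho> i x * \<eta> (x + s) \<partial>lborel)" for i s
    note mb = mollified_test_function_bounds[OF \<rho>(1-4) _ \<eta>]
    have m1: "\<bar>m i s\<bar> \<le> b" for i s
      unfolding m_def using b by (intro mb(1)) auto
    have m2: "m i s = 0" if "norm s > r + DIM('a)" for i s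
    proof -
      have "1 / real (Suc i) * DIM('a) \<le> DIM('a)" by (simp add: divide_le_eq)
      then show ?thesis unfolding m_def using that r by (intro mb(2)) auto
    qed
    have m3: "(\<lambda>i. m i s) \<longlonglongrightarrow> \<eta> s" for s
    proof -
      have lim0: "(\<lambda>i. L * real DIM('a) / real (Suc i)) \<longlonglongrightarrow> 0"
        by (rule LIMSEQ_Suc[OF lim_const_over_n])
      have "\<bar>m i s - \<eta> s\<bar> \<le> L * (1 / real (Suc i) * real DIM('a))" for i
        unfolding m_def using L by (intro mb(3)) auto
      then have "norm (m i s - \<eta> s) \<le> L * real DIM('a) / real (Suc i)" for i by simp
      then have "(\<lambda>i. m i s - \<eta> s) \<longlonglongrightarrow> 0"
        by (intro Lim_null_comparison[OF _ lim0] always_eventually allI)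
      then show ?thesis by (simp add: LIM_zero_iff)
    qed
    have kl: "(\<lambda>i. k (J i) s) \<longlonglongrightarrow> 1" for s
    proof -
      have "(\<lambda>j. \<kappa> ((1 / real (Suc j)) *\<^sub>R s)) \<longlonglongrightarrow> \<kappa> (0 *\<^sub>R s)"
      proof (rule isCont_tendsto_compose[of _ \<kappa>])
        show "isCont \<kappa> (0 *\<^sub>R s)" using test_functions_continuous[OF \<kappa>(1)] by (simp add: continuous_on_eq_continuous_at)
        show "(\<lambda>j. (1 / real (Suc j)) *\<^sub>R s) \<longlonglongrightarrow> 0 *\<^sub>R s"
          by (intro tendsto_scaleR tendsto_const LIMSEQ_Suc[OF lim_const_over_n])
      qed
      then have "(\<lambda>j. k j s) \<longlonglongrightarrow> 1" by (simp add: k_def \<kappa>(4))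
      moreover have "filterlim J at_top sequentially"
        using J(1) by (rule filterlim_at_top_mono[OF filterlim_ident always_eventually, rule_format])
      ultimately show ?thesis by (rule filterlim_compose)
    qed
    have "(\<lambda>i. \<integral>s. p (J i) s * m i s \<partial>lebesgue) \<longlonglongrightarrow> (\<integral>s. d s * \<eta> s \<partial>lebesgue)"
    proof (rule integral_dominated_convergence)
      let ?w = "\<lambda>s. b * norm (indicat_real (cball 0 (r + DIM('a))) s *\<^sub>R d s)"
      show "integrable lebesgue ?w"
        using dL by (intro integrable_mult_right integrable_norm) (simp only: L1_loc_iff_cball)
      show "AE s in lebesgue. norm (p (J i) s * m i s) \<le> ?w s" for i
      proof (rule AE_I2)
        fix s
        show "norm (p (J i) s * m i s) \<le> ?w s"
        proof (cases "norm s > r + DIM('a)")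
          case False
          have "\<bar>k (J i) s\<bar> * (\<bar>m i s\<bar> * \<bar>d s\<bar>) \<le> 1 * (b * \<bar>d s\<bar>)"
            using kb[of "J i" s] m1[of i s] by (intro mult_mono) auto
          then show ?thesis using False by (simp add: p_def abs_mult mult_ac)
        qed (simp add: m2)
      qed
      show "AE s in lebesgue. (\<lambda>i. p (J i) s * m i s) \<longlonglongrightarrow> d s * \<eta> s"
      proof (rule AE_I2)
        fix s
        have "(\<lambda>i. k (J i) s * d s * m i s) \<longlonglongrightarrow> 1 * d s * \<eta> s"
          by (intro tendsto_intros kl m3)
        then show "(\<lambda>i. p (J i) s * m i s) \<longlonglongrightarrow> d s * \<eta> s" by (simp add: p_def)
      qed
      show "(\<lambda>s. d s * \<eta> s) \<in> borel_measurable lebesgue"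
        using L1_loc_test_mult_integrable[OF dL \<eta>] by (rule borel_measurable_integrable)
      show "(\<lambda>s. p (J i) s * m i s) \<in> borel_measurable lebesgue" for i
      proof (rule borel_measurable_times[OF borel_measurable_integrable[OF ip]])
        note [measurable] = test_functions_measurable[OF \<rho>(1)] test_functions_measurable[OF \<eta>]
        show "m i \<in> borel_measurable lebesgue"
          unfolding m_def by (intro borel_measurable_lebesgueI) measurable
      qed
    qed
    then show "(\<lambda>i. \<integral>x. conv (\<rho> i) (p (J i)) x * \<eta> x \<partial>lebesgue) \<longlonglongrightarrow> (\<integral>x. d x * \<eta> x \<partial>lebesgue)"
      unfolding conv_against_test_function[OF \<rho>(1) ip \<eta>] m_def .
  qed
  have le: "ereal (- (?y (conv (\<rho> i) (p (J i))) + ?y (conv (\<rho> i) (q (J i))))) \<le> TV ?y" for i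
  proof -
    \<comment> \<open>Averaging with a probability density keeps the bound 1 and makes it hold at
      every point, as \<open>TV\<close> demands.\<close>
    define \<phi> where "\<phi> = conv (\<rho> i) (\<lambda>s. k (J i) s *\<^sub>R Z s)"
    have "\<phi> \<in> test_functions"
      unfolding \<phi>_def using kout
      by (intro conv_test_functions[OF \<rho>(1) integrable_lebesgue_test_function[OF ZL kt], where R="real (Suc (J i)) * DIM('a)"]) auto
    moreover have "norm (\<phi> x) \<le> 1" for x
      unfolding \<phi>_def
    proof (rule norm_conv_le[OF \<rho>(1-3)])
      show "AE s in lebesgue. norm (k (J i) s *\<^sub>R Z s) \<le> 1"
        using Z(2) by eventually_elim (use kb in \<open>simp add: mult_le_one\<close>)
    qed
    moreover have dv: "divergence \<phi> x = 1 * conv (\<rho> i) (p (J i)) x + 1 * conv (\<rho> i) (q (J i)) x" for x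
      unfolding \<phi>_def p_def q_def using divergence_mollified_cutoff[OF Z(1) \<rho>(1) kt] by simp
    have "?y (\<lambda>x. 1 * conv (\<rho> i) (p (J i)) x + 1 * conv (\<rho> i) (q (J i)) x) =
        1 * ?y (conv (\<rho> i) (p (J i))) + 1 * ?y (conv (\<rho> i) (q (J i)))"
      by (rule E_sum_lincomb[OF \<psi> w test_functions_D1[OF pt] test_functions_D1[OF qt]])
    then have ydv: "?y (divergence \<phi>) = ?y (conv (\<rho> i) (p (J i))) + ?y (conv (\<rho> i) (q (J i)))"
      unfolding dv[THEN ext] mult_1 .
    ultimately have "ereal (?y (\<lambda>x. - divergence \<phi> x)) \<le> TV ?y"
      unfolding TV_def by (intro SUP_upper) auto
    moreover have "?y (\<lambda>x. - divergence \<phi> x) = - ?y (divergence \<phi>)"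
      by (intro E_sum_minus \<psi> w test_functions_D1 divergence_test_functions \<open>\<phi> \<in> test_functions\<close>)
    ultimately show ?thesis
      unfolding ydv by simp
  qed
  have "(\<lambda>i. ?y (conv (\<rho> i) (q (J i)))) \<longlonglongrightarrow> 0"
  proof (rule Lim_null_comparison[OF always_eventually])
    show "\<forall>i. norm (?y (conv (\<rho> i) (q (J i)))) \<le> 1 / real (Suc i)" using J(2) by (simp add: less_imp_le)
    show "(\<lambda>i. 1 / real (Suc i)) \<longlonglongrightarrow> 0" by (rule LIMSEQ_Suc[OF lim_const_over_n])
  qed
  from tendsto_minus[OF tendsto_add[OF plim this]]
  have "(\<lambda>i. ereal (- (?y (conv (\<rho> i) (p (J i))) + ?y (conv (\<rho> i) (q (J i)))))) \<longlonglongrightarrow> ereal (- ?y d)"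
    by (simp add: lim_ereal)
  then show ?thesis by (rule LIMSEQ_le_const2) (use le in blast)
qed

subsection \<open>The Hilbert spaces \<open>D\<^sup>-\<^sup>1\<close> and \<open>E\<^sup>-\<^sup>1\<close>\<close>

lemma D_neg1_zero_outside: "w \<in> D_neg1 \<Longrightarrow> f \<notin> D1 \<Longrightarrow> w f = 0"
  by (simp add: D_neg1_def)

lemma D_neg1_combination:
  assumes w: "w \<in> D_neg1" and w': "w' \<in> D_neg1" shows "(\<lambda>f. a * w f + b * w' f) \<in> D_neg1"
proof -
  obtain C where C: "\<And>f. f \<in> D1 \<Longrightarrow> \<bar>w f\<bar> \<le> C * sqrt (D1_inner f f)" using D_neg1_bound[OF w] by blast
  obtain C' where C': "\<And>f. f \<in> D1 \<Longrightarrow> \<bar>w' f\<bar> \<le> C' * sqrt (D1_inner f f)" using D_neg1_bound[OF w'] by blast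
  have "\<bar>a * w f + b * w' f\<bar> \<le> (\<bar>a\<bar> * C + \<bar>b\<bar> * C') * sqrt (D1_inner f f)" if "f \<in> D1" for f
  proof -
    have "\<bar>a * w f + b * w' f\<bar> \<le> \<bar>a\<bar> * \<bar>w f\<bar> + \<bar>b\<bar> * \<bar>w' f\<bar>"
      using abs_triangle_ineq[of "a * w f" "b * w' f"] by (simp add: abs_mult)
    also have "\<dots> \<le> \<bar>a\<bar> * (C * sqrt (D1_inner f f)) + \<bar>b\<bar> * (C' * sqrt (D1_inner f f))"
      by (intro add_mono mult_left_mono C C' that) auto
    finally show ?thesis by (simp add: algebra_simps)
  qed
  then have "\<exists>C. \<forall>f\<in>D1. \<bar>a * w f + b * w' f\<bar> \<le> C * sqrt (D1_inner f f)" by blast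
  then show ?thesis using w w' by (simp add: D_neg1_def algebra_simps)
qed

lemma D_neg1_minus_mem: "w \<in> D_neg1 \<Longrightarrow> w' \<in> D_neg1 \<Longrightarrow> w - w' \<in> D_neg1"
  using D_neg1_combination[of w w' 1 "-1"] by (simp add: fun_diff_def)

text \<open>\<open>inv_into\<close> may return a function other than \<open>p\<close>; the two
  differ by a function of zero energy, on which \<open>w\<close> vanishes.\<close>

lemma D_neg1_inner_eq:
  assumes w: "w \<in> D_neg1" and p: "p \<in> D1" shows "D_neg1_inner w (neg_laplacian p) = w p"
proof -
  define q where "q = inv_into D1 neg_laplacian (neg_laplacian p)"
  have im: "neg_laplacian p \<in> neg_laplacian ` D1" using p by blast
  have q: "q \<in> D1" "neg_laplacian q = neg_laplacian p"
    unfolding q_def by (rule inv_into_into[OF im], rule f_inv_into_f[OF im])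
  have "D1_inner q h = D1_inner p h" if "h \<in> D1" for h
    using fun_cong[OF q(2), of h] that by (simp add: neg_laplacian_def)
  from this[OF D1_diff[OF q(1) p]]
  have "D1_inner (\<lambda>x. q x - p x) (\<lambda>x. q x - p x) = 0"
    using D1_inner_lincomb[OF q(1) p D1_diff[OF q(1) p], of 1 "-1"] by simp
  then show ?thesis using D_neg1_cong[OF w q(1) p] by (simp add: D_neg1_inner_def q_def)
qed

text \<open>The arguments are exchanged by the symmetry of \<open>D1_inner\<close>, which needs a
  Riesz representative of \<open>w\<close> as well.\<close>

lemma D_neg1_inner_neg_laplacian:
  assumes w: "w \<in> D_neg1" and p: "p \<in> D1" shows "D_neg1_inner (neg_laplacian p) w = w p"
proof -
  obtain q where q: "q \<in> D1" "neg_laplacian q = w" using Riesz_D1[OF w] by blast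
  have "D_neg1_inner (neg_laplacian p) (neg_laplacian q) = neg_laplacian p q"
    by (rule D_neg1_inner_eq[OF neg_laplacian_D_neg1[OF p] q(1)])
  also have "\<dots> = neg_laplacian q p" using p q(1) by (simp add: neg_laplacian_def D1_inner_commute)
  finally show ?thesis by (simp add: q(2))
qed

lemma laplacian_eq: "d \<in> D1 \<Longrightarrow> laplacian d = neg_laplacian (\<lambda>x. - d x)"
  using D1_inner_lincomb[of d d _ "-1" 0] by (auto simp: laplacian_def neg_laplacian_def)

lemma D_neg1_const: assumes "w \<in> D_neg1" shows "w (\<lambda>x. r) = 0"
proof -
  have z: "w (\<lambda>x. 0) = 0" using D_neg1_lincomb[OF assms D1_const D1_const, of 0 0 0 0] by simp
  have "D1_inner (\<lambda>x::'a. r - 0) (\<lambda>x. r - 0) = 0"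
    using D1_inner_self_eq[OF has_weak_gradient_const L2_0] by (simp add: L2sq_def)
  from D_neg1_cong[OF assms D1_const D1_const this] z show ?thesis by simp
qed

lemma D_neg1_add_const:
  assumes "w \<in> D_neg1" "f \<in> D1" shows "w (\<lambda>x. f x + r) = w f"
proof -
  have "w (\<lambda>x. 1 * f x + 1 * r) = 1 * w f + 1 * w (\<lambda>x. r)" by (rule D_neg1_lincomb[OF assms D1_const])
  then show ?thesis using D_neg1_const[OF assms(1)] by simp
qed

text \<open>The constant function 1 separates the components: elements of \<open>D_neg1\<close>
  annihilate it and \<psi> has mass 1, so evaluating there returns \<open>c\<close>.\<close>

lemma E_sum_unique:
  assumes w: "w \<in> D_neg1" "w' \<in> D_neg1" and m: "(\<integral>x. \<psi> x \<partial>lebesgue) = 1"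
    and eq: "E_sum \<psi> w c = E_sum \<psi> w' c'"
  shows "w = w'" "c = c'"
proof -
  show c: "c = c'"
    using fun_cong[OF eq, of "\<lambda>x. 1"] w m by (simp add: E_sum_def D1_const D_neg1_const)
  show "w = w'"
  proof (rule D_neg1_eqI[OF w])
    fix f :: "'a \<Rightarrow> real" assume "f \<in> D1"
    then show "w f = w' f" using fun_cong[OF eq, of f] by (simp add: E_sum_def c)
  qed
qed

lemma E_sum_0: "w \<in> D_neg1 \<Longrightarrow> E_sum \<psi> w 0 = w"
  by (auto simp: E_sum_def D_neg1_zero_outside)

lemma E_sum_diff: "E_sum \<psi> w c - E_sum \<psi> w' c' = E_sum \<psi> (w - w') (c - c')"
  by (auto simp: E_sum_def algebra_simps)

lemma E_neg1_inner_eq: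
  assumes m: "(\<integral>x. \<psi> x \<partial>lebesgue) = 1" and w: "w \<in> D_neg1" "w' \<in> D_neg1"
  shows "E_neg1_inner \<psi> (E_sum \<psi> w c) (E_sum \<psi> w' c') = D_neg1_inner w w' + c * c'"
  unfolding E_neg1_inner_def
proof (rule the_equality)
  show "\<exists>w\<^sub>1\<in>D_neg1. \<exists>w\<^sub>2\<in>D_neg1. \<exists>c\<^sub>1 c\<^sub>2. E_sum \<psi> w c = E_sum \<psi> w\<^sub>1 c\<^sub>1 \<and> E_sum \<psi> w' c' = E_sum \<psi> w\<^sub>2 c\<^sub>2 \<and>
      D_neg1_inner w w' + c * c' = D_neg1_inner w\<^sub>1 w\<^sub>2 + c\<^sub>1 * c\<^sub>2"
    using w by blast
  fix r assume "\<exists>w\<^sub>1\<in>D_neg1. \<exists>w\<^sub>2\<in>D_neg1. \<exists>c\<^sub>1 c\<^sub>2. E_sum \<psi> w c = E_sum \<psi> w\<^sub>1 c\<^sub>1 \<and> E_sum \<psi> w' c' = E_sum \<psi> w\<^sub>2 c\<^sub>2 \<and>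
      r = D_neg1_inner w\<^sub>1 w\<^sub>2 + c\<^sub>1 * c\<^sub>2"
  then obtain w1 w2 c1 c2 where *: "w1 \<in> D_neg1" "w2 \<in> D_neg1" "E_sum \<psi> w c = E_sum \<psi> w1 c1"
      "E_sum \<psi> w' c' = E_sum \<psi> w2 c2" "r = D_neg1_inner w1 w2 + c1 * c2" by blast
  then show "r = D_neg1_inner w w' + c * c'"
    using E_sum_unique[OF w(1) *(1) m *(3)] E_sum_unique[OF w(2) *(2) m *(4)] by simp
qed

lemma orthogonal_projection_E_sum:
  assumes m: "(\<integral>x. \<psi> x \<partial>lebesgue) = 1" and w: "w \<in> D_neg1"
  shows "orthogonal_projection (E_neg1_inner \<psi>) D_neg1 (E_sum \<psi> w c) = w"
  unfolding orthogonal_projection_def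
proof (rule the_equality)
  have ip: "E_neg1_inner \<psi> (E_sum \<psi> w c - p) z = D_neg1_inner (w - p) z" if "p \<in> D_neg1" "z \<in> D_neg1" for p z
    using E_neg1_inner_eq[OF m D_neg1_minus_mem[OF w that(1)] that(2), of c 0] E_sum_diff[of \<psi> w c p 0]
    by (simp add: E_sum_0 that)
  show "w \<in> D_neg1 \<and> (\<forall>z\<in>D_neg1. E_neg1_inner \<psi> (E_sum \<psi> w c - w) z = 0)"
    using w by (simp add: ip D_neg1_inner_def)
  fix p assume p: "p \<in> D_neg1 \<and> (\<forall>z\<in>D_neg1. E_neg1_inner \<psi> (E_sum \<psi> w c - p) z = 0)"
  have q: "w - p \<in> D_neg1" using D_neg1_minus_mem w p by blast
  obtain g where g: "g \<in> D1" "neg_laplacian g = w - p" using Riesz_D1[OF q] by blast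
  \<comment> \<open>Orthogonality tested with w - p itself shows that its representative
    \<open>g\<close> has zero energy; Cauchy-Schwarz then makes the functional vanish.\<close>
  have "D_neg1_inner (w - p) (w - p) = 0" using p q ip[of p "w - p"] by auto
  then have g0: "D1_inner g g = 0"
    using D_neg1_inner_eq[OF q g(1)] g by (simp add: neg_laplacian_def flip: g(2))
  have "(w - p) h = 0" if "h \<in> D1" for h
    using D1_Cauchy_Schwarz[OF g(1) that] g0 that by (simp add: neg_laplacian_def flip: g(2))
  then show "p = w" using w p by (intro D_neg1_eqI) auto
qed

subsection \<open>Subgradients are divergences of bounded fields\<close>

text \<open>Fields bounded by 1 need not be square integrable. Multiplied by a square integrable
  weight they are, with a common bound, and positivity everywhere allows the weight to be divided
  out of an almost everywhere limit.\<close>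

lemma positive_L2_weight:
  obtains \<omega> :: "'a::euclidean_space \<Rightarrow> real" where "\<omega> \<in> L2" "\<And>x. \<omega> x > 0"
proof -
  obtain h :: "'a \<Rightarrow> ennreal" where h: "h \<in> borel_measurable lborel" "integral\<^sup>N lborel h \<noteq> \<infinity>"
      "\<And>x. 0 < h x \<and> h x < \<infinity>"
    using sigma_finite_measure.Ex_finite_integrable_function[OF sigma_finite_lborel] by auto
  define \<omega> where "\<omega> x = sqrt (enn2real (h x))" for x
  have [measurable]: "\<omega> \<in> borel_measurable borel" unfolding \<omega>_def using h(1) by measurable
  have "(\<integral>\<^sup>+x. ennreal ((norm (\<omega> x))\<^sup>2) \<partial>lebesgue) = integral\<^sup>N lborel h"
    unfolding nn_integral_completion using h(3) by (intro nn_integral_cong) (simp add: \<omega>_def)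
  then have "\<omega> \<in> L2"
    using h(2) by (intro L2I(1)[where c="enn2real (integral\<^sup>N lborel h)"])
      (auto intro: borel_measurable_lebesgueI simp: less_top)
  moreover have "\<omega> x > 0" for x using h(3)[of x] by (simp add: \<omega>_def enn2real_positive_iff)
  ultimately show ?thesis using that by blast
qed

definition neg_div :: "('a::euclidean_space \<Rightarrow> 'a) \<Rightarrow> 'a \<Rightarrow> real" where
  "neg_div \<phi> = (\<lambda>x. - divergence \<phi> x)"

definition unit_fields :: "('a::euclidean_space \<Rightarrow> 'a) set" where
  "unit_fields = {\<phi> \<in> test_functions. \<forall>x. norm (\<phi> x) \<le> 1}"

lemma TV_eq: "TV u = (SUP \<phi>\<in>unit_fields. ereal (u (neg_div \<phi>)))"
  by (simp add: TV_def unit_fields_def neg_div_def)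

lemma neg_div_test: "\<phi> \<in> test_functions \<Longrightarrow> neg_div \<phi> \<in> test_functions"
  unfolding neg_div_def by (rule test_functions_linear[OF bounded_linear_minus[OF bounded_linear_ident] divergence_test_functions])

lemma neg_div_D1: "\<phi> \<in> unit_fields \<Longrightarrow> neg_div \<phi> \<in> D1"
  by (intro test_functions_D1 neg_div_test) (simp add: unit_fields_def)

lemma neg_div_lincomb:
  assumes "\<phi> \<in> test_functions" "\<chi>' \<in> test_functions"
  shows "neg_div (\<lambda>x. a *\<^sub>R \<phi> x + b *\<^sub>R \<chi>' x) = (\<lambda>x. a * neg_div \<phi> x + b * neg_div \<chi>' x)"
proof
  fix x
  have "frechet_derivative (\<lambda>x. a *\<^sub>R \<phi> x + b *\<^sub>R \<chi>' x) (at x) =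
      (\<lambda>h. a *\<^sub>R frechet_derivative \<phi> (at x) h + b *\<^sub>R frechet_derivative \<chi>' (at x) h)"
    by (rule frechet_derivative_at[symmetric])
       (intro has_derivative_add has_derivative_scaleR_right test_functions_differentiable assms)
  then show "neg_div (\<lambda>x. a *\<^sub>R \<phi> x + b *\<^sub>R \<chi>' x) x = a * neg_div \<phi> x + b * neg_div \<chi>' x"
    by (simp add: neg_div_def divergence_def inner_add_left sum.distrib sum_distrib_left)
qed

lemma unit_fields_convex:
  assumes "\<phi> \<in> unit_fields" "\<chi>' \<in> unit_fields" "0 \<le> a" "0 \<le> b" "a + b = 1"
  shows "(\<lambda>x. a *\<^sub>R \<phi> x + b *\<^sub>R \<chi>' x) \<in> unit_fields"
proof -
  have "norm (a *\<^sub>R \<phi> x + b *\<^sub>R \<chi>' x) \<le> 1" for x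
  proof -
    have "norm (a *\<^sub>R \<phi> x + b *\<^sub>R \<chi>' x) \<le> a * norm (\<phi> x) + b * norm (\<chi>' x)"
      using norm_triangle_ineq[of "a *\<^sub>R \<phi> x" "b *\<^sub>R \<chi>' x"] assms by simp
    also have "\<dots> \<le> a * 1 + b * 1" using assms by (intro add_mono mult_left_mono) (auto simp: unit_fields_def)
    finally show ?thesis using assms by simp
  qed
  then show ?thesis using assms
    by (auto simp: unit_fields_def intro!: test_functions_add test_functions_linear[OF bounded_linear_scaleR_right])
qed

lemma zero_unit_field: "(\<lambda>x. 0) \<in> unit_fields"
  by (simp add: unit_fields_def test_functions_0)

text \<open>
  Projection of \<open>(p, s)\<close> onto the closure of the convex set of all \<open>([f], b f)\<close>, where \<open>f = -div \<phi>\<close>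
  (second coordinate up to decrease). A positive distance would give a functional \<open>(-\<Delta> e, a)\<close>
  separating them, contradicting the subgradient inequality at \<open>(w + \<Delta> e) / (1 + a)\<close>.
\<close>

lemma subgradient_approximation:
  fixes w :: "('a::euclidean_space \<Rightarrow> real) \<Rightarrow> real" and b :: "('a \<Rightarrow> real) \<Rightarrow> real"
  assumes w: "w \<in> D_neg1" and p: "p \<in> D1"
    and b: "\<And>f g r t. f \<in> D1 \<Longrightarrow> g \<in> D1 \<Longrightarrow> b (\<lambda>x. r * f x + t * g x) = r * b f + t * b g"
    and S: "\<And>\<phi>. \<phi> \<in> unit_fields \<Longrightarrow> w (neg_div \<phi>) + b (neg_div \<phi>) \<le> S"
    and sub: "\<And>w' T. w' \<in> D_neg1 \<Longrightarrow> (\<And>\<phi>. \<phi> \<in> unit_fields \<Longrightarrow> w' (neg_div \<phi>) + b (neg_div \<phi>) \<le> T) \<Longrightarrow> S + w' p - w p \<le> T"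
  obtains x :: "nat \<Rightarrow> 'a \<Rightarrow> 'a" where "\<And>k. x k \<in> unit_fields"
    "\<And>k. D1_inner (\<lambda>y. neg_div (x k) y - p y) (\<lambda>y. neg_div (x k) y - p y) \<le> 8 * (1/4)^k"
    "\<And>k. S - w p - b (neg_div (x k)) \<le> 2 * (1/2)^k"
proof -
  define s where "s = S - w p"
  define g where "g \<phi> = (\<lambda>y. neg_div \<phi> y - p y)" for \<phi>
  \<comment> \<open>Distance in the second coordinate: the set is closed under decreasing it, so
    only the deficit of \<open>b\<close> below s counts.\<close>
  define a where "a \<phi> = max 0 (s - b (neg_div \<phi>))" for \<phi>
  define Q where "Q \<phi> = D1_inner (g \<phi>) (g \<phi>) + (a \<phi>)\<^sup>2" for \<phi>
  define N where "N \<phi> \<chi>' = D1_inner (\<lambda>y. g \<phi> y - g \<chi>' y) (\<lambda>y. g \<phi> y - g \<chi>' y) / 4 + (a \<phi> - a \<chi>')\<^sup>2 / 4" for \<phi> \<chi>'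
  have gD: "g \<phi> \<in> D1" if "\<phi> \<in> unit_fields" for \<phi>
    unfolding g_def by (intro D1_diff neg_div_D1 that p)
  have gcomb: "g (\<lambda>x. r *\<^sub>R \<phi> x + t *\<^sub>R \<chi>' x) = (\<lambda>y. r * g \<phi> y + t * g \<chi>' y)"
    and bcomb: "s - b (neg_div (\<lambda>x. r *\<^sub>R \<phi> x + t *\<^sub>R \<chi>' x)) = r * (s - b (neg_div \<phi>)) + t * (s - b (neg_div \<chi>'))"
    if u: "\<phi> \<in> unit_fields" "\<chi>' \<in> unit_fields" and rt: "r + t = 1" for \<phi> \<chi>' r t
  proof -
    have r: "r = 1 - t" using rt by simp
    have n: "neg_div (\<lambda>x. r *\<^sub>R \<phi> x + t *\<^sub>R \<chi>' x) = (\<lambda>x. r * neg_div \<phi> x + t * neg_div \<chi>' x)"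
      using u by (intro neg_div_lincomb) (auto simp: unit_fields_def)
    show "g (\<lambda>x. r *\<^sub>R \<phi> x + t *\<^sub>R \<chi>' x) = (\<lambda>y. r * g \<phi> y + t * g \<chi>' y)"
      unfolding g_def n by (auto simp: r algebra_simps)
    show "s - b (neg_div (\<lambda>x. r *\<^sub>R \<phi> x + t *\<^sub>R \<chi>' x)) = r * (s - b (neg_div \<phi>)) + t * (s - b (neg_div \<chi>'))"
      unfolding n b[OF neg_div_D1[OF u(1)] neg_div_D1[OF u(2)]] by (simp add: r algebra_simps)
  qed
  obtain x where x: "\<And>k::nat. x k \<in> unit_fields" "\<And>k l. k \<le> l \<Longrightarrow> N (x k) (x l) \<le> (1/4)^k"
      "\<And>k z. (\<And>j::nat. unit_fields = (unit_fields :: ('a \<Rightarrow> 'a) set)) \<Longrightarrow> z \<in> unit_fields \<Longrightarrow> Q (x k) \<le> Q z + (1/4)^k"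
  proof (rule nested_near_minimisers[where C="\<lambda>_. unit_fields" and Q=Q and N=N and b=0 and B="Q (\<lambda>x. 0)"])
    show "0 \<le> Q \<phi>" for \<phi> by (simp add: Q_def D1_inner_nonneg)
    show "\<exists>z\<in>unit_fields. Q z \<le> Q (\<lambda>x. 0)" using zero_unit_field by blast
    show "\<exists>z\<in>unit_fields. Q z \<le> (Q \<phi> + Q \<chi>') / 2 - N \<phi> \<chi>'" if u: "\<phi> \<in> unit_fields" "\<chi>' \<in> unit_fields" for \<phi> \<chi>'
    proof (rule bexI)
      let ?z = "\<lambda>x. (1/2) *\<^sub>R \<phi> x + (1/2) *\<^sub>R \<chi>' x"
      show "?z \<in> unit_fields" by (rule unit_fields_convex[OF u]) auto
      have half: "(1/2::real) + 1/2 = 1" by simp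
      \<comment> \<open>Convexity of the positive part carries the midpoint estimate to the second
        coordinate.\<close>
      have mx: "max 0 (1/2 * X + 1/2 * Y) \<le> (max 0 X + max 0 Y) / 2" for X Y :: real by (auto simp: max_def)
      have "0 \<le> a ?z" "a ?z \<le> (a \<phi> + a \<chi>') / 2"
        unfolding a_def bcomb[OF u half] by (simp, rule mx)
      then have "(a ?z)\<^sup>2 \<le> ((a \<phi> + a \<chi>') / 2)\<^sup>2" by (intro power_mono)
      also have "\<dots> = ((a \<phi>)\<^sup>2 + (a \<chi>')\<^sup>2) / 2 - (a \<phi> - a \<chi>')\<^sup>2 / 4" by (simp add: power2_eq_square field_simps)
      finally show "Q ?z \<le> (Q \<phi> + Q \<chi>') / 2 - N \<phi> \<chi>'"
        using D1_parallelogram[OF gD[OF u(1)] gD[OF u(2)]]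
        unfolding Q_def N_def gcomb[OF u half] by (simp add: field_simps)
    qed
  qed (use zero_unit_field that in auto)
  have xg: "g (x k) \<in> D1" for k by (rule gD[OF x(1)])
  have NN: "D1_inner (\<lambda>y. g (x k) y - g (x l) y) (\<lambda>y. g (x k) y - g (x l) y) \<le> 4 * (1/4)^k"
    "(a (x k) - a (x l))\<^sup>2 \<le> 4 * (1/4)^k" if "k \<le> l" for k l
    using x(2)[OF that] D1_inner_nonneg[of "\<lambda>y. g (x k) y - g (x l) y"] zero_le_power2[of "a (x k) - a (x l)"]
    unfolding N_def by linarith+
  obtain e where e: "e \<in> D1" "\<And>k. D1_inner (\<lambda>y. g (x k) y - e y) (\<lambda>y. g (x k) y - e y) \<le> 4 * (1/4)^k"
  proof (rule D1_complete[where f="\<lambda>k. g (x k)" and c=4, OF xg])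
    show "D1_inner (\<lambda>y. g (x k) y - g (x l) y) (\<lambda>y. g (x k) y - g (x l) y) \<le> 4 * (1/4)^k" if "k \<le> l" for k l
      by (rule NN(1)[OF that])
  qed (use that in auto)
  have aN: "\<bar>a (x k) - a (x l)\<bar> \<le> 2 * (1/2)^k" if "k \<le> l" for k l
  proof -
    have "4 * (1/4::real)^k = (2 * (1/2)^k)\<^sup>2"
      by (simp add: power_mult_distrib power2_eq_square flip: power_mult_distrib)
    then have "\<bar>a (x k) - a (x l)\<bar>\<^sup>2 \<le> (2 * (1/2)^k)\<^sup>2" using NN(2)[OF that] by simp
    then show ?thesis by (rule power2_le_imp_le) simp
  qed
  have "Cauchy (\<lambda>k. a (x k))"
  proof (rule metric_CauchyI)
    fix r :: real assume "r > 0"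
    moreover have "(\<lambda>k. 4 * (1/2::real)^k) \<longlonglongrightarrow> 0" by (intro tendsto_mult_right_zero LIMSEQ_power_zero) simp
    ultimately obtain M where M: "4 * (1/2::real)^M < r"
      using order_tendstoD(2)[of "\<lambda>k. 4 * (1/2::real)^k" 0 sequentially r] by (auto dest: eventually_happens)
    show "\<exists>M. \<forall>m\<ge>M. \<forall>n\<ge>M. dist (a (x m)) (a (x n)) < r"
    proof (intro exI[of _ M] allI impI)
      fix m n assume "M \<le> m" "M \<le> n"
      from aN[OF this(1)] aN[OF this(2)] M show "dist (a (x m)) (a (x n)) < r"
        unfolding dist_real_def by linarith
    qed
  qed
  then obtain A where A: "(\<lambda>k. a (x k)) \<longlonglongrightarrow> A" using Cauchy_convergent_iff convergent_def by blast
  have A0: "0 \<le> A" using A by (rule LIMSEQ_le_const) (auto simp: a_def)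
  let ?E = "D1_inner e e"
  have lim: "(\<lambda>k. D1_inner (g (x k)) v) \<longlonglongrightarrow> D1_inner e v" if "v \<in> D1" for v
    by (rule D1_inner_diff_LIMSEQ[OF xg e(1) that e(2)])
  have limE: "(\<lambda>k. D1_inner (g (x k)) (g (x k))) \<longlonglongrightarrow> ?E"
  proof -
    have l0: "(\<lambda>k. 4 * (1/4::real)^k) \<longlonglongrightarrow> 0" by (intro tendsto_mult_right_zero LIMSEQ_power_zero) simp
    have "norm (D1_inner (\<lambda>y. g (x k) y - e y) (\<lambda>y. g (x k) y - e y)) \<le> 4 * (1/4)^k" for k
      using e(2)[of k] D1_inner_nonneg[of "\<lambda>y. g (x k) y - e y"] by simp
    then have "(\<lambda>k. D1_inner (\<lambda>y. g (x k) y - e y) (\<lambda>y. g (x k) y - e y)) \<longlonglongrightarrow> 0"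
      by (intro Lim_null_comparison[OF _ l0] always_eventually allI)
    from tendsto_add[OF this tendsto_diff[OF tendsto_mult_left[OF lim[OF e(1)], of 2] tendsto_const[of ?E]]]
    show ?thesis
      using D1_inner_lincomb_self[OF xg e(1), of 1 _ "-1"] by simp
  qed
  \<comment> \<open>\<open>e\<close> and \<open>A\<close> are the limits of the two components of
    the distance vector. Comparing \<open>x k\<close> with convex combinations towards \<phi>,
    dividing by t and letting t tend to 0 gives the obtuse angle condition of a projection.\<close>
  have var: "?E + A\<^sup>2 \<le> D1_inner e (g \<phi>) + A * (s - b (neg_div \<phi>))" if \<phi>: "\<phi> \<in> unit_fields" for \<phi>
  proof -
    let ?B = "s - b (neg_div \<phi>)" and ?X = "D1_inner e (g \<phi>)" and ?G = "D1_inner (g \<phi>) (g \<phi>)"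
    have ineq: "?E + A\<^sup>2 \<le> (1 - t)\<^sup>2 * ?E + 2 * (1 - t) * t * ?X + t\<^sup>2 * ?G + ((1 - t) * A + t * ?B)\<^sup>2"
      if t: "0 < t" "t \<le> 1" for t
    proof -
      have st: "(1 - t) + t = 1" by simp
      have "D1_inner (g (x k)) (g (x k)) + (a (x k))\<^sup>2 \<le> (1 - t)\<^sup>2 * D1_inner (g (x k)) (g (x k)) +
          2 * (1 - t) * t * D1_inner (g (x k)) (g \<phi>) + t\<^sup>2 * ?G + ((1 - t) * a (x k) + t * ?B)\<^sup>2 + (1/4)^k" for k
      proof -
        let ?z = "\<lambda>y. (1 - t) *\<^sub>R x k y + t *\<^sub>R \<phi> y"
        have z: "?z \<in> unit_fields" using t by (intro unit_fields_convex x(1) \<phi>) auto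
        have "(a ?z)\<^sup>2 \<le> ((1 - t) * a (x k) + t * ?B)\<^sup>2"
        proof -
          define X where "X = s - b (neg_div ?z)"
          define Y where "Y = (1 - t) * a (x k) + t * ?B"
          have "X \<le> Y"
            unfolding X_def Y_def bcomb[OF x(1) \<phi> st] using t
            by (intro add_mono mult_left_mono) (auto simp: a_def)
          then have "(max 0 X)\<^sup>2 \<le> Y\<^sup>2" by (cases "X \<le> 0") (auto simp: max_def intro: power_mono)
          then show ?thesis by (simp add: X_def Y_def a_def)
        qed
        moreover have "D1_inner (g ?z) (g ?z) = (1 - t)\<^sup>2 * D1_inner (g (x k)) (g (x k)) +
          2 * (1 - t) * t * D1_inner (g (x k)) (g \<phi>) + t\<^sup>2 * ?G"
          unfolding gcomb[OF x(1) \<phi> st] by (rule D1_inner_lincomb_self[OF xg gD[OF \<phi>]])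
        ultimately show ?thesis using x(3)[OF refl z, of k] unfolding Q_def by linarith
      qed
      moreover have "(\<lambda>k. D1_inner (g (x k)) (g (x k)) + (a (x k))\<^sup>2) \<longlonglongrightarrow> ?E + A\<^sup>2"
        by (intro tendsto_intros limE A)
      moreover have "(\<lambda>k. (1 - t)\<^sup>2 * D1_inner (g (x k)) (g (x k)) +
          2 * (1 - t) * t * D1_inner (g (x k)) (g \<phi>) + t\<^sup>2 * ?G + ((1 - t) * a (x k) + t * ?B)\<^sup>2 + (1/4)^k)
          \<longlonglongrightarrow> (1 - t)\<^sup>2 * ?E + 2 * (1 - t) * t * ?X + t\<^sup>2 * ?G + ((1 - t) * A + t * ?B)\<^sup>2 + 0"
        by (intro tendsto_intros limE A lim[OF gD[OF \<phi>]] LIMSEQ_power_zero) simp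
      ultimately show ?thesis by (intro LIMSEQ_le[of _ "?E + A\<^sup>2"]) auto
    qed
    let ?L = "?E - ?X + A\<^sup>2 - A * ?B" and ?R = "?E - 2 * ?X + ?G + (?B - A)\<^sup>2"
    have "2 * ?L \<le> t * ?R" if t: "0 < t" "t \<le> 1" for t
    proof -
      have "t * (2 * ?L) \<le> t * (t * ?R)"
        using ineq[OF t] by (simp add: power2_eq_square algebra_simps)
      then show ?thesis using t(1) by (simp only: mult_le_cancel_left_pos)
    qed
    then have ev: "\<forall>\<^sub>F t in at_right 0. 2 * ?L \<le> t * ?R"
      unfolding eventually_at_right_field by (intro exI[of _ 1]) auto
    have "((\<lambda>t. t * ?R) \<longlongrightarrow> 0 * ?R) (at_right 0)" by (intro tendsto_intros)
    then have "2 * ?L \<le> 0 * ?R" by (rule tendsto_lowerbound[OF _ ev]) simp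
    then show ?thesis by simp
  qed
  have De: "neg_laplacian e f = D1_inner e f" if "f \<in> D1" for f using that by (simp add: neg_laplacian_def)
  have A1: "1 + A \<noteq> 0" using A0 by linarith
  \<comment> \<open>The angle condition is added to w f + b f \<le> S, so that \<open>b\<close> gets
    the coefficient 1 + A, which is positive also for A = 0; dividing by it restores the coefficient
    1 in which the subgradient hypothesis is stated. \<open>T\<close> is the resulting right-hand
    side.\<close>
  define w' where "w' = (\<lambda>f. 1 / (1 + A) * w f + (- 1 / (1 + A)) * neg_laplacian e f)"
  define T where "T = (S - D1_inner e p + A * s - (?E + A\<^sup>2)) / (1 + A)"
  have w': "w' \<in> D_neg1" unfolding w'_def by (rule D_neg1_combination[OF w neg_laplacian_D_neg1[OF e(1)]])
  have "w' (neg_div \<phi>) + b (neg_div \<phi>) \<le> T" if \<phi>: "\<phi> \<in> unit_fields" for \<phi>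
  proof -
    have "D1_inner e (g \<phi>) = D1_inner e (neg_div \<phi>) - D1_inner e p"
      using D1_inner_lincomb_right[OF neg_div_D1[OF \<phi>] p e(1), of 1 "-1"] by (simp add: g_def)
    with var[OF \<phi>] S[OF \<phi>]
    have "w (neg_div \<phi>) - D1_inner e (neg_div \<phi>) + (1 + A) * b (neg_div \<phi>) \<le> S - D1_inner e p + A * s - (?E + A\<^sup>2)"
      by (simp add: algebra_simps)
    moreover have "w' (neg_div \<phi>) + b (neg_div \<phi>) =
        (w (neg_div \<phi>) - D1_inner e (neg_div \<phi>) + (1 + A) * b (neg_div \<phi>)) / (1 + A)"
      using A1 De[OF neg_div_D1[OF \<phi>]] by (simp add: w'_def divide_simps)
    ultimately show ?thesis using A0 by (simp add: T_def divide_right_mono)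
  qed
  from sub[OF w' this] have "(1 + A) * (S + w' p - w p) \<le> (1 + A) * T"
    using A0 by (intro mult_left_mono) auto
  moreover have "w' p = (w p - D1_inner e p) / (1 + A)" using De[OF p] by (simp add: w'_def diff_divide_distrib)
  then have "(1 + A) * w' p = w p - D1_inner e p" using A1 by simp
  moreover have "(1 + A) * T = S - D1_inner e p + A * s - (?E + A\<^sup>2)" using A0 by (simp add: T_def)
  \<comment> \<open>With s = S - w p all other terms cancel, and the squared distance is
    left.\<close>
  ultimately have "?E + A\<^sup>2 \<le> 0" by (simp add: s_def algebra_simps)
  then have E0: "?E = 0" and A00: "A = 0"
    using D1_inner_nonneg[of e] zero_le_power2[of A] by (smt (verit) zero_eq_power2)+
  show ?thesis
  proof (rule that[OF x(1)])
    fix k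
    have "D1_inner (g (x k)) (g (x k)) \<le> 8 * (1/4)^k"
    proof -
      let ?h = "\<lambda>y. g (x k) y - e y"
      have h: "?h \<in> D1" by (intro D1_diff xg e(1))
      \<comment> \<open>\<open>e\<close> has zero energy but may be a non-zero constant, so it is
        removed by Cauchy-Schwarz.\<close>
      have "(D1_inner ?h e)\<^sup>2 \<le> 0" using D1_Cauchy_Schwarz[OF h e(1)] E0 by simp
      then have "D1_inner ?h e = 0" by simp
      then have "D1_inner (g (x k)) (g (x k)) = D1_inner ?h ?h"
        using D1_inner_lincomb_self[OF h e(1), of 1 1] E0 by simp
      then show ?thesis using e(2)[of k] by (smt (verit) zero_le_power divide_nonneg_nonneg)
    qed
    then show "D1_inner (\<lambda>y. neg_div (x k) y - p y) (\<lambda>y. neg_div (x k) y - p y) \<le> 8 * (1/4)^k"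
      by (simp add: g_def)
    have "(\<lambda>l. \<bar>a (x k) - a (x l)\<bar>) \<longlonglongrightarrow> \<bar>a (x k) - A\<bar>" by (intro tendsto_intros A)
    then have "\<bar>a (x k) - A\<bar> \<le> 2 * (1/2)^k"
      by (rule LIMSEQ_le_const2) (use aN in blast)
    then show "S - w p - b (neg_div (x k)) \<le> 2 * (1/2)^k"
      by (simp add: A00 a_def s_def)
  qed
qed

text \<open>Approximating \<open>p\<close> modulo constants by divergences leaves the fields
  themselves undetermined. They are pinned down by selecting, among the fields that approximate
  equally well, those of nearly minimal weighted norm. The almost everywhere limit has divergence
  -(p + m) with a constant m that is recovered from the fields.\<close>

lemma subgradient_field:
  fixes w v :: "('a::euclidean_space \<Rightarrow> real) \<Rightarrow> real" and \<psi> :: "'a \<Rightarrow> real"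
  assumes \<psi>: "\<psi> \<in> L2" "compact_support \<psi>" "(\<integral>x. \<psi> x \<partial>lebesgue) = 1" and w: "w \<in> D_neg1"
    and v: "v \<in> subdifferential D_neg1 D_neg1_inner (\<lambda>w'. TV (E_sum \<psi> w' c)) w"
  obtains Z d where "Z \<in> Linf" "d \<in> D1" "has_weak_divergence Z d" "AE x in lebesgue. norm (Z x) \<le> 1"
    "v = laplacian d" "ereal (- E_sum \<psi> w c d) = TV (E_sum \<psi> w c)"
proof -
  have vD: "v \<in> D_neg1" and fin: "TV (E_sum \<psi> w c) < \<infinity>"
    and sub: "\<And>w'. w' \<in> D_neg1 \<Longrightarrow> TV (E_sum \<psi> w c) + ereal (D_neg1_inner v (w' - w)) \<le> TV (E_sum \<psi> w' c)"
    using v by (auto simp: subdifferential_def)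
  obtain p where p: "p \<in> D1" "neg_laplacian p = v" using Riesz_D1[OF vD] by blast
  define b where "b f = c * (\<integral>x. \<psi> x * f x \<partial>lebesgue)" for f :: "'a \<Rightarrow> real"
  have E: "E_sum \<psi> w' c f = w' f + b f" if "f \<in> D1" for w' f
    using that by (simp add: E_sum_def b_def)
  have blin: "b (\<lambda>x. r * f x + t * g x) = r * b f + t * b g" if "f \<in> D1" "g \<in> D1" for f g r t
    using L2_compact_D1_integrable(1)[OF \<psi>(1,2) that(1)] L2_compact_D1_integrable(1)[OF \<psi>(1,2) that(2)]
    by (simp add: b_def algebra_simps)
  have TV_up: "ereal (w' (neg_div \<phi>) + b (neg_div \<phi>)) \<le> TV (E_sum \<psi> w' c)" if "\<phi> \<in> unit_fields" for w' \<phi>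
    unfolding TV_eq using E[OF neg_div_D1[OF that], of w'] that by (intro SUP_upper2[of \<phi>]) auto
  have n0: "neg_div (\<lambda>x. 0) = (\<lambda>x. 0 :: real)"
    using neg_div_lincomb[OF test_functions_0 test_functions_0, of 0 0] by simp
  have "0 \<le> TV (E_sum \<psi> w c)"
    using TV_up[OF zero_unit_field, of w] D_neg1_const[OF w, of 0] by (simp add: n0 b_def zero_ereal_def)
  then obtain S where S: "TV (E_sum \<psi> w c) = ereal S" using fin by (cases "TV (E_sum \<psi> w c)") auto
  have Sle: "w (neg_div \<phi>) + b (neg_div \<phi>) \<le> S" if "\<phi> \<in> unit_fields" for \<phi>
    using TV_up[OF that, of w] by (simp add: S)
  have Ssub: "S + w' p - w p \<le> T"
    if w': "w' \<in> D_neg1" and T: "\<And>\<phi>. \<phi> \<in> unit_fields \<Longrightarrow> w' (neg_div \<phi>) + b (neg_div \<phi>) \<le> T" for w' T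
  proof -
    have "D_neg1_inner v (w' - w) = w' p - w p"
      using D_neg1_inner_neg_laplacian[OF D_neg1_minus_mem[OF w' w] p(1)] p(2) by simp
    with sub[OF w'] have "ereal (S + (w' p - w p)) \<le> TV (E_sum \<psi> w' c)" by (simp add: S)
    also have "\<dots> \<le> ereal T"
      unfolding TV_eq using T E[OF neg_div_D1] by (intro SUP_least) simp
    finally show ?thesis by simp
  qed
  obtain x :: "nat \<Rightarrow> 'a \<Rightarrow> 'a" where x: "\<And>k. x k \<in> unit_fields"
    "\<And>k. D1_inner (\<lambda>y. neg_div (x k) y - p y) (\<lambda>y. neg_div (x k) y - p y) \<le> 8 * (1/4)^k"
    "\<And>k. S - w p - b (neg_div (x k)) \<le> 2 * (1/2)^k"
    by (rule subgradient_approximation[where b=b and S=S, OF w p(1)]) (blast intro: blin Sle Ssub that)+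
  define G where "G \<phi> = D1_inner (\<lambda>y. neg_div \<phi> y - p y) (\<lambda>y. neg_div \<phi> y - p y)" for \<phi>
  \<comment> \<open>The conditions are convex in \<phi> and tighten with k, and the approximating
    sequence shows that the sets are non-empty. Whichever elements the minimisation selects, they
    keep the energy estimate and the near-maximality.\<close>
  define C where "C k = {\<phi> \<in> unit_fields. G \<phi> \<le> 8 * (1/4)^k \<and> S - w p - b (neg_div \<phi>) \<le> 2 * (1/2)^k}" for k :: nat
  obtain \<omega> :: "'a \<Rightarrow> real" where \<omega>: "\<omega> \<in> L2" "\<And>x. \<omega> x > 0" by (rule positive_L2_weight) (rule that; assumption)
  have \<omega>m: "\<omega> \<in> borel_measurable lebesgue" using \<omega> by (simp add: L2_def)
  have fm: "\<phi> \<in> borel_measurable lebesgue" if "\<phi> \<in> unit_fields" for \<phi> :: "'a \<Rightarrow> 'a"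
    using that by (intro borel_measurable_lebesgueI test_functions_measurable) (simp add: unit_fields_def)
  have wL: "(\<lambda>y. \<omega> y *\<^sub>R \<phi> y) \<in> L2" "L2sq (\<lambda>y. \<omega> y *\<^sub>R \<phi> y) \<le> 1\<^sup>2 * L2sq \<omega>" if "\<phi> \<in> unit_fields" for \<phi> :: "'a \<Rightarrow> 'a"
  proof -
    have "AE y in lebesgue. norm (\<omega> y *\<^sub>R \<phi> y) \<le> 1 * norm (\<omega> y)"
      using that by (intro AE_I2) (simp add: unit_fields_def mult_left_le)
    from L2_dominated[OF \<omega>(1) borel_measurable_scaleR[OF \<omega>m fm[OF that]] this]
    show "(\<lambda>y. \<omega> y *\<^sub>R \<phi> y) \<in> L2" "L2sq (\<lambda>y. \<omega> y *\<^sub>R \<phi> y) \<le> 1\<^sup>2 * L2sq \<omega>" by auto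
  qed
  define Q where "Q \<phi> = L2sq (\<lambda>y. \<omega> y *\<^sub>R \<phi> y)" for \<phi> :: "'a \<Rightarrow> 'a"
  define N where "N \<phi> \<chi>' = L2sq (\<lambda>y. \<omega> y *\<^sub>R \<phi> y - \<omega> y *\<^sub>R \<chi>' y) / 4" for \<phi> \<chi>' :: "'a \<Rightarrow> 'a"
  obtain z where z: "\<And>k. z k \<in> C k" "\<And>k l. k \<le> l \<Longrightarrow> N (z k) (z l) \<le> (1/4)^k"
  proof (rule nested_near_minimisers[where C=C and Q=Q and N=N and b=0 and B="L2sq \<omega>"])
    show "C k \<noteq> {}" for k using x by (auto simp: C_def G_def)
    show "C j \<subseteq> C i" if "i \<le> j" for i j
    proof -
      have "(1/4::real)^j \<le> (1/4)^i" "(1/2::real)^j \<le> (1/2)^i"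
        using that by (auto intro!: power_decreasing)
      then have "\<phi> \<in> C i" if "\<phi> \<in> C j" for \<phi>
        using that unfolding C_def mem_Collect_eq by linarith
      then show ?thesis by blast
    qed
    show "0 \<le> Q \<phi>" for \<phi> by (simp add: Q_def L2sq_nonneg)
    show "\<exists>\<phi>\<in>C k. Q \<phi> \<le> L2sq \<omega>" for k
      using x[of k] wL(2)[OF x(1)[of k]] by (intro bexI[of _ "x k"]) (auto simp: C_def G_def Q_def)
    show "\<exists>\<zeta>\<in>C k. Q \<zeta> \<le> (Q \<phi> + Q \<chi>') / 2 - N \<phi> \<chi>'" if u: "\<phi> \<in> C k" "\<chi>' \<in> C k" for k \<phi> \<chi>'
    proof (rule bexI)
      let ?z = "\<lambda>x. (1/2) *\<^sub>R \<phi> x + (1/2) *\<^sub>R \<chi>' x"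
      have uf: "\<phi> \<in> unit_fields" "\<chi>' \<in> unit_fields" using u by (auto simp: C_def)
      have n: "neg_div ?z = (\<lambda>x. (1/2) * neg_div \<phi> x + (1/2) * neg_div \<chi>' x)"
        using uf by (intro neg_div_lincomb) (auto simp: unit_fields_def)
      have "(\<lambda>y. neg_div ?z y - p y) = (\<lambda>y. (1/2) * (neg_div \<phi> y - p y) + (1/2) * (neg_div \<chi>' y - p y))"
        unfolding n by (auto simp: field_simps)
      then have Gz: "G ?z \<le> (G \<phi> + G \<chi>') / 2"
        unfolding G_def
        using D1_parallelogram[OF D1_diff[OF neg_div_D1[OF uf(1)] p(1)] D1_diff[OF neg_div_D1[OF uf(2)] p(1)]]
          D1_inner_nonneg[of "\<lambda>x. neg_div \<phi> x - p x - (neg_div \<chi>' x - p x)"] by (simp del: divide_le_eq_numeral1 le_divide_eq_numeral1)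
      have bz: "b (neg_div ?z) = (1/2) * b (neg_div \<phi>) + (1/2) * b (neg_div \<chi>')"
        unfolding n by (rule blin[OF neg_div_D1[OF uf(1)] neg_div_D1[OF uf(2)]])
      have mid: "(a + a') / 2 \<le> t" if "a \<le> t" "a' \<le> t" for a a' t :: real using that by (simp add: field_simps)
      have "(G \<phi> + G \<chi>') / 2 \<le> 8 * (1/4)^k" using u by (intro mid) (auto simp: C_def)
      then have Gz': "G ?z \<le> 8 * (1/4)^k" by (rule order_trans[OF Gz])
      have "((S - w p - b (neg_div \<phi>)) + (S - w p - b (neg_div \<chi>'))) / 2 \<le> 2 * (1/2)^k"
        using u by (intro mid) (auto simp: C_def)
      then have "S - w p - b (neg_div ?z) \<le> 2 * (1/2)^k" unfolding bz by (simp add: field_simps)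
      moreover note Gz'
      moreover have "?z \<in> unit_fields" by (rule unit_fields_convex[OF uf]) auto
      ultimately show "?z \<in> C k" by (simp add: C_def)
      let ?f = "\<lambda>y. \<omega> y *\<^sub>R \<phi> y" and ?h = "\<lambda>y. \<omega> y *\<^sub>R \<chi>' y"
      note fh = wL(1)[OF uf(1)] wL(1)[OF uf(2)]
      have "Q ?z = L2sq (\<lambda>y. (1/2) *\<^sub>R (?f y + 1 *\<^sub>R ?h y))"
        unfolding Q_def by (simp add: scaleR_right_distrib mult.commute)
      also have "\<dots> = (1/2)\<^sup>2 * (L2sq ?f + 2 * 1 * (\<integral>y. ?f y \<bullet> ?h y \<partial>lebesgue) + 1\<^sup>2 * L2sq ?h)"
        unfolding L2_scaleR(2)[OF L2_add_scaleR(1)[OF fh]] L2_add_scaleR(2)[OF fh] ..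
      finally show "Q ?z \<le> (Q \<phi> + Q \<chi>') / 2 - N \<phi> \<chi>'"
        unfolding N_def L2_diff(2)[OF fh] Q_def by (simp add: power2_eq_square field_simps)
    qed
  qed (rule that; assumption)
  have zu: "z k \<in> unit_fields" and zG: "G (z k) \<le> 8 * (1/4)^k" and zb: "S - w p - b (neg_div (z k)) \<le> 2 * (1/2)^k" for k
    using z(1)[of k] by (auto simp: C_def)
  have zt: "z k \<in> test_functions" and z1: "norm (z k y) \<le> 1" for k y using zu[of k] by (auto simp: unit_fields_def)
  note zm = fm[OF zu]
  have "AE y in lebesgue. convergent (\<lambda>k. \<omega> y *\<^sub>R z k y)"
  proof (rule L2_fast_Cauchy_convergent[where c=4])
    show "(\<lambda>y. \<omega> y *\<^sub>R z k y) \<in> borel_measurable lebesgue" for k by (rule borel_measurable_scaleR[OF \<omega>m zm])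
    show "(\<integral>\<^sup>+y. ennreal ((norm (\<omega> y *\<^sub>R z k y - \<omega> y *\<^sub>R z (Suc k) y))\<^sup>2) \<partial>lebesgue) \<le> ennreal (4 * (1/4)^k)" for k
      unfolding L2_nn_integral[OF L2_diff(1)[OF wL(1)[OF zu] wL(1)[OF zu]]]
      using z(2)[of k "Suc k"] by (intro ennreal_leI) (simp add: N_def)
  qed simp
  then have conv: "AE y in lebesgue. convergent (\<lambda>k. z k y)"
  proof eventually_elim
    case (elim y)
    then obtain L where "(\<lambda>k. \<omega> y *\<^sub>R z k y) \<longlonglongrightarrow> L" by (auto simp: convergent_def)
    then have "(\<lambda>k. inverse (\<omega> y) *\<^sub>R (\<omega> y *\<^sub>R z k y)) \<longlonglongrightarrow> inverse (\<omega> y) *\<^sub>R L" by (intro tendsto_intros)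
    then show ?case using \<omega>(2)[of y] by (auto simp: convergent_def)
  qed
  define Z where "Z y = lim (\<lambda>k. z k y)" for y
  have Zm: "Z \<in> borel_measurable lebesgue" unfolding Z_def by (intro borel_measurable_lim_metric zm)
  have Zlim: "AE y in lebesgue. (\<lambda>k. z k y) \<longlonglongrightarrow> Z y"
    using conv by eventually_elim (simp add: Z_def convergent_LIMSEQ_iff)
  have Z1: "AE y in lebesgue. norm (Z y) \<le> 1"
    using Zlim
  proof eventually_elim
    case (elim y)
    from tendsto_norm[OF this] show ?case by (rule LIMSEQ_le_const2) (use z1 in blast)
  qed
  have ZI: "Z \<in> Linf" using Zm Z1 by (auto simp: Linf_def)
  have Zint: "(\<lambda>k. \<integral>y. z k y \<bullet> gradient \<eta> y \<partial>lebesgue) \<longlonglongrightarrow> (\<integral>y. Z y \<bullet> gradient \<eta> y \<partial>lebesgue)"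
    if \<eta>: "\<eta> \<in> test_functions" for \<eta>
  proof (rule integral_dominated_convergence)
    note g = gradient_test_functions[OF \<eta>]
    note gm = borel_measurable_lebesgueI[OF test_functions_measurable[OF g]]
    show "(\<lambda>y. z k y \<bullet> gradient \<eta> y) \<in> borel_measurable lebesgue" for k by (rule borel_measurable_inner[OF zm gm])
    show "(\<lambda>y. Z y \<bullet> gradient \<eta> y) \<in> borel_measurable lebesgue" by (rule borel_measurable_inner[OF Zm gm])
    show "integrable lebesgue (\<lambda>y. norm (gradient \<eta> y))"
      using test_functions_integrable[OF g] test_functions_measurable[OF g]
      by (intro integrable_norm) (simp add: integrable_lebesgue_lborel)
    show "AE y in lebesgue. (\<lambda>k. z k y \<bullet> gradient \<eta> y) \<longlonglongrightarrow> Z y \<bullet> gradient \<eta> y"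
      using Zlim by eventually_elim (intro tendsto_intros)
    show "AE y in lebesgue. norm (z k y \<bullet> gradient \<eta> y) \<le> norm (gradient \<eta> y)" for k
    proof (rule AE_I2)
      fix y
      have "norm (z k y \<bullet> gradient \<eta> y) \<le> norm (z k y) * norm (gradient \<eta> y)" using Cauchy_Schwarz_ineq2 by simp
      also have "\<dots> \<le> 1 * norm (gradient \<eta> y)" by (intro mult_right_mono z1) simp
      finally show "norm (z k y \<bullet> gradient \<eta> y) \<le> norm (gradient \<eta> y)" by simp
    qed
  qed
  let ?f = "\<lambda>k. neg_div (z k)"
  have fD: "?f k \<in> D1" for k by (rule neg_div_D1[OF zu])
  have fIBP: "(\<integral>y. \<eta> y * ?f k y \<partial>lebesgue) = (\<integral>y. z k y \<bullet> gradient \<eta> y \<partial>lebesgue)" if "\<eta> \<in> test_functions" for \<eta> k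
    using integration_by_parts[OF that, of "z k"] zt[of k]
    by (simp add: neg_div_def test_functions_iff inner_commute)
  obtain \<zeta> :: "'a \<Rightarrow> real" where \<zeta>: "\<zeta> \<in> test_functions" "\<And>x. 0 \<le> \<zeta> x" "(\<integral>x. \<zeta> x \<partial>lebesgue) = 1" "\<And>x. x \<notin> cube 1 \<Longrightarrow> \<zeta> x = 0"
    by (rule unit_mass_test_function) (rule that; assumption)
  note \<zeta>L = test_functions_L2[OF \<zeta>(1)] test_functions_compact_support[OF \<zeta>(1)]
  \<comment> \<open>Against \<zeta> the divergences equal integrals of the fields against grad
    \<zeta>, which converge to that of \<open>Z\<close>; the excess over the weighted mean of
    \<open>p\<close> is the missing constant.\<close>
  define m where "m = (\<integral>y. Z y \<bullet> gradient \<zeta> y \<partial>lebesgue) - (\<integral>y. \<zeta> y * p y \<partial>lebesgue)"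
  \<comment> \<open>\<open>g\<close> is split into a part of mean zero, where convergence in the
    seminorm suffices, and a multiple of \<zeta>, where the convergence of the fields is used. It is
    applied to test functions for the divergence of \<open>Z\<close>, and to \<psi> for the
    pairing.\<close>
  have glim: "(\<lambda>k. \<integral>y. g y * ?f k y \<partial>lebesgue) \<longlonglongrightarrow> (\<integral>y. g y * (p y + m) \<partial>lebesgue)"
    if g: "g \<in> L2" "compact_support g" for g
  proof -
    let ?M = "\<integral>y. g y \<partial>lebesgue"
    let ?h = "\<lambda>y. g y - ?M *\<^sub>R \<zeta> y"
    note h = L2_compact_diff[OF g \<zeta>L, of ?M]
    note ig = L2_compact_D1_integrable[OF g] and i\<zeta> = L2_compact_D1_integrable[OF \<zeta>L]
    have "(\<integral>y. ?h y \<partial>lebesgue) = 0" using ig(2)[OF D1_const] i\<zeta>(2)[OF D1_const] \<zeta>(3) by simp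
    then obtain K where K: "K \<ge> 0" "\<And>f. f \<in> D1 \<Longrightarrow> \<bar>\<integral>y. ?h y * f y \<partial>lebesgue\<bar> \<le> K * sqrt (D1_inner f f)"
      using L2_compact_mean_zero_bound[OF h] by metis
    have split: "(\<integral>y. ?h y * q y \<partial>lebesgue) = (\<integral>y. g y * q y \<partial>lebesgue) - ?M * (\<integral>y. \<zeta> y * q y \<partial>lebesgue)" if "q \<in> D1" for q
      using ig(1)[OF that] i\<zeta>(1)[OF that] by (simp add: left_diff_distrib mult.assoc)
    have hlim: "(\<lambda>k. \<integral>y. ?h y * ?f k y \<partial>lebesgue) \<longlonglongrightarrow> (\<integral>y. ?h y * p y \<partial>lebesgue)"
    proof (rule LIMSEQ_if_square_le_geometric)
      fix k
      have d: "(\<lambda>y. ?f k y - p y) \<in> D1" by (rule D1_diff[OF fD p(1)])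
      have "(\<integral>y. ?h y * ?f k y \<partial>lebesgue) - (\<integral>y. ?h y * p y \<partial>lebesgue) = (\<integral>y. ?h y * (?f k y - p y) \<partial>lebesgue)"
        using L2_compact_D1_integrable(1)[OF h fD] L2_compact_D1_integrable(1)[OF h p(1)]
        by (simp add: right_diff_distrib)
      then have "\<bar>(\<integral>y. ?h y * ?f k y \<partial>lebesgue) - (\<integral>y. ?h y * p y \<partial>lebesgue)\<bar> \<le> K * sqrt (G (z k))"
        using K(2)[OF d] unfolding G_def by (simp only:)
      then have "((\<integral>y. ?h y * ?f k y \<partial>lebesgue) - (\<integral>y. ?h y * p y \<partial>lebesgue))\<^sup>2 \<le> (K * sqrt (G (z k)))\<^sup>2"
        using power_mono[OF _ abs_ge_zero, of _ _ 2] by fastforce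
      also have "\<dots> = K\<^sup>2 * G (z k)" by (simp add: power_mult_distrib G_def D1_inner_nonneg)
      also have "\<dots> \<le> K\<^sup>2 * (8 * (1/4)^k)" by (intro mult_left_mono zG) simp
      finally show "((\<integral>y. ?h y * ?f k y \<partial>lebesgue) - (\<integral>y. ?h y * p y \<partial>lebesgue))\<^sup>2 \<le> (K\<^sup>2 * 8) * (1/4)^k"
        by (simp add: mult.assoc)
    qed
    have "(\<lambda>k. (\<integral>y. ?h y * ?f k y \<partial>lebesgue) + ?M * (\<integral>y. z k y \<bullet> gradient \<zeta> y \<partial>lebesgue)) \<longlonglongrightarrow>
        (\<integral>y. ?h y * p y \<partial>lebesgue) + ?M * (\<integral>y. Z y \<bullet> gradient \<zeta> y \<partial>lebesgue)"
      by (intro tendsto_intros hlim Zint \<zeta>(1))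
    moreover have "(\<integral>y. ?h y * ?f k y \<partial>lebesgue) + ?M * (\<integral>y. z k y \<bullet> gradient \<zeta> y \<partial>lebesgue) = (\<integral>y. g y * ?f k y \<partial>lebesgue)" for k
      unfolding split[OF fD] fIBP[OF \<zeta>(1)] by simp
    moreover have "(\<integral>y. ?h y * p y \<partial>lebesgue) + ?M * (\<integral>y. Z y \<bullet> gradient \<zeta> y \<partial>lebesgue) = (\<integral>y. g y * (p y + m) \<partial>lebesgue)"
      unfolding split[OF p(1)] using ig(1)[OF p(1)] ig(2)[OF p(1)] by (simp add: m_def distrib_left algebra_simps)
    ultimately show ?thesis by simp
  qed
  define d where "d = (\<lambda>y. - (p y + m))"
  have pm: "(\<lambda>y. p y + m) \<in> D1" by (intro D1_add p(1) D1_const)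
  have dD: "d \<in> D1" unfolding d_def by (rule D1_minus[OF pm])
  have "has_weak_divergence Z d"
    unfolding has_weak_divergence_def
  proof (intro conjI ballI Linf_L1_loc[OF ZI] D1_L1_loc[OF dD])
    fix \<eta> :: "'a \<Rightarrow> real" assume \<eta>: "\<eta> \<in> test_functions"
    have "(\<integral>y. Z y \<bullet> gradient \<eta> y \<partial>lebesgue) = (\<integral>y. \<eta> y * (p y + m) \<partial>lebesgue)"
      using LIMSEQ_unique[OF Zint[OF \<eta>]] glim[OF test_functions_L2[OF \<eta>] test_functions_compact_support[OF \<eta>]]
      by (simp add: fIBP[OF \<eta>])
    also have "\<dots> = - (\<integral>y. d y * \<eta> y \<partial>lebesgue)"
      unfolding Bochner_Integration.integral_minus[symmetric]
      by (rule Bochner_Integration.integral_cong) (simp_all add: d_def algebra_simps)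
    finally show "(\<integral>y. Z y \<bullet> gradient \<eta> y \<partial>lebesgue) = - (\<integral>y. d y * \<eta> y \<partial>lebesgue)" .
  qed
  moreover have "v = laplacian d"
  proof -
    have "laplacian d = neg_laplacian (\<lambda>y. p y + m)" unfolding laplacian_eq[OF dD] by (simp add: d_def add.commute)
    also have "\<dots> = neg_laplacian p"
    proof (rule D_neg1_eqI[OF neg_laplacian_D_neg1[OF pm] neg_laplacian_D_neg1[OF p(1)]])
      fix f :: "'a \<Rightarrow> real" assume f: "f \<in> D1"
      show "neg_laplacian (\<lambda>y. p y + m) f = neg_laplacian p f"
        using D1_inner_diff_const[OF p(1) f, of "- m" 0] f by (simp add: neg_laplacian_def)
    qed
    finally show ?thesis using p(2) by simp
  qed
  moreover have "ereal (- E_sum \<psi> w c d) = TV (E_sum \<psi> w c)"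
  proof -
    \<comment> \<open>\<open>w\<close> is blind to the constant m but \<open>b\<close> is not, so
      the limit of \<open>b\<close> is taken at p + m; near-maximality then becomes
      equality.\<close>
    let ?b = "b (\<lambda>y. p y + m)"
    have blim: "(\<lambda>k. b (?f k)) \<longlonglongrightarrow> ?b" unfolding b_def by (intro tendsto_intros glim \<psi>)
    obtain K where K: "K \<ge> 0" "\<And>f. f \<in> D1 \<Longrightarrow> \<bar>w f\<bar> \<le> K * sqrt (D1_inner f f)" using D_neg1_bound[OF w] by blast
    have wlim: "(\<lambda>k. w (?f k)) \<longlonglongrightarrow> w p"
    proof (rule LIMSEQ_if_square_le_geometric)
      fix k
      have "\<bar>w (\<lambda>y. ?f k y - p y)\<bar> \<le> K * sqrt (G (z k))"
        unfolding G_def by (rule K(2)[OF D1_diff[OF fD p(1)]])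
      then have "(w (?f k) - w p)\<^sup>2 \<le> (K * sqrt (G (z k)))\<^sup>2"
        unfolding D_neg1_diff[OF w fD p(1)] using power_mono[OF _ abs_ge_zero, of _ _ 2] by fastforce
      also have "\<dots> = K\<^sup>2 * G (z k)" by (simp add: power_mult_distrib G_def D1_inner_nonneg)
      also have "\<dots> \<le> K\<^sup>2 * (8 * (1/4)^k)" by (intro mult_left_mono zG) simp
      finally show "(w (?f k) - w p)\<^sup>2 \<le> (K\<^sup>2 * 8) * (1/4)^k" by (simp add: mult.assoc)
    qed
    have "w p + ?b \<le> S"
      by (rule LIMSEQ_le_const2[OF tendsto_add[OF wlim blim]]) (use Sle[OF zu] in blast)
    moreover have "S \<le> w p + ?b"
    proof -
      have l0: "(\<lambda>k. w p + b (?f k) + 2 * (1/2)^k) \<longlonglongrightarrow> w p + ?b + 2 * 0"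
        by (intro tendsto_intros blim LIMSEQ_power_zero) simp
      have "S \<le> w p + b (?f k) + 2 * (1/2)^k" for k using zb[of k] by linarith
      then show ?thesis using LIMSEQ_le_const[OF l0] by auto
    qed
    moreover have "E_sum \<psi> w c d = - (w p + ?b)"
      unfolding d_def E_sum_minus[OF \<psi>(1,2) w pm] E[OF pm] D_neg1_add_const[OF w p(1)] ..
    ultimately show ?thesis by (simp add: S)
  qed
  ultimately show ?thesis using that ZI dD Z1 by blast
qed

section \<open>Subgradients of the total variation and their projection\<close>

lemma subdifferential_iff:
  fixes w :: "('a::euclidean_space \<Rightarrow> real) \<Rightarrow> real"
  assumes n: "DIM('a) \<le> 2" and \<psi>: "\<psi> \<in> L2" "compact_support \<psi>" "(\<integral>x. \<psi> x \<partial>lebesgue) = 1" and w: "w \<in> D_neg1"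
    and v: "v \<in> D_neg1"
  shows "v \<in> subdifferential D_neg1 D_neg1_inner (\<lambda>w'. TV (E_sum \<psi> w' c)) w \<longleftrightarrow>
     (\<exists>Z\<in>Linf. \<exists>d\<in>D1. has_weak_divergence Z d \<and> (AE x in lebesgue. norm (Z x) \<le> 1) \<and> v = laplacian d \<and>
        ereal (- E_sum \<psi> w c d) = TV (E_sum \<psi> w c))" (is "?L \<longleftrightarrow> ?R")
proof
  assume ?L
  from subgradient_field[OF \<psi> w this] show ?R by metis
next
  assume ?R
  then obtain Z d where Z: "has_weak_divergence Z d" "AE x in lebesgue. norm (Z x) \<le> 1" and d: "d \<in> D1" "v = laplacian d"
    and eq: "ereal (- E_sum \<psi> w c d) = TV (E_sum \<psi> w c)" by blast
  \<comment> \<open>By the duality inequality, minus evaluation at \<open>d\<close> is a linear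
    minorant of \<open>TV\<close>. Condition (iii) says that it touches at \<open>u\<close>, and
    \<open>v\<close> is its slope along D^-1.\<close>
  have "TV (E_sum \<psi> w c) + ereal (D_neg1_inner v (w' - w)) \<le> TV (E_sum \<psi> w' c)" if w': "w' \<in> D_neg1" for w'
  proof -
    have "D_neg1_inner v (w' - w) = (w' - w) (\<lambda>x. - d x)"
      unfolding d(2) laplacian_eq[OF d(1)]
      by (rule D_neg1_inner_neg_laplacian[OF D_neg1_minus_mem[OF w' w] D1_minus[OF d(1)]])
    also have "\<dots> = w d - w' d" using D_neg1_minus[OF w d(1)] D_neg1_minus[OF w' d(1)] by simp
    finally have "TV (E_sum \<psi> w c) + ereal (D_neg1_inner v (w' - w)) = ereal (- E_sum \<psi> w' c d)"
      unfolding eq[symmetric] using d(1) by (simp add: E_sum_def)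
    also have "\<dots> \<le> TV (E_sum \<psi> w' c)" by (rule pairing_le_TV[OF n \<psi>(1,2) w' Z d(1)])
    finally show ?thesis .
  qed
  moreover have "TV (E_sum \<psi> w c) < \<infinity>" by (simp flip: eq)
  ultimately show ?L using v by (simp add: subdifferential_def)
qed

theorem theorem23:
  fixes \<psi> :: "'a::euclidean_space \<Rightarrow> real" and c :: real
    and w u :: "('a \<Rightarrow> real) \<Rightarrow> real"
  assumes "DIM('a) \<le> 2"
    and "\<psi> \<in> L2" and "compact_support \<psi>" and "(\<integral>x. \<psi> x \<partial>lebesgue) = 1"
    and "w \<in> D_neg1" and "u = E_sum \<psi> w c"
  shows "subdifferential D_neg1 D_neg1_inner (\<lambda>w'. TV (E_sum \<psi> w' c)) w =
           orthogonal_projection (E_neg1_inner \<psi>) D_neg1 `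
             subdifferential (E_neg1 \<psi>) (E_neg1_inner \<psi>) TV u \<and>
         (\<forall>v\<in>D_neg1. v \<in> subdifferential D_neg1 D_neg1_inner (\<lambda>w'. TV (E_sum \<psi> w' c)) w \<longleftrightarrow>
           (\<exists>Z\<in>Linf. \<exists>d\<in>D1. has_weak_divergence Z d \<and>
              (AE x in lebesgue. norm (Z x) \<le> 1) \<and>
              v = laplacian d \<and>
              ereal (- u d) = TV u))"
proof (intro conjI ballI equalityI subsetI)
  note \<psi> = assms(2-4) and w = assms(5)
  note iff = subdifferential_iff[OF assms(1) \<psi> w]
  fix v assume v: "v \<in> subdifferential D_neg1 D_neg1_inner (\<lambda>w'. TV (E_sum \<psi> w' c)) w"
  then have vD: "v \<in> D_neg1" by (simp add: subdifferential_def)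
  obtain Z d where Z: "has_weak_divergence Z d" "AE x in lebesgue. norm (Z x) \<le> 1" and d: "d \<in> D1" "v = laplacian d"
    and eq: "ereal (- E_sum \<psi> w c d) = TV (E_sum \<psi> w c)" using iff[OF vD] v by blast
  \<comment> \<open>Minus evaluation at \<open>d\<close> acts on all of E^-1, and t is the \<psi>
    component of its representative. With this t the inequality also covers competitors whose
    coefficient c' differs from \<open>c\<close>.\<close>
  define t where "t = - (\<integral>x. \<psi> x * d x \<partial>lebesgue)"
  have "E_sum \<psi> v t \<in> subdifferential (E_neg1 \<psi>) (E_neg1_inner \<psi>) TV u"
    unfolding subdifferential_def
  proof (intro CollectI conjI ballI)
    show "E_sum \<psi> v t \<in> E_neg1 \<psi>" using vD by (auto simp: E_neg1_def)
    show "TV u < \<infinity>" by (simp add: assms(6) flip: eq)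
    fix y assume "y \<in> E_neg1 \<psi>"
    then obtain w' c' where w': "w' \<in> D_neg1" and y: "y = E_sum \<psi> w' c'" by (auto simp: E_neg1_def)
    have "E_neg1_inner \<psi> (E_sum \<psi> v t) (y - u) = D_neg1_inner v (w' - w) + t * (c' - c)"
      unfolding y assms(6) E_sum_diff by (rule E_neg1_inner_eq[OF \<psi>(3) vD D_neg1_minus_mem[OF w' w]])
    moreover have "D_neg1_inner v (w' - w) = (w' - w) (\<lambda>x. - d x)"
      unfolding d(2) laplacian_eq[OF d(1)]
      by (rule D_neg1_inner_neg_laplacian[OF D_neg1_minus_mem[OF w' w] D1_minus[OF d(1)]])
    moreover have "(w' - w) (\<lambda>x. - d x) = w d - w' d"
      using D_neg1_minus[OF w d(1)] D_neg1_minus[OF w' d(1)] by simp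
    ultimately have "TV u + ereal (E_neg1_inner \<psi> (E_sum \<psi> v t) (y - u)) = ereal (- E_sum \<psi> w' c' d)"
      unfolding assms(6) eq[symmetric] using d(1) by (simp add: E_sum_def t_def algebra_simps)
    also have "\<dots> \<le> TV y" unfolding y by (rule pairing_le_TV[OF assms(1) \<psi>(1,2) w' Z d(1)])
    finally show "TV u + ereal (E_neg1_inner \<psi> (E_sum \<psi> v t) (y - u)) \<le> TV y" .
  qed
  then show "v \<in> orthogonal_projection (E_neg1_inner \<psi>) D_neg1 ` subdifferential (E_neg1 \<psi>) (E_neg1_inner \<psi>) TV u"
    using orthogonal_projection_E_sum[OF \<psi>(3) vD, of t] by (metis image_eqI)
next
  note \<psi> = assms(2-4) and w = assms(5)
  fix v assume "v \<in> orthogonal_projection (E_neg1_inner \<psi>) D_neg1 ` subdifferential (E_neg1 \<psi>) (E_neg1_inner \<psi>) TV u"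
  then obtain v' where v': "v' \<in> subdifferential (E_neg1 \<psi>) (E_neg1_inner \<psi>) TV u"
    and v: "v = orthogonal_projection (E_neg1_inner \<psi>) D_neg1 v'" by blast
  then obtain v0 t where v0: "v0 \<in> D_neg1" "v' = E_sum \<psi> v0 t" by (auto simp: subdifferential_def E_neg1_def)
  have vv: "v = v0" unfolding v v0(2) by (rule orthogonal_projection_E_sum[OF \<psi>(3) v0(1)])
  \<comment> \<open>The competitors have the same coefficient \<open>c\<close> as \<open>u\<close>,
    so the \<psi> component t of the subgradient is multiplied by zero and drops out.\<close>
  have "TV (E_sum \<psi> w c) + ereal (D_neg1_inner v (w' - w)) \<le> TV (E_sum \<psi> w' c)" if w': "w' \<in> D_neg1" for w'
  proof -
    have "E_sum \<psi> w' c \<in> E_neg1 \<psi>" using w' by (auto simp: E_neg1_def)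
    then have "TV u + ereal (E_neg1_inner \<psi> v' (E_sum \<psi> w' c - u)) \<le> TV (E_sum \<psi> w' c)"
      using v' by (simp add: subdifferential_def)
    moreover have "E_neg1_inner \<psi> v' (E_sum \<psi> w' c - u) = D_neg1_inner v0 (w' - w) + t * (c - c)"
      unfolding v0(2) assms(6) E_sum_diff by (rule E_neg1_inner_eq[OF \<psi>(3) v0(1) D_neg1_minus_mem[OF w' w]])
    ultimately show ?thesis by (simp add: assms(6) vv)
  qed
  then show "v \<in> subdifferential D_neg1 D_neg1_inner (\<lambda>w'. TV (E_sum \<psi> w' c)) w"
    using v' v0(1) by (simp add: subdifferential_def vv assms(6))
next
  fix v :: "('a \<Rightarrow> real) \<Rightarrow> real" assume "v \<in> D_neg1"
  then show "v \<in> subdifferential D_neg1 D_neg1_inner (\<lambda>w'. TV (E_sum \<psi> w' c)) w \<longleftrightarrow>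
           (\<exists>Z\<in>Linf. \<exists>d\<in>D1. has_weak_divergence Z d \<and>
              (AE x in lebesgue. norm (Z x) \<le> 1) \<and> v = laplacian d \<and> ereal (- u d) = TV u)"
    unfolding assms(6) by (rule subdifferential_iff[OF assms(1-5)])
qed

end
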